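(* There exist absolute constants $K>0$ and $x_0>0$ such that for all $x\ge x_0$ and all $1<y\le\log\log x/\log\log\log x$, \[ \mathbb{P}\bigg(\max_{h\in[0,1]}|F_x(1/2+ih)|>\frac{\log x}{(\log\log x)^{3/4}}e^y\bigg)\le K\,y\exp\Big(-2y-\frac{y^2}{\log\log x}\Big). \]
   Context: Let $(Z_p)_p$ be i.i.d. random variables indexed by the primes, each uniformly distributed on the complex unit circle, and let $f$ be the Steinhaus random multiplicative function, i.e. the completely multiplicative function $f:\mathbb{N}\to\mathbb{C}$ with $f(p)=Z_p$ for $p$ prime. For $x>0$ and complex $s$, $F_x(s):=\prod_{p\le x}(1-f(p)p^{-s})^{-1}$ (product over primes). *)

theory Defs
  imports "HOL-Probability.Probability" "HOL-Computational_Algebra.Primes"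
begin

definition uniform_circle :: "complex measure" where
  "uniform_circle = distr (uniform_measure lborel {0..2 * pi}) borel cis"

(* The i.i.d. family (Z_p) of the usual construction is (f p) for p prime. Positive integers only:
   the value of f at 0 is unconstrained, as 0 is not in the domain of the multiplicative function. *)
locale steinhaus_multiplicative = prob_space M
  for M :: "'a measure" +
  fixes f :: "nat \<Rightarrow> 'a \<Rightarrow> complex"
  assumes f_one: "\<And>\<omega>. \<omega> \<in> space M \<Longrightarrow> f 1 \<omega> = 1"
    and f_mult: "\<And>\<omega> m n. \<omega> \<in> space M \<Longrightarrow> 0 < m \<Longrightarrow> 0 < n \<Longrightarrow> f (m * n) \<omega> = f m \<omega> * f n \<omega>"
    and f_indep: "indep_vars (\<lambda>_. borel) f {p. prime p}"
    and f_uniform: "\<And>p. prime p \<Longrightarrow> distr M borel (f p) = uniform_circle"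

definition euler_product :: "(nat \<Rightarrow> complex) \<Rightarrow> real \<Rightarrow> complex \<Rightarrow> complex" where
  "euler_product a x s =
     (\<Prod>p | prime p \<and> real p \<le> x. inverse (1 - a p * of_nat p powr (- s)))"

end

theory Submission
  imports Defs "HOL-Number_Theory.Number_Theory" "HOL-Complex_Analysis.Complex_Analysis"
begin

text \<open>
  Write \<open>log |F| = \<Sum> - ln |1 - Z p * p powr (-s)|\<close> as a sum of independent increments over the primes and
  cut the primes into blocks so that block \<open>k\<close> carries variance about \<open>1/2\<close> and resolves points of the
  critical line at distance \<open>exp (-k)\<close>. With \<open>n = ln (ln x)\<close>, a large value of \<open>F\<close> forces the partial sums
  to exceed, for the first time and in some block \<open>k\<close>, the barrier \<open>k + y - g k\<close>, where
  \<open>g k\<close> is about \<open>3/4 * ln n - ln (n - k)\<close>. As nothing exceeds the barrier before that block, Harnack's inequality for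
  the distance to the barrier places the sum at the nearest of \<open>O (exp k)\<close> grid points within a constant multiple of the jump made
  inside block \<open>k\<close>. Doob's maximal inequality for a high moment makes the jump cost an exponential.
  Tilting the measure by \<open>2 * (1 + y / n)\<close> produces \<open>exp (- k - 2 * y - y\<^sup>2 / n)\<close>, and under the tilted
  measure a walk that stays below the barrier and ends near it has probability of ballot type
  \<open>y * k powr (-3/2)\<close>. Summing over blocks and grid points gives the factor \<open>y\<close>; the shape of \<open>g\<close>
  keeps the blocks close to the end summable.
\<close>

subsection \<open>Mertens' theorem\<close>

text \<open>At scale \<open>k\<close> there are of order \<open>exp k\<close> grid points and the
  tilted probability is of order \<open>exp (- k)\<close>. The two cancel exactly, so the remaining
  ballot factor must carry the right power of \<open>k\<close>; no loss per scale can be afforded.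
  The tilt \<open>2 * (1 + y / n)\<close> gives the walk the slope \<open>1 + y / n\<close>, more
  than the slope 1 of the barrier. Seen from the start this only lowers the barrier; seen from the
  end it becomes a barrier of slope \<open>y / n\<close>, which the ballot estimate has to tolerate.
  The hypothesis \<open>y \<le> n / ln n\<close> is spent twice in the final sum: it keeps
  \<open>y / n * g\<close> bounded, and it makes \<open>y^2 / n\<close> times a harmonic sum
  \<open>O(y)\<close>. The ballot estimate rests on exponential moments alone, through an inequality
  for survival probabilities, in place of a comparison with Gaussian walks. The moment 30 is
  dictated by two other constants: Harnack's inequality loses a factor 7 and the tilt is at most 4,
  so missing the barrier by \<open>7 * (m + 1)\<close> costs \<open>exp (28 * m)\<close>, and a jump
  of size \<open>m\<close> has to cost more than that.\<close>

lemma sum_ln_eq_sum_mangoldt: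
  "(\<Sum>k=1..N. ln (real k)) = (\<Sum>d=1..N. mangoldt d * real (N div d))"
proof -
  have "(\<Sum>k=1..N. ln (real k)) = (\<Sum>k=1..N. \<Sum>d | d dvd k. mangoldt d)"
    by (intro sum.cong) (auto simp: mangoldt_sum)
  also have "\<dots> = (\<Sum>k=1..N. \<Sum>d | d \<in> {1..N} \<and> d dvd k. mangoldt d)"
    by (intro sum.cong) (auto simp: dvd_imp_le Suc_le_eq intro!: Nat.gr0I dest: dvd_imp_le)
  also have "\<dots> = (\<Sum>d=1..N. \<Sum>k | k \<in> {1..N} \<and> d dvd k. mangoldt d)"
    by (rule sum.swap_restrict) auto
  also have "\<dots> = (\<Sum>d=1..N. mangoldt d * real (N div d))"
  proof (intro sum.cong refl)
    fix d assume d: "d \<in> {1..N}"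
    have "{k \<in> {1..N}. d dvd k} = (\<lambda>j. d * j) ` {1..N div d}"
    proof -
      have "d * j \<le> N" if "j \<le> N div d" for j
        using that d by (metis le_trans mult_le_mono2 times_div_less_eq_dividend)
      moreover have "j \<le> N div d" if "d * j \<le> N" for j
        using that d by (simp add: less_eq_div_iff_mult_less_eq mult.commute)
      ultimately show ?thesis using d by (auto simp: image_iff Suc_le_eq elim!: dvdE)
    qed
    moreover have "inj_on (\<lambda>j. d * j) {1..N div d}" using d by (auto simp: inj_on_def)
    ultimately show "(\<Sum>k | k \<in> {1..N} \<and> d dvd k. mangoldt d) = mangoldt d * real (N div d)"
      by (simp add: card_image mult.commute)
  qed
  finally show ?thesis .
qed

lemma ln_fact_eq_sum: "ln (fact n :: real) = (\<Sum>k=1..n. ln (real k))"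
proof (induction n)
  case (Suc n)
  then show ?case by (simp add: ln_mult del: of_nat_Suc)
qed simp

lemma ln_fact_ge: "real n * ln (real n) - real n \<le> ln (fact n)" if "n \<ge> 1"
  using that
proof (induction n rule: nat_induct_at_least)
  case base then show ?case by simp
next
  case (Suc n)
  have "ln (real (Suc n) / real n) \<le> real (Suc n) / real n - 1"
    using Suc by (intro ln_le_minus_one) auto
  hence "ln (real (Suc n)) - ln (real n) \<le> 1 / real n"
    using Suc by (simp add: ln_div field_simps)
  hence "real n * (ln (real (Suc n)) - ln (real n)) \<le> 1"
    using Suc by (simp add: field_simps)
  then show ?case using Suc by (simp add: ln_mult algebra_simps del: of_nat_Suc) (simp add: algebra_simps)
qed

lemma ln_fact_le: "ln (fact n :: real) \<le> real n * ln (real n)"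
proof -
  have "(\<Sum>k=1..n. ln (real k)) \<le> (\<Sum>k=1..n. ln (real n))" by (intro sum_mono) auto
  thus ?thesis by (simp add: ln_fact_eq_sum)
qed

text \<open>Chebyshev's argument: in \<open>ln (fact N) - 2 * ln (fact m)\<close> with
  \<open>m = N div 2\<close> every \<open>d\<close> carries the weight
  \<open>N div d - 2 * (m div d) \<ge> 0\<close>, which is 1 for \<open>m < d \<le> N\<close>, and
  the whole is essentially the logarithm of a central binomial coefficient. The term
  \<open>ln N\<close> covers odd \<open>N\<close>, where \<open>N - m = m + 1\<close>. Halving
  closes the recursion: \<open>2 * N + 4 * (N / 2) = 4 * N\<close>.\<close>

lemma sum_mangoldt_le: "(\<Sum>d=1..N. mangoldt d) \<le> 4 * real N"
proof (induction N rule: less_induct)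
  case (less N)
  show ?case
  proof (cases "N = 0")
    case False
    define m where "m = N div 2"
    have mN: "m < N" "m \<le> N" using False by (auto simp: m_def)
    have "(\<Sum>d=m+1..N. mangoldt d) \<le> (\<Sum>d=1..N. mangoldt d * (real (N div d) - 2 * real (m div d)) :: real)"
    proof -
      have 1: "(\<Sum>d=m+1..N. mangoldt d :: real) = (\<Sum>d=m+1..N. mangoldt d * (real (N div d) - 2 * real (m div d)))"
      proof (intro sum.cong refl)
        fix d assume d: "d \<in> {m+1..N}"
        hence "m div d = 0" by auto
        moreover have "N div d = 1" using d by (auto simp: m_def intro!: div_nat_eqI)
        ultimately show "(mangoldt d :: real) = mangoldt d * (real (N div d) - 2 * real (m div d))" by simp
      qed
      have "real (N div d) - 2 * real (m div d) \<ge> 0" for d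
      proof -
        have "2 * (m div d) * d \<le> N" 
          by (metis m_def div_mult2_eq dual_order.trans mult.assoc mult.commute mult_le_mono2 times_div_less_eq_dividend)
        hence "2 * (m div d) \<le> N div d" if "d > 0" using that by (simp add: less_eq_div_iff_mult_less_eq)
        thus ?thesis by (cases "d = 0") (simp_all flip: of_nat_le_iff[where 'a=real])
      qed
      thus ?thesis unfolding 1 by (intro sum_mono2) (auto simp: mangoldt_nonneg)
    qed
    also have "\<dots> = (\<Sum>d=1..N. mangoldt d * real (N div d)) - 2 * (\<Sum>d=1..N. mangoldt d * real (m div d))"
      by (simp add: sum_subtractf sum_distrib_left algebra_simps)
    also have "(\<Sum>d=1..N. mangoldt d * real (m div d)) = (\<Sum>d=1..m. mangoldt d * real (m div d))"
      using mN by (intro sum.mono_neutral_right) auto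
    also have "(\<Sum>d=1..N. mangoldt d * real (N div d)) - 2 * \<dots> = ln (fact N) - 2 * ln (fact m)"
      by (simp only: ln_fact_eq_sum sum_ln_eq_sum_mangoldt)
    also have "\<dots> \<le> real N * ln 2 + ln (real N)"
    proof -
      have f: "(fact N :: real) = fact m * fact (N - m) * real (N choose m)"
        using binomial_fact_lemma[OF mN(2)] by (metis of_nat_fact of_nat_mult)
      have "real (N choose m) \<le> 2 ^ N" using binomial_le_pow2[of N m] by (metis of_nat_le_iff of_nat_numeral of_nat_power)
      moreover have pos: "real (N choose m) > 0" using mN by simp
      ultimately have c: "ln (real (N choose m)) \<le> real N * ln 2"
        by (metis ln_le_cancel_iff ln_realpow zero_less_numeral zero_less_power)
      have "(fact (N - m) :: real) \<le> real N * fact m"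
      proof (cases "even N")
        case True
        hence "N - m = m" by (auto simp: m_def)
        thus ?thesis using False by simp
      next
        case odd: False
        hence "N - m = Suc m" unfolding m_def by (auto elim!: oddE)
        moreover have "Suc m \<le> N" using mN by simp
        hence "real (Suc m) \<le> real N" using of_nat_le_iff by blast
        ultimately show ?thesis using mult_right_mono[of "real (Suc m)" "real N" "fact m"] by (simp del: of_nat_Suc)
      qed
      hence "ln (fact (N - m) :: real) \<le> ln (real N * fact m)" by (subst ln_le_cancel_iff) (use False in auto)
      also have "\<dots> = ln (real N) + ln (fact m)" using False by (simp add: ln_mult)
      finally have d: "ln (fact (N - m) :: real) \<le> ln (real N) + ln (fact m)" .
      have "ln (fact N :: real) = ln (fact m) + ln (fact (N-m)) + ln (real (N choose m))"
        unfolding f using pos by (simp add: ln_mult)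
      thus ?thesis using c d by linarith
    qed
    also have "ln (real N) \<le> real N" using ln_le_minus_one[of "real N"] False by simp
    also have "real N * ln 2 \<le> real N * 1" using ln_2_less_1 by (intro mult_left_mono) auto
    finally have "(\<Sum>d=m+1..N. mangoldt d) \<le> 2 * real N" by simp
    moreover have "(\<Sum>d=1..m. mangoldt d) \<le> 4 * real m" by (rule less.IH) fact
    moreover have "(\<Sum>d=1..N. mangoldt d :: real) = (\<Sum>d=1..m. mangoldt d) + (\<Sum>d=m+1..N. mangoldt d)"
    proof -
      have "{1..N} = {1..m} \<union> {m+1..N}" using mN by auto
      thus ?thesis by (simp add: sum.union_disjoint)
    qed
    moreover have "4 * real m \<le> 2 * real N" by (simp add: m_def)
    ultimately show ?thesis by linarith
  qed auto
qed

text \<open>\<open>ln (fact N)\<close> is evaluated twice, by the leading terms of Stirling's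
  formula and as the sum of \<open>mangoldt d * (N div d)\<close>. Dropping the integer part costs
  at most the sum of \<open>mangoldt d\<close>, which is \<open>O(N)\<close>, and dividing by
  \<open>N\<close> leaves \<open>O(1)\<close>.\<close>

lemma sum_mangoldt_over:
  assumes "N \<ge> 1"
  shows "\<bar>(\<Sum>d=1..N. mangoldt d / real d) - ln (real N)\<bar> \<le> 4"
proof -
  have eq: "ln (fact N :: real) = (\<Sum>d=1..N. mangoldt d * real (N div d))"
    by (simp only: ln_fact_eq_sum sum_ln_eq_sum_mangoldt)
  have le: "real (N div d) \<le> real N / real d" for d by (rule of_nat_div_le_of_nat)
  have ge: "real N / real d - 1 \<le> real (N div d)" for d
  proof (cases "d = 0")
    case False
    have "real N = real (N div d * d + N mod d)" by (subst div_mult_mod_eq) (rule refl)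
    hence "real N = real (N div d) * real d + real (N mod d)" by (simp only: of_nat_add of_nat_mult)
    moreover have "real (N mod d) \<le> real d" using False by simp
    ultimately show ?thesis using False by (simp add: field_simps)
  qed auto
  have "ln (fact N) \<le> (\<Sum>d=1..N. mangoldt d * (real N / real d))"
    unfolding eq by (intro sum_mono mult_left_mono le mangoldt_nonneg)
  also have "\<dots> = real N * (\<Sum>d=1..N. mangoldt d / real d)"
    by (simp add: sum_distrib_left mult.commute)
  finally have 1: "ln (fact N) \<le> real N * (\<Sum>d=1..N. mangoldt d / real d)" .
  have "(\<Sum>d=1..N. mangoldt d * (real N / real d - 1)) \<le> ln (fact N)"
    unfolding eq by (intro sum_mono mult_left_mono ge mangoldt_nonneg)
  also have "(\<Sum>d=1..N. mangoldt d * (real N / real d - 1)) = real N * (\<Sum>d=1..N. mangoldt d / real d) - (\<Sum>d=1..N. mangoldt d)"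
    by (simp add: sum_distrib_left sum_subtractf algebra_simps)
  finally have 2: "real N * (\<Sum>d=1..N. mangoldt d / real d) \<le> ln (fact N) + (\<Sum>d=1..N. mangoldt d)" by simp
  have "real N * (\<Sum>d=1..N. mangoldt d / real d) \<le> real N * (ln (real N) + 4)"
    using 2 sum_mangoldt_le[of N] ln_fact_le[of N] by (simp add: algebra_simps)
  moreover have "real N * (ln (real N) - 1) \<le> real N * (\<Sum>d=1..N. mangoldt d / real d)"
    using 1 ln_fact_ge[OF assms] by (simp add: algebra_simps)
  ultimately show ?thesis using assms by (simp add: mult_le_cancel_left)
qed

lemma summable_inverse_three_halves: "summable (\<lambda>n. real n powr (-3/2))"
  by (simp add: summable_real_powr_iff)

lemma ln_over_square_le:
  assumes "n \<ge> 1" shows "ln (real n) / (real n)\<^sup>2 \<le> 2 * real n powr (-3/2)"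
proof -
  have "ln (real n) = 2 * ln (real n powr (1/2))" using assms by (simp add: ln_powr)
  also have "\<dots> \<le> 2 * real n powr (1/2)" using ln_le_minus_one[of "real n powr (1/2)"] assms by simp
  finally have "ln (real n) / (real n)\<^sup>2 \<le> 2 * real n powr (1/2) / (real n)\<^sup>2"
    by (intro divide_right_mono) auto
  also have "\<dots> = 2 * real n powr (-3/2)"
  proof -
    have "(real n)\<^sup>2 = real n powr 2" using assms by (simp add: powr_numeral)
    hence "2 * real n powr (1/2) / (real n)\<^sup>2 = 2 * real n powr (1/2 - 2)" by (simp only: powr_diff times_divide_eq_right)
    thus ?thesis by simp
  qed
  finally show ?thesis .
qed

text \<open>Only prime powers with exponent at least 2 remain, and for each \<open>p\<close> they
  contribute \<open>O(ln p / p^2)\<close>, which is summable.\<close>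

lemma sum_mangoldt_nonprime:
  "\<exists>C. \<forall>N. (\<Sum>d | d \<in> {1..N} \<and> \<not> prime d. mangoldt d / real d) \<le> C"
proof (intro exI allI)
  fix N :: nat
  let ?P = "{p. prime p \<and> p \<le> N}"
  have fin: "finite ?P" by (rule finite_subset[of _ "{..N}"]) auto
  have "(\<Sum>d | d \<in> {1..N} \<and> \<not> prime d. mangoldt d / real d) = (\<Sum>d | d \<in> {1..N} \<and> \<not> prime d \<and> primepow d. mangoldt d / real d)"
    by (intro sum.mono_neutral_right) (auto simp: mangoldt_def)
  also have "\<dots> \<le> (\<Sum>d \<in> (\<lambda>(p,k). p ^ k) ` (?P \<times> {2..N+2}). mangoldt d / real d)"
  proof (rule sum_mono2)
    show "finite ((\<lambda>(p,k). p ^ k) ` (?P \<times> {2..N+2}))" using fin by auto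
    show "{d \<in> {1..N}. \<not> prime d \<and> primepow d} \<subseteq> (\<lambda>(p, k). p ^ k) ` (?P \<times> {2..N + 2})"
    proof
      fix d assume d: "d \<in> {d \<in> {1..N}. \<not> prime d \<and> primepow d}"
      then obtain p k where pk: "prime p" "k > 0" "d = p ^ k" by (auto simp: primepow_def)
      have "k \<noteq> 1" using d pk by auto
      \<comment> \<open>The exponent satisfies \<open>k < p ^ k \<le> N\<close>, so a finite
        rectangle of pairs covers all prime powers up to \<open>N\<close>.\<close>
      moreover have "k < p ^ k" using pk less_le_trans[OF less_exp[of k] power_mono[of 2 p k]] prime_ge_2_nat[of p] by simp
      moreover have "p ^ 1 \<le> p ^ k" using pk by (intro power_increasing) (auto simp: Suc_leI prime_gt_0_nat)
      ultimately show "d \<in> (\<lambda>(p, k). p ^ k) ` (?P \<times> {2..N + 2})" using d pk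
        by (intro image_eqI[of _ _ "(p,k)"]) auto
    qed
  qed (auto simp: mangoldt_nonneg)
  also have "\<dots> \<le> (\<Sum>(p,k)\<in>?P \<times> {2..N+2}. mangoldt (p ^ k) / real (p ^ k))"
    by (intro order_trans[OF sum_image_le]) (use fin in \<open>auto simp: mangoldt_nonneg case_prod_unfold\<close>)
  also have "\<dots> = (\<Sum>p\<in>?P. \<Sum>k=2..N+2. ln (real p) * (1 / real p) ^ k)"
    using fin by (subst sum.cartesian_product [symmetric]) (auto intro!: sum.cong simp: field_simps)
  also have "\<dots> \<le> (\<Sum>p\<in>?P. 4 * real p powr (-3/2))"
  proof (intro sum_mono)
    fix p assume "p \<in> ?P"
    hence p: "p \<ge> 2" using prime_ge_2_nat by auto
    have "(\<Sum>k=2..N+2. (1 / real p) ^ k) = (1/real p)^2 * (\<Sum>k\<le>N. (1/real p)^k)"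
      by (subst sum.atLeastAtMost_shift_0) (auto simp: sum_distrib_left atLeast0AtMost power_add power2_eq_square)
    also have "(\<Sum>k\<le>N. (1/real p)^k) \<le> (\<Sum>k\<le>N. (1/2)^k)"
      using p by (intro sum_mono power_mono) (auto simp: field_simps)
    also have "\<dots> \<le> 2" by (subst sum_gp0) auto
    finally have "(\<Sum>k=2..N+2. (1 / real p) ^ k) \<le> 2 / real p ^ 2" by (simp add: power_divide divide_right_mono mult.commute)
    hence "ln (real p) * (\<Sum>k=2..N+2. (1 / real p) ^ k) \<le> ln (real p) * (2 / real p ^ 2)"
      using p by (intro mult_left_mono) auto
    also have "\<dots> = 2 * (ln (real p) / (real p)\<^sup>2)" by simp
    also have "\<dots> \<le> 2 * (2 * real p powr (-3/2))" using ln_over_square_le[of p] p by (intro mult_left_mono) auto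
    also have "2 * (2 * real p powr (-3/2)) = 4 * real p powr (-3/2)" by simp
    finally show "(\<Sum>k=2..N+2. ln (real p) * (1 / real p) ^ k) \<le> 4 * real p powr (-3/2)"
      by (simp only: sum_distrib_left)
  qed
  also have "\<dots> = 4 * (\<Sum>p\<in>?P. real p powr (-3/2))" by (simp add: sum_distrib_left)
  also have "\<dots> \<le> 4 * (\<Sum>n. real n powr (-3/2))"
    using fin by (intro mult_left_mono sum_le_suminf summable_inverse_three_halves) auto
  finally show "(\<Sum>d | d \<in> {1..N} \<and> \<not> prime d. mangoldt d / real d) \<le> 4 * (\<Sum>n. real n powr (-3/2))" .
qed

lemma mertens_first:
  "\<exists>C. \<forall>N\<ge>1. \<bar>(\<Sum>p | prime p \<and> p \<le> N. ln (real p) / real p) - ln (real N)\<bar> \<le> C"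
proof -
  obtain C where C: "\<And>N. (\<Sum>d | d \<in> {1..N} \<and> \<not> prime d. mangoldt d / real d) \<le> C"
    using sum_mangoldt_nonprime by blast
  have "\<bar>(\<Sum>p | prime p \<and> p \<le> N. ln (real p) / real p) - ln (real N)\<bar> \<le> C + 4" if N: "N \<ge> 1" for N
  proof -
    have "(\<Sum>d=1..N. mangoldt d / real d) = (\<Sum>d\<in>{d\<in>{1..N}. prime d} \<union> {d\<in>{1..N}. \<not>prime d}. mangoldt d / real d)"
      by (intro sum.cong) auto
    also have "\<dots> = (\<Sum>d\<in>{d\<in>{1..N}. prime d}. mangoldt d / real d) + (\<Sum>d | d \<in> {1..N} \<and> \<not> prime d. mangoldt d / real d)"
      by (intro sum.union_disjoint) auto
    also have "(\<Sum>d\<in>{d\<in>{1..N}. prime d}. mangoldt d / real d) = (\<Sum>p | prime p \<and> p \<le> N. ln (real p) / real p)"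
      by (intro sum.cong) (auto simp: Suc_le_eq prime_gt_0_nat)
    finally have "(\<Sum>d=1..N. mangoldt d / real d) = (\<Sum>p | prime p \<and> p \<le> N. ln (real p) / real p) + (\<Sum>d | d \<in> {1..N} \<and> \<not> prime d. mangoldt d / real d)" .
    moreover have "(\<Sum>d | d \<in> {1..N} \<and> \<not> prime d. mangoldt d / real d) \<ge> 0" by (intro sum_nonneg) (auto simp: mangoldt_nonneg)
    ultimately show ?thesis using C[of N] sum_mangoldt_over[OF N] by linarith
  qed
  thus ?thesis by blast
qed

lemma sum_primes_Suc:
  "(\<Sum>p | prime p \<and> p \<le> Suc n. f p) = (\<Sum>p | prime p \<and> p \<le> n. f p) + (if prime (Suc n) then f (Suc n) else 0 :: real)"
proof -
  have "{p. prime p \<and> p \<le> Suc n} = (if prime (Suc n) then insert (Suc n) {p. prime p \<and> p \<le> n} else {p. prime p \<and> p \<le> n})"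
    by (auto simp: le_Suc_eq)
  moreover have "finite {p. prime p \<and> p \<le> n}" by (rule finite_subset[of _ "{..n}"]) auto
  ultimately show ?thesis by auto
qed

text \<open>Partial summation from the sum of \<open>ln p / p\<close>. From \<open>N\<close> to
  \<open>N + 1\<close> the quantity \<open>T N - A N / ln N\<close> moves by
  \<open>A N * (1 / u - 1 / v)\<close>, with \<open>u\<close>, \<open>v\<close> the logarithms of
  \<open>N\<close> and \<open>N + 1\<close>. Since \<open>A N = u + O(1)\<close>, the main part is
  \<open>1 - u / v\<close>, which agrees with \<open>ln v - ln u\<close> up to
  \<open>O(1 / N^2)\<close>.\<close>

lemma mertens_second:
  "\<exists>C. \<forall>N\<ge>2. \<bar>(\<Sum>p | prime p \<and> p \<le> N. 1 / real p) - ln (ln (real N))\<bar> \<le> C"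
proof -
  define A where "A N = (\<Sum>p | prime p \<and> p \<le> N. ln (real p) / real p)" for N :: nat
  define T where "T N = (\<Sum>p | prime p \<and> p \<le> N. 1 / real p)" for N :: nat
  obtain C where C: "\<And>N. N \<ge> 1 \<Longrightarrow> \<bar>A N - ln (real N)\<bar> \<le> C"
    using mertens_first unfolding A_def by blast
  have C0: "C \<ge> 0" using C[of 1] by linarith
  define l where "l n = ln (real n)" for n :: nat
  have lpos: "l n \<ge> ln 2" if "n \<ge> 2" for n using that by (simp add: l_def)
  have lpos': "l n > 0" if "n \<ge> 2" for n using that by (simp add: l_def)
  have lmono: "l n \<le> l (Suc n)" if "n \<ge> 2" for n using that by (simp add: l_def)
  have ldiff: "l (Suc n) - l n \<le> 1 / real n" if "n \<ge> 2" for n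
  proof -
    have "ln (real (Suc n) / real n) \<le> real (Suc n) / real n - 1"
      using that by (intro ln_le_minus_one) auto
    thus ?thesis using that by (simp add: ln_div field_simps l_def)
  qed
  define S where "S = (\<Sum>n. 1 / real n ^ 2)"
  have summ: "summable (\<lambda>n. 1 / real n ^ 2)" using inverse_power_summable[of 2, where 'a=real] by (simp add: field_simps)
  \<comment> \<open>The error bound is chosen to telescope: its first term collects the deviation of
    \<open>A N\<close> from \<open>ln N\<close>, its second the second-order errors of replacing
    \<open>1 - u / v\<close> by \<open>ln v - ln u\<close>.\<close>
  have main: "\<bar>T N - A N / l N - (ln (l N) - ln (l 2))\<bar> \<le> C * (1 / l 2 - 1 / l N) + (\<Sum>n=2..<N. 1 / real n ^ 2) / (ln 2)^2"
    if "N \<ge> 2" for N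
    using that
  proof (induction N rule: nat_induct_at_least)
    case base
    have "{p::nat. prime p \<and> p \<le> 2} = {2}" using prime_ge_2_nat by (auto simp: le_antisym)
    thus ?case by (simp add: T_def A_def l_def)
  next
    case (Suc N)
    let ?u = "l N" and ?v = "l (Suc N)"
    have u: "?u > 0" and v: "?v > 0" and uv: "?u \<le> ?v" using lpos' lmono Suc by auto
    have "T (Suc N) - A (Suc N) / ?v = T N - A N / ?v"
      using v by (simp add: T_def A_def sum_primes_Suc l_def add_divide_distrib del: of_nat_Suc)
    also have "\<dots> = (T N - A N / ?u) + A N * (1/?u - 1/?v)"
      by (simp add: algebra_simps)
    finally have 1: "T (Suc N) - A (Suc N) / ?v = (T N - A N / ?u) + A N * (1/?u - 1/?v)" .
    have inv: "1/?u - 1/?v \<ge> 0" using u uv by (simp add: frac_le)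
    have "\<bar>(A N - ?u) * (1/?u - 1/?v)\<bar> \<le> C * (1/?u - 1/?v)"
      using C[of N] Suc inv by (auto simp: abs_mult l_def intro!: mult_right_mono)
    moreover have "?u * (1/?u - 1/?v) = 1 - ?u / ?v" using u by (simp add: field_simps)
    moreover have "A N * (1/?u - 1/?v) = (A N - ?u) * (1/?u - 1/?v) + ?u * (1/?u - 1/?v)"
      by (simp only: left_diff_distrib)
    ultimately have 2: "\<bar>A N * (1/?u - 1/?v) - (1 - ?u/?v)\<bar> \<le> C * (1/?u - 1/?v)"
      by linarith
    have a: "ln ?v - ln ?u \<le> ?v / ?u - 1" using ln_le_minus_one[of "?v/?u"] u v by (simp add: ln_div)
    have b: "ln ?u - ln ?v \<le> ?u / ?v - 1" using ln_le_minus_one[of "?u/?v"] u v by (simp add: ln_div)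
    have "(?v / ?u - 1) - (1 - ?u/?v) = (?v - ?u)^2 / (?u * ?v)"
      using u v by (simp add: field_simps power2_eq_square)
    also have "\<dots> \<le> (1 / real N)^2 / (ln 2 * ln 2)"
      using ldiff[of N] uv Suc lpos[of N] lpos[of "Suc N"] u v by (intro frac_le power_mono mult_mono) auto
    finally have 3: "\<bar>(1 - ?u/?v) - (ln ?v - ln ?u)\<bar> \<le> 1 / real N ^ 2 / (ln 2)^2"
      using a b by (simp add: power_divide power2_eq_square)
    have "(\<Sum>n=2..<Suc N. 1 / real n ^ 2) = (\<Sum>n=2..<N. 1 / real n ^ 2) + 1 / real N ^ 2" using Suc by simp
    hence S: "(\<Sum>n=2..<Suc N. 1 / real n ^ 2) / (ln 2)^2 = (\<Sum>n=2..<N. 1 / real n ^ 2) / (ln 2)^2 + 1 / real N ^ 2 / (ln 2)^2"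
      by (simp add: add_divide_distrib)
    have C: "C * (1 / l 2 - 1 / ?v) = C * (1 / l 2 - 1 / ?u) + C * (1/?u - 1/?v)" by (simp add: algebra_simps)
    show ?case using 1 2 3 Suc.IH S C by (simp only:)
  qed
  have "\<bar>T N - ln (ln (real N))\<bar> \<le> 1 + C / l 2 + \<bar>ln (l 2)\<bar> + (C / l 2 + S / (ln 2)^2)" if N: "N \<ge> 2" for N
  proof -
    have p: "l N > 0" "l 2 > 0" "l 2 \<le> l N" using lpos'[of N] lpos'[of 2] N by (auto simp: l_def)
    have "A N / l N = 1 + (A N - l N) / l N" using p by (simp add: field_simps)
    moreover have "\<bar>(A N - l N) / l N\<bar> \<le> C / l 2"
      unfolding abs_divide using C[of N] N p by (intro frac_le) (auto simp: l_def)
    moreover have "C * (1 / l 2 - 1 / l N) \<le> C / l 2" using C0 p by (simp add: algebra_simps)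
    moreover have "(\<Sum>n=2..<N. 1 / real n ^ 2) / (ln 2)^2 \<le> S / (ln 2)^2"
      unfolding S_def by (intro divide_right_mono sum_le_suminf summ) auto
    ultimately show ?thesis using main[OF N] unfolding l_def by linarith
  qed
  thus ?thesis unfolding T_def by blast
qed

subsection \<open>A ballot theorem for bounded independent increments\<close>

text \<open>The equations \<open>G (restrict x J) = G x\<close> and
  \<open>H (restrict x K) = H x\<close> say that each functional looks only at its own coordinates.
  In this form both can be applied to the full family, and the conclusions follow from the
  independence of the two restricted families.\<close>

lemma (in prob_space)
  fixes G H :: "('i \<Rightarrow> 'b::topological_space) \<Rightarrow> 'c::{real_normed_field, banach, second_countable_topology}"
  assumes ind: "indep_vars (\<lambda>_. borel) X I" and JK: "J \<inter> K = {}" "J \<subseteq> I" "K \<subseteq> I"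
    and G: "G \<in> borel_measurable (PiM J (\<lambda>_. borel))" "\<And>x. G (restrict x J) = G x"
    and H: "H \<in> borel_measurable (PiM K (\<lambda>_. borel))" "\<And>x. H (restrict x K) = H x"
    and int: "integrable M (\<lambda>\<omega>. G (\<lambda>i. X i \<omega>))" "integrable M (\<lambda>\<omega>. H (\<lambda>i. X i \<omega>))"
  shows indep_disjoint_expectation_mult:
      "expectation (\<lambda>\<omega>. G (\<lambda>i. X i \<omega>) * H (\<lambda>i. X i \<omega>)) = expectation (\<lambda>\<omega>. G (\<lambda>i. X i \<omega>)) * expectation (\<lambda>\<omega>. H (\<lambda>i. X i \<omega>))"
    and indep_disjoint_integrable_mult: "integrable M (\<lambda>\<omega>. G (\<lambda>i. X i \<omega>) * H (\<lambda>i. X i \<omega>))"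
proof -
  have "indep_var borel (G \<circ> (\<lambda>\<omega>. restrict (\<lambda>i. X i \<omega>) J)) borel (H \<circ> (\<lambda>\<omega>. restrict (\<lambda>i. X i \<omega>) K))"
    by (rule indep_var_compose[OF indep_var_restrict[OF ind JK] G(1) H(1)])
  hence iv: "indep_var borel (\<lambda>\<omega>. G (\<lambda>i. X i \<omega>)) borel (\<lambda>\<omega>. H (\<lambda>i. X i \<omega>))"
    by (simp add: o_def G(2) H(2))
  show "expectation (\<lambda>\<omega>. G (\<lambda>i. X i \<omega>) * H (\<lambda>i. X i \<omega>)) = expectation (\<lambda>\<omega>. G (\<lambda>i. X i \<omega>)) * expectation (\<lambda>\<omega>. H (\<lambda>i. X i \<omega>))"
    by (rule indep_var_lebesgue_integral[OF iv int])
  show "integrable M (\<lambda>\<omega>. G (\<lambda>i. X i \<omega>) * H (\<lambda>i. X i \<omega>))"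
    by (rule indep_var_integrable[OF iv int])
qed

lemma (in prob_space) integrable_bounded:
  fixes g :: "'a \<Rightarrow> 'c::{banach, second_countable_topology}"
  assumes "g \<in> borel_measurable M" "\<And>\<omega>. \<omega> \<in> space M \<Longrightarrow> norm (g \<omega>) \<le> B"
  shows "integrable M g"
  by (rule integrable_const_bound[of _ B]) (use assms in auto)

text \<open>Optional stopping for the exponential martingale at the first exit from the barrier.\<close>

lemma (in prob_space) exp_barrier_inequality:
  fixes X :: "nat \<Rightarrow> 'a \<Rightarrow> real" and v f :: "nat \<Rightarrow> real"
  assumes ind: "indep_vars (\<lambda>_. borel) X {..<N}"
    and bdd: "\<And>i \<omega>. i < N \<Longrightarrow> \<omega> \<in> space M \<Longrightarrow> \<bar>X i \<omega>\<bar> \<le> B"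
    and mgf: "\<And>i. i < N \<Longrightarrow> exp (v i) \<le> expectation (\<lambda>\<omega>. exp (\<theta> * X i \<omega>))"
    and th: "\<theta> \<ge> 0" and f0: "f 0 \<ge> 0"
  defines "S \<equiv> (\<lambda>n \<omega>. \<Sum>i<n. X i \<omega>)"
  defines "p \<equiv> (\<lambda>n. prob {\<omega>\<in>space M. \<forall>j\<le>n. S j \<omega> \<le> f j})"
  assumes n: "n \<le> N"
  shows "1 \<le> exp (\<theta> * f n - (\<Sum>i<n. v i)) * p n
            + (\<Sum>j<n. exp (\<theta> * (f j + B) - (\<Sum>i<Suc j. v i)) * (p j - p (Suc j)))"
proof -
  have X[measurable]: "i < N \<Longrightarrow> X i \<in> borel_measurable M" for i
    using ind by (auto simp: indep_vars_def)
  have SM[measurable]: "m \<le> N \<Longrightarrow> S m \<in> borel_measurable M" for m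
    unfolding S_def by (intro borel_measurable_sum X) auto
  define A where "A m = {\<omega>\<in>space M. \<forall>j\<le>m. S j \<omega> \<le> f j}" for m
  have A: "A m \<in> sets M" if "m \<le> N" for m
  proof -
    have "A m = space M \<inter> (\<Inter>j\<in>{..m}. {\<omega>\<in>space M. S j \<omega> \<le> f j})" by (auto simp: A_def)
    moreover have "{\<omega>\<in>space M. S j \<omega> \<le> f j} \<in> sets M" if "j \<in> {..m}" for j
    proof -
      have "S j \<in> borel_measurable M" using that \<open>m \<le> N\<close> by (intro SM) auto
      thus ?thesis by measurable
    qed
    ultimately show ?thesis by (auto intro!: sets.Int sets.finite_INT)
  qed
  have Adec: "A (Suc m) \<subseteq> A m" for m by (auto simp: A_def)
  define V where "V m = (\<Sum>i<m. v i)" for m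
  define W where "W m \<omega> = exp (\<theta> * S m \<omega> - V m)" for m \<omega>
  have Sb: "\<bar>S m \<omega>\<bar> \<le> real m * B" if "m \<le> N" "\<omega> \<in> space M" for m \<omega>
  proof -
    have "\<bar>S m \<omega>\<bar> \<le> (\<Sum>i<m. \<bar>X i \<omega>\<bar>)" unfolding S_def by (rule sum_abs)
    also have "\<dots> \<le> (\<Sum>i<m. B)" by (intro sum_mono bdd) (use that in auto)
    finally show ?thesis by simp
  qed
  have Wint: "integrable M (\<lambda>\<omega>. W m \<omega> * indicator C \<omega>)" if "m \<le> N" "C \<in> sets M" for m C
  proof (rule integrable_bounded[of _ "exp (\<theta> * (real m * B) - V m)"])
    show "(\<lambda>\<omega>. W m \<omega> * indicator C \<omega>) \<in> borel_measurable M"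
      unfolding W_def using SM[OF that(1)] that(2) by measurable
    fix \<omega> assume w: "\<omega> \<in> space M"
    have "\<theta> * S m \<omega> \<le> \<theta> * (real m * B)" using Sb[OF that(1) w] th by (intro mult_left_mono) auto
    thus "norm (W m \<omega> * indicator C \<omega>) \<le> exp (\<theta> * (real m * B) - V m)"
      by (auto simp: W_def indicator_def)
  qed
  have pA: "p m = prob (A m)" for m by (simp add: p_def A_def)
  have "n \<le> N \<Longrightarrow> 1 \<le> expectation (\<lambda>\<omega>. W n \<omega> * indicator (A n) \<omega>)
      + (\<Sum>j<n. exp (\<theta> * (f j + B) - V (Suc j)) * (p j - p (Suc j)))"
  proof (induction n)
    case 0
    have "A 0 = space M" using f0 by (auto simp: A_def S_def)
    thus ?case by (simp add: W_def S_def V_def prob_space)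
  next
    case (Suc n)
    have nN: "n < N" "n \<le> N" using Suc by auto
    define G where "G x = exp (\<theta> * (\<Sum>i<n. x i) - V n) * indicator {x. \<forall>j\<le>n. (\<Sum>i<j. x i) \<le> f j} x"
      for x :: "nat \<Rightarrow> real"
    define H where "H x = exp (\<theta> * x n)" for x :: "nat \<Rightarrow> real"
    have GX: "G (\<lambda>i. X i \<omega>) = W n \<omega> * indicator (A n) \<omega>" if "\<omega> \<in> space M" for \<omega>
      using that by (auto simp: G_def W_def S_def A_def indicator_def)
    have HX: "W (Suc n) \<omega> = W n \<omega> * H (\<lambda>i. X i \<omega>) * exp (- v n)" for \<omega>
      by (simp add: W_def H_def S_def V_def algebra_simps flip: exp_add)
    have mG: "G \<in> borel_measurable (PiM {..<n} (\<lambda>_. borel))"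
    proof -
      have *: "(\<lambda>x. \<Sum>i<j. x i) \<in> borel_measurable (PiM {..<n} (\<lambda>_. borel :: real measure))" if "j \<le> n" for j
        using that by (intro borel_measurable_sum measurable_component_singleton) auto
      have "{x \<in> space (PiM {..<n} (\<lambda>_. borel)). \<forall>j\<le>n. (\<Sum>i<j. x i) \<le> f j} 
         = space (PiM {..<n} (\<lambda>_. borel)) \<inter> (\<Inter>j\<in>{..n}. {x \<in> space (PiM {..<n} (\<lambda>_. borel)). (\<Sum>i<j. x i) \<le> f j})"
        by auto
      also have "\<dots> \<in> sets (PiM {..<n} (\<lambda>_. borel))"
      proof (intro sets.Int sets.top sets.finite_INT)
        fix j assume "j \<in> {..n}"
        thus "{x \<in> space (PiM {..<n} (\<lambda>_. borel)). (\<Sum>i<j. x i) \<le> f j} \<in> sets (PiM {..<n} (\<lambda>_. borel))"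
          using *[of j] by simp measurable
      qed auto
      finally have s: "{x \<in> space (PiM {..<n} (\<lambda>_. borel)). \<forall>j\<le>n. (\<Sum>i<j. x i) \<le> f j} \<in> sets (PiM {..<n} (\<lambda>_. borel))" .
      have "(\<lambda>x. exp (\<theta> * (\<Sum>i<n. x i) - V n) * indicator {x \<in> space (PiM {..<n} (\<lambda>_. borel)). \<forall>j\<le>n. (\<Sum>i<j. x i) \<le> f j} x) \<in> borel_measurable (PiM {..<n} (\<lambda>_. borel))"
        using *[of n] s by measurable
      also have "?this \<longleftrightarrow> ?thesis" unfolding G_def
        by (intro measurable_cong) (auto simp: indicator_def)
      finally show ?thesis .
    qed
    have mH: "H \<in> borel_measurable (PiM {n} (\<lambda>_. borel))"
      unfolding H_def by measurable
    have rG: "G (restrict x {..<n}) = G x" for x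
    proof -
      have "(\<Sum>i<j. restrict x {..<n} i) = (\<Sum>i<j. x i)" if "j \<le> n" for j
        using that by (intro sum.cong) auto
      thus ?thesis by (simp add: G_def indicator_def)
    qed
    have intG: "integrable M (\<lambda>\<omega>. G (\<lambda>i. X i \<omega>))"
      using Wint[OF nN(2) A[OF nN(2)]] by (subst Bochner_Integration.integrable_cong[OF refl GX])
    have intH: "integrable M (\<lambda>\<omega>. H (\<lambda>i. X i \<omega>))"
    proof (rule integrable_bounded[of _ "exp (\<theta> * B)"])
      show "(\<lambda>\<omega>. H (\<lambda>i. X i \<omega>)) \<in> borel_measurable M" unfolding H_def using X[OF nN(1)] by measurable
      fix \<omega> assume w: "\<omega> \<in> space M"
      have "\<theta> * X n \<omega> \<le> \<theta> * B" using bdd[OF nN(1) w] th by (intro mult_left_mono) auto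
      thus "norm (H (\<lambda>i. X i \<omega>)) \<le> exp (\<theta> * B)" by (simp add: H_def)
    qed
    have eq: "expectation (\<lambda>\<omega>. G (\<lambda>i. X i \<omega>) * H (\<lambda>i. X i \<omega>)) = expectation (\<lambda>\<omega>. G (\<lambda>i. X i \<omega>)) * expectation (\<lambda>\<omega>. H (\<lambda>i. X i \<omega>))"
      using nN by (intro indep_disjoint_expectation_mult[OF ind _ _ _ mG rG mH _ intG intH]) (auto simp: H_def)
    have "expectation (\<lambda>\<omega>. W n \<omega> * indicator (A n) \<omega>) = expectation (\<lambda>\<omega>. G (\<lambda>i. X i \<omega>))"
      by (intro Bochner_Integration.integral_cong) (auto simp: GX)
    also have "\<dots> = expectation (\<lambda>\<omega>. G (\<lambda>i. X i \<omega>)) * exp (v n) * exp (- v n)"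
      by (simp flip: exp_add)
    \<comment> \<open>The lower bound on the exponential moments makes \<open>W\<close> a
      submartingale, so its mass on \<open>A n\<close> can only grow in one step.\<close>
    also have "\<dots> \<le> expectation (\<lambda>\<omega>. G (\<lambda>i. X i \<omega>)) * expectation (\<lambda>\<omega>. H (\<lambda>i. X i \<omega>)) * exp (- v n)"
      using mgf[OF nN(1)] unfolding H_def
      by (intro mult_right_mono mult_left_mono Bochner_Integration.integral_nonneg) (auto simp: G_def)
    also have "\<dots> = expectation (\<lambda>\<omega>. G (\<lambda>i. X i \<omega>) * H (\<lambda>i. X i \<omega>) * exp (- v n))"
      by (simp add: eq)
    also have "\<dots> = expectation (\<lambda>\<omega>. W (Suc n) \<omega> * indicator (A n) \<omega>)"
      by (intro Bochner_Integration.integral_cong) (auto simp: GX HX)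
    also have "\<dots> = expectation (\<lambda>\<omega>. W (Suc n) \<omega> * indicator (A (Suc n)) \<omega> + W (Suc n) \<omega> * indicator (A n - A (Suc n)) \<omega>)"
      using Adec[of n] by (intro Bochner_Integration.integral_cong) (auto simp: indicator_def)
    also have "\<dots> = expectation (\<lambda>\<omega>. W (Suc n) \<omega> * indicator (A (Suc n)) \<omega>) + expectation (\<lambda>\<omega>. W (Suc n) \<omega> * indicator (A n - A (Suc n)) \<omega>)"
      using Suc.prems nN by (intro Bochner_Integration.integral_add Wint sets.Diff A) auto
    \<comment> \<open>One step before the exit the sum was still at most \<open>f n\<close>, so it
      overshoots by at most \<open>B\<close>.\<close>
    also have "expectation (\<lambda>\<omega>. W (Suc n) \<omega> * indicator (A n - A (Suc n)) \<omega>)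
        \<le> expectation (\<lambda>\<omega>. exp (\<theta> * (f n + B) - V (Suc n)) * indicator (A n - A (Suc n)) \<omega>)"
    proof (intro integral_mono Wint)
      show "integrable M (\<lambda>\<omega>. exp (\<theta> * (f n + B) - V (Suc n)) * indicator (A n - A (Suc n)) \<omega>)"
        using Suc.prems nN by (intro integrable_mult_right integrable_real_indicator sets.Diff A) (auto simp: emeasure_eq_measure)
      fix \<omega> assume w: "\<omega> \<in> space M"
      show "W (Suc n) \<omega> * indicator (A n - A (Suc n)) \<omega> \<le> exp (\<theta> * (f n + B) - V (Suc n)) * indicator (A n - A (Suc n)) \<omega>"
      proof (cases "\<omega> \<in> A n")
        case True
        hence "S n \<omega> \<le> f n" by (auto simp: A_def)
        moreover have "X n \<omega> \<le> B" using bdd[OF nN(1) w] by auto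
        ultimately have "S (Suc n) \<omega> \<le> f n + B" by (simp add: S_def)
        hence "\<theta> * S (Suc n) \<omega> \<le> \<theta> * (f n + B)" using th by (intro mult_left_mono) auto
        thus ?thesis by (auto simp: W_def indicator_def)
      qed auto
    qed (use Suc.prems nN A in auto)
    also have "\<dots> = exp (\<theta> * (f n + B) - V (Suc n)) * (p n - p (Suc n))"
      using Suc.prems nN A Adec[of n] by (simp add: pA finite_measure_Diff)
    finally show ?case using Suc.IH nN by simp
  qed
  also have "expectation (\<lambda>\<omega>. W n \<omega> * indicator (A n) \<omega>) \<le> expectation (\<lambda>\<omega>. exp (\<theta> * f n - V n) * indicator (A n) \<omega>)" if "n \<le> N"
  proof (intro integral_mono Wint)
    show "integrable M (\<lambda>\<omega>. exp (\<theta> * f n - V n) * indicator (A n) \<omega>)"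
      using that by (intro integrable_mult_right integrable_real_indicator A) (auto simp: emeasure_eq_measure)
    fix \<omega> assume w: "\<omega> \<in> space M"
    show "W n \<omega> * indicator (A n) \<omega> \<le> exp (\<theta> * f n - V n) * indicator (A n) \<omega>"
      using th by (auto simp: W_def indicator_def A_def intro!: mult_left_mono)
  qed (use that A in auto)
  also have "n \<le> N \<Longrightarrow> expectation (\<lambda>\<omega>. exp (\<theta> * f n - V n) * indicator (A n) \<omega>) = exp (\<theta> * f n - V n) * p n"
    using A by (simp add: pA)
  finally show ?thesis using n by (simp add: V_def)
qed

text \<open>The bound is bootstrapped: freezing the barrier at its largest value gives decay
  of order \<^term>\<open>V powr (-3/8)\<close>, which makes the slowly growing part of the barrier summable.\<close>

lemma barrier_sequence_bound:
  fixes c B D :: real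
  assumes c: "c > 0" and B: "B \<ge> 0" and D: "D \<ge> 0"
  shows "\<exists>K>0. \<forall>(p::nat\<Rightarrow>real) V N b \<delta>.
    (\<forall>n. 0 \<le> p n \<and> p (Suc n) \<le> p n \<and> p n \<le> 1) \<longrightarrow> V 0 = 0 \<longrightarrow> (\<forall>n<N. V n \<le> V (Suc n)) \<longrightarrow> b \<ge> 1 \<longrightarrow> \<delta> \<ge> 0 \<longrightarrow>
    \<delta> * sqrt (1 + V N) \<le> D \<longrightarrow>
    (\<forall>\<theta>\<in>{0..1}. \<forall>n\<le>N. 1 \<le> exp (\<theta> * (b + \<delta> * V n + 8 * (1 + V n) powr (1/8)) - c * \<theta>\<^sup>2 * V n) * p n
       + (\<Sum>j<n. exp (\<theta> * (b + \<delta> * V j + 8 * (1 + V j) powr (1/8) + B) - c * \<theta>\<^sup>2 * V (Suc j)) * (p j - p (Suc j)))) \<longrightarrow>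
    p N \<le> K * b / sqrt (1 + V N)"
proof -
  \<comment> \<open>The tilt will be \<open>\<kappa> / sqrt (1 + V n)\<close>. The summand
    \<open>2 * D / c\<close> makes \<open>\<delta> \<le> c / 2 * \<theta>\<close>, so half of the
    quadratic term absorbs the slope of the barrier and the other half is left for
    \<open>\<eta>\<close>. The summand 2 forces \<open>V n \<ge> r n ^ 8 / 2\<close> as soon as
    \<open>\<theta> \<le> 1\<close>.\<close>
  define \<kappa> where "\<kappa> = 2 + 2 * D / c"
  have k2: "\<kappa> \<ge> 2" using c D by (simp add: \<kappa>_def)
  \<comment> \<open>The remaining half of the quadratic term is at least
    \<open>c * \<kappa>^2 / 4\<close> at that tilt, so survival up to time \<open>n\<close> enters
    the inequality only with the fraction \<open>1 - \<eta>\<close>.\<close>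
  define \<eta> where "\<eta> = 1 - exp (- (c / 2 * \<kappa>\<^sup>2 / 2))"
  have eta: "\<eta> > 0" "\<eta> \<le> 1" using c k2 by (auto simp: \<eta>_def)
  define C1 where "C1 = \<kappa> * (9 + B) / \<eta>"
  have C1: "C1 \<ge> \<kappa>"
  proof -
    have "\<kappa> * 1 \<le> \<kappa> * ((9 + B) / \<eta>)" using eta k2 B by (intro mult_left_mono) (auto simp: le_divide_eq)
    thus ?thesis by (simp add: C1_def)
  qed
  define C2 where "C2 = exp (1 + 8 * \<kappa>)"
  have C2: "C2 \<ge> 1" using k2 by (simp add: C2_def)
  define K where "K = C2 * \<kappa> * (1 + B) * (9 + 4 * C1) / \<eta>"
  have K\<kappa>: "K \<ge> \<kappa> * (1 + B)"
  proof -
    have "\<kappa> * (1 + B) * \<eta> \<le> \<kappa> * (1 + B) * 1" using eta k2 B by (intro mult_left_mono) auto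
    also have "\<dots> \<le> \<kappa> * (1 + B) * (C2 * (9 + 4 * C1))"
    proof (intro mult_left_mono)
      have "1 * 1 \<le> C2 * (9 + 4 * C1)" using C2 C1 k2 by (intro mult_mono) auto
      thus "1 \<le> C2 * (9 + 4 * C1)" by simp
    qed (use k2 B in auto)
    finally show ?thesis using eta by (simp add: K_def field_simps)
  qed
  have Kpos: "K > 0" using K\<kappa> k2 B by (smt (verit) mult_pos_pos)
  show ?thesis
  proof (intro exI[of _ K] conjI Kpos allI impI)
    fix p V :: "nat \<Rightarrow> real" and N :: nat and b \<delta> :: real
    assume p: "\<forall>n. 0 \<le> p n \<and> p (Suc n) \<le> p n \<and> p n \<le> 1" and V0: "V 0 = 0" and Vmono: "\<forall>n<N. V n \<le> V (Suc n)"
      and b: "b \<ge> 1" and d: "\<delta> \<ge> 0" and dD: "\<delta> * sqrt (1 + V N) \<le> D"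
      and main: "\<forall>\<theta>\<in>{0..1}. \<forall>n\<le>N. 1 \<le> exp (\<theta> * (b + \<delta> * V n + 8 * (1 + V n) powr (1/8)) - c * \<theta>\<^sup>2 * V n) * p n
       + (\<Sum>j<n. exp (\<theta> * (b + \<delta> * V j + 8 * (1 + V j) powr (1/8) + B) - c * \<theta>\<^sup>2 * V (Suc j)) * (p j - p (Suc j)))"
    \<comment> \<open>With this eighth root, \<open>sqrt (1 + V)\<close> is \<open>r ^ 4\<close>,
      \<open>1 + V\<close> is \<open>r ^ 8\<close>, and the growing part of the barrier is
      \<open>8 * r\<close>.\<close>
    define r where "r j = (1 + V j) powr (1/8)" for j
    have VN: "V i \<le> V j" if "i \<le> j" "j \<le> N" for i j
      using that by (induction j rule: dec_induct) (use Vmono in \<open>auto intro: order_trans\<close>)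
    have V_nonneg: "V j \<ge> 0" if "j \<le> N" for j using VN[of 0 j] V0 that by simp
    have r1: "r j \<ge> 1" if "j \<le> N" for j using V_nonneg[OF that] by (simp add: r_def ge_one_powr_ge_zero)
    have rmono: "r i \<le> r j" if "i \<le> j" "j \<le> N" for i j
      using VN[OF that] V_nonneg[of i] that unfolding r_def by (intro powr_mono2) auto
    have r4: "sqrt (1 + V j) = r j ^ 4" if "j \<le> N" for j
      using V_nonneg[OF that] by (simp add: r_def powr_half_sqrt[symmetric] powr_power)
    have r8: "1 + V j = r j ^ 8" if "j \<le> N" for j
      using V_nonneg[OF that] by (simp add: r_def powr_power)
    define \<beta> where "\<beta> = b + B"
    have be: "\<beta> \<ge> 1" "\<beta> \<ge> b" using b B by (auto simp: \<beta>_def)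
    have beb: "\<beta> \<le> (1 + B) * b" using b mult_left_mono[OF b B] by (simp add: \<beta>_def algebra_simps)
    have pdec: "p (Suc j) \<le> p j" "p j \<ge> 0" "p j \<le> 1" for j using p by auto
    have tele: "(\<Sum>j<n. p j - p (Suc j)) = p 0 - p n" for n by (induction n) auto
    \<comment> \<open>The deficit \<open>1 - \<eta>\<close> at the final time is the source of the
      bound: without it the inequality would hold for \<open>p\<close> identically 1.\<close>
    have core: "1 \<le> exp (\<kappa> / r n ^ 4 * (\<beta> + 8 * r n)) * (1 - \<eta>) * p n
        + (\<Sum>j<n. exp (\<kappa> / r n ^ 4 * (\<beta> + 8 * r j)) * (p j - p (Suc j)))"
      if n: "n \<le> N" and rn: "r n ^ 4 \<ge> \<kappa>" for n
    proof -
      define \<theta> where "\<theta> = \<kappa> / r n ^ 4"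
      have r0: "r n ^ 4 > 0" using r1[OF n] by (intro zero_less_power) linarith
      have th: "\<theta> \<in> {0..1}" "\<theta> > 0" using r0 rn k2 by (auto simp: \<theta>_def)
      have d_le: "\<delta> \<le> c / 2 * \<theta>"
      proof -
        have "\<delta> * r n ^ 4 \<le> \<delta> * sqrt (1 + V N)" using VN[OF n] d unfolding r4[OF n, symmetric] by (intro mult_left_mono) auto
        also have "\<dots> \<le> D" by (rule dD)
        also have "\<dots> \<le> c / 2 * \<kappa>" using c by (simp add: \<kappa>_def field_simps)
        finally show ?thesis using r0 by (simp add: \<theta>_def field_simps)
      qed
      have lin: "\<theta> * (\<delta> * V j) \<le> c / 2 * \<theta>\<^sup>2 * V j" if "j \<le> N" for j
        using mult_right_mono[OF d_le, of "\<theta> * V j"] V_nonneg[OF that] th by (simp add: power2_eq_square algebra_simps)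
      have e1: "exp (\<theta> * (b + \<delta> * V n + 8 * (1 + V n) powr (1/8)) - c * \<theta>\<^sup>2 * V n) \<le> exp (\<theta> * (\<beta> + 8 * r n)) * (1 - \<eta>)"
      proof -
        have "V n \<ge> r n ^ 8 / 2"
        proof -
          have "r n ^ 8 = (r n ^ 4) ^ 2" by (simp flip: power_mult)
          also have "\<dots> \<ge> 2 ^ 2" using rn k2 by (intro power_mono) auto
          finally show ?thesis using r8[OF n] by simp
        qed
        hence "c / 2 * \<theta>\<^sup>2 * V n \<ge> c / 2 * \<theta>\<^sup>2 * (r n ^ 8 / 2)" using c by (intro mult_left_mono) auto
        also have "c / 2 * \<theta>\<^sup>2 * (r n ^ 8 / 2) = c / 2 * \<kappa>\<^sup>2 / 2"
        proof -
          have "r n ^ 8 = (r n ^ 4) ^ 2" by (simp flip: power_mult)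
          thus ?thesis using r0 by (simp add: \<theta>_def power_divide)
        qed
        finally have 1: "c / 2 * \<theta>\<^sup>2 * V n \<ge> c / 2 * \<kappa>\<^sup>2 / 2" .
        have "\<theta> * b \<le> \<theta> * \<beta>" using th be by (intro mult_left_mono) auto
        hence "\<theta> * (b + \<delta> * V n + 8 * r n) - c * \<theta>\<^sup>2 * V n \<le> \<theta> * (\<beta> + 8 * r n) - c / 2 * \<kappa>\<^sup>2 / 2"
          using lin[OF n] 1 by (simp add: algebra_simps)
        hence "exp (\<theta> * (b + \<delta> * V n + 8 * r n) - c * \<theta>\<^sup>2 * V n) \<le> exp (\<theta> * (\<beta> + 8 * r n) + - (c / 2 * \<kappa>\<^sup>2 / 2))" by simp
        thus ?thesis by (simp only: exp_add r_def \<eta>_def) simp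
      qed
      have e2: "exp (\<theta> * (b + \<delta> * V j + 8 * (1 + V j) powr (1/8) + B) - c * \<theta>\<^sup>2 * V (Suc j)) \<le> exp (\<theta> * (\<beta> + 8 * r j))"
        if j: "j < n" for j
      proof -
        have "c / 2 * \<theta>\<^sup>2 * V j \<le> c * \<theta>\<^sup>2 * V (Suc j)"
          using Vmono V_nonneg[of j] j n c by (intro mult_mono) auto
        hence "\<theta> * (\<delta> * V j) \<le> c * \<theta>\<^sup>2 * V (Suc j)" using lin[of j] j n by linarith
        thus ?thesis by (simp add: \<beta>_def r_def algebra_simps)
      qed
      have "1 \<le> exp (\<theta> * (b + \<delta> * V n + 8 * (1 + V n) powr (1/8)) - c * \<theta>\<^sup>2 * V n) * p n
       + (\<Sum>j<n. exp (\<theta> * (b + \<delta> * V j + 8 * (1 + V j) powr (1/8) + B) - c * \<theta>\<^sup>2 * V (Suc j)) * (p j - p (Suc j)))"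
        using main th n by blast
      also have "\<dots> \<le> exp (\<theta> * (\<beta> + 8 * r n)) * (1 - \<eta>) * p n + (\<Sum>j<n. exp (\<theta> * (\<beta> + 8 * r j)) * (p j - p (Suc j)))"
        using e1 e2 pdec by (intro add_mono sum_mono mult_right_mono) auto
      finally show ?thesis unfolding \<theta>_def .
    qed
    \<comment> \<open>With \<open>r j\<close> replaced by \<open>r n\<close> the drops telescope, so
      \<open>1 \<le> exp s * (1 - \<eta> * p n)\<close> and hence
      \<open>p n \<le> s / \<eta>\<close>, where \<open>s\<close> is of order
      \<open>\<beta> / r n ^ 3\<close>.\<close>
    have crude: "p n \<le> C1 * \<beta> / r n ^ 3" if n: "n \<le> N" for n
    proof (cases "r n ^ 4 \<ge> \<kappa>")
      case True
      define s where "s = \<kappa> / r n ^ 4 * (\<beta> + 8 * r n)"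
      have "(\<Sum>j<n. exp (\<kappa> / r n ^ 4 * (\<beta> + 8 * r j)) * (p j - p (Suc j))) \<le> (\<Sum>j<n. exp s * (p j - p (Suc j)))"
        unfolding s_def using pdec rmono n k2 r1[OF n]
        by (intro sum_mono mult_right_mono) (auto intro!: mult_left_mono divide_right_mono)
      also have "\<dots> = exp s * (p 0 - p n)" by (simp add: tele flip: sum_distrib_left)
      also have "\<dots> \<le> exp s * (1 - p n)" using pdec by (intro mult_left_mono) auto
      finally have "1 \<le> exp s * (1 - \<eta> * p n)" using core[OF n True] by (simp add: s_def algebra_simps)
      hence "exp (- s) \<le> 1 - \<eta> * p n" by (simp add: exp_minus field_simps)
      moreover have "1 - s \<le> exp (- s)" using exp_ge_add_one_self[of "- s"] by simp
      ultimately have "p n \<le> s / \<eta>" using eta by (simp add: field_simps)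
      also have "s \<le> \<kappa> / r n ^ 4 * (\<beta> * (9 + B) * r n)"
        unfolding s_def
      proof (intro mult_left_mono)
        have "\<beta> * 1 \<le> \<beta> * r n" "8 * r n * 1 \<le> 8 * r n * \<beta>" "0 \<le> \<beta> * B * r n"
          using be r1[OF n] B by (auto intro!: mult_left_mono)
        thus "\<beta> + 8 * r n \<le> \<beta> * (9 + B) * r n" by (simp add: algebra_simps)
      qed (use k2 r1[OF n] in auto)
      also have "\<dots> = \<kappa> * (9 + B) * \<beta> / r n ^ 3" using r1[OF n] by (simp add: field_simps eval_nat_numeral)
      finally show ?thesis using eta by (simp add: C1_def divide_right_mono field_simps)
    next
      case False
      have "r n ^ 3 \<le> r n ^ 4" using r1[OF n] by (intro power_increasing) auto
      hence "r n ^ 3 \<le> C1 * \<beta>" using False C1 be k2 mult_mono[of \<kappa> C1 1 \<beta>] by auto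
      moreover have "r n ^ 3 > 0" using r1[OF n] by (intro zero_less_power) linarith
      ultimately have "1 \<le> C1 * \<beta> / r n ^ 3" by (simp add: field_simps)
      thus ?thesis using pdec(3)[of n] by linarith
    qed
    show "p N \<le> K * b / sqrt (1 + V N)"
    \<comment> \<open>If the condition fails, \<open>sqrt (1 + V N)\<close> is at most of order
      \<open>b\<close> and the claimed bound exceeds 1.\<close>
    proof (cases "\<kappa> * \<beta> \<le> r N ^ 4")
      case False
      have "r N ^ 4 \<le> \<kappa> * ((1 + B) * b)" using False beb k2 by (smt (verit) mult_left_mono)
      also have "\<dots> \<le> K * b" using K\<kappa> b by (simp add: mult_right_mono mult.assoc[symmetric])
      finally have "1 \<le> K * b / r N ^ 4" using r1[of N] by (simp add: field_simps)
      thus ?thesis using pdec(3)[of N] r4[of N] by simp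
    next
      case True
      have rk: "\<kappa> \<le> r N ^ 4" using True mult_left_mono[OF be(1), of \<kappa>] k2 by linarith
      define \<theta> where "\<theta> = \<kappa> / r N ^ 4"
      have r0: "r N ^ 4 > 0" using r1[of N] by (intro zero_less_power) auto
      have th: "\<theta> > 0" using r0 k2 by (auto simp: \<theta>_def)
      have thb: "\<theta> * \<beta> \<le> 1" using True r0 by (simp add: \<theta>_def field_simps)
      \<comment> \<open>Here \<open>\<theta> * r j \<le> \<kappa> / r N ^ 3 \<le> \<kappa>\<close>,
        so the exponents stay below \<open>1 + 8 * \<kappa>\<close> and the exponential may be
        linearised at the price of the constant \<open>C2\<close>.\<close>
      have lin: "exp (\<theta> * (\<beta> + 8 * r j)) \<le> 1 + C2 * (\<theta> * (\<beta> + 8 * r j))" if j: "j \<le> N" for j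
      proof -
        define u where "u = \<theta> * (\<beta> + 8 * r j)"
        have "\<theta> * r j \<le> \<theta> * r N" using rmono[OF j] th by (intro mult_left_mono) auto
        also have "\<dots> = \<kappa> / r N ^ 3" using r1[of N] by (simp add: \<theta>_def field_simps eval_nat_numeral)
        also have "\<dots> \<le> \<kappa> / 1" using r1[of N] k2 by (intro divide_left_mono) auto
        finally have u: "u \<le> 1 + 8 * \<kappa>" using thb by (simp add: u_def algebra_simps)
        have u0: "u \<ge> 0" using th be r1[OF j] by (simp add: u_def)
        have "1 - u \<le> exp (- u)" using exp_ge_add_one_self[of "- u"] by simp
        hence "exp u * (1 - u) \<le> exp u * exp (- u)" by (intro mult_left_mono) auto
        hence "exp u \<le> 1 + exp u * u" by (simp add: algebra_simps flip: exp_add)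
        also have "exp u * u \<le> C2 * u" unfolding C2_def using u u0 by (intro mult_right_mono) auto
        finally show ?thesis by (simp add: u_def)
      qed
      \<comment> \<open>Summation by parts moves the differences from \<open>p\<close> to
        \<open>r\<close>, where the crude bound \<open>p \<le> C1 * \<beta> / r ^ 3\<close> applies:
        the increments of \<open>r\<close> divided by \<open>r ^ 3\<close> have a bounded sum, like
        the integral of \<open>1 / r ^ 3\<close>.\<close>
      have abel: "r N * p N + (\<Sum>j<N. r j * (p j - p (Suc j))) = r 0 * p 0 + (\<Sum>j<N. (r (Suc j) - r j) * p (Suc j))"
      proof (induction N)
        case (Suc m) then show ?case by (simp add: algebra_simps)
      qed simp
      have sum_le: "(\<Sum>j<N. (r (Suc j) - r j) * p (Suc j)) \<le> C1 * \<beta> / 2"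
      proof -
        have "(\<Sum>j<N. (r (Suc j) - r j) * p (Suc j)) \<le> (\<Sum>j<N. C1 * \<beta> / 2 * (1 / r j ^ 2 - 1 / r (Suc j) ^ 2))"
        proof (intro sum_mono)
          fix j assume "j \<in> {..<N}"
          hence j: "j < N" "Suc j \<le> N" by auto
          define u w where "u = r j" and "w = r (Suc j)"
          have uw: "1 \<le> u" "u \<le> w" using r1[of j] rmono[of j "Suc j"] j by (auto simp: u_def w_def)
          have "(w - u) * p (Suc j) \<le> (w - u) * (C1 * \<beta> / w ^ 3)"
            using crude[of "Suc j"] j uw by (intro mult_left_mono) (auto simp: w_def)
          also have "\<dots> = C1 * \<beta> / 2 * (2 * (w - u) / w ^ 3)" using uw by (simp add: field_simps)
          also have "2 * (w - u) / w ^ 3 \<le> 1 / u ^ 2 - 1 / w ^ 2"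
          proof -
            have "u * w \<le> w * w" "u * u \<le> w * u" "u * u \<le> w * w" using uw by (auto intro!: mult_mono)
            hence "2 * u ^ 2 \<le> (w + u) * w" by (simp add: power2_eq_square algebra_simps)
            hence "(w - u) * w ^ 2 * (2 * u ^ 2) \<le> (w - u) * w ^ 2 * ((w + u) * w)" using uw by (intro mult_left_mono) auto
            hence "2 * (w - u) * (u ^ 2 * w ^ 2) \<le> (w ^ 2 - u ^ 2) * w ^ 3"
              by (simp add: power2_eq_square power3_eq_cube algebra_simps)
            moreover have "u > 0" "w > 0" using uw by auto
            ultimately have "2 * (w - u) / w ^ 3 \<le> (w ^ 2 - u ^ 2) / (u ^ 2 * w ^ 2)"
              by (simp add: divide_le_eq pos_le_divide_eq mult.commute)
            also have "\<dots> = 1 / u ^ 2 - 1 / w ^ 2" using \<open>u > 0\<close> \<open>w > 0\<close> by (simp add: field_simps)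
            finally show ?thesis .
          qed
          finally show "(r (Suc j) - r j) * p (Suc j) \<le> C1 * \<beta> / 2 * (1 / r j ^ 2 - 1 / r (Suc j) ^ 2)"
            using C1 k2 be by (simp add: u_def w_def mult_left_mono)
        qed
        also have "\<dots> = C1 * \<beta> / 2 * (1 / r 0 ^ 2 - 1 / r N ^ 2)"
        proof -
          have "(\<Sum>j<m. 1 / r j ^ 2 - 1 / r (Suc j) ^ 2) = 1 / r 0 ^ 2 - 1 / r m ^ 2" for m by (induction m) auto
          thus ?thesis by (simp only: sum_distrib_left[symmetric])
        qed
        also have "\<dots> \<le> C1 * \<beta> / 2 * 1" using C1 k2 be by (intro mult_left_mono) (auto simp: r_def V0)
        finally show ?thesis by simp
      qed
      have r0p: "r 0 * p 0 \<le> 1" using pdec[of 0] by (simp add: r_def V0)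
      have "1 \<le> exp (\<theta> * (\<beta> + 8 * r N)) * (1 - \<eta>) * p N + (\<Sum>j<N. exp (\<theta> * (\<beta> + 8 * r j)) * (p j - p (Suc j)))"
        using core[of N] rk unfolding \<theta>_def by simp
      also have "\<dots> \<le> (1 - \<eta>) * p N + C2 * (\<theta> * (\<beta> + 8 * r N)) * p N + (\<Sum>j<N. (1 + C2 * (\<theta> * (\<beta> + 8 * r j))) * (p j - p (Suc j)))"
      proof (intro add_mono sum_mono mult_right_mono lin)
        have "exp (\<theta> * (\<beta> + 8 * r N)) * (1 - \<eta>) \<le> (1 + C2 * (\<theta> * (\<beta> + 8 * r N))) * (1 - \<eta>)"
          using lin[of N] eta by (intro mult_right_mono) auto
        also have "\<dots> \<le> (1 - \<eta>) + C2 * (\<theta> * (\<beta> + 8 * r N))"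
          using eta C2 th be r1[of N] by (simp add: algebra_simps)
        finally show "exp (\<theta> * (\<beta> + 8 * r N)) * (1 - \<eta>) * p N \<le> (1 - \<eta>) * p N + C2 * (\<theta> * (\<beta> + 8 * r N)) * p N"
          using mult_right_mono[of _ _ "p N"] pdec(2)[of N] by (simp only: distrib_right[symmetric])
      qed (use pdec in auto)
      also have "\<dots> = (1 - \<eta>) * p N + (p 0 - p N) + C2 * \<theta> * (\<beta> * p 0 + 8 * (r N * p N + (\<Sum>j<N. r j * (p j - p (Suc j)))))"
      proof -
        have "(\<Sum>j<N. (1 + C2 * (\<theta> * (\<beta> + 8 * r j))) * (p j - p (Suc j)))
           = (\<Sum>j<N. (1 + C2 * \<theta> * \<beta>) * (p j - p (Suc j)) + C2 * \<theta> * 8 * (r j * (p j - p (Suc j))))"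
          by (intro sum.cong) (auto simp: algebra_simps)
        also have "\<dots> = (1 + C2 * \<theta> * \<beta>) * (p 0 - p N) + C2 * \<theta> * 8 * (\<Sum>j<N. r j * (p j - p (Suc j)))"
          by (simp add: sum.distrib tele flip: sum_distrib_left)
        finally show ?thesis by (simp add: algebra_simps)
      qed
      also have "\<dots> \<le> (1 - \<eta>) * p N + (1 - p N) + C2 * \<theta> * (\<beta> * 1 + 8 * (1 + C1 * \<beta> / 2))"
        unfolding abel using sum_le r0p pdec C2 th be
        by (intro add_mono mult_left_mono order_refl) auto
      finally have "\<eta> * p N \<le> C2 * \<theta> * (\<beta> + 8 * (1 + C1 * \<beta> / 2))" by (simp add: algebra_simps)
      also have "\<dots> \<le> C2 * \<theta> * (\<beta> * (9 + 4 * C1))"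
        using C2 th be by (intro mult_left_mono) (auto simp: algebra_simps)
      also have "\<dots> \<le> C2 * \<theta> * (((1 + B) * b) * (9 + 4 * C1))"
        using C2 th beb C1 k2 by (intro mult_left_mono mult_right_mono) auto
      also have "\<dots> = \<eta> * (K * b / r N ^ 4)" using eta by (simp add: K_def \<theta>_def)
      finally have "p N \<le> K * b / r N ^ 4" by (rule mult_left_le_imp_le) (use eta in auto)
      thus ?thesis using r4[of N] by simp
    qed
  qed
qed

text \<open>The quantifier over measures stands inside the existential because one constant has to
  serve all tilted measures and all lengths at once.\<close>

lemma ballot_bound:
  fixes c B D :: real
  assumes c: "c > 0" and B: "B \<ge> 0" and D: "D \<ge> 0"
  shows "\<exists>K>0. \<forall>(M::'a measure) X v N b \<delta>. prob_space M \<longrightarrow>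
    prob_space.indep_vars M (\<lambda>_. borel) X {..<N::nat} \<longrightarrow>
    (\<forall>i<N. \<forall>\<omega>\<in>space M. \<bar>X i \<omega> :: real\<bar> \<le> B) \<longrightarrow>
    (\<forall>i<N. 0 \<le> v i) \<longrightarrow>
    (\<forall>\<theta>\<in>{0..1}. \<forall>i<N. exp (c * \<theta>\<^sup>2 * v i) \<le> prob_space.expectation M (\<lambda>\<omega>. exp (\<theta> * X i \<omega>))) \<longrightarrow>
    b \<ge> 1 \<longrightarrow> \<delta> \<ge> 0 \<longrightarrow> \<delta> * sqrt (1 + (\<Sum>i<N. v i)) \<le> D \<longrightarrow>
    measure M {\<omega>\<in>space M. \<forall>j\<le>N. (\<Sum>i<j. X i \<omega>) \<le> b + \<delta> * (\<Sum>i<j. v i) + 8 * (1 + (\<Sum>i<j. v i)) powr (1/8)}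
      \<le> K * b / sqrt (1 + (\<Sum>i<N. v i))"
proof -
  have "\<exists>K>0. \<forall>(p::nat\<Rightarrow>real) V N b \<delta>.
    (\<forall>n. 0 \<le> p n \<and> p (Suc n) \<le> p n \<and> p n \<le> 1) \<longrightarrow> V 0 = 0 \<longrightarrow> (\<forall>n<N. V n \<le> V (Suc n)) \<longrightarrow> b \<ge> 1 \<longrightarrow> \<delta> \<ge> 0 \<longrightarrow>
    \<delta> * sqrt (1 + V N) \<le> D \<longrightarrow>
    (\<forall>\<theta>\<in>{0..1}. \<forall>n\<le>N. 1 \<le> exp (\<theta> * (b + \<delta> * V n + 8 * (1 + V n) powr (1/8)) - c * \<theta>\<^sup>2 * V n) * p n
       + (\<Sum>j<n. exp (\<theta> * (b + \<delta> * V j + 8 * (1 + V j) powr (1/8) + B) - c * \<theta>\<^sup>2 * V (Suc j)) * (p j - p (Suc j)))) \<longrightarrow>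
    p N \<le> K * b / sqrt (1 + V N)"
    by (rule barrier_sequence_bound[OF c B D])
  then obtain K where K: "K > 0" and Kb: "\<forall>(p::nat\<Rightarrow>real) V N b \<delta>.
    (\<forall>n. 0 \<le> p n \<and> p (Suc n) \<le> p n \<and> p n \<le> 1) \<longrightarrow> V 0 = 0 \<longrightarrow> (\<forall>n<N. V n \<le> V (Suc n)) \<longrightarrow> b \<ge> 1 \<longrightarrow> \<delta> \<ge> 0 \<longrightarrow>
    \<delta> * sqrt (1 + V N) \<le> D \<longrightarrow>
    (\<forall>\<theta>\<in>{0..1}. \<forall>n\<le>N. 1 \<le> exp (\<theta> * (b + \<delta> * V n + 8 * (1 + V n) powr (1/8)) - c * \<theta>\<^sup>2 * V n) * p n
       + (\<Sum>j<n. exp (\<theta> * (b + \<delta> * V j + 8 * (1 + V j) powr (1/8) + B) - c * \<theta>\<^sup>2 * V (Suc j)) * (p j - p (Suc j)))) \<longrightarrow>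
    p N \<le> K * b / sqrt (1 + V N)"
    by (elim exE conjE) (rule that)
  show ?thesis
  proof (intro exI[of _ K] conjI K allI impI)
    fix M :: "'a measure" and X :: "nat \<Rightarrow> 'a \<Rightarrow> real" and v :: "nat \<Rightarrow> real" and N :: nat and b \<delta> :: real
    assume "prob_space M"
    then interpret prob_space M .
    assume ind: "indep_vars (\<lambda>_. borel) X {..<N}" and bdd: "\<forall>i<N. \<forall>\<omega>\<in>space M. \<bar>X i \<omega>\<bar> \<le> B"
      and v: "\<forall>i<N. 0 \<le> v i"
      and mgf: "\<forall>\<theta>\<in>{0..1}. \<forall>i<N. exp (c * \<theta>\<^sup>2 * v i) \<le> expectation (\<lambda>\<omega>. exp (\<theta> * X i \<omega>))"
      and b: "b \<ge> 1" and d: "\<delta> \<ge> 0" and dD: "\<delta> * sqrt (1 + (\<Sum>i<N. v i)) \<le> D"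
    define V where "V j = (\<Sum>i<j. v i)" for j
    define f where "f j = b + \<delta> * V j + 8 * (1 + V j) powr (1/8)" for j
    define q where "q n = prob {\<omega>\<in>space M. \<forall>j\<le>n. (\<Sum>i<j. X i \<omega>) \<le> f j}" for n
    \<comment> \<open>Frozen beyond \<open>N\<close>: monotonicity is demanded for every index, but
      the variables are under control only below \<open>N\<close>.\<close>
    define p where "p n = q (min n N)" for n
    have X[measurable]: "i < N \<Longrightarrow> X i \<in> borel_measurable M" for i
      using ind by (auto simp: indep_vars_def)
    have qdec: "q (Suc n) \<le> q n" if "n < N" for n
      unfolding q_def
    proof (rule finite_measure_mono)
      have "{\<omega>\<in>space M. \<forall>j\<le>n. (\<Sum>i<j. X i \<omega>) \<le> f j} = space M \<inter> (\<Inter>j\<in>{..n}. {\<omega>\<in>space M. (\<Sum>i<j. X i \<omega>) \<le> f j})" by auto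
      moreover have "{\<omega>\<in>space M. (\<Sum>i<j. X i \<omega>) \<le> f j} \<in> sets M" if "j \<in> {..n}" for j
      proof -
        have "(\<lambda>\<omega>. \<Sum>i<j. X i \<omega>) \<in> borel_measurable M" using that \<open>n < N\<close> by (intro borel_measurable_sum X) auto
        thus ?thesis by measurable
      qed
      ultimately show "{\<omega>\<in>space M. \<forall>j\<le>n. (\<Sum>i<j. X i \<omega>) \<le> f j} \<in> sets M" by (auto intro!: sets.Int sets.finite_INT)
    qed auto
    have "p N \<le> K * b / sqrt (1 + V N)"
    proof (rule Kb[THEN spec[of _ p], THEN spec[of _ V], THEN spec[of _ N], THEN spec[of _ b], THEN spec[of _ \<delta>],
        THEN mp, THEN mp, THEN mp, THEN mp, THEN mp, THEN mp, THEN mp])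
      show "\<forall>n. 0 \<le> p n \<and> p (Suc n) \<le> p n \<and> p n \<le> 1"
      proof (intro allI conjI)
        fix n show "p (Suc n) \<le> p n" using qdec[of n] by (cases "n < N") (auto simp: p_def min_def)
      qed (auto simp: p_def q_def)
      show "\<forall>\<theta>\<in>{0..1}. \<forall>n\<le>N. 1 \<le> exp (\<theta> * (b + \<delta> * V n + 8 * (1 + V n) powr (1/8)) - c * \<theta>\<^sup>2 * V n) * p n
       + (\<Sum>j<n. exp (\<theta> * (b + \<delta> * V j + 8 * (1 + V j) powr (1/8) + B) - c * \<theta>\<^sup>2 * V (Suc j)) * (p j - p (Suc j)))"
      proof (intro ballI allI impI)
        fix \<theta> :: real and n assume th: "\<theta> \<in> {0..1}" and n: "n \<le> N"
        have "1 \<le> exp (\<theta> * f n - (\<Sum>i<n. c * \<theta>\<^sup>2 * v i)) * q n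
            + (\<Sum>j<n. exp (\<theta> * (f j + B) - (\<Sum>i<Suc j. c * \<theta>\<^sup>2 * v i)) * (q j - q (Suc j)))"
          unfolding q_def
          using bdd mgf th n b by (intro exp_barrier_inequality[OF ind]) (auto simp: f_def V_def)
        also have "\<dots> = exp (\<theta> * f n - c * \<theta>\<^sup>2 * V n) * p n
            + (\<Sum>j<n. exp (\<theta> * (f j + B) - c * \<theta>\<^sup>2 * V (Suc j)) * (p j - p (Suc j)))"
          using n by (intro arg_cong2[where f="(+)"] sum.cong) (auto simp: p_def V_def min_def simp flip: sum_distrib_left simp del: sum.lessThan_Suc)
        finally show "1 \<le> exp (\<theta> * (b + \<delta> * V n + 8 * (1 + V n) powr (1/8)) - c * \<theta>\<^sup>2 * V n) * p n
       + (\<Sum>j<n. exp (\<theta> * (b + \<delta> * V j + 8 * (1 + V j) powr (1/8) + B) - c * \<theta>\<^sup>2 * V (Suc j)) * (p j - p (Suc j)))"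
          by (simp only: f_def)
      qed
    qed (use v b d dD in \<open>auto simp: V_def\<close>)
    thus "prob {\<omega>\<in>space M. \<forall>j\<le>N. (\<Sum>i<j. X i \<omega>) \<le> b + \<delta> * (\<Sum>i<j. v i) + 8 * (1 + (\<Sum>i<j. v i)) powr (1/8)}
      \<le> K * b / sqrt (1 + (\<Sum>i<N. v i))"
      by (simp add: p_def q_def f_def V_def)
  qed
qed

subsection \<open>Euler factors at a uniform point of the circle\<close>

lemma borel_measurable_cis [measurable]: "cis \<in> borel_measurable borel"
  by (intro borel_measurable_continuous_onI continuous_intros)

text \<open>Turns expectations over the circle into gauge integrals over the unit interval, the form
  in which contour integrals deliver mean values.\<close>

lemma integral_uniform_circle:
  fixes \<phi> :: "complex \<Rightarrow> real"
  assumes \<phi>[measurable]: "\<phi> \<in> borel_measurable borel" and c: "continuous_on (sphere 0 1) \<phi>"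
  shows "(\<integral>z. \<phi> z \<partial>uniform_circle) = integral {0..1} (\<lambda>x. \<phi> (cis (2 * pi * x)))"
proof -
  have cc: "continuous_on S (\<lambda>x. \<phi> (cis x))" for S
    by (rule continuous_on_compose2[OF c]) (auto intro!: continuous_intros)
  have "(\<integral>z. \<phi> z \<partial>uniform_circle) = (\<integral>x. \<phi> (cis x) \<partial>uniform_measure lborel {0..2*pi})"
    unfolding uniform_circle_def by (subst integral_distr) auto
  also have "\<dots> = (\<integral>x. (indicator {0..2*pi} x / (2*pi)) *\<^sub>R \<phi> (cis x) \<partial>lborel)"
  proof -
    have "uniform_measure lborel {0..2*pi} = density lborel (\<lambda>x. ennreal (indicator {0..2*pi} x / (2*pi)))"
      unfolding uniform_measure_def
      by (intro density_cong) (auto simp: indicator_def divide_ennreal[symmetric] ennreal_divide_numeral simp flip: ennreal_1)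
    thus ?thesis by (simp add: integral_density)
  qed
  also have "\<dots> = (1 / (2*pi)) * (LINT x:{0..2*pi}|lborel. \<phi> (cis x))"
    by (simp add: set_lebesgue_integral_def field_simps flip: integral_mult_right_zero)
  also have "(LINT x:{0..2*pi}|lborel. \<phi> (cis x)) = integral {0..2*pi} (\<lambda>x. \<phi> (cis x))"
    by (intro set_borel_integral_eq_integral borel_integrable_atLeastAtMost' cc)
  also have "(1 / (2*pi)) * integral {0..2*pi} (\<lambda>x. \<phi> (cis x)) = integral {0..1} (\<lambda>x. \<phi> (cis (2 * pi * x)))"
  proof -
    have "((\<lambda>x. \<phi> (cis x)) has_integral integral {0..2*pi} (\<lambda>x. \<phi> (cis x))) {0..2*pi}"
      by (intro integrable_integral integrable_continuous_interval cc)
    from has_integral_stretch_real[OF this, of "2*pi"]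
    have "((\<lambda>x. \<phi> (cis (2*pi*x))) has_integral (1 / (2*pi)) * integral {0..2*pi} (\<lambda>x. \<phi> (cis x))) ((\<lambda>x. x / (2*pi)) ` {0..2*pi})"
      by simp
    also have "(\<lambda>x. x / (2*pi)) ` {0..2*pi} = {0..1}"
      by (subst image_divide_atLeastAtMost) auto
    finally show ?thesis by (rule integral_unique[symmetric])
  qed
  finally show ?thesis .
qed

lemma integral_uniform_unit_interval:
  fixes g :: "real \<Rightarrow> 'b::euclidean_space"
  assumes [measurable]: "g \<in> borel_measurable borel" and c: "continuous_on {0..1} g"
  shows "(\<integral>x. g x \<partial>uniform_measure lborel {0..1}) = integral {0..1} g"
proof -
  have "uniform_measure lborel {0..1::real} = density lborel (\<lambda>x. ennreal (indicator {0..1} x))"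
    unfolding uniform_measure_def
    by (intro density_cong) (auto simp: indicator_def)
  hence "(\<integral>x. g x \<partial>uniform_measure lborel {0..1}) = (LINT x:{0..1}|lborel. g x)"
    by (simp add: integral_density set_lebesgue_integral_def)
  also have "\<dots> = integral {0..1} g"
    by (intro set_borel_integral_eq_integral borel_integrable_atLeastAtMost' c)
  finally show ?thesis .
qed

lemma prob_space_uniform_unit_interval: "prob_space (uniform_measure lborel {0..1::real})"
  by (rule prob_space_uniform_measure) auto

lemma circle_mean_value:
  assumes "g holomorphic_on cball c R" "R > 0"
  shows "((\<lambda>x. g (c + R * cis (2 * pi * x))) has_integral g c) {0..1}"
proof -
  have "((\<lambda>u. g u / (u - c)) has_contour_integral (2 * of_real pi * \<i>) * g c) (circlepath c R)"
    by (rule Cauchy_integral_circlepath_simple) (use assms in auto)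
  hence "((\<lambda>x. g (circlepath c R x) / (circlepath c R x - c) * vector_derivative (circlepath c R) (at x within {0..1})) has_integral (2 * of_real pi * \<i>) * g c) {0..1}"
    by (simp add: has_contour_integral_def)
  also have "?this \<longleftrightarrow> ((\<lambda>x. (2 * of_real pi * \<i>) * g (c + R * cis (2*pi*x))) has_integral (2 * of_real pi * \<i>) * g c) {0..1}"
  proof (rule has_integral_cong)
    fix x :: real assume x: "x \<in> {0..1}"
    have e: "cis (2*pi*x) = exp (2 * of_real pi * \<i> * x)" by (simp add: cis_conv_exp mult_ac)
    have vd: "vector_derivative (circlepath c R) (at x within {0..1}) = 2 * pi * \<i> * R * cis (2*pi*x)"
      unfolding e using x by (intro vector_derivative_circlepath01) auto
    have cp: "circlepath c R x = c + R * cis (2*pi*x)" by (simp add: circlepath e)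
    show "g (circlepath c R x) / (circlepath c R x - c) * vector_derivative (circlepath c R) (at x within {0..1}) = (2 * of_real pi * \<i>) * g (c + R * cis (2*pi*x))"
      unfolding vd cp using assms by simp
  qed
  finally have "((\<lambda>x. (2 * of_real pi * \<i>) * g (c + R * cis (2*pi*x))) has_integral (2 * of_real pi * \<i>) * g c) {0..1}" .
  from has_integral_mult_right[OF this, of "1 / (2 * of_real pi * \<i>)"] show ?thesis by simp
qed

text \<open>Cauchy's formula, with the circle at distance at least \<open>R / 2\<close> from
  \<open>w\<close>. A value at a point that may depend on the randomness is thus bounded by an
  average over a fixed circle, and expectations can be taken under the integral.\<close>

lemma circle_sup_bound:
  assumes g: "g holomorphic_on cball c R" and R: "R > 0" and w: "dist c w \<le> R / 2"
  shows "norm (g w) \<le> 2 * integral {0..1} (\<lambda>x. norm (g (c + R * cis (2 * pi * x))))"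
proof -
  have wR: "norm (w - c) < R" using w R by (simp add: dist_norm norm_minus_commute)
  have cg: "continuous_on {0..1} (\<lambda>x. g (c + R * cis (2 * pi * x)))"
    by (rule continuous_on_compose2[OF holomorphic_on_imp_continuous_on[OF g]])
       (use R in \<open>auto intro!: continuous_intros simp: dist_norm norm_mult\<close>)
  have "((\<lambda>u. g u / (u - w)) has_contour_integral (2 * of_real pi * \<i>) * g w) (circlepath c R)"
    by (rule Cauchy_integral_circlepath_simple) (use g wR in auto)
  hence "((\<lambda>x. g (circlepath c R x) / (circlepath c R x - w) * vector_derivative (circlepath c R) (at x within {0..1})) has_integral (2 * of_real pi * \<i>) * g w) {0..1}"
    by (simp add: has_contour_integral_def)
  hence "norm ((2 * of_real pi * \<i>) * g w) \<le> integral {0..1} (\<lambda>x. 4 * pi * norm (g (c + R * cis (2 * pi * x))))"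
  proof (subst integral_unique[symmetric], assumption, intro integral_norm_bound_integral)
    show "(\<lambda>x. 4 * pi * norm (g (c + R * cis (2 * pi * x)))) integrable_on {0..1}"
      by (intro integrable_continuous_interval continuous_intros cg)
    fix x :: real assume x: "x \<in> {0..1}"
    have e: "cis (2*pi*x) = exp (2 * of_real pi * \<i> * x)" by (simp add: cis_conv_exp mult_ac)
    have vd: "vector_derivative (circlepath c R) (at x within {0..1}) = 2 * pi * \<i> * R * cis (2*pi*x)"
      unfolding e using x by (intro vector_derivative_circlepath01) auto
    have cp: "circlepath c R x = c + R * cis (2*pi*x)" by (simp add: circlepath e)
    have "R = norm ((c + R * cis (2*pi*x)) - c)" using R by (simp add: norm_mult)
    also have "\<dots> \<le> norm ((c + R * cis (2*pi*x)) - w) + norm (w - c)" by (metis diff_add_cancel add_diff_eq norm_triangle_ineq)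
    finally have "norm ((c + R * cis (2*pi*x)) - w) \<ge> R / 2" using w by (simp add: dist_norm norm_minus_commute)
    moreover from this have "norm ((c + R * cis (2*pi*x)) - w) > 0" using R by linarith
    ultimately have "R / norm ((c + R * cis (2*pi*x)) - w) \<le> 2" by (simp only: pos_divide_le_eq)
    hence "2 * pi * norm (g (c + R * cis (2*pi*x))) * (R / norm ((c + R * cis (2*pi*x)) - w)) \<le> 2 * pi * norm (g (c + R * cis (2*pi*x))) * 2"
      by (intro mult_left_mono) auto
    moreover have "norm (g (circlepath c R x) / (circlepath c R x - w) * vector_derivative (circlepath c R) (at x within {0..1}))
      = 2 * pi * norm (g (c + R * cis (2*pi*x))) * (R / norm ((c + R * cis (2*pi*x)) - w))"
      unfolding vd cp using R by (simp add: norm_mult norm_divide)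
    ultimately show "norm (g (circlepath c R x) / (circlepath c R x - w) * vector_derivative (circlepath c R) (at x within {0..1})) \<le> 4 * pi * norm (g (c + R * cis (2*pi*x)))"
      by simp
  qed (auto simp: has_integral_integrable)
  thus ?thesis by (simp add: norm_mult)
qed

definition log_factor :: "complex \<Rightarrow> complex \<Rightarrow> real" where
  "log_factor w z = - ln (norm (1 - z * w))"

lemma log_factor_measurable [measurable]: "log_factor w \<in> borel_measurable borel"
  unfolding log_factor_def by measurable

lemma log_factor_eq_Re_Ln:
  assumes "norm z = 1" "norm w < 1"
  shows "log_factor w z = Re (- Ln (1 - z * w))"
proof -
  have "norm (z * w) < 1" using assms by (simp add: norm_mult)
  hence "1 - z * w \<noteq> 0" by auto
  thus ?thesis by (simp add: log_factor_def)
qed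

text \<open>The bound \<open>9/10\<close> keeps \<open>z * w\<close> away from the singularity of
  the logarithm; the factor 10 is \<open>1 / (1 - 9/10)\<close>.\<close>

lemma log_factor_linear_approx:
  assumes z: "norm z = 1" and w: "norm w \<le> 9/10"
  shows "\<bar>log_factor w z - Re (z * w)\<bar> \<le> 10 * norm w ^ 2" "\<bar>log_factor w z\<bar> \<le> 10 * norm w"
proof -
  have n: "norm (- (z * w)) = norm w" using z by (simp add: norm_mult)
  have "norm (Ln (1 + - (z * w)) - - (z * w)) \<le> norm (- (z * w)) ^ 2 / (1 - norm (- (z * w)))"
    by (rule Ln_approx_linear) (use n w in simp)
  also have "\<dots> \<le> norm w ^ 2 / (1 / 10)" unfolding n using w by (intro divide_left_mono) auto
  finally have "norm (Ln (1 - z * w) + z * w) \<le> 10 * norm w ^ 2" by simp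
  moreover have "log_factor w z - Re (z * w) = - Re (Ln (1 - z * w) + z * w)"
    using log_factor_eq_Re_Ln[OF z, of w] w by simp
  ultimately show 1: "\<bar>log_factor w z - Re (z * w)\<bar> \<le> 10 * norm w ^ 2"
    using abs_Re_le_cmod[of "Ln (1 - z * w) + z * w"] by simp
  have "\<bar>Re (z * w)\<bar> \<le> norm w" using abs_Re_le_cmod[of "z * w"] z by (simp add: norm_mult)
  moreover have "norm w ^ 2 \<le> 9/10 * norm w" using w using mult_right_mono[OF w, of "norm w"] by (simp add: power2_eq_square)
  ultimately show "\<bar>log_factor w z\<bar> \<le> 10 * norm w" using 1 by linarith
qed

lemma continuous_on_log_factor:
  assumes "norm w < 1"
  shows "continuous_on (sphere 0 1) (log_factor w)"
proof -
  have "1 - z * w \<noteq> 0" if "norm z = 1" for z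
  proof
    assume "1 - z * w = 0"
    hence "norm (z * w) = 1" by simp
    thus False using that assms by (simp add: norm_mult)
  qed
  thus ?thesis unfolding log_factor_def by (intro continuous_intros) auto
qed

lemma cis_in_sphere [simp]: "cis t \<in> sphere 0 1" by simp

text \<open>The logarithm of the modulus of \<open>1 - z * w\<close> is harmonic in \<open>z\<close>
  on the closed disc and vanishes at the centre, so the increments are exactly centred.\<close>

lemma log_factor_mean:
  assumes w: "norm w \<le> 9/10"
  shows "(\<integral>z. log_factor w z \<partial>uniform_circle) = 0"
proof -
  have hol: "(\<lambda>z. - Ln (1 - z * w)) holomorphic_on cball 0 1"
  proof (intro holomorphic_intros)
    fix z :: complex assume "z \<in> cball 0 1"
    hence "norm (z * w) < 1" using w mult_mono[of "norm z" 1 "norm w" "9/10"] by (simp add: norm_mult)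
    hence "Re (1 - z * w) > 0" using complex_Re_le_cmod[of "z * w"] by simp
    thus "1 - z * w \<notin> \<real>\<^sub>\<le>\<^sub>0" by (auto simp: complex_nonpos_Reals_iff)
  qed
  have "((\<lambda>x. Re (- Ln (1 - cis (2*pi*x) * w))) has_integral Re 0) {0..1}"
    using has_integral_Re[OF circle_mean_value[OF hol]] by (simp del: uminus_complex.sel)
  moreover have "Re (- Ln (1 - cis (2*pi*x) * w)) = log_factor w (cis (2*pi*x))" for x
    using w by (intro log_factor_eq_Re_Ln[symmetric]) auto
  ultimately have "((\<lambda>x. log_factor w (cis (2*pi*x))) has_integral 0) {0..1}"
    by (simp only: zero_complex.sel)
  thus ?thesis
    using w by (subst integral_uniform_circle) (auto intro!: continuous_on_log_factor integral_unique)
qed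

text \<open>\<open>(Re u)^2\<close> is \<open>Re (u^2) / 2\<close> plus half the squared modulus of
  \<open>u\<close>, and the mean of the holomorphic \<open>z^2 * w^2\<close> is its value 0 at the
  centre.\<close>

lemma Re_mult_second_moment: "(\<integral>z. (Re (z * w))\<^sup>2 \<partial>uniform_circle) = norm w ^ 2 / 2"
proof -
  have "(\<lambda>z. z^2 * w^2) holomorphic_on cball 0 1" by (intro holomorphic_intros)
  from has_integral_Re[OF circle_mean_value[OF this]]
  have "((\<lambda>x. Re ((cis (2*pi*x))\<^sup>2 * w\<^sup>2)) has_integral 0) {0..1}" by simp
  from has_integral_add[OF has_integral_divide[OF this, of 2] has_integral_const_real[of "norm w ^ 2 / 2" 0 1]]
  have "((\<lambda>x. Re ((cis (2*pi*x))\<^sup>2 * w\<^sup>2) / 2 + norm w ^ 2 / 2) has_integral (0 / 2 + norm w ^ 2 / 2)) {0..1}"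
    by (simp del: times_complex.sel)
  also have "?this \<longleftrightarrow> ((\<lambda>x. (Re (cis (2*pi*x) * w))\<^sup>2) has_integral (norm w ^ 2 / 2)) {0..1}"
  proof -
    have "(Re u)\<^sup>2 = Re (u\<^sup>2) / 2 + norm u ^ 2 / 2" for u
      unfolding cmod_power2 by (simp add: power2_eq_square field_simps)
    hence "(Re (cis t * w))\<^sup>2 = Re ((cis t)\<^sup>2 * w\<^sup>2) / 2 + norm w ^ 2 / 2" for t
      by (simp only: power_mult_distrib norm_mult norm_cis) simp
    thus ?thesis by (simp only: add_0 div_0)
  qed
  finally have "integral {0..1} (\<lambda>x. (Re (cis (2*pi*x) * w))\<^sup>2) = norm w ^ 2 / 2" by (rule integral_unique)
  thus ?thesis by (subst integral_uniform_circle) (auto intro!: continuous_intros simp del: times_complex.sel)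
qed

lemma uniform_circle_space [simp]: "space uniform_circle = UNIV" "sets uniform_circle = sets borel"
  by (simp_all add: uniform_circle_def)

lemma prob_space_uniform_circle: "prob_space uniform_circle"
  unfolding uniform_circle_def
proof (rule prob_space.prob_space_distr)
  show "prob_space (uniform_measure lborel {0..2*pi})" by (rule prob_space_uniform_measure) auto
  show "cis \<in> borel_measurable (uniform_measure lborel {0..2*pi})" by measurable
qed

lemma AE_uniform_circle: "AE z in uniform_circle. norm z = 1"
proof -
  show ?thesis unfolding uniform_circle_def
    by (subst AE_distr_iff) auto
qed

lemma integrable_uniform_circle:
  fixes g :: "complex \<Rightarrow> real"
  assumes "g \<in> borel_measurable borel" "\<And>z. norm z = 1 \<Longrightarrow> \<bar>g z\<bar> \<le> B"
  shows "integrable uniform_circle g"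
proof -
  interpret prob_space uniform_circle by (rule prob_space_uniform_circle)
  have "AE z in uniform_circle. norm (g z) \<le> B" using AE_uniform_circle assms(2) by auto
  moreover have "g \<in> borel_measurable uniform_circle" using assms(1) by (simp add: measurable_def)
  ultimately show ?thesis by (intro integrable_const_bound)
qed

lemma log_factor_second_moment:
  assumes w: "norm w \<le> 9/10"
  shows "\<bar>(\<integral>z. (log_factor w z)\<^sup>2 \<partial>uniform_circle) - norm w ^ 2 / 2\<bar> \<le> 110 * norm w ^ 3"
proof -
  interpret prob_space uniform_circle by (rule prob_space_uniform_circle)
  have bd: "\<bar>Re (z * w)\<bar> \<le> norm w" if "norm z = 1" for z
    using abs_Re_le_cmod[of "z * w"] that by (simp add: norm_mult)
  have d: "\<bar>(log_factor w z)\<^sup>2 - (Re (z * w))\<^sup>2\<bar> \<le> 110 * norm w ^ 3" if "norm z = 1" for z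
  proof -
    have "(log_factor w z)\<^sup>2 - (Re (z * w))\<^sup>2 = (log_factor w z - Re (z * w)) * (log_factor w z + Re (z * w))"
      by (simp add: power2_eq_square algebra_simps)
    also have "\<bar>\<dots>\<bar> \<le> (10 * norm w ^ 2) * (11 * norm w)"
      unfolding abs_mult using log_factor_linear_approx[OF that w] bd[OF that] by (intro mult_mono) auto
    finally show ?thesis by (simp add: power2_eq_square power3_eq_cube)
  qed
  have i1: "integrable uniform_circle (\<lambda>z. (log_factor w z)\<^sup>2)"
    using log_factor_linear_approx(2)[OF _ w]
    by (intro integrable_uniform_circle[of _ "(10 * norm w)\<^sup>2"]) (auto simp only: abs_power2 intro!: power2_le_iff_abs_le[THEN iffD2] borel_measurable_power log_factor_measurable mult_nonneg_nonneg norm_ge_zero zero_le_numeral)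
  have i2: "integrable uniform_circle (\<lambda>z. (Re (z * w))\<^sup>2)"
    using bd by (intro integrable_uniform_circle[of _ "(norm w)\<^sup>2"]) (auto intro!: power2_le_iff_abs_le[THEN iffD2])
  have "\<bar>(\<integral>z. (log_factor w z)\<^sup>2 - (Re (z * w))\<^sup>2 \<partial>uniform_circle)\<bar> \<le> (\<integral>z. \<bar>(log_factor w z)\<^sup>2 - (Re (z * w))\<^sup>2\<bar> \<partial>uniform_circle)"
    by (rule integral_abs_bound)
  also have "\<dots> \<le> (\<integral>z. 110 * norm w ^ 3 \<partial>uniform_circle)"
  proof (rule integral_mono_AE)
    show "AE z in uniform_circle. \<bar>(log_factor w z)\<^sup>2 - (Re (z * w))\<^sup>2\<bar> \<le> 110 * norm w ^ 3"
      using AE_uniform_circle d by auto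
  qed (use i1 i2 in auto)
  also have "\<dots> = 110 * norm w ^ 3" using prob_space by simp
  finally show ?thesis using i1 i2 by (simp add: Re_mult_second_moment del: times_complex.sel)
qed

text \<open>The holomorphic power has mean 1, its value at 0, and the mean of its modulus is at
  least that. This is the submartingale property behind the maximal inequality for partial Euler
  products.\<close>

lemma inverse_power_circle_ge_1:
  assumes w: "norm w \<le> 9/10"
  shows "1 \<le> (\<integral>z. norm (inverse (1 - z * w)) ^ n \<partial>uniform_circle)"
proof -
  have nz: "z * w \<noteq> 1" if "norm z \<le> 1" for z
  proof
    assume "z * w = 1"
    hence "norm (z * w) = 1" by simp
    thus False using that w mult_mono[of "norm z" 1 "norm w" "9/10"] by (simp add: norm_mult)
  qed
  have hol: "(\<lambda>z. inverse (1 - z * w) ^ n) holomorphic_on cball 0 1"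
    by (intro holomorphic_intros) (use nz in force)
  have mv: "((\<lambda>x. inverse (1 - cis (2*pi*x) * w) ^ n) has_integral 1) {0..1}"
    using circle_mean_value[OF hol] by simp
  have cc: "continuous_on (sphere 0 1) (\<lambda>z. norm (inverse (1 - z * w)) ^ n)"
    by (intro continuous_intros) (use nz in force)
  have "norm (integral {0..1} (\<lambda>x. inverse (1 - cis (2*pi*x) * w) ^ n)) \<le> integral {0..1} (\<lambda>x. norm (inverse (1 - cis (2*pi*x) * w)) ^ n)"
    using mv by (intro integral_norm_bound_integral)
      (use nz[of "cis _"] in \<open>auto simp: norm_power intro!: integrable_continuous_interval continuous_on_compose2[OF cc] continuous_intros\<close>)
  thus ?thesis unfolding integral_unique[OF mv] using cc by (subst integral_uniform_circle) auto
qed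

subsection \<open>Exponential tilting\<close>

text \<open>For independent \<open>X i\<close>, normalising each factor separately agrees with
  normalising the exponential of the total, and it lets expectations under the tilt be computed
  factor by factor.\<close>

definition tilted :: "'a measure \<Rightarrow> 'i set \<Rightarrow> ('i \<Rightarrow> 'a \<Rightarrow> real) \<Rightarrow> real \<Rightarrow> 'a measure" where
  "tilted M I X l = density M (\<lambda>\<omega>. ennreal (\<Prod>i\<in>I. exp (l * X i \<omega>) / (\<integral>\<omega>. exp (l * X i \<omega>) \<partial>M)))"

lemma space_tilted [simp]: "space (tilted M I X l) = space M"
  and sets_tilted [simp, measurable_cong]: "sets (tilted M I X l) = sets M"
  by (simp_all add: tilted_def)

context prob_space
begin

context
  fixes I :: "'i set" and X :: "'i \<Rightarrow> 'a \<Rightarrow> real" and l B :: real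
  assumes I: "finite I" and ind: "indep_vars (\<lambda>_. borel) X I"
    and bdd: "\<And>i \<omega>. i \<in> I \<Longrightarrow> \<omega> \<in> space M \<Longrightarrow> \<bar>X i \<omega>\<bar> \<le> B"
begin

lemma tilt_rv: "i \<in> I \<Longrightarrow> X i \<in> borel_measurable M"
  using ind by (auto simp: indep_vars_def)

lemma tilt_bound:
  assumes "i \<in> I" "\<omega> \<in> space M" shows "l * X i \<omega> \<le> \<bar>l\<bar> * B"
proof -
  have "l * X i \<omega> \<le> \<bar>l * X i \<omega>\<bar>" by simp
  also have "\<dots> \<le> \<bar>l\<bar> * B" unfolding abs_mult using bdd[OF assms] by (intro mult_left_mono) auto
  finally show ?thesis .
qed

lemma tilt_integrable: "i \<in> I \<Longrightarrow> integrable M (\<lambda>\<omega>. exp (l * X i \<omega>))"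
  using tilt_rv tilt_bound by (intro integrable_bounded[of _ "exp (\<bar>l\<bar> * B)"]) auto

lemma tilt_mgf_pos: assumes "i \<in> I" shows "expectation (\<lambda>\<omega>. exp (l * X i \<omega>)) > 0"
proof -
  have "exp (- (\<bar>l\<bar> * B)) \<le> exp (l * X i \<omega>)" if "\<omega> \<in> space M" for \<omega>
  proof -
    have "\<bar>l * X i \<omega>\<bar> \<le> \<bar>l\<bar> * B" unfolding abs_mult using bdd[OF assms that] by (intro mult_left_mono) auto
    thus ?thesis by auto
  qed
  hence "expectation (\<lambda>\<omega>. exp (- (\<bar>l\<bar> * B))) \<le> expectation (\<lambda>\<omega>. exp (l * X i \<omega>))"
    using assms by (intro integral_mono tilt_integrable) auto
  hence "exp (- (\<bar>l\<bar> * B)) \<le> expectation (\<lambda>\<omega>. exp (l * X i \<omega>))" using prob_space by simp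
  thus ?thesis by (rule less_le_trans[OF exp_gt_zero])
qed

lemma measure_tilted:
  assumes A: "A \<in> sets M"
  shows "measure (tilted M I X l) A = expectation (\<lambda>\<omega>. (\<Prod>i\<in>I. exp (l * X i \<omega>) / expectation (\<lambda>\<omega>. exp (l * X i \<omega>))) * indicator A \<omega>)"
proof -
  have "measure (tilted M I X l) A = (\<integral>\<omega>. indicator A \<omega> \<partial>tilted M I X l)"
    using A sets.sets_into_space[OF A] by (simp add: Int_absorb2)
  also have "\<dots> = expectation (\<lambda>\<omega>. (\<Prod>i\<in>I. exp (l * X i \<omega>) / expectation (\<lambda>\<omega>. exp (l * X i \<omega>))) *\<^sub>R indicator A \<omega>)"
    unfolding tilted_def using A tilt_rv
    by (intro integral_density) (auto intro!: prod_nonneg divide_nonneg_nonneg Bochner_Integration.integral_nonneg borel_measurable_prod borel_measurable_divide)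
  finally show ?thesis by simp
qed

text \<open>The source of the other facts about the tilt: constant \<open>g\<close> gives total mass
  1, a single nonconstant \<open>g i\<close> the marginals, and indicators show that the variables
  stay independent.\<close>

lemma tilted_expectation_product:
  assumes g: "\<And>i. i \<in> I \<Longrightarrow> g i \<in> borel_measurable borel" and gb: "\<And>i \<omega>. i \<in> I \<Longrightarrow> \<omega> \<in> space M \<Longrightarrow> \<bar>g i (X i \<omega>)\<bar> \<le> C"
  shows "(\<integral>\<omega>. (\<Prod>i\<in>I. g i (X i \<omega>)) \<partial>tilted M I X l)
      = (\<Prod>i\<in>I. expectation (\<lambda>\<omega>. g i (X i \<omega>) * exp (l * X i \<omega>)) / expectation (\<lambda>\<omega>. exp (l * X i \<omega>)))"
    and "integrable (tilted M I X l) (\<lambda>\<omega>. \<Prod>i\<in>I. g i (X i \<omega>))"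
proof -
  define W where "W i = expectation (\<lambda>\<omega>. exp (l * X i \<omega>))" for i
  define Y where "Y i \<omega> = g i (X i \<omega>) * exp (l * X i \<omega>) / W i" for i \<omega>
  have mg: "(\<lambda>\<omega>. g i (X i \<omega>)) \<in> borel_measurable M" if "i \<in> I" for i
    using measurable_compose[OF tilt_rv[OF that] g[OF that]] .
  have md: "(\<lambda>\<omega>. \<Prod>i\<in>I. exp (l * X i \<omega>) / W i) \<in> borel_measurable M"
    using tilt_rv by (intro borel_measurable_prod) auto
  have nn: "AE \<omega> in M. 0 \<le> (\<Prod>i\<in>I. exp (l * X i \<omega>) / W i)"
    unfolding W_def by (auto intro!: prod_nonneg divide_nonneg_nonneg Bochner_Integration.integral_nonneg)
  have YI: "integrable M (Y i)" if i: "i \<in> I" for i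
  proof (rule integrable_bounded[of _ "C * exp (\<bar>l\<bar> * B) / W i"])
    show "Y i \<in> borel_measurable M" unfolding Y_def using mg[OF i] tilt_rv[OF i] by measurable
    fix \<omega> assume w: "\<omega> \<in> space M"
    have "\<bar>g i (X i \<omega>)\<bar> * exp (l * X i \<omega>) \<le> C * exp (\<bar>l\<bar> * B)"
      using gb[OF i w] tilt_bound[OF i w] by (intro mult_mono) auto
    thus "norm (Y i \<omega>) \<le> C * exp (\<bar>l\<bar> * B) / W i"
      using tilt_mgf_pos[OF i] by (auto simp: Y_def abs_mult W_def[symmetric] intro!: divide_right_mono)
  qed
  have indY: "indep_vars (\<lambda>_. borel) Y I"
    unfolding Y_def using g by (intro indep_vars_compose2[OF ind, where Y="\<lambda>i x. g i x * exp (l * x) / W i"]) auto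
  have eq: "(\<Prod>i\<in>I. exp (l * X i \<omega>) / W i) *\<^sub>R (\<Prod>i\<in>I. g i (X i \<omega>)) = (\<Prod>i\<in>I. Y i \<omega>)" for \<omega>
    by (simp add: Y_def mult_ac flip: prod.distrib)
  have "(\<integral>\<omega>. (\<Prod>i\<in>I. g i (X i \<omega>)) \<partial>tilted M I X l) = expectation (\<lambda>\<omega>. (\<Prod>i\<in>I. exp (l * X i \<omega>) / W i) *\<^sub>R (\<Prod>i\<in>I. g i (X i \<omega>)))"
    unfolding tilted_def W_def[symmetric] using md nn mg
    by (intro integral_density) (auto intro!: borel_measurable_prod)
  also have "\<dots> = expectation (\<lambda>\<omega>. \<Prod>i\<in>I. Y i \<omega>)" by (simp only: eq)
  also have "\<dots> = (\<Prod>i\<in>I. expectation (Y i))" by (rule indep_vars_lebesgue_integral[OF I indY YI])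
  finally show "(\<integral>\<omega>. (\<Prod>i\<in>I. g i (X i \<omega>)) \<partial>tilted M I X l)
      = (\<Prod>i\<in>I. expectation (\<lambda>\<omega>. g i (X i \<omega>) * exp (l * X i \<omega>)) / expectation (\<lambda>\<omega>. exp (l * X i \<omega>)))"
    by (simp add: Y_def[abs_def] W_def[abs_def])
  show "integrable (tilted M I X l) (\<lambda>\<omega>. \<Prod>i\<in>I. g i (X i \<omega>))"
    unfolding tilted_def W_def[symmetric] using md nn mg indep_vars_integrable[OF I indY YI]
    by (subst integrable_density) (auto intro!: borel_measurable_prod simp: eq[simplified])
qed

lemma prob_space_tilted: "prob_space (tilted M I X l)"
proof (rule prob_spaceI)
  have "integrable (tilted M I X l) (\<lambda>\<omega>. 1 :: real)"
    using tilted_expectation_product(2)[of "\<lambda>_ _. 1" 1] by simp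
  also have "?this \<longleftrightarrow> integrable (tilted M I X l) (indicator (space (tilted M I X l)) :: _ \<Rightarrow> real)"
    by (intro Bochner_Integration.integrable_cong) auto
  finally have f: "finite_measure (tilted M I X l)"
    by (intro finite_measureI) (auto simp: integrable_indicator_iff)
  have "measure (tilted M I X l) (space (tilted M I X l)) = (\<integral>\<omega>. 1 \<partial>tilted M I X l)" by simp
  also have "\<dots> = 1"
    using tilted_expectation_product(1)[of "\<lambda>_ _. 1" 1] tilt_mgf_pos by (simp add: less_imp_neq[symmetric])
  finally show "emeasure (tilted M I X l) (space (tilted M I X l)) = 1"
    using finite_measure.emeasure_eq_measure[OF f] by simp
qed

lemma tilted_expectation:
  assumes i: "i \<in> I" and g: "g \<in> borel_measurable borel" and gb: "\<And>\<omega>. \<omega> \<in> space M \<Longrightarrow> \<bar>g (X i \<omega>)\<bar> \<le> C"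
  shows "(\<integral>\<omega>. g (X i \<omega>) \<partial>tilted M I X l) = expectation (\<lambda>\<omega>. g (X i \<omega>) * exp (l * X i \<omega>)) / expectation (\<lambda>\<omega>. exp (l * X i \<omega>))"
proof -
  let ?g = "\<lambda>j. if j = i then g else (\<lambda>_. 1)"
  have pr: "(\<Prod>j\<in>I. ?g j (X j \<omega>)) = g (X i \<omega>)" for \<omega>
    using I i by (subst prod.remove[of _ i]) auto
  have "(\<integral>\<omega>. (\<Prod>j\<in>I. ?g j (X j \<omega>)) \<partial>tilted M I X l)
      = (\<Prod>j\<in>I. expectation (\<lambda>\<omega>. ?g j (X j \<omega>) * exp (l * X j \<omega>)) / expectation (\<lambda>\<omega>. exp (l * X j \<omega>)))"
    by (rule tilted_expectation_product[where C="max C 1"]) (use g gb in \<open>auto simp: le_max_iff_disj\<close>)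
  also have "\<dots> = expectation (\<lambda>\<omega>. g (X i \<omega>) * exp (l * X i \<omega>)) / expectation (\<lambda>\<omega>. exp (l * X i \<omega>))"
    using I i tilt_mgf_pos by (subst prod.remove[of _ i]) (auto intro!: prod.neutral simp: less_imp_neq[symmetric])
  finally show ?thesis by (simp only: pr)
qed

lemma indep_vars_tilted: "prob_space.indep_vars (tilted M I X l) (\<lambda>_. borel) X I"
proof -
  interpret T: prob_space "tilted M I X l" by (rule prob_space_tilted)
  have mX: "X i \<in> borel_measurable (tilted M I X l)" if "i \<in> I" for i
    using tilt_rv[OF that] by simp
  have key: "T.prob (\<Inter>j\<in>J. X j -` A j \<inter> space M) = (\<Prod>j\<in>J. T.prob (X j -` A j \<inter> space M))"
    if J: "J \<noteq> {}" "J \<subseteq> I" and A: "\<And>j. j \<in> J \<Longrightarrow> A j \<in> sets borel" for J and A :: "'i \<Rightarrow> real set"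
  proof -
    have fJ: "finite J" using J I by (metis finite_subset)
    let ?e = "\<lambda>i. expectation (\<lambda>\<omega>. exp (l * X i \<omega>))"
    let ?g = "\<lambda>j. if j \<in> J then indicator (A j) else (\<lambda>_. 1 :: real)"
    have pr: "(\<Prod>j\<in>I. ?g j (X j \<omega>)) = indicator (\<Inter>j\<in>J. X j -` A j \<inter> space M) \<omega>" if "\<omega> \<in> space M" for \<omega>
    proof -
      have "(\<Prod>j\<in>I. ?g j (X j \<omega>)) = (\<Prod>j\<in>J. indicator (A j) (X j \<omega>))"
        using I J by (intro prod.mono_neutral_cong_right) auto
      also have "\<dots> = indicator (\<Inter>j\<in>J. X j -` A j \<inter> space M) \<omega>"
        using J(1) that by (auto simp: indicator_def prod_zero_iff fJ)
      finally show ?thesis .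
    qed
    have ms: "(\<Inter>j\<in>J. X j -` A j \<inter> space M) \<in> sets M"
      using J A fJ tilt_rv by (intro sets.finite_INT) (auto intro!: measurable_sets)
    have "T.prob (\<Inter>j\<in>J. X j -` A j \<inter> space M) = (\<integral>\<omega>. indicator (\<Inter>j\<in>J. X j -` A j \<inter> space M) \<omega> \<partial>tilted M I X l)"
      using ms J by (auto intro!: arg_cong[where f=T.prob])
    also have "\<dots> = (\<integral>\<omega>. (\<Prod>j\<in>I. ?g j (X j \<omega>)) \<partial>tilted M I X l)"
      by (intro Bochner_Integration.integral_cong) (auto simp: pr)
    also have "\<dots> = (\<Prod>j\<in>I. expectation (\<lambda>\<omega>. ?g j (X j \<omega>) * exp (l * X j \<omega>)) / ?e j)"
      by (rule tilted_expectation_product[where C=1]) (use A in \<open>auto simp: indicator_def\<close>)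
    also have "\<dots> = (\<Prod>j\<in>J. expectation (\<lambda>\<omega>. indicator (A j) (X j \<omega>) * exp (l * X j \<omega>)) / ?e j)"
      using I J tilt_mgf_pos by (intro prod.mono_neutral_cong_right) (auto simp: less_imp_neq[symmetric])
    also have "\<dots> = (\<Prod>j\<in>J. T.prob (X j -` A j \<inter> space M))"
    proof (intro prod.cong refl)
      fix j assume j: "j \<in> J"
      have "expectation (\<lambda>\<omega>. indicator (A j) (X j \<omega>) * exp (l * X j \<omega>)) / ?e j = (\<integral>\<omega>. indicator (A j) (X j \<omega>) \<partial>tilted M I X l)"
        by (rule tilted_expectation[symmetric, where C=1]) (use j J A in \<open>auto simp: indicator_def\<close>)
      also have "\<dots> = (\<integral>\<omega>. indicator (X j -` A j \<inter> space M) \<omega> \<partial>tilted M I X l)"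
        by (intro Bochner_Integration.integral_cong) (auto simp: indicator_def)
      also have "\<dots> = T.prob (X j -` A j \<inter> space M)" by (auto intro!: arg_cong[where f=T.prob])
      finally show "expectation (\<lambda>\<omega>. indicator (A j) (X j \<omega>) * exp (l * X j \<omega>)) / ?e j = T.prob (X j -` A j \<inter> space M)" .
    qed
    finally show ?thesis .
  qed
  show ?thesis
    unfolding T.indep_vars_def2
  proof (intro conjI ballI mX T.indep_setsI)
    fix i assume i: "i \<in> I"
    thus "{X i -` A \<inter> space (tilted M I X l) |A. A \<in> sets borel} \<subseteq> T.events"
      using measurable_sets[OF mX[OF i]] by auto
  next
    fix A J assume J: "J \<noteq> {}" "J \<subseteq> I" "finite J" and A: "\<forall>j\<in>J. A j \<in> {X j -` A \<inter> space (tilted M I X l) |A. A \<in> sets borel}"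
    then obtain A' where A': "\<And>j. j \<in> J \<Longrightarrow> A j = X j -` A' j \<inter> space M" "\<And>j. j \<in> J \<Longrightarrow> A' j \<in> sets borel"
      by (simp add: Bex_def) metis
    show "T.prob (\<Inter>j\<in>J. A j) = (\<Prod>j\<in>J. T.prob (A j))"
      using key[OF J(1,2), of A'] A' by simp
  qed
qed

text \<open>On \<open>A\<close> the inverse of the density is at most \<open>exp (- l * u)\<close>
  times the product of the normalisations.\<close>

lemma prob_le_tilted:
  assumes l: "l \<ge> 0" and A: "A \<in> sets M" and u: "\<And>\<omega>. \<omega> \<in> A \<Longrightarrow> u \<le> (\<Sum>i\<in>I. X i \<omega>)"
  shows "prob A \<le> exp (- l * u) * (\<Prod>i\<in>I. expectation (\<lambda>\<omega>. exp (l * X i \<omega>))) * measure (tilted M I X l) A"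
proof -
  define W where "W = (\<Prod>i\<in>I. expectation (\<lambda>\<omega>. exp (l * X i \<omega>)))"
  have W: "W > 0" unfolding W_def using tilt_mgf_pos by (intro prod_pos) auto
  have eq: "(\<Prod>i\<in>I. exp (l * X i \<omega>) / expectation (\<lambda>\<omega>. exp (l * X i \<omega>))) = exp (l * (\<Sum>i\<in>I. X i \<omega>)) / W" for \<omega>
    using I by (simp add: prod_dividef W_def exp_sum sum_distrib_left)
  have Sb: "(\<Sum>i\<in>I. X i \<omega>) \<le> real (card I) * B" if "\<omega> \<in> space M" for \<omega>
    using bdd that by (intro sum_bounded_above[THEN order_trans]) (auto dest: abs_le_D1)
  have "prob A = expectation (\<lambda>\<omega>. indicator A \<omega>)" using A sets.sets_into_space[OF A] by (simp add: Int_absorb2)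
  also have "\<dots> \<le> expectation (\<lambda>\<omega>. exp (- l * u) * W * (exp (l * (\<Sum>i\<in>I. X i \<omega>)) / W * indicator A \<omega>))"
  proof (rule integral_mono)
    show "integrable M (\<lambda>\<omega>. indicator A \<omega> :: real)" using A by (intro integrable_real_indicator) (auto simp: emeasure_eq_measure)
    have "integrable M (\<lambda>\<omega>. exp (l * (\<Sum>i\<in>I. X i \<omega>)) / W * indicator A \<omega>)"
    proof (rule integrable_bounded[of _ "exp (l * (real (card I) * B)) / W"])
      show "(\<lambda>\<omega>. exp (l * (\<Sum>i\<in>I. X i \<omega>)) / W * indicator A \<omega>) \<in> borel_measurable M"
        using A tilt_rv by (intro borel_measurable_times borel_measurable_divide borel_measurable_indicator
            measurable_compose[OF _ borel_measurable_exp] borel_measurable_sum) auto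
      fix \<omega> assume "\<omega> \<in> space M"
      hence "l * (\<Sum>i\<in>I. X i \<omega>) \<le> l * (real (card I) * B)" using l Sb by (intro mult_left_mono) auto
      thus "norm (exp (l * (\<Sum>i\<in>I. X i \<omega>)) / W * indicator A \<omega>) \<le> exp (l * (real (card I) * B)) / W"
        using W by (auto simp: indicator_def intro!: divide_right_mono)
    qed
    thus "integrable M (\<lambda>\<omega>. exp (- l * u) * W * (exp (l * (\<Sum>i\<in>I. X i \<omega>)) / W * indicator A \<omega>))"
      by (intro integrable_mult_right)
    fix \<omega> assume "\<omega> \<in> space M"
    show "indicator A \<omega> \<le> exp (- l * u) * W * (exp (l * (\<Sum>i\<in>I. X i \<omega>)) / W * indicator A \<omega>)"
      using mult_left_mono[OF u l, of \<omega>] W by (auto simp: indicator_def simp flip: exp_add)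
  qed
  also have "\<dots> = exp (- l * u) * W * measure (tilted M I X l) A"
    by (subst measure_tilted[OF A]) (simp add: eq)
  finally show ?thesis unfolding W_def .
qed

end

end

section \<open>Exponential moments of a small centred variable\<close>

lemma square_le_of_abs_le:
  fixes x r :: real
  shows "\<bar>x\<bar> \<le> 10 * r \<Longrightarrow> x\<^sup>2 \<le> 100 * r\<^sup>2" "\<bar>x\<bar> \<le> 20 * r \<Longrightarrow> x\<^sup>2 \<le> 400 * r\<^sup>2"
  using power_mono[of "\<bar>x\<bar>" "10 * r" 2] power_mono[of "\<bar>x\<bar>" "20 * r" 2] by (auto simp: power_mult_distrib)

lemma exp_taylor1: "\<bar>exp (u::real) - 1 - u\<bar> \<le> u\<^sup>2 * exp \<bar>u\<bar>"
proof -
  obtain t where t: "\<bar>t\<bar> \<le> \<bar>u\<bar>" "exp u = (\<Sum>m<2. u ^ m / fact m) + exp t / fact 2 * u ^ 2"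
    using Maclaurin_exp_le[of u 2] by blast
  have "exp u - 1 - u = exp t / 2 * u\<^sup>2" using t(2) by (simp add: eval_nat_numeral)
  moreover have "exp t \<le> exp \<bar>u\<bar>" using t(1) by simp
  hence "exp t / 2 * u\<^sup>2 \<le> exp \<bar>u\<bar> * u\<^sup>2" using exp_gt_zero[of t] by (intro mult_right_mono, linarith) simp
  moreover have "exp t / 2 * u\<^sup>2 \<ge> 0" by simp
  ultimately have "\<bar>exp u - 1 - u\<bar> \<le> exp \<bar>u\<bar> * u\<^sup>2" by linarith
  thus ?thesis by (simp add: mult.commute)
qed

lemma exp_taylor2: "\<bar>exp (u::real) - 1 - u - u\<^sup>2 / 2\<bar> \<le> \<bar>u\<bar> ^ 3 * exp \<bar>u\<bar>"
proof -
  obtain t where t: "\<bar>t\<bar> \<le> \<bar>u\<bar>" "exp u = (\<Sum>m<3. u ^ m / fact m) + exp t / fact 3 * u ^ 3"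
    using Maclaurin_exp_le[of u 3] by blast
  have "exp u - 1 - u - u\<^sup>2 / 2 = exp t / 6 * u ^ 3" using t(2) by (simp add: eval_nat_numeral)
  moreover have "exp t \<le> exp \<bar>u\<bar>" using t(1) by simp
  hence "exp t / 6 * \<bar>u\<bar> ^ 3 \<le> exp \<bar>u\<bar> * \<bar>u\<bar> ^ 3" using exp_gt_zero[of t] by (intro mult_right_mono, linarith) simp
  moreover have "\<bar>exp t / 6 * u ^ 3\<bar> = exp t / 6 * \<bar>u\<bar> ^ 3" by (simp add: abs_mult power_abs)
  ultimately have "\<bar>exp u - 1 - u - u\<^sup>2 / 2\<bar> \<le> exp \<bar>u\<bar> * \<bar>u\<bar> ^ 3" by simp
  thus ?thesis by (simp add: mult.commute)
qed

lemma exp_ge_quadratic: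
  assumes "\<bar>u::real\<bar> \<le> R" shows "1 + u + exp (- R) / 2 * u\<^sup>2 \<le> exp u"
proof -
  obtain t where t: "\<bar>t\<bar> \<le> \<bar>u\<bar>" "exp u = (\<Sum>m<2. u ^ m / fact m) + exp t / fact 2 * u ^ 2"
    using Maclaurin_exp_le[of u 2] by blast
  have "exp u = 1 + u + exp t / 2 * u\<^sup>2" using t(2) by (simp add: eval_nat_numeral)
  moreover have "exp (- R) \<le> exp t" using t(1) assms by simp
  hence "exp (- R) / 2 * u\<^sup>2 \<le> exp t / 2 * u\<^sup>2" by (intro mult_right_mono) auto
  ultimately show ?thesis by simp
qed

text \<open>A centred variable of size \<open>r\<close> with the variance of \<open>Re (r Z)\<close>, up to third order.\<close>

definition small_var :: "'a measure \<Rightarrow> ('a \<Rightarrow> real) \<Rightarrow> real \<Rightarrow> bool" where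
  "small_var M X r \<longleftrightarrow> X \<in> borel_measurable M \<and> 0 < r \<and> r \<le> 9/10 \<and> (\<forall>\<omega>\<in>space M. \<bar>X \<omega>\<bar> \<le> 10 * r)
     \<and> (\<integral>\<omega>. X \<omega> \<partial>M) = 0 \<and> \<bar>(\<integral>\<omega>. (X \<omega>)\<^sup>2 \<partial>M) - r\<^sup>2 / 2\<bar> \<le> 110 * r ^ 3"

text \<open>The exponent is the bound \<open>4 * 10 * 9/10 = 36\<close> for \<open>l * X\<close>;
  100000 exceeds \<open>64000 + 880\<close>, the Taylor error and the variance error in the worst of
  the three moment estimates.\<close>

definition tilt_const :: real where "tilt_const = 100000 * exp 36"

lemma tilt_const_ge: "tilt_const \<ge> 100000"
  by (simp add: tilt_const_def)

lemma cube_pos_bounds: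
  assumes "0 < r" "r \<le> (1::real)"
  shows "r ^ 3 \<le> r\<^sup>2" "r ^ 4 \<le> r ^ 3" "r ^ 5 \<le> r ^ 3" "0 < r ^ 3" "0 < r\<^sup>2"
  using assms by (auto intro!: power_decreasing)

context prob_space
begin

lemma expectation_approx:
  fixes g h :: "'a \<Rightarrow> real"
  assumes "integrable M g" "integrable M h" "\<And>\<omega>. \<omega> \<in> space M \<Longrightarrow> \<bar>g \<omega> - h \<omega>\<bar> \<le> e"
  shows "\<bar>expectation g - expectation h\<bar> \<le> e"
proof -
  have "\<bar>expectation g - expectation h\<bar> = \<bar>expectation (\<lambda>\<omega>. g \<omega> - h \<omega>)\<bar>" using assms by simp
  also have "\<dots> \<le> expectation (\<lambda>\<omega>. \<bar>g \<omega> - h \<omega>\<bar>)" by (rule integral_abs_bound)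
  also have "\<dots> \<le> expectation (\<lambda>\<omega>. e)" using assms by (intro integral_mono) auto
  finally show ?thesis using prob_space by simp
qed

context
  fixes X :: "'a \<Rightarrow> real" and r l :: real
  assumes sv: "small_var M X r" and l: "0 \<le> l" "l \<le> 4"
begin

lemma sv_facts: "X \<in> borel_measurable M" "0 < r" "r \<le> 9/10" "expectation X = 0"
   "\<bar>expectation (\<lambda>\<omega>. (X \<omega>)\<^sup>2) - r\<^sup>2 / 2\<bar> \<le> 110 * r ^ 3"
  using sv by (auto simp: small_var_def)

lemma sv_bound: "\<omega> \<in> space M \<Longrightarrow> \<bar>X \<omega>\<bar> \<le> 10 * r"
  using sv by (auto simp: small_var_def)

lemma sv_int:
  fixes g :: "real \<Rightarrow> real"
  assumes "g \<in> borel_measurable borel" "\<And>x. \<bar>x\<bar> \<le> 10 * r \<Longrightarrow> \<bar>g x\<bar> \<le> C"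
  shows "integrable M (\<lambda>\<omega>. g (X \<omega>))"
  using assms sv_bound measurable_compose[OF sv_facts(1) assms(1)] by (intro integrable_bounded[of _ C]) auto

lemma sv_lx: assumes "\<omega> \<in> space M" shows "\<bar>l * X \<omega>\<bar> \<le> 40 * r" "exp \<bar>l * X \<omega>\<bar> \<le> exp 36"
proof -
  show "\<bar>l * X \<omega>\<bar> \<le> 40 * r"
    unfolding abs_mult using mult_mono[of "\<bar>l\<bar>" 4 "\<bar>X \<omega>\<bar>" "10 * r"] sv_bound[OF assms] l by auto
  thus "exp \<bar>l * X \<omega>\<bar> \<le> exp 36" using sv_facts by auto
qed

lemma sv_lin_bound: assumes "\<bar>x\<bar> \<le> 10 * r" shows "l * x \<le> 36"
proof -
  have "\<bar>l * x\<bar> \<le> 4 * (10 * r)" unfolding abs_mult using assms l by (intro mult_mono) auto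
  thus ?thesis using sv_facts(3) by linarith
qed

lemma sv_int_exp: "integrable M (\<lambda>\<omega>. exp (l * X \<omega>))"
  using sv_int[of "\<lambda>x. exp (l * x)" "exp 36"] sv_lin_bound by auto

lemma sv_int_X: "integrable M X" "integrable M (\<lambda>\<omega>. (X \<omega>)\<^sup>2)"
  using sv_int[of "\<lambda>x. x" "10 * r"] sv_int[of "\<lambda>x. x\<^sup>2" "100 * r\<^sup>2"]
  by (auto simp: square_le_of_abs_le)

lemma sv_int_Xexp: "integrable M (\<lambda>\<omega>. X \<omega> * exp (l * X \<omega>))" "integrable M (\<lambda>\<omega>. (X \<omega>)\<^sup>2 * exp (l * X \<omega>))"
proof -
  show "integrable M (\<lambda>\<omega>. X \<omega> * exp (l * X \<omega>))"
    using sv_lin_bound sv_facts by (intro sv_int[of "\<lambda>x. x * exp (l * x)" "10 * r * exp 36"]) (auto simp: abs_mult intro!: mult_mono)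
  show "integrable M (\<lambda>\<omega>. (X \<omega>)\<^sup>2 * exp (l * X \<omega>))"
    using sv_lin_bound sv_facts by (intro sv_int[of "\<lambda>x. x\<^sup>2 * exp (l * x)" "100 * r\<^sup>2 * exp 36"])
      (auto simp: abs_mult square_le_of_abs_le intro!: mult_mono)
qed

lemma small_var_mgf: "\<bar>expectation (\<lambda>\<omega>. exp (l * X \<omega>)) - 1 - l\<^sup>2 * r\<^sup>2 / 4\<bar> \<le> tilt_const * r ^ 3"
proof -
  have r: "0 < r" "r \<le> 9/10" using sv_facts by auto
  have "\<bar>expectation (\<lambda>\<omega>. exp (l * X \<omega>)) - expectation (\<lambda>\<omega>. 1 + l * X \<omega> + l\<^sup>2 / 2 * (X \<omega>)\<^sup>2)\<bar> \<le> (40 * r) ^ 3 * exp 36"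
  proof (rule expectation_approx[OF sv_int_exp])
    fix \<omega> assume w: "\<omega> \<in> space M"
    have "\<bar>exp (l * X \<omega>) - (1 + l * X \<omega> + l\<^sup>2 / 2 * (X \<omega>)\<^sup>2)\<bar> \<le> \<bar>l * X \<omega>\<bar> ^ 3 * exp \<bar>l * X \<omega>\<bar>"
      using exp_taylor2[of "l * X \<omega>"] by (simp add: power_mult_distrib algebra_simps)
    also have "\<dots> \<le> (40 * r) ^ 3 * exp 36" using sv_lx[OF w] by (intro mult_mono power_mono) auto
    finally show "\<bar>exp (l * X \<omega>) - (1 + l * X \<omega> + l\<^sup>2 / 2 * (X \<omega>)\<^sup>2)\<bar> \<le> (40 * r) ^ 3 * exp 36" .
  qed (use sv_int_X in auto)
  also have "expectation (\<lambda>\<omega>. 1 + l * X \<omega> + l\<^sup>2 / 2 * (X \<omega>)\<^sup>2) = 1 + l\<^sup>2 / 2 * expectation (\<lambda>\<omega>. (X \<omega>)\<^sup>2)"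
    using sv_int_X sv_facts(4) prob_space by simp
  finally have 1: "\<bar>expectation (\<lambda>\<omega>. exp (l * X \<omega>)) - (1 + l\<^sup>2 / 2 * expectation (\<lambda>\<omega>. (X \<omega>)\<^sup>2))\<bar> \<le> 64000 * exp 36 * r ^ 3"
    by (simp add: power_mult_distrib mult_ac)
  have "\<bar>l\<^sup>2 / 2 * (expectation (\<lambda>\<omega>. (X \<omega>)\<^sup>2) - r\<^sup>2 / 2)\<bar> \<le> 4\<^sup>2 / 2 * (110 * r ^ 3)"
    unfolding abs_mult using sv_facts(5) power_mono[OF l(2,1), of 2] by (intro mult_mono) auto
  hence 2: "\<bar>l\<^sup>2 / 2 * expectation (\<lambda>\<omega>. (X \<omega>)\<^sup>2) - l\<^sup>2 * r\<^sup>2 / 4\<bar> \<le> 880 * r ^ 3"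
    by (simp add: algebra_simps)
  have "880 * r ^ 3 \<le> 880 * exp 36 * r ^ 3" using r by simp
  moreover have "exp (36::real) * r ^ 3 \<ge> 0" using r by simp
  ultimately show ?thesis using 1 2 unfolding tilt_const_def abs_le_iff by (simp only: mult.assoc) linarith
qed

lemma small_var_moment1: "\<bar>expectation (\<lambda>\<omega>. X \<omega> * exp (l * X \<omega>)) - l * r\<^sup>2 / 2\<bar> \<le> tilt_const * r ^ 3"
proof -
  have r: "0 < r" "r \<le> 9/10" using sv_facts by auto
  have "\<bar>expectation (\<lambda>\<omega>. X \<omega> * exp (l * X \<omega>)) - expectation (\<lambda>\<omega>. X \<omega> + l * (X \<omega>)\<^sup>2)\<bar> \<le> 10 * r * ((40 * r) ^ 2 * exp 36)"
  proof (rule expectation_approx[OF sv_int_Xexp(1)])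
    fix \<omega> assume w: "\<omega> \<in> space M"
    have "X \<omega> * exp (l * X \<omega>) - (X \<omega> + l * (X \<omega>)\<^sup>2) = X \<omega> * (exp (l * X \<omega>) - 1 - l * X \<omega>)"
      by (simp add: algebra_simps power2_eq_square)
    also have "\<bar>\<dots>\<bar> \<le> (10 * r) * (\<bar>l * X \<omega>\<bar> ^ 2 * exp \<bar>l * X \<omega>\<bar>)"
      unfolding abs_mult[of "X \<omega>"] using exp_taylor1[of "l * X \<omega>"] sv_bound[OF w] r by (intro mult_mono) auto
    also have "\<dots> \<le> (10 * r) * ((40 * r) ^ 2 * exp 36)" using sv_lx[OF w] r by (intro mult_left_mono mult_mono power_mono) auto
    finally show "\<bar>X \<omega> * exp (l * X \<omega>) - (X \<omega> + l * (X \<omega>)\<^sup>2)\<bar> \<le> 10 * r * ((40 * r) ^ 2 * exp 36)" .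
  qed (use sv_int_X in auto)
  also have "expectation (\<lambda>\<omega>. X \<omega> + l * (X \<omega>)\<^sup>2) = l * expectation (\<lambda>\<omega>. (X \<omega>)\<^sup>2)"
    using sv_int_X sv_facts(4) by simp
  finally have 1: "\<bar>expectation (\<lambda>\<omega>. X \<omega> * exp (l * X \<omega>)) - l * expectation (\<lambda>\<omega>. (X \<omega>)\<^sup>2)\<bar> \<le> 16000 * exp 36 * r ^ 3"
    by (simp add: power_mult_distrib mult_ac power2_eq_square power3_eq_cube)
  have "\<bar>l * (expectation (\<lambda>\<omega>. (X \<omega>)\<^sup>2) - r\<^sup>2 / 2)\<bar> \<le> 4 * (110 * r ^ 3)"
    unfolding abs_mult using sv_facts(5) l by (intro mult_mono) auto
  hence 2: "\<bar>l * expectation (\<lambda>\<omega>. (X \<omega>)\<^sup>2) - l * r\<^sup>2 / 2\<bar> \<le> 440 * r ^ 3"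
    by (simp add: algebra_simps)
  have "440 * r ^ 3 \<le> 440 * exp 36 * r ^ 3" using r by simp
  moreover have "exp (36::real) * r ^ 3 \<ge> 0" using r by simp
  ultimately show ?thesis using 1 2 unfolding tilt_const_def abs_le_iff by (simp only: mult.assoc) linarith
qed

lemma small_var_moment2: "\<bar>expectation (\<lambda>\<omega>. (X \<omega>)\<^sup>2 * exp (l * X \<omega>)) - r\<^sup>2 / 2\<bar> \<le> tilt_const * r ^ 3"
proof -
  have r: "0 < r" "r \<le> 9/10" using sv_facts by auto
  have "\<bar>expectation (\<lambda>\<omega>. (X \<omega>)\<^sup>2 * exp (l * X \<omega>)) - expectation (\<lambda>\<omega>. (X \<omega>)\<^sup>2)\<bar> \<le> 100 * r\<^sup>2 * (40 * r * exp 36 )"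
  proof (rule expectation_approx[OF sv_int_Xexp(2)])
    fix \<omega> assume w: "\<omega> \<in> space M"
    define u where "u = l * X \<omega>"
    obtain t where t: "\<bar>t\<bar> \<le> \<bar>u\<bar>" "exp u = (\<Sum>m<1. u ^ m / fact m) + exp t / fact 1 * u ^ 1"
      using Maclaurin_exp_le[of u 1] by blast
    have "\<bar>exp u - 1\<bar> = \<bar>u\<bar> * exp t" using t(2) by (simp add: abs_mult)
    also have "\<dots> \<le> (40 * r) * exp 36"
      using t(1) sv_lx[OF w] r by (intro mult_mono) (auto simp: u_def)
    finally have e: "\<bar>exp u - 1\<bar> \<le> 40 * r * exp 36" .
    have "(X \<omega>)\<^sup>2 * exp (l * X \<omega>) - (X \<omega>)\<^sup>2 = (X \<omega>)\<^sup>2 * (exp u - 1)"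
      by (simp add: algebra_simps u_def)
    also have "\<bar>\<dots>\<bar> \<le> 100 * r\<^sup>2 * (40 * r * exp 36)"
      unfolding abs_mult using e sv_bound[OF w] r by (intro mult_mono) (auto simp: square_le_of_abs_le)
    finally show "\<bar>(X \<omega>)\<^sup>2 * exp (l * X \<omega>) - (X \<omega>)\<^sup>2\<bar> \<le> 100 * r\<^sup>2 * (40 * r * exp 36)" .
  qed (use sv_int_X in auto)
  hence 1: "\<bar>expectation (\<lambda>\<omega>. (X \<omega>)\<^sup>2 * exp (l * X \<omega>)) - expectation (\<lambda>\<omega>. (X \<omega>)\<^sup>2)\<bar> \<le> 4000 * exp 36 * r ^ 3"
    by (simp add: power_mult_distrib mult_ac power2_eq_square power3_eq_cube)
  have "110 * r ^ 3 \<le> 110 * exp 36 * r ^ 3" using r by simp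
  moreover have "exp (36::real) * r ^ 3 \<ge> 0" using r by simp
  ultimately show ?thesis using 1 sv_facts(5) unfolding tilt_const_def abs_le_iff by (simp only: mult.assoc) linarith
qed

lemma small_var_mgf_ge_1: "expectation (\<lambda>\<omega>. exp (l * X \<omega>)) \<ge> 1"
proof -
  have "expectation (\<lambda>\<omega>. 1 + l * X \<omega>) \<le> expectation (\<lambda>\<omega>. exp (l * X \<omega>))"
    using sv_int_X sv_int_exp by (intro integral_mono) (auto simp: exp_ge_add_one_self)
  thus ?thesis using sv_int_X sv_facts(4) prob_space by simp
qed

section \<open>One variable of a jointly tilted family\<close>

context
  fixes T
  assumes T: "prob_space T" "sets T = sets M"
    and TE: "\<And>g C. g \<in> borel_measurable borel \<Longrightarrow> (\<And>\<omega>. \<omega> \<in> space M \<Longrightarrow> \<bar>g (X \<omega>)\<bar> \<le> C) \<Longrightarrow>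
       (\<integral>\<omega>. g (X \<omega>) \<partial>T) = expectation (\<lambda>\<omega>. g (X \<omega>) * exp (l * X \<omega>)) / expectation (\<lambda>\<omega>. exp (l * X \<omega>))"
begin

lemma sT: "space T = space M"
  using T(2) by (rule sets_eq_imp_space_eq)

lemma XT: "X \<in> borel_measurable T"
  using sv_facts(1) T(2) by (simp cong: measurable_cong_sets)

lemma tilt_int:
  assumes "g \<in> borel_measurable borel" "\<And>x. \<bar>x\<bar> \<le> 10 * r \<Longrightarrow> \<bar>g x\<bar> \<le> C"
  shows "integrable T (\<lambda>\<omega>. g (X \<omega>) :: real)"
proof -
  interpret T: prob_space T by (rule T)
  show ?thesis using assms sv_bound measurable_compose[OF XT assms(1)]
    by (intro T.integrable_bounded[of _ C]) (auto simp: sT)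
qed

text \<open>The normalisation exceeds 1 by \<open>O(r^2)\<close> and \<open>b\<close> is itself
  \<open>O(r^2)\<close>, so dividing by it costs only \<open>O(r^4)\<close>, which the third-order
  error absorbs.\<close>

lemma tilt_ratio:
  assumes a: "\<bar>a - b\<bar> \<le> tilt_const * r ^ 3" and b: "0 \<le> b" "b \<le> 2 * r\<^sup>2"
  shows "\<bar>a / expectation (\<lambda>\<omega>. exp (l * X \<omega>)) - b\<bar> \<le> 4 * tilt_const * r ^ 3"
proof -
  define Z where "Z = expectation (\<lambda>\<omega>. exp (l * X \<omega>))"
  have Z1: "Z \<ge> 1" using small_var_mgf_ge_1 by (simp add: Z_def)
  have r: "0 < r" "r \<le> 1" using sv_facts by auto
  have K: "tilt_const \<ge> 100000" by (rule tilt_const_ge)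
  have "l\<^sup>2 * r\<^sup>2 \<le> 4\<^sup>2 * r\<^sup>2" using l by (intro mult_right_mono power_mono) auto
  hence "l\<^sup>2 * r\<^sup>2 / 4 \<le> 4 * r\<^sup>2" by simp
  hence Z2: "Z - 1 \<le> 4 * r\<^sup>2 + tilt_const * r ^ 3" using small_var_mgf unfolding Z_def by (simp only: abs_le_iff) linarith
  have "a / Z - b = (a - b) / Z - b * ((Z - 1) / Z)" using Z1 by (simp add: field_simps)
  also have "\<bar>\<dots>\<bar> \<le> \<bar>(a - b) / Z\<bar> + \<bar>b * ((Z - 1) / Z)\<bar>" by (rule abs_triangle_ineq4)
  also have "\<bar>(a - b) / Z\<bar> \<le> tilt_const * r ^ 3"
  proof -
    have "\<bar>(a - b) / Z\<bar> \<le> \<bar>a - b\<bar> / 1" unfolding abs_divide using Z1 by (intro frac_le) auto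
    thus ?thesis using a by simp
  qed
  also have "\<bar>b * ((Z - 1) / Z)\<bar> \<le> 2 * r\<^sup>2 * (4 * r\<^sup>2 + tilt_const * r ^ 3)"
  proof -
    have "(Z - 1) / Z \<le> (Z - 1) / 1" using Z1 by (intro frac_le) auto
    hence "(Z - 1) / Z \<le> 4 * r\<^sup>2 + tilt_const * r ^ 3" using Z2 by simp
    moreover have "(Z - 1) / Z \<ge> 0" using Z1 by simp
    ultimately show ?thesis unfolding abs_mult using b by (intro mult_mono) auto
  qed
  also have "2 * r\<^sup>2 * (4 * r\<^sup>2 + tilt_const * r ^ 3) = 8 * r ^ 4 + 2 * tilt_const * r ^ 5"
    by (simp add: algebra_simps eval_nat_numeral)
  also have "\<dots> \<le> 8 * r ^ 3 + 2 * tilt_const * r ^ 3"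
    using cube_pos_bounds[OF r] K by (intro add_mono mult_left_mono) auto
  also have "tilt_const * r ^ 3 + (8 * r ^ 3 + 2 * tilt_const * r ^ 3) \<le> 4 * tilt_const * r ^ 3"
    using mult_right_mono[OF K, of "r^3"] r by (simp add: algebra_simps)
  finally show ?thesis by (simp add: Z_def)
qed

lemma tilted_mean_approx: "\<bar>(\<integral>\<omega>. X \<omega> \<partial>T) - l * r\<^sup>2 / 2\<bar> \<le> 4 * tilt_const * r ^ 3"
proof -
  have "(\<integral>\<omega>. X \<omega> \<partial>T) = expectation (\<lambda>\<omega>. X \<omega> * exp (l * X \<omega>)) / expectation (\<lambda>\<omega>. exp (l * X \<omega>))"
    by (rule TE[of "\<lambda>x. x" "10 * r"]) (auto simp: sv_bound)
  moreover have "l * r\<^sup>2 \<le> 4 * r\<^sup>2" using l by (intro mult_right_mono) auto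
  ultimately show ?thesis using tilt_ratio[OF small_var_moment1] l by simp
qed

lemma tilted_mean_bound: "\<bar>(\<integral>\<omega>. X \<omega> \<partial>T)\<bar> \<le> 10 * r"
proof -
  interpret T: prob_space T by (rule T)
  have "\<bar>(\<integral>\<omega>. X \<omega> \<partial>T) - (\<integral>\<omega>. 0 \<partial>T)\<bar> \<le> 10 * r"
    using tilt_int[of "\<lambda>x. x" "10 * r"] sv_bound by (intro T.expectation_approx) (auto simp: sT)
  thus ?thesis by simp
qed

lemma tilted_centred_bound: "\<omega> \<in> space M \<Longrightarrow> \<bar>X \<omega> - (\<integral>\<omega>. X \<omega> \<partial>T)\<bar> \<le> 20 * r"
  using sv_bound[of \<omega>] tilted_mean_bound by linarith

lemma tilted_variance:
  assumes r0: "256 * tilt_const * r \<le> 1"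
  shows "(\<integral>\<omega>. (X \<omega> - (\<integral>\<omega>. X \<omega> \<partial>T))\<^sup>2 \<partial>T) \<ge> r\<^sup>2 / 4"
proof -
  interpret T: prob_space T by (rule T)
  define m where "m = (\<integral>\<omega>. X \<omega> \<partial>T)"
  have r: "0 < r" "r \<le> 1" using sv_facts by auto
  have K: "tilt_const \<ge> 100000" by (rule tilt_const_ge)
  have i: "integrable T X" "integrable T (\<lambda>\<omega>. (X \<omega>)\<^sup>2)"
    using tilt_int[of "\<lambda>x. x" "10 * r"] tilt_int[of "\<lambda>x. x\<^sup>2" "100 * r\<^sup>2"]
    by (auto simp: square_le_of_abs_le)
  have "(\<integral>\<omega>. (X \<omega> - m)\<^sup>2 \<partial>T) = (\<integral>\<omega>. (X \<omega>)\<^sup>2 - 2 * m * X \<omega> + m\<^sup>2 \<partial>T)"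
    by (simp add: power2_eq_square algebra_simps)
  also have "\<dots> = (\<integral>\<omega>. (X \<omega>)\<^sup>2 \<partial>T) - m\<^sup>2"
    using i T.prob_space by (simp add: m_def power2_eq_square algebra_simps)
  finally have v: "(\<integral>\<omega>. (X \<omega> - m)\<^sup>2 \<partial>T) = (\<integral>\<omega>. (X \<omega>)\<^sup>2 \<partial>T) - m\<^sup>2" .
  have "(\<integral>\<omega>. (X \<omega>)\<^sup>2 \<partial>T) = expectation (\<lambda>\<omega>. (X \<omega>)\<^sup>2 * exp (l * X \<omega>)) / expectation (\<lambda>\<omega>. exp (l * X \<omega>))"
    by (rule TE[of "\<lambda>x. x\<^sup>2" "100 * r\<^sup>2"]) (use sv_bound r in \<open>auto simp: square_le_of_abs_le\<close>)
  hence s: "(\<integral>\<omega>. (X \<omega>)\<^sup>2 \<partial>T) \<ge> r\<^sup>2 / 2 - 4 * tilt_const * r ^ 3"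
    using tilt_ratio[OF small_var_moment2] by (simp add: abs_le_iff) 
  have "l * r\<^sup>2 \<le> 4 * r\<^sup>2" using l by (intro mult_right_mono) auto
  hence "\<bar>m\<bar> \<le> 2 * r\<^sup>2 + 4 * tilt_const * r ^ 3" using tilted_mean_approx l unfolding m_def
    using mult_nonneg_nonneg[OF l(1) zero_le_power2[of r]] unfolding abs_le_iff by linarith
  hence "\<bar>m\<bar> * \<bar>m\<bar> \<le> (10 * r) * (2 * r\<^sup>2 + 4 * tilt_const * r ^ 3)"
    using tilted_mean_bound r unfolding m_def by (intro mult_mono) auto
  hence "m\<^sup>2 \<le> 20 * r ^ 3 + 40 * tilt_const * r ^ 4" by (simp add: power2_eq_square algebra_simps eval_nat_numeral)
  also have "\<dots> \<le> tilt_const * r ^ 3 + 40 * tilt_const * r ^ 3"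
    using cube_pos_bounds[OF r] K by (intro add_mono mult_left_mono mult_right_mono) auto
  finally have "m\<^sup>2 \<le> 41 * tilt_const * r ^ 3" by simp
  \<comment> \<open>The errors add up to \<open>(4 + 41) * tilt_const * r ^ 3\<close>, and
    \<open>45/256 < 1/4\<close>: the threshold 256 preserves half of the variance
    \<open>r^2 / 2\<close>.\<close>
  moreover have "256 * tilt_const * r ^ 3 \<le> r\<^sup>2" using mult_right_mono[OF r0, of "r\<^sup>2"]
    by (simp add: power2_eq_square power3_eq_cube algebra_simps)
  ultimately show ?thesis using v s zero_le_power2[of r] unfolding m_def by linarith
qed

text \<open>The bound 1 is centring. For the sharper bound, \<open>\<theta> * (X - m)\<close> is at
  most 18 in modulus, so \<open>exp\<close> has a quadratic minorant with coefficient
  \<open>exp (-18) / 2\<close>; the variance \<open>r^2 / 4\<close> turns it into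
  \<open>exp (-18) / 8\<close>, and half of that is given up in
  \<open>exp z \<le> 1 + 2 * z\<close>.\<close>

lemma tilted_mgf_ge_1: "(\<integral>\<omega>. exp (\<theta> * (X \<omega> - (\<integral>\<omega>. X \<omega> \<partial>T))) \<partial>T) \<ge> 1"
  and tilted_mgf_lower: "256 * tilt_const * r \<le> 1 \<Longrightarrow> \<bar>\<theta>\<bar> \<le> 1 \<Longrightarrow>
     exp (exp (-18) / 16 * \<theta>\<^sup>2 * r\<^sup>2) \<le> (\<integral>\<omega>. exp (\<theta> * (X \<omega> - (\<integral>\<omega>. X \<omega> \<partial>T))) \<partial>T)"
proof -
  interpret T: prob_space T by (rule T)
  define m where "m = (\<integral>\<omega>. X \<omega> \<partial>T)"
  have r: "0 < r" "r \<le> 9/10" using sv_facts by auto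
  have mb: "\<bar>m\<bar> \<le> 10 * r" using tilted_mean_bound by (simp add: m_def)
  have iY: "integrable T (\<lambda>\<omega>. X \<omega> - m)"
    using mb by (intro tilt_int[of "\<lambda>x. x - m" "20 * r"]) auto
  have EY: "(\<integral>\<omega>. X \<omega> - m \<partial>T) = 0"
    using tilt_int[of "\<lambda>x. x" "10 * r"] T.prob_space by (simp add: m_def)
  have iE: "integrable T (\<lambda>\<omega>. exp (\<theta> * (X \<omega> - m)))" for \<theta>
  proof (rule tilt_int[of "\<lambda>x. exp (\<theta> * (x - m))" "exp (\<bar>\<theta>\<bar> * (20 * r))"])
    fix x assume x: "\<bar>x\<bar> \<le> 10 * r"
    have "\<theta> * (x - m) \<le> \<bar>\<theta>\<bar> * \<bar>x - m\<bar>" using abs_ge_self[of "\<theta> * (x - m)"] by (simp add: abs_mult)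
    also have "\<dots> \<le> \<bar>\<theta>\<bar> * (20 * r)" using x mb by (intro mult_left_mono) auto
    finally show "\<bar>exp (\<theta> * (x - m))\<bar> \<le> exp (\<bar>\<theta>\<bar> * (20 * r))" by simp
  qed measurable
  have "(\<integral>\<omega>. 1 + \<theta> * (X \<omega> - m) \<partial>T) \<le> (\<integral>\<omega>. exp (\<theta> * (X \<omega> - m)) \<partial>T)"
    using iY iE by (intro integral_mono) (auto simp: exp_ge_add_one_self)
  thus "(\<integral>\<omega>. exp (\<theta> * (X \<omega> - (\<integral>\<omega>. X \<omega> \<partial>T))) \<partial>T) \<ge> 1"
    using iY EY T.prob_space by (simp add: m_def)
  assume r0: "256 * tilt_const * r \<le> 1" and th: "\<bar>\<theta>\<bar> \<le> 1"
  have V: "(\<integral>\<omega>. (X \<omega> - m)\<^sup>2 \<partial>T) \<ge> r\<^sup>2 / 4" using tilted_variance[OF r0] by (simp add: m_def)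
  have iV: "integrable T (\<lambda>\<omega>. (X \<omega> - m)\<^sup>2)"
    using mb by (intro tilt_int[of "\<lambda>x. (x - m)\<^sup>2" "400 * r\<^sup>2"]) (auto simp: square_le_of_abs_le)
  define c where "c = exp (-18 :: real)"
  have c: "0 < c" "c \<le> 1" by (auto simp: c_def)
  have t1: "\<theta>\<^sup>2 \<le> 1" using th by (simp add: abs_square_le_1)
  define z where "z = c / 16 * \<theta>\<^sup>2 * r\<^sup>2"
  have z0: "0 \<le> z" using c by (simp add: z_def)
  have z1: "z \<le> 1"
  proof -
    have "c / 16 * \<theta>\<^sup>2 * r\<^sup>2 \<le> 1 / 16 * 1 * 1\<^sup>2" using c t1 r by (intro mult_mono power_mono) auto
    thus ?thesis by (simp add: z_def)
  qed
  have "exp z \<le> 1 + z + z\<^sup>2" using z0 z1 by (intro exp_bound)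
  also have "z\<^sup>2 \<le> z" using z0 z1 by (simp add: power2_eq_square mult_left_le)
  finally have "exp z \<le> 1 + c / 2 * \<theta>\<^sup>2 * (r\<^sup>2 / 4)" by (simp add: z_def)
  also have "\<dots> \<le> 1 + c / 2 * \<theta>\<^sup>2 * (\<integral>\<omega>. (X \<omega> - m)\<^sup>2 \<partial>T)" using V c by (intro add_left_mono mult_left_mono) auto
  also have "\<dots> = (\<integral>\<omega>. 1 + \<theta> * (X \<omega> - m) + c / 2 * (\<theta> * (X \<omega> - m))\<^sup>2 \<partial>T)"
    using iY iV EY T.prob_space by (simp add: power_mult_distrib)
  also have "\<dots> \<le> (\<integral>\<omega>. exp (\<theta> * (X \<omega> - m)) \<partial>T)"
  proof (intro integral_mono iE)
    show "integrable T (\<lambda>\<omega>. 1 + \<theta> * (X \<omega> - m) + c / 2 * (\<theta> * (X \<omega> - m))\<^sup>2)"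
      using iY iV by (simp add: power_mult_distrib)
    fix \<omega> assume "\<omega> \<in> space T"
    hence "\<bar>X \<omega> - m\<bar> \<le> 18" using tilted_centred_bound[of \<omega>] r by (auto simp: m_def sT)
    hence "\<bar>\<theta> * (X \<omega> - m)\<bar> \<le> 1 * 18" unfolding abs_mult using th by (intro mult_mono) auto
    thus "1 + \<theta> * (X \<omega> - m) + c / 2 * (\<theta> * (X \<omega> - m))\<^sup>2 \<le> exp (\<theta> * (X \<omega> - m))"
      unfolding c_def by (intro exp_ge_quadratic) auto
  qed
  finally show "exp (exp (-18) / 16 * \<theta>\<^sup>2 * r\<^sup>2) \<le> (\<integral>\<omega>. exp (\<theta> * (X \<omega> - (\<integral>\<omega>. X \<omega> \<partial>T))) \<partial>T)"
    by (simp add: z_def c_def m_def)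
qed

text \<open>Second-order expansion of the characteristic function: the main part is
  \<open>1 - t^2 * V / 2\<close> with \<open>V \<ge> r^2 / 4\<close>, and the cubic error is a small
  multiple of \<open>t^2 * r^2\<close> because the threshold forces
  \<open>r \<le> 1 / 100000\<close>.\<close>

lemma tilted_char_bound:
  assumes r0: "256 * tilt_const * r \<le> 1" and t: "\<bar>t\<bar> \<le> 1"
  shows "norm (\<integral>\<omega>. iexp (t * (X \<omega> - (\<integral>\<omega>. X \<omega> \<partial>T))) \<partial>T) \<le> exp (- (t\<^sup>2 * r\<^sup>2 / 16))"
proof -
  interpret T: prob_space T by (rule T)
  define m where "m = (\<integral>\<omega>. X \<omega> \<partial>T)"
  have r: "0 < r" "r \<le> 1" using sv_facts by auto
  have K: "tilt_const \<ge> 100000" by (rule tilt_const_ge)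
  have mb: "\<bar>m\<bar> \<le> 10 * r" using tilted_mean_bound by (simp add: m_def)
  have iY: "integrable T (\<lambda>\<omega>. X \<omega> - m)"
    using mb by (intro tilt_int[of "\<lambda>x. x - m" "20 * r"]) auto
  have EY: "(\<integral>\<omega>. X \<omega> - m \<partial>T) = 0"
    using tilt_int[of "\<lambda>x. x" "10 * r"] T.prob_space by (simp add: m_def)
  define V where "V = (\<integral>\<omega>. (X \<omega> - m)\<^sup>2 \<partial>T)"
  have V: "V \<ge> r\<^sup>2 / 4" using tilted_variance[OF r0] by (simp add: m_def V_def)
  have iV: "integrable T (\<lambda>\<omega>. (X \<omega> - m)\<^sup>2)"
    using mb by (intro tilt_int[of "\<lambda>x. (x - m)\<^sup>2" "400 * r\<^sup>2"]) (auto simp: square_le_of_abs_le)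
  have VU: "V \<le> 400 * r\<^sup>2"
  proof -
    have "V \<le> (\<integral>\<omega>. 400 * r\<^sup>2 \<partial>T)" unfolding V_def
      using tilted_centred_bound iV r by (intro integral_mono) (auto simp: m_def sT square_le_of_abs_le)
    thus ?thesis using T.prob_space by simp
  qed
  have rt: "r \<le> 1 / 100000"
  proof -
    have "100000 * r \<le> 256 * tilt_const * r" using K r by (intro mult_right_mono) auto
    thus ?thesis using r0 by linarith
  qed
  have ci: "complex_integrable T (\<lambda>\<omega>. iexp (t * (X \<omega> - m)))"
    using XT by (intro T.integrable_bounded[of _ 1]) auto
  \<comment> \<open>The quadratic approximation rewritten as a partial sum of the exponential
    series, the shape in which \<open>iexp_approx1\<close> bounds the remainder.\<close>
  have cm: "(\<lambda>\<omega>. 1 + \<i> * complex_of_real (t * (X \<omega> - m)) - complex_of_real (t\<^sup>2 / 2 * (X \<omega> - m)\<^sup>2)) = (\<lambda>\<omega>. \<Sum>k\<le>2. (\<i> * complex_of_real (t * (X \<omega> - m))) ^ k / fact k)"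
    by (simp add: fun_eq_iff eval_nat_numeral power_mult_distrib)
  have ct: "complex_integrable T (\<lambda>\<omega>. 1 + \<i> * complex_of_real (t * (X \<omega> - m)) - complex_of_real (t\<^sup>2 / 2 * (X \<omega> - m)\<^sup>2))"
    by (intro Bochner_Integration.integrable_diff Bochner_Integration.integrable_add integrable_mult_right integrable_of_real iY iV T.integrable_const)
  have "(CLINT \<omega>|T. 1 + \<i> * complex_of_real (t * (X \<omega> - m)) - complex_of_real (t\<^sup>2 / 2 * (X \<omega> - m)\<^sup>2)) = 1 - complex_of_real (t\<^sup>2 / 2 * V)"
  proof -
    have "complex_integrable T (\<lambda>\<omega>. \<i> * complex_of_real (t * (X \<omega> - m)))"
      by (intro integrable_mult_right integrable_of_real iY)
    moreover have "complex_integrable T (\<lambda>\<omega>. complex_of_real (t\<^sup>2 / 2 * (X \<omega> - m)\<^sup>2))"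
      by (intro integrable_of_real integrable_mult_right iV)
    moreover have "(CLINT \<omega>|T. \<i> * complex_of_real (t * (X \<omega> - m))) = 0"
      using EY by (simp only: integral_mult_right_zero integral_complex_of_real) simp
    moreover have "(CLINT \<omega>|T. complex_of_real (t\<^sup>2 / 2 * (X \<omega> - m)\<^sup>2)) = complex_of_real (t\<^sup>2 / 2 * V)"
      by (simp only: integral_mult_right_zero integral_complex_of_real V_def)
    ultimately show ?thesis
      using T.prob_space by (subst Bochner_Integration.integral_diff) (auto simp del: of_real_mult of_real_diff of_real_divide of_real_power)
  qed
  hence "norm ((CLINT \<omega>|T. iexp (t * (X \<omega> - m))) - (1 - complex_of_real (t\<^sup>2 / 2 * V)))
     = norm (CLINT \<omega>|T. iexp (t * (X \<omega> - m)) - (1 + \<i> * complex_of_real (t * (X \<omega> - m)) - complex_of_real (t\<^sup>2 / 2 * (X \<omega> - m)\<^sup>2)))"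
    by (subst Bochner_Integration.integral_diff[OF ci ct]) simp
  also have "\<dots> \<le> (\<integral>\<omega>. (\<bar>t\<bar> * (20 * r)) ^ 3 / 6 \<partial>T)"
  proof (rule order_trans[OF integral_norm_bound integral_mono])
    fix \<omega> assume w: "\<omega> \<in> space T"
    have "norm (iexp (t * (X \<omega> - m)) - (\<Sum>k\<le>2. (\<i> * complex_of_real (t * (X \<omega> - m))) ^ k / fact k)) \<le> \<bar>t * (X \<omega> - m)\<bar> ^ Suc 2 / fact (Suc 2)"
      by (rule iexp_approx1)
    also have "\<dots> \<le> (\<bar>t\<bar> * (20 * r)) ^ 3 / 6"
    proof -
      have e: "Suc 2 = 3" "fact 3 = (6::real)" by (auto simp: eval_nat_numeral)
      show ?thesis unfolding abs_mult e using tilted_centred_bound[of \<omega>] w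
        by (intro divide_right_mono power_mono mult_left_mono) (auto simp: sT m_def)
    qed
    finally show "norm (iexp (t * (X \<omega> - m)) - (1 + \<i> * complex_of_real (t * (X \<omega> - m)) - complex_of_real (t\<^sup>2 / 2 * (X \<omega> - m)\<^sup>2))) \<le> (\<bar>t\<bar> * (20 * r)) ^ 3 / 6"
      unfolding fun_cong[OF cm] .
  qed (intro integrable_norm Bochner_Integration.integrable_diff ci ct T.integrable_const)+
  also have "\<dots> = \<bar>t\<bar> ^ 3 * (8000 * r ^ 3) / 6" using T.prob_space by (simp add: power_mult_distrib)
  also have "\<dots> \<le> t\<^sup>2 * (8000 * r ^ 3) / 6"
  proof -
    have "\<bar>t\<bar> ^ 3 \<le> \<bar>t\<bar>\<^sup>2" using t by (intro power_decreasing) auto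
    thus ?thesis using r by (intro divide_right_mono mult_right_mono) auto
  qed
  also have "8000 * r ^ 3 \<le> 8000 * (r\<^sup>2 * (1 / 100000))" using rt r by (simp add: power3_eq_cube power2_eq_square mult_left_mono)
  hence "t\<^sup>2 * (8000 * r ^ 3) / 6 \<le> t\<^sup>2 * (8000 * (r\<^sup>2 * (1 / 100000))) / 6" by (intro divide_right_mono mult_left_mono) auto
  also have "\<dots> \<le> t\<^sup>2 * r\<^sup>2 / 16" by simp
  finally have 1: "norm ((CLINT \<omega>|T. iexp (t * (X \<omega> - m))) - (1 - complex_of_real (t\<^sup>2 / 2 * V))) \<le> t\<^sup>2 * r\<^sup>2 / 16" .
  have tv: "t\<^sup>2 / 2 * V \<le> 1"
  proof -
    have "r * r \<le> 1 / 100000 * 1" using rt r by (intro mult_mono) auto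
    hence "400 * r\<^sup>2 \<le> 1" by (simp add: power2_eq_square)
    moreover have "t\<^sup>2 \<le> 1" using t by (simp add: abs_square_le_1)
    moreover have "V \<ge> 0" using V by (rule order_trans[rotated]) simp
    ultimately have "t\<^sup>2 / 2 * V \<le> 1 / 2 * 1" using VU by (intro mult_mono) auto
    thus ?thesis by simp
  qed
  have "norm (1 - complex_of_real (t\<^sup>2 / 2 * V)) = \<bar>1 - t\<^sup>2 / 2 * V\<bar>"
    by (metis norm_of_real of_real_1 of_real_diff)
  also have "\<dots> = 1 - t\<^sup>2 / 2 * V" using tv by simp
  also have "\<dots> \<le> 1 - t\<^sup>2 / 2 * (r\<^sup>2 / 4)" using V by (intro diff_left_mono mult_left_mono) auto
  finally have "norm (1 - complex_of_real (t\<^sup>2 / 2 * V)) \<le> 1 - t\<^sup>2 * r\<^sup>2 / 8" by simp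
  hence "norm (CLINT \<omega>|T. iexp (t * (X \<omega> - m))) \<le> 1 - t\<^sup>2 * r\<^sup>2 / 16"
    using 1 norm_triangle_sub[of "CLINT \<omega>|T. iexp (t * (X \<omega> - m))" "1 - complex_of_real (t\<^sup>2 / 2 * V)"] by linarith
  also have "\<dots> \<le> exp (- (t\<^sup>2 * r\<^sup>2 / 16))" using exp_ge_add_one_self[of "- (t\<^sup>2 * r\<^sup>2 / 16)"] by simp
  finally show ?thesis by (simp add: m_def)
qed

end

end

end

subsection \<open>Anticoncentration of the middle increments\<close>

text \<open>\<open>exp (- u) \<le> 1 / (1 + u)\<close> replaces the Gaussian by an integrand with
  antiderivative \<open>arctan\<close>. For \<open>s > 3\<close> the bounds
  \<open>pi / 2 \<le> 8/5\<close> and \<open>sqrt (1 + s) \<le> 5/4 * sqrt s\<close> multiply to the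
  constant 2.\<close>

lemma integral_gaussian_le:
  assumes "s \<ge> 0"
  shows "integral {0..1} (\<lambda>t. exp (- (s * t\<^sup>2))) \<le> 2 / sqrt (1 + s)"
proof (cases "s \<le> 3")
  case True
  have "integral {0..1} (\<lambda>t. exp (- (s * t\<^sup>2))) \<le> integral {0..1::real} (\<lambda>t. 1)"
    using assms by (intro Henstock_Kurzweil_Integration.integral_le) (auto intro!: integrable_continuous_interval continuous_intros)
  also have "integral {0..1::real} (\<lambda>t. 1 :: real) \<le> 2 / sqrt (1 + s)"
    using True assms real_sqrt_le_mono[of "1 + s" 4] by (simp add: field_simps)
  finally show ?thesis .
next
  case False
  define a where "a = sqrt s"
  have a: "a > 0" "a\<^sup>2 = s" using False by (auto simp: a_def)
  have hi: "((\<lambda>t. 1 / (1 + s * t\<^sup>2)) has_integral (arctan (a * 1) / a - arctan (a * 0) / a)) {0..1}"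
  proof (rule fundamental_theorem_of_calculus)
    fix t :: real assume "t \<in> {0..1}"
    have "((\<lambda>t. arctan (a * t) / a) has_real_derivative (inverse (1 + (a * t)\<^sup>2) * a) / a) (at t within {0..1})"
      by (auto intro!: derivative_eq_intros) 
    thus "((\<lambda>t. arctan (a * t) / a) has_vector_derivative 1 / (1 + s * t\<^sup>2)) (at t within {0..1})"
      using a by (simp add: has_real_derivative_iff_has_vector_derivative power_mult_distrib inverse_eq_divide)
  qed auto
  have "integral {0..1} (\<lambda>t. exp (- (s * t\<^sup>2))) \<le> integral {0..1} (\<lambda>t. 1 / (1 + s * t\<^sup>2))"
  proof (intro integral_le integrable_continuous_interval continuous_intros)
    fix t :: real assume "t \<in> {0..1}"
    have "1 + s * t\<^sup>2 \<le> exp (s * t\<^sup>2)" by (rule exp_ge_add_one_self)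
    moreover have "1 + s * t\<^sup>2 > 0" using assms by (simp add: add_pos_nonneg)
    ultimately show "exp (- (s * t\<^sup>2)) \<le> 1 / (1 + s * t\<^sup>2)" by (simp add: exp_minus field_simps)
  next
    show "\<forall>t\<in>{0..1}. 1 + s * t\<^sup>2 \<noteq> 0"
    proof
      fix t :: real
      show "1 + s * t\<^sup>2 \<noteq> 0" using add_pos_nonneg[OF zero_less_one mult_nonneg_nonneg[OF assms zero_le_power2[of t]]] by linarith
    qed
  qed
  also have "\<dots> = arctan a / a" using integral_unique[OF hi] by simp
  also have "\<dots> \<le> (pi / 2) / a" using a arctan_ubound[of a] by (intro divide_right_mono) auto
  also have "\<dots> \<le> (8 / 5) / a" using pi_less_4 pi_approx a by (intro divide_right_mono) auto
  also have "\<dots> \<le> 2 / sqrt (1 + s)"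
  proof -
    have "sqrt (1 + s) \<le> sqrt ((5/4 * a)\<^sup>2)" using False a by (intro real_sqrt_le_mono) (simp add: power_mult_distrib power2_eq_square)
    also have "\<dots> = 5 / 4 * a" using a by simp
    finally show ?thesis using a assms by (simp add: field_simps)
  qed
  finally show ?thesis .
qed

text \<open>The kernel \<open>2 * (1 - cos x) / x^2\<close>, written as a cosine transform over a
  probability measure so that Fubini's theorem can exchange it with the expectation. The closed form
  is what gives nonnegativity.\<close>

definition fejer :: "real \<Rightarrow> real" where
  "fejer x = (\<integral>t. 2 * (1 - t) * cos (t * x) \<partial>uniform_measure lborel {0..1})"

lemma fejer_eq: "fejer x = integral {0..1} (\<lambda>t. 2 * (1 - t) * cos (t * x))"
  unfolding fejer_def by (intro integral_uniform_unit_interval continuous_intros) measurable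

lemma fejer_nonneg: "fejer x \<ge> 0"
proof (cases "x = 0")
  case True
  have "integral {0..1} (\<lambda>t. 2 * (1 - t) * cos (t * x)) \<ge> 0"
    using True by (intro integral_nonneg integrable_continuous_interval continuous_intros) auto
  thus ?thesis by (simp add: fejer_eq)
next
  case False
  let ?G = "\<lambda>t. 2 * (1 - t) * sin (t * x) / x - 2 * cos (t * x) / x\<^sup>2"
  have "((\<lambda>t. 2 * (1 - t) * cos (t * x)) has_integral (?G 1 - ?G 0)) {0..1}"
  proof (rule fundamental_theorem_of_calculus)
    fix t :: real assume "t \<in> {0..1}"
    have "(?G has_real_derivative (2 * (1 - t) * cos (t * x))) (at t within {0..1})"
      using False by (auto intro!: derivative_eq_intros simp: field_simps power2_eq_square)
    thus "(?G has_vector_derivative (2 * (1 - t) * cos (t * x))) (at t within {0..1})"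
      by (simp add: has_real_derivative_iff_has_vector_derivative)
  qed auto
  hence "fejer x = ?G 1 - ?G 0" unfolding fejer_eq by (rule integral_unique)
  also have "\<dots> = 2 * (1 - cos x) / x\<^sup>2" by (simp add: diff_divide_distrib right_diff_distrib)
  finally show ?thesis by simp
qed

lemma fejer_ge_half:
  assumes "\<bar>x\<bar> \<le> 1" shows "fejer x \<ge> 1 / 2"
proof -
  have hi: "((\<lambda>t. 1 - t) has_integral (1/2 - 0)) {0..1::real}"
  proof -
    have "((\<lambda>t. 1 - t) has_integral ((1 - 1\<^sup>2/2) - (0 - 0\<^sup>2/2))) {0..1::real}"
    proof (rule fundamental_theorem_of_calculus)
      fix t :: real
      have "((\<lambda>t. t - t\<^sup>2/2) has_real_derivative (1 - t)) (at t within {0..1})"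
        by (auto intro!: derivative_eq_intros)
      thus "((\<lambda>t. t - t\<^sup>2/2) has_vector_derivative (1 - t)) (at t within {0..1})"
        by (simp add: has_real_derivative_iff_has_vector_derivative)
    qed auto
    thus ?thesis by simp
  qed
  have "1/2 = integral {0..1} (\<lambda>t. 1 - t :: real)" using integral_unique[OF hi] by simp
  also have "\<dots> \<le> integral {0..1} (\<lambda>t. 2 * (1 - t) * cos (t * x))"
  proof (intro integral_le integrable_continuous_interval continuous_intros)
    fix t :: real assume t: "t \<in> {0..1}"
    have "\<bar>t * x\<bar> \<le> 1 * 1" unfolding abs_mult using t assms by (intro mult_mono) auto
    hence "\<bar>t * x\<bar> \<le> pi / 3" using pi_gt3 by simp
    hence "cos (pi / 3) \<le> cos \<bar>t * x\<bar>" by (intro cos_monotone_0_pi_le) auto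
    hence "1 / 2 \<le> cos (t * x)" by (simp add: cos_60)
    hence "2 * (1 - t) * (1/2) \<le> 2 * (1 - t) * cos (t * x)" using t by (intro mult_left_mono) auto
    thus "1 - t \<le> 2 * (1 - t) * cos (t * x)" by simp
  qed
  finally show ?thesis by (simp add: fejer_eq)
qed

text \<open>Majorising the indicator of \<open>|S - u| \<le> 1\<close> by a Fejer kernel, whose Fourier transform
  has compact support, decouples the three blocks without conditioning.\<close>

lemma (in prob_space) three_block_bound:
  fixes Y :: "'i \<Rightarrow> 'a \<Rightarrow> real" and s :: "'i \<Rightarrow> real"
  assumes I: "finite I" and ind: "indep_vars (\<lambda>_. borel) Y I"
    and J: "JF \<subseteq> I" "JR \<subseteq> I" "JM \<subseteq> I" "JF \<inter> JR = {}" "JF \<inter> JM = {}" "JR \<inter> JM = {}"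
    and F: "{x \<in> space (PiM JF (\<lambda>_. borel)). PF x} \<in> sets (PiM JF (\<lambda>_. borel))" "\<And>x. PF (restrict x JF) = PF x"
    and R: "{x \<in> space (PiM JR (\<lambda>_. borel)). PR x} \<in> sets (PiM JR (\<lambda>_. borel))" "\<And>x. PR (restrict x JR) = PR x"
    and s: "\<And>i. i \<in> JM \<Longrightarrow> 0 \<le> s i" "\<And>i t. i \<in> JM \<Longrightarrow> t \<in> {0..1} \<Longrightarrow> norm (expectation (\<lambda>\<omega>. iexp (t * Y i \<omega>))) \<le> exp (- (s i * t\<^sup>2))"
  shows "prob {\<omega>\<in>space M. PF (\<lambda>i. Y i \<omega>) \<and> PR (\<lambda>i. Y i \<omega>) \<and> \<bar>(\<Sum>i\<in>JF \<union> JR \<union> JM. Y i \<omega>) - u\<bar> \<le> 1}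
    \<le> 8 * prob {\<omega>\<in>space M. PF (\<lambda>i. Y i \<omega>)} * prob {\<omega>\<in>space M. PR (\<lambda>i. Y i \<omega>)} / sqrt (1 + (\<Sum>i\<in>JM. s i))"
proof -
  define N where "N = uniform_measure lborel {0..1::real}"
  interpret N: prob_space N unfolding N_def by (rule prob_space_uniform_unit_interval)
  interpret P: pair_sigma_finite M N ..
  have sN[measurable_cong]: "sets N = sets borel" by (simp add: N_def)
  have mY[measurable]: "i \<in> I \<Longrightarrow> Y i \<in> borel_measurable M" for i using ind by (auto simp: indep_vars_def)
  have fin: "finite JF" "finite JR" "finite JM" using I J by (auto intro: finite_subset)
  define A where "A = {\<omega>\<in>space M. PF (\<lambda>i. Y i \<omega>)}"
  define B where "B = {\<omega>\<in>space M. PR (\<lambda>i. Y i \<omega>)}"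
  have rM: "(\<lambda>\<omega>. restrict (\<lambda>i. Y i \<omega>) K) \<in> measurable M (PiM K (\<lambda>_. borel))" if "K \<subseteq> I" for K
    using that by (intro measurable_restrict mY) auto
  have ms: "{\<omega>\<in>space M. Q (\<lambda>i. Y i \<omega>)} \<in> sets M"
    if "{x \<in> space (PiM K (\<lambda>_. borel)). Q x} \<in> sets (PiM K (\<lambda>_. borel))" "\<And>x. Q (restrict x K) = Q x" "K \<subseteq> I" for Q K
  proof -
    have "{\<omega>\<in>space M. Q (\<lambda>i. Y i \<omega>)} = (\<lambda>\<omega>. restrict (\<lambda>i. Y i \<omega>) K) -` {x \<in> space (PiM K (\<lambda>_. borel)). Q x} \<inter> space M"
      using measurable_space[OF rM[OF that(3)]] by (auto simp: that(2))
    thus ?thesis using measurable_sets[OF rM[OF that(3)] that(1)] by simp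
  qed
  have A[measurable]: "A \<in> sets M" unfolding A_def by (rule ms[OF F J(1)])
  have B[measurable]: "B \<in> sets M" unfolding B_def by (rule ms[OF R J(2)])
  define S where "S \<omega> = (\<Sum>i\<in>JF \<union> JR \<union> JM. Y i \<omega>)" for \<omega>
  have S[measurable]: "S \<in> borel_measurable M" unfolding S_def[abs_def] using J by (intro borel_measurable_sum mY) auto
  have Ssum: "S \<omega> = (\<Sum>i\<in>JF. Y i \<omega>) + ((\<Sum>i\<in>JR. Y i \<omega>) + (\<Sum>i\<in>JM. Y i \<omega>))" for \<omega>
    unfolding S_def using fin J by (subst sum.union_disjoint, auto)+
  define \<sigma> where "\<sigma> = (\<Sum>i\<in>JM. s i)"
  have s0: "\<sigma> \<ge> 0" unfolding \<sigma>_def using s(1) by (intro sum_nonneg) auto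
  \<comment> \<open>The cosine term is the real part of a product of three independent factors.
    Those of the outer blocks are bounded in modulus by the probabilities of their events, that of
    the middle block by its characteristic functions.\<close>
  have char: "\<bar>expectation (\<lambda>\<omega>. indicator A \<omega> * indicator B \<omega> * cos (t * (S \<omega> - u)))\<bar> \<le> prob A * prob B * exp (- (\<sigma> * t\<^sup>2))"
    if t: "t \<in> {0..1}" for t
  proof -
    let ?e = "\<lambda>K x. iexp (t * (\<Sum>i\<in>K. x i :: real))"
    define GF where "GF x = of_real (indicator {x. PF x} x) * ?e JF x" for x :: "'i \<Rightarrow> real"
    define GR where "GR x = of_real (indicator {x. PR x} x) * ?e JR x" for x :: "'i \<Rightarrow> real"
    define GM where "GM x = ?e JM x" for x :: "'i \<Rightarrow> real"
    have me: "(\<lambda>x. ?e K x) \<in> borel_measurable (PiM L (\<lambda>_. borel))" if "K \<subseteq> L" for K L :: "'i set"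
    proof -
      have "(\<lambda>x. \<Sum>i\<in>K. x i) \<in> borel_measurable (PiM L (\<lambda>_. borel :: real measure))"
        using that by (intro borel_measurable_sum measurable_component_singleton) auto
      thus ?thesis by measurable
    qed
    have re: "?e K (restrict x L) = ?e K x" if "K \<subseteq> L" for K L x
      using that by (intro arg_cong[where f="\<lambda>s. iexp (t * s)"] sum.cong) auto
    have mi: "(\<lambda>x. complex_of_real (indicator {x. Q x} x)) \<in> borel_measurable (PiM K (\<lambda>_. borel :: real measure))"
      if "{x \<in> space (PiM K (\<lambda>_. borel)). Q x} \<in> sets (PiM K (\<lambda>_. borel))" for Q and K :: "'i set"
    proof -
      have "(\<lambda>x. complex_of_real (indicator {x \<in> space (PiM K (\<lambda>_. borel)). Q x} x)) \<in> borel_measurable (PiM K (\<lambda>_. borel))"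
        using that by measurable
      also have "?this \<longleftrightarrow> ?thesis" by (intro measurable_cong) (auto simp: indicator_def)
      finally show ?thesis .
    qed
    have mGF: "GF \<in> borel_measurable (PiM JF (\<lambda>_. borel))" unfolding GF_def using mi[OF F(1)] me[of JF JF] by measurable
    have mGR: "GR \<in> borel_measurable (PiM JR (\<lambda>_. borel))" unfolding GR_def using mi[OF R(1)] me[of JR JR] by measurable
    have mGM: "GM \<in> borel_measurable (PiM JM (\<lambda>_. borel))" unfolding GM_def using me[of JM JM] by measurable
    have rGF: "GF (restrict x JF) = GF x" for x unfolding GF_def using re[of JF JF x] by (simp add: indicator_def F(2))
    have rGR: "GR (restrict x JR) = GR x" for x unfolding GR_def using re[of JR JR x] by (simp add: indicator_def R(2))
    have rGM: "GM (restrict x JM) = GM x" for x unfolding GM_def using re[of JM JM x] by simp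
    have G1: "norm (GF x) \<le> 1" "norm (GR x) \<le> 1" "norm (GM x) \<le> 1" for x
      by (auto simp: GF_def GR_def GM_def norm_mult indicator_def)
    have comp: "(\<lambda>\<omega>. G (\<lambda>i. Y i \<omega>)) \<in> borel_measurable M"
      if "G \<in> borel_measurable (PiM K (\<lambda>_. borel))" "\<And>x. G (restrict x K) = G x" "K \<subseteq> I" for G :: "('i \<Rightarrow> real) \<Rightarrow> complex" and K
      using measurable_compose[OF rM[OF that(3)] that(1)] that(2) by simp
    have iF: "integrable M (\<lambda>\<omega>. GF (\<lambda>i. Y i \<omega>))" using comp[OF mGF rGF J(1)] G1 by (intro integrable_bounded[of _ 1]) auto
    have iR: "integrable M (\<lambda>\<omega>. GR (\<lambda>i. Y i \<omega>))" using comp[OF mGR rGR J(2)] G1 by (intro integrable_bounded[of _ 1]) auto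
    have iM: "integrable M (\<lambda>\<omega>. GM (\<lambda>i. Y i \<omega>))" using comp[OF mGM rGM J(3)] G1 by (intro integrable_bounded[of _ 1]) auto
    have e1: "expectation (\<lambda>\<omega>. GR (\<lambda>i. Y i \<omega>) * GM (\<lambda>i. Y i \<omega>)) = expectation (\<lambda>\<omega>. GR (\<lambda>i. Y i \<omega>)) * expectation (\<lambda>\<omega>. GM (\<lambda>i. Y i \<omega>))"
      by (rule indep_disjoint_expectation_mult[OF ind J(6) J(2) J(3) mGR rGR mGM rGM iR iM])
    have i2: "integrable M (\<lambda>\<omega>. GR (\<lambda>i. Y i \<omega>) * GM (\<lambda>i. Y i \<omega>))"
      by (rule indep_disjoint_integrable_mult[OF ind J(6) J(2) J(3) mGR rGR mGM rGM iR iM])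
    have emb: "G \<in> borel_measurable (PiM (JR \<union> JM) (\<lambda>_. borel))"
      if "G \<in> borel_measurable (PiM K (\<lambda>_. borel))" "\<And>x. G (restrict x K) = G x" "K \<subseteq> JR \<union> JM" for G :: "('i \<Rightarrow> real) \<Rightarrow> complex" and K
      using measurable_compose[OF measurable_restrict_subset[OF that(3)] that(1)] that(2) by simp
    have rr: "G (restrict x (JR \<union> JM)) = G x" if "\<And>x. G (restrict x K) = G x" "K \<subseteq> JR \<union> JM" for G :: "('i \<Rightarrow> real) \<Rightarrow> complex" and K x
    proof -
      have "restrict (restrict x (JR \<union> JM)) K = restrict x K" using that(2) by (simp add: Int_absorb1)
      thus ?thesis using that(1)[of "restrict x (JR \<union> JM)"] that(1)[of x] by simp
    qed
    have mRM: "(\<lambda>x. GR x * GM x) \<in> borel_measurable (PiM (JR \<union> JM) (\<lambda>_. borel))"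
      by (intro borel_measurable_times emb[OF mGR rGR] emb[OF mGM rGM]) auto
    have rRM: "GR (restrict x (JR \<union> JM)) * GM (restrict x (JR \<union> JM)) = GR x * GM x" for x
      using rr[of GR JR x] rr[of GM JM x] rGR rGM by simp
    have e2: "expectation (\<lambda>\<omega>. GF (\<lambda>i. Y i \<omega>) * (GR (\<lambda>i. Y i \<omega>) * GM (\<lambda>i. Y i \<omega>)))
       = expectation (\<lambda>\<omega>. GF (\<lambda>i. Y i \<omega>)) * expectation (\<lambda>\<omega>. GR (\<lambda>i. Y i \<omega>) * GM (\<lambda>i. Y i \<omega>))"
      using J by (intro indep_disjoint_expectation_mult[OF ind _ _ _ mGF rGF mRM rRM iF i2]) auto
    have nF: "norm (expectation (\<lambda>\<omega>. GF (\<lambda>i. Y i \<omega>))) \<le> prob A"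
    proof -
      have "norm (expectation (\<lambda>\<omega>. GF (\<lambda>i. Y i \<omega>))) \<le> expectation (\<lambda>\<omega>. norm (GF (\<lambda>i. Y i \<omega>)))" by (rule integral_norm_bound)
      also have "\<dots> = expectation (indicator A)" 
        by (intro Bochner_Integration.integral_cong) (auto simp: GF_def A_def norm_mult indicator_def)
      finally show ?thesis using A by simp
    qed
    have nR: "norm (expectation (\<lambda>\<omega>. GR (\<lambda>i. Y i \<omega>))) \<le> prob B"
    proof -
      have "norm (expectation (\<lambda>\<omega>. GR (\<lambda>i. Y i \<omega>))) \<le> expectation (\<lambda>\<omega>. norm (GR (\<lambda>i. Y i \<omega>)))" by (rule integral_norm_bound)
      also have "\<dots> = expectation (indicator B)" 
        by (intro Bochner_Integration.integral_cong) (auto simp: GR_def B_def norm_mult indicator_def)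
      finally show ?thesis using B by simp
    qed
    have nM: "norm (expectation (\<lambda>\<omega>. GM (\<lambda>i. Y i \<omega>))) \<le> exp (- (\<sigma> * t\<^sup>2))"
    proof -
      have "expectation (\<lambda>\<omega>. GM (\<lambda>i. Y i \<omega>)) = expectation (\<lambda>\<omega>. \<Prod>i\<in>JM. iexp (t * Y i \<omega>))"
        using fin by (simp add: GM_def exp_sum sum_distrib_left)
      also have "\<dots> = (\<Prod>i\<in>JM. expectation (\<lambda>\<omega>. iexp (t * Y i \<omega>)))"
      proof (rule indep_vars_lebesgue_integral[OF fin(3)])
        show "indep_vars (\<lambda>_. borel) (\<lambda>i \<omega>. iexp (t * Y i \<omega>)) JM"
          by (rule indep_vars_compose2[OF indep_vars_subset[OF ind J(3)], where Y="\<lambda>_ x. iexp (t * x)"]) auto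
        fix i assume "i \<in> JM"
        hence "Y i \<in> borel_measurable M" using mY J by auto
        thus "integrable M (\<lambda>\<omega>. iexp (t * Y i \<omega>))" by (intro integrable_bounded[of _ 1]) auto
      qed
      also have "norm \<dots> = (\<Prod>i\<in>JM. norm (expectation (\<lambda>\<omega>. iexp (t * Y i \<omega>))))" by (simp add: prod_norm)
      also have "\<dots> \<le> (\<Prod>i\<in>JM. exp (- (s i * t\<^sup>2)))" using s(2) t by (intro prod_mono) auto
      also have "\<dots> = exp (- (\<sigma> * t\<^sup>2))" using fin by (simp add: \<sigma>_def exp_sum sum_distrib_right flip: sum_negf)
      finally show ?thesis .
    qed
    have cx: "complex_of_real (indicator A \<omega> * indicator B \<omega>) * iexp (t * (S \<omega> - u)) = iexp (- t * u) * (GF (\<lambda>i. Y i \<omega>) * (GR (\<lambda>i. Y i \<omega>) * GM (\<lambda>i. Y i \<omega>)))"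
      if "\<omega> \<in> space M" for \<omega>
    proof -
      have "iexp (t * (S \<omega> - u)) = iexp (- t * u) * (?e JF (\<lambda>i. Y i \<omega>) * (?e JR (\<lambda>i. Y i \<omega>) * ?e JM (\<lambda>i. Y i \<omega>)))"
        unfolding Ssum by (simp add: algebra_simps flip: exp_add)
      thus ?thesis using that by (auto simp: GF_def GR_def GM_def A_def B_def indicator_def)
    qed
    have ic: "complex_integrable M (\<lambda>\<omega>. complex_of_real (indicator A \<omega> * indicator B \<omega>) * iexp (t * (S \<omega> - u)))"
      by (intro integrable_bounded[of _ 1]) (auto simp: norm_mult indicator_def)
    have "expectation (\<lambda>\<omega>. indicator A \<omega> * indicator B \<omega> * cos (t * (S \<omega> - u))) = expectation (\<lambda>\<omega>. Re (complex_of_real (indicator A \<omega> * indicator B \<omega>) * iexp (t * (S \<omega> - u))))"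
      by (intro Bochner_Integration.integral_cong) (auto simp: Re_exp indicator_def)
    also have "\<dots> = Re (expectation (\<lambda>\<omega>. complex_of_real (indicator A \<omega> * indicator B \<omega>) * iexp (t * (S \<omega> - u))))"
      by (rule integral_Re[OF ic])
    also have "\<bar>\<dots>\<bar> \<le> norm (expectation (\<lambda>\<omega>. complex_of_real (indicator A \<omega> * indicator B \<omega>) * iexp (t * (S \<omega> - u))))"
      by (rule abs_Re_le_cmod)
    also have "expectation (\<lambda>\<omega>. complex_of_real (indicator A \<omega> * indicator B \<omega>) * iexp (t * (S \<omega> - u)))
       = expectation (\<lambda>\<omega>. iexp (- t * u) * (GF (\<lambda>i. Y i \<omega>) * (GR (\<lambda>i. Y i \<omega>) * GM (\<lambda>i. Y i \<omega>))))"
      by (intro Bochner_Integration.integral_cong refl cx)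
    also have "\<dots> = iexp (- t * u) * (expectation (\<lambda>\<omega>. GF (\<lambda>i. Y i \<omega>)) * (expectation (\<lambda>\<omega>. GR (\<lambda>i. Y i \<omega>)) * expectation (\<lambda>\<omega>. GM (\<lambda>i. Y i \<omega>))))"
      by (simp only: integral_mult_right_zero e2 e1)
    also have "norm \<dots> \<le> prob A * (prob B * exp (- (\<sigma> * t\<^sup>2)))"
      unfolding norm_mult norm_exp_i_times mult_1_left using nF nR nM by (intro mult_mono) auto
    finally show ?thesis by (simp add: mult.assoc)
  qed
  \<comment> \<open>The uniform measure has the whole line as its space; the indicator of the unit
    interval, which is 1 almost everywhere, makes the integrand bounded there.\<close>
  let ?f = "\<lambda>\<omega> t. indicator A \<omega> * indicator B \<omega> * (2 * (1 - t) * cos (t * (S \<omega> - u))) * indicator {0..1} t"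
  have fb: "integrable (M \<Otimes>\<^sub>M N) (case_prod ?f)"
  proof -
    interpret MN: pair_prob_space M N ..
    show ?thesis
    proof (rule MN.P.integrable_bounded[of _ 2])
      show "case_prod ?f \<in> borel_measurable (M \<Otimes>\<^sub>M N)" by measurable
      fix x assume "x \<in> space (M \<Otimes>\<^sub>M N)"
      obtain \<omega> t where x: "x = (\<omega>, t)" by (cases x)
      have "\<bar>2 * (1 - t) * cos (t * (S \<omega> - u))\<bar> \<le> 2 * 1" if "t \<in> {0..1}"
        unfolding abs_mult using that by (intro mult_mono) auto
      thus "norm (case_prod ?f x) \<le> 2" by (auto simp: x indicator_def)
    qed
  qed
  have tI: "(\<integral>t. g t * indicator {0..1} t \<partial>N) = (\<integral>t. g t \<partial>N)" if "g \<in> borel_measurable borel" for g :: "real \<Rightarrow> real"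
  proof (rule integral_cong_AE)
    show "AE t in N. g t * indicator {0..1} t = g t"
      unfolding N_def by (rule AE_uniform_measureI) auto
  qed (use that in measurable)
  have sub: "{\<omega>\<in>space M. PF (\<lambda>i. Y i \<omega>) \<and> PR (\<lambda>i. Y i \<omega>) \<and> \<bar>(\<Sum>i\<in>JF \<union> JR \<union> JM. Y i \<omega>) - u\<bar> \<le> 1} = A \<inter> B \<inter> {\<omega>\<in>space M. \<bar>S \<omega> - u\<bar> \<le> 1}"
    by (auto simp: A_def B_def S_def)
  have fej: "(\<integral>t. ?f \<omega> t \<partial>N) = indicator A \<omega> * indicator B \<omega> * fejer (S \<omega> - u)" for \<omega>
  proof -
    have "(\<integral>t. ?f \<omega> t \<partial>N) = (\<integral>t. indicator A \<omega> * indicator B \<omega> * (2 * (1 - t) * cos (t * (S \<omega> - u))) \<partial>N)"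
      by (intro tI) measurable
    thus ?thesis by (simp add: fejer_def N_def)
  qed
  have iF: "integrable M (\<lambda>\<omega>. indicator A \<omega> * indicator B \<omega> * fejer (S \<omega> - u))"
    using P.integrable_fst'[OF fb] by (simp only: fej prod.case)
  have "prob (A \<inter> B \<inter> {\<omega>\<in>space M. \<bar>S \<omega> - u\<bar> \<le> 1}) = expectation (indicator (A \<inter> B \<inter> {\<omega>\<in>space M. \<bar>S \<omega> - u\<bar> \<le> 1}))"
    by (simp add: Int_absorb2 Int_assoc) (metis (no_types, lifting) Int_absorb2 inf.coboundedI1 A sets.sets_into_space Int_commute Int_assoc)?
  also have "\<dots> \<le> expectation (\<lambda>\<omega>. 2 * (indicator A \<omega> * indicator B \<omega> * fejer (S \<omega> - u)))"
  proof (intro integral_mono integrable_mult_right iF)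
    show "integrable M (indicator (A \<inter> B \<inter> {\<omega>\<in>space M. \<bar>S \<omega> - u\<bar> \<le> 1}) :: _ \<Rightarrow> real)"
      by (intro integrable_real_indicator) (auto simp: emeasure_eq_measure)
    fix \<omega> assume "\<omega> \<in> space M"
    show "indicator (A \<inter> B \<inter> {\<omega>\<in>space M. \<bar>S \<omega> - u\<bar> \<le> 1}) \<omega> \<le> 2 * (indicator A \<omega> * indicator B \<omega> * fejer (S \<omega> - u))"
      using fejer_ge_half[of "S \<omega> - u"] fejer_nonneg[of "S \<omega> - u"] by (auto simp: indicator_def)
  qed
  also have "\<dots> = 2 * expectation (\<lambda>\<omega>. \<integral>t. ?f \<omega> t \<partial>N)" by (simp only: fej integral_mult_right_zero)
  also have "expectation (\<lambda>\<omega>. \<integral>t. ?f \<omega> t \<partial>N) = (\<integral>t. expectation (\<lambda>\<omega>. ?f \<omega> t) \<partial>N)"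
    using P.Fubini_integral[OF fb] by simp
  also have "\<dots> \<le> (\<integral>t. 2 * (prob A * prob B) * exp (- (\<sigma> * t\<^sup>2)) * indicator {0..1} t \<partial>N)"
  proof (rule integral_mono)
    show "integrable N (\<lambda>t. expectation (\<lambda>\<omega>. ?f \<omega> t))"
      using P.integrable_snd[OF fb] by simp
    show "integrable N (\<lambda>t. 2 * (prob A * prob B) * exp (- (\<sigma> * t\<^sup>2)) * indicator {0..1} t)"
    proof (rule N.integrable_bounded[of _ "2 * (prob A * prob B)"])
      fix t :: real
      have "2 * (prob A * prob B) * exp (- (\<sigma> * t\<^sup>2)) \<le> 2 * (prob A * prob B) * 1"
        using s0 by (intro mult_left_mono) auto
      thus "norm (2 * (prob A * prob B) * exp (- (\<sigma> * t\<^sup>2)) * indicator {0..1} t) \<le> 2 * (prob A * prob B)"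
        by (auto simp: indicator_def abs_mult)
    qed measurable
    fix t assume "t \<in> space N"
    show "expectation (\<lambda>\<omega>. ?f \<omega> t) \<le> 2 * (prob A * prob B) * exp (- (\<sigma> * t\<^sup>2)) * indicator {0..1} t"
    proof (cases "t \<in> {0..1}")
      case True
      have "expectation (\<lambda>\<omega>. ?f \<omega> t) = expectation (\<lambda>\<omega>. 2 * (1 - t) * (indicator A \<omega> * indicator B \<omega> * cos (t * (S \<omega> - u))))"
        using True by (intro Bochner_Integration.integral_cong) (auto simp: mult_ac)
      also have "\<dots> = 2 * (1 - t) * expectation (\<lambda>\<omega>. indicator A \<omega> * indicator B \<omega> * cos (t * (S \<omega> - u)))" by simp
      also have "\<dots> \<le> 2 * (1 - t) * (prob A * prob B * exp (- (\<sigma> * t\<^sup>2)))"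
        using char[OF True] True by (intro mult_left_mono) auto
      also have "\<dots> \<le> 2 * 1 * (prob A * prob B * exp (- (\<sigma> * t\<^sup>2)))"
        using True by (intro mult_right_mono) auto
      finally show ?thesis using True by simp
    qed auto
  qed
  also have "\<dots> = (\<integral>t. 2 * (prob A * prob B) * exp (- (\<sigma> * t\<^sup>2)) \<partial>N)"
    by (intro tI) measurable
  also have "\<dots> = 2 * (prob A * prob B) * integral {0..1} (\<lambda>t. exp (- (\<sigma> * t\<^sup>2)))"
    unfolding N_def by (simp, subst integral_uniform_unit_interval) (auto intro!: continuous_intros)
  \<comment> \<open>The constant 8 is a factor 2 each from the lower bound \<open>1/2\<close> of the
    kernel, from the weight \<open>2 * (1 - t)\<close> and from the Gaussian integral.\<close>
  also have "\<dots> \<le> 2 * (prob A * prob B) * (2 / sqrt (1 + \<sigma>))"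
    by (intro mult_left_mono integral_gaussian_le s0) auto
  finally show ?thesis unfolding sub A_def[symmetric] B_def[symmetric] \<sigma>_def[symmetric] by simp
qed

subsection \<open>Local suprema of the Euler product\<close>

text \<open>Averaged over the parameter, the partial products in increasing order of
  \<open>p\<close> form a nonnegative submartingale, because each factor has expectation at least 1;
  this is Doob's inequality for it. The average is not a product of independent factors, so
  expectations are compared for each fixed parameter and then integrated. Measurability in the
  coordinates alone is included for later use with independence.\<close>

lemma (in prob_space) product_maximal_inequality:
  fixes Z :: "nat \<Rightarrow> 'a \<Rightarrow> complex" and g :: "nat \<Rightarrow> complex \<Rightarrow> real \<Rightarrow> real" and N :: "real measure"
  assumes J: "finite J" and ind: "indep_vars (\<lambda>_. borel) Z J" and N: "prob_space N"
    and mg: "\<And>p. p \<in> J \<Longrightarrow> (\<lambda>(z, \<phi>). g p z \<phi>) \<in> borel_measurable (borel \<Otimes>\<^sub>M N)"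
    and g0: "\<And>p z \<phi>. p \<in> J \<Longrightarrow> 0 \<le> g p z \<phi>"
    and gC: "\<And>p \<omega> \<phi>. p \<in> J \<Longrightarrow> \<omega> \<in> space M \<Longrightarrow> \<phi> \<in> space N \<Longrightarrow> g p (Z p \<omega>) \<phi> \<le> C"
    and g1: "\<And>p \<phi>. p \<in> J \<Longrightarrow> \<phi> \<in> space N \<Longrightarrow> 1 \<le> expectation (\<lambda>\<omega>. g p (Z p \<omega>) \<phi>)"
    and ge: "\<And>p \<phi>. p \<in> J \<Longrightarrow> \<phi> \<in> space N \<Longrightarrow> expectation (\<lambda>\<omega>. g p (Z p \<omega>) \<phi>) \<le> exp (e p)"
    and u: "u > 0"
  shows "{\<omega>\<in>space M. \<exists>t\<in>J. u \<le> (\<integral>\<phi>. (\<Prod>p | p \<in> J \<and> p \<le> t. g p (Z p \<omega>) \<phi>) \<partial>N)} \<in> sets M"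
    and "{z\<in>space (PiM J (\<lambda>_. borel)). \<exists>t\<in>J. u \<le> (\<integral>\<phi>. (\<Prod>p | p \<in> J \<and> p \<le> t. g p (z p) \<phi>) \<partial>N)} \<in> sets (PiM J (\<lambda>_. borel))"
    and "prob {\<omega>\<in>space M. \<exists>t\<in>J. u \<le> (\<integral>\<phi>. (\<Prod>p | p \<in> J \<and> p \<le> t. g p (Z p \<omega>) \<phi>) \<partial>N)} \<le> exp (\<Sum>p\<in>J. e p) / u"
proof -
  interpret N: prob_space N by (rule N)
  interpret P: pair_sigma_finite M N ..
  have mZ: "p \<in> J \<Longrightarrow> Z p \<in> borel_measurable M" for p using ind by (auto simp: indep_vars_def)
  define G where "G K z \<phi> = (\<Prod>p\<in>K. g p (z p) \<phi>)" for K and z :: "nat \<Rightarrow> complex" and \<phi>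
  define Phi where "Phi K z = (\<integral>\<phi>. G K z \<phi> \<partial>N)" for K z
  define E where "E K z \<longleftrightarrow> (\<exists>t\<in>K. u \<le> Phi {p\<in>K. p \<le> t} z)" for K z
  have mG: "(\<lambda>(z, \<phi>). G K z \<phi>) \<in> borel_measurable (PiM L (\<lambda>_. borel) \<Otimes>\<^sub>M N)" if "K \<subseteq> L" "K \<subseteq> J" for K L
  proof -
    have "(\<lambda>x. g p (fst x p) (snd x)) \<in> borel_measurable (PiM L (\<lambda>_. borel) \<Otimes>\<^sub>M N)" if "p \<in> K" for p
    proof -
      have "(\<lambda>x. (fst x p, snd x)) \<in> measurable (PiM L (\<lambda>_. borel) \<Otimes>\<^sub>M N) (borel \<Otimes>\<^sub>M N)"
        using that \<open>K \<subseteq> L\<close>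
        by (intro measurable_Pair measurable_compose[OF measurable_fst measurable_component_singleton] measurable_snd) auto
      from measurable_compose[OF this mg[of p]] show ?thesis using that \<open>K \<subseteq> J\<close> by (auto simp: case_prod_beta)
    qed
    thus ?thesis unfolding G_def case_prod_beta by (intro borel_measurable_prod) auto
  qed
  have mPhi: "Phi K \<in> borel_measurable (PiM L (\<lambda>_. borel))" if "K \<subseteq> L" "K \<subseteq> J" for K L
    unfolding Phi_def using mG[OF that] by (intro N.borel_measurable_lebesgue_integral) (simp add: case_prod_beta)
  have finK: "finite K" if "K \<subseteq> J" for K using that J finite_subset by blast
  have mE: "{z \<in> space (PiM K (\<lambda>_. borel)). E K z} \<in> sets (PiM K (\<lambda>_. borel))" if "K \<subseteq> J" for K
  proof -
    have "{z \<in> space (PiM K (\<lambda>_. borel)). E K z} = (\<Union>t\<in>K. {z \<in> space (PiM K (\<lambda>_. borel)). u \<le> Phi {p\<in>K. p \<le> t} z})"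
      by (auto simp: E_def)
    moreover have "{z \<in> space (PiM K (\<lambda>_. borel)). u \<le> Phi {p\<in>K. p \<le> t} z} \<in> sets (PiM K (\<lambda>_. borel))" for t
    proof -
      have "Phi {p\<in>K. p \<le> t} \<in> borel_measurable (PiM K (\<lambda>_. borel))" using that by (intro mPhi) auto
      thus ?thesis by measurable
    qed
    ultimately show ?thesis using finK[OF that] by (auto intro!: sets.finite_UN)
  qed
  have rG: "G K (restrict z L) \<phi> = G K z \<phi>" if "K \<subseteq> L" for K L z \<phi>
    unfolding G_def using that by (intro prod.cong) auto
  have rPhi: "Phi K (restrict z L) = Phi K z" if "K \<subseteq> L" for K L z
  proof -
    have "G K (restrict z L) = G K z" by (rule ext) (rule rG[OF that])
    thus ?thesis by (simp add: Phi_def)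
  qed
  have rE: "E K (restrict z K) = E K z" for K z
    unfolding E_def by (intro bex_cong refl arg_cong[where f="\<lambda>v. u \<le> v"] rPhi) auto
  have rM: "(\<lambda>\<omega>. restrict (\<lambda>i. Z i \<omega>) K) \<in> measurable M (PiM K (\<lambda>_. borel))" if "K \<subseteq> J" for K
    using that by (intro measurable_restrict mZ) auto
  define EM where "EM K = {\<omega>\<in>space M. E K (\<lambda>i. Z i \<omega>)}" for K
  have EM: "EM K \<in> sets M" if "K \<subseteq> J" for K
  proof -
    have "EM K = (\<lambda>\<omega>. restrict (\<lambda>i. Z i \<omega>) K) -` {x \<in> space (PiM K (\<lambda>_. borel)). E K x} \<inter> space M"
      using measurable_space[OF rM[OF that]] by (auto simp: rE EM_def)
    thus ?thesis using measurable_sets[OF rM[OF that] mE[OF that]] by simp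
  qed
  define C' where "C' = max 1 C"
  have Gb: "0 \<le> G K (\<lambda>i. Z i \<omega>) \<phi>" "G K (\<lambda>i. Z i \<omega>) \<phi> \<le> C' ^ card K" if "K \<subseteq> J" "\<omega> \<in> space M" "\<phi> \<in> space N" for K \<omega> \<phi>
  proof -
    show "0 \<le> G K (\<lambda>i. Z i \<omega>) \<phi>" unfolding G_def using g0 that by (intro prod_nonneg) auto
    have "G K (\<lambda>i. Z i \<omega>) \<phi> \<le> (\<Prod>p\<in>K. C')"
      unfolding G_def using that g0 gC[of _ \<omega> \<phi>] by (intro prod_mono) (auto simp: C'_def le_max_iff_disj)
    thus "G K (\<lambda>i. Z i \<omega>) \<phi> \<le> C' ^ card K" by simp
  qed
  have mGM: "(\<lambda>(\<omega>, \<phi>). G K (\<lambda>i. Z i \<omega>) \<phi>) \<in> borel_measurable (M \<Otimes>\<^sub>M N)" if "K \<subseteq> J" for K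
  proof -
    have "(\<lambda>x. (restrict (\<lambda>i. Z i (fst x)) K, snd x)) \<in> measurable (M \<Otimes>\<^sub>M N) (PiM K (\<lambda>_. borel) \<Otimes>\<^sub>M N)"
      by (intro measurable_Pair measurable_compose[OF measurable_fst rM[OF that]] measurable_snd)
    from measurable_compose[OF this mG[OF subset_refl that]] show ?thesis
      by (simp add: case_prod_beta rG)
  qed
  have mPM: "(\<lambda>\<omega>. Phi K (\<lambda>i. Z i \<omega>)) \<in> borel_measurable M" if "K \<subseteq> J" for K
    using measurable_compose[OF rM[OF that] mPhi[OF subset_refl that]] by (simp add: rPhi)
  have GN: "integrable N (\<lambda>\<phi>. G K (\<lambda>i. Z i \<omega>) \<phi>)" if "K \<subseteq> J" "\<omega> \<in> space M" for K \<omega>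
  proof (rule N.integrable_bounded[of _ "C' ^ card K"])
    show "(\<lambda>\<phi>. G K (\<lambda>i. Z i \<omega>) \<phi>) \<in> borel_measurable N"
      using measurable_Pair2[OF mGM[OF that(1)] that(2)] by simp
  qed (use Gb[OF that] in auto)
  have Phib: "0 \<le> Phi K (\<lambda>i. Z i \<omega>)" "Phi K (\<lambda>i. Z i \<omega>) \<le> C' ^ card K" if "K \<subseteq> J" "\<omega> \<in> space M" for K \<omega>
  proof -
    show "0 \<le> Phi K (\<lambda>i. Z i \<omega>)" unfolding Phi_def using Gb[OF that] by (intro Bochner_Integration.integral_nonneg) auto
    have "Phi K (\<lambda>i. Z i \<omega>) \<le> (\<integral>\<phi>. C' ^ card K \<partial>N)"
      unfolding Phi_def using Gb[OF that] GN[OF that] by (intro integral_mono) auto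
    thus "Phi K (\<lambda>i. Z i \<omega>) \<le> C' ^ card K" using N.prob_space by simp
  qed
  have intP: "integrable M (\<lambda>\<omega>. Phi K (\<lambda>i. Z i \<omega>) * indicator A \<omega>)" if "K \<subseteq> J" "A \<in> sets M" for K A
    using Phib[OF that(1)] mPM[OF that(1)] that(2) C'_def
    by (intro integrable_bounded[of _ "C' ^ card K"]) (auto simp: indicator_def)
  have fub: "expectation (\<lambda>\<omega>. Phi K (\<lambda>i. Z i \<omega>) * indicator A \<omega>) = (\<integral>\<phi>. expectation (\<lambda>\<omega>. G K (\<lambda>i. Z i \<omega>) \<phi> * indicator A \<omega>) \<partial>N)"
    and fubi: "integrable N (\<lambda>\<phi>. expectation (\<lambda>\<omega>. G K (\<lambda>i. Z i \<omega>) \<phi> * indicator A \<omega>))"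
    if K: "K \<subseteq> J" and A[measurable]: "A \<in> sets M" for K A
  proof -
    interpret MN: pair_prob_space M N ..
    have int: "integrable (M \<Otimes>\<^sub>M N) (\<lambda>(\<omega>, \<phi>). G K (\<lambda>i. Z i \<omega>) \<phi> * indicator A \<omega>)"
    proof (rule MN.P.integrable_bounded[of _ "C' ^ card K"])
      have "(\<lambda>x. (\<lambda>(\<omega>, \<phi>). G K (\<lambda>i. Z i \<omega>) \<phi>) x * indicator A (fst x)) \<in> borel_measurable (M \<Otimes>\<^sub>M N)"
        using mGM[OF K] by measurable
      thus "(\<lambda>(\<omega>, \<phi>). G K (\<lambda>i. Z i \<omega>) \<phi> * indicator A \<omega>) \<in> borel_measurable (M \<Otimes>\<^sub>M N)"
        by (simp add: case_prod_beta)
      fix x assume "x \<in> space (M \<Otimes>\<^sub>M N)"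
      thus "norm ((\<lambda>(\<omega>, \<phi>). G K (\<lambda>i. Z i \<omega>) \<phi> * indicator A \<omega>) x) \<le> C' ^ card K"
        using Gb[OF K] by (auto simp: space_pair_measure indicator_def C'_def)
    qed
    show "integrable N (\<lambda>\<phi>. expectation (\<lambda>\<omega>. G K (\<lambda>i. Z i \<omega>) \<phi> * indicator A \<omega>))"
      using P.integrable_snd[OF int] by simp
    have "(\<integral>\<phi>. expectation (\<lambda>\<omega>. G K (\<lambda>i. Z i \<omega>) \<phi> * indicator A \<omega>) \<partial>N) = expectation (\<lambda>\<omega>. \<integral>\<phi>. G K (\<lambda>i. Z i \<omega>) \<phi> * indicator A \<omega> \<partial>N)"
      using P.Fubini_integral[OF int] by simp
    thus "expectation (\<lambda>\<omega>. Phi K (\<lambda>i. Z i \<omega>) * indicator A \<omega>) = (\<integral>\<phi>. expectation (\<lambda>\<omega>. G K (\<lambda>i. Z i \<omega>) \<phi> * indicator A \<omega>) \<partial>N)"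
      by (simp add: Phi_def)
  qed
  \<comment> \<open>The event \<open>EM K\<close> uses only coordinates in \<open>K\<close>, so for
    each fixed parameter the new factor is independent of it and has expectation at least 1.\<close>
  have step: "expectation (\<lambda>\<omega>. Phi K (\<lambda>i. Z i \<omega>) * indicator (EM K) \<omega>) \<le> expectation (\<lambda>\<omega>. Phi (insert b K) (\<lambda>i. Z i \<omega>) * indicator (EM K) \<omega>)"
    if K: "insert b K \<subseteq> J" and b: "b \<notin> K" for K b
  proof -
    have KJ: "K \<subseteq> J" "b \<in> J" using K by auto
    have "(\<integral>\<phi>. expectation (\<lambda>\<omega>. G K (\<lambda>i. Z i \<omega>) \<phi> * indicator (EM K) \<omega>) \<partial>N) \<le> (\<integral>\<phi>. expectation (\<lambda>\<omega>. G (insert b K) (\<lambda>i. Z i \<omega>) \<phi> * indicator (EM K) \<omega>) \<partial>N)"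
    proof (rule integral_mono[OF fubi[OF KJ(1) EM[OF KJ(1)]] fubi[OF K EM[OF KJ(1)]]])
      fix \<phi> assume f: "\<phi> \<in> space N"
      define G1 where "G1 z = G K z \<phi> * indicator {z. E K z} z" for z
      define H where "H z = g b (z b) \<phi>" for z :: "nat \<Rightarrow> complex"
      have m1: "G1 \<in> borel_measurable (PiM K (\<lambda>_. borel))"
      proof -
        have "(\<lambda>z. G K z \<phi>) \<in> borel_measurable (PiM K (\<lambda>_. borel))"
          using measurable_compose[OF _ mG[OF subset_refl KJ(1)], of "\<lambda>z. (z, \<phi>)"] f by simp
        hence "(\<lambda>z. G K z \<phi> * indicator {z \<in> space (PiM K (\<lambda>_. borel)). E K z} z) \<in> borel_measurable (PiM K (\<lambda>_. borel))"
          using mE[OF KJ(1)] by measurable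
        also have "?this \<longleftrightarrow> ?thesis" unfolding G1_def by (intro measurable_cong) (auto simp: indicator_def)
        finally show ?thesis .
      qed
      have m2: "H \<in> borel_measurable (PiM {b} (\<lambda>_. borel))"
      proof -
        have "(\<lambda>z. (z b, \<phi>)) \<in> measurable (PiM {b} (\<lambda>_. borel)) (borel \<Otimes>\<^sub>M N)" using f by measurable
        from measurable_compose[OF this mg[OF KJ(2)]] show ?thesis by (simp add: H_def[abs_def])
      qed
      have mgb: "(\<lambda>\<omega>. g b (Z b \<omega>) \<phi>) \<in> borel_measurable M"
      proof -
        have "(\<lambda>\<omega>. (Z b \<omega>, \<phi>)) \<in> measurable M (borel \<Otimes>\<^sub>M N)" using f mZ[OF KJ(2)] by measurable
        from measurable_compose[OF this mg[OF KJ(2)]] show ?thesis by simp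
      qed
      have r1: "G1 (restrict z K) = G1 z" for z by (simp add: G1_def rG rE indicator_def)
      have i1: "integrable M (\<lambda>\<omega>. G1 (\<lambda>i. Z i \<omega>))"
      proof (rule integrable_bounded[of _ "C' ^ card K"])
        show "(\<lambda>\<omega>. G1 (\<lambda>i. Z i \<omega>)) \<in> borel_measurable M" using measurable_compose[OF rM[OF KJ(1)] m1] by (simp add: r1)
      qed (use Gb[OF KJ(1) _ f] in \<open>auto simp: G1_def indicator_def C'_def\<close>)
      have i2: "integrable M (\<lambda>\<omega>. H (\<lambda>i. Z i \<omega>))"
        unfolding H_def using mgb gC[OF KJ(2) _ f] g0[OF KJ(2)] by (intro integrable_bounded[of _ C]) auto
      have eq: "expectation (\<lambda>\<omega>. G1 (\<lambda>i. Z i \<omega>) * H (\<lambda>i. Z i \<omega>)) = expectation (\<lambda>\<omega>. G1 (\<lambda>i. Z i \<omega>)) * expectation (\<lambda>\<omega>. H (\<lambda>i. Z i \<omega>))"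
        using b KJ by (intro indep_disjoint_expectation_mult[OF ind _ _ _ m1 r1 m2 _ i1 i2]) (auto simp: H_def)
      have "expectation (\<lambda>\<omega>. G K (\<lambda>i. Z i \<omega>) \<phi> * indicator (EM K) \<omega>) = expectation (\<lambda>\<omega>. G1 (\<lambda>i. Z i \<omega>)) * 1"
        by (simp, intro Bochner_Integration.integral_cong) (auto simp: G1_def EM_def indicator_def)
      also have "\<dots> \<le> expectation (\<lambda>\<omega>. G1 (\<lambda>i. Z i \<omega>)) * expectation (\<lambda>\<omega>. H (\<lambda>i. Z i \<omega>))"
        unfolding H_def using g1[OF KJ(2) f] Gb[OF KJ(1) _ f]
        by (intro mult_left_mono Bochner_Integration.integral_nonneg) (auto simp: G1_def)
      also have "\<dots> = expectation (\<lambda>\<omega>. G (insert b K) (\<lambda>i. Z i \<omega>) \<phi> * indicator (EM K) \<omega>)"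
        unfolding eq[symmetric] using b finK[OF KJ(1)]
        by (intro Bochner_Integration.integral_cong) (auto simp: G1_def H_def G_def EM_def indicator_def)
      finally show "expectation (\<lambda>\<omega>. G K (\<lambda>i. Z i \<omega>) \<phi> * indicator (EM K) \<omega>) \<le> expectation (\<lambda>\<omega>. G (insert b K) (\<lambda>i. Z i \<omega>) \<phi> * indicator (EM K) \<omega>)" .
    qed
    thus ?thesis by (simp only: fub[OF KJ(1) EM[OF KJ(1)]] fub[OF K EM[OF KJ(1)]])
  qed
  \<comment> \<open>The largest index \<open>b\<close> is added last: on the old event the
    expectation can only grow, and on the newly reached part \<open>D\<close> the full averaged
    product is at least \<open>u\<close>.\<close>
  have main: "u * prob (EM K) \<le> expectation (\<lambda>\<omega>. Phi K (\<lambda>i. Z i \<omega>) * indicator (EM K) \<omega>)" if "finite K" "K \<subseteq> J" for K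
    using that
  proof (induction K rule: finite_linorder_max_induct)
    case empty
    have "EM {} = {}" by (auto simp: EM_def E_def)
    thus ?case by simp
  next
    case (insert b K)
    have KJ: "K \<subseteq> J" "insert b K \<subseteq> J" using insert.prems by auto
    have bK: "b \<notin> K" using insert.hyps by auto
    have trunc: "{p\<in>insert b K. p \<le> t} = {p\<in>K. p \<le> t}" if "t \<in> K" for t
      using that insert.hyps by force
    have truncb: "{p\<in>insert b K. p \<le> b} = insert b K"
      using insert.hyps by force
    have sub2: "EM K \<subseteq> EM (insert b K)"
      by (auto simp: EM_def E_def trunc simp del: insert_iff intro!: bexI[rotated, OF insertI2])
    define D where "D = EM (insert b K) - EM K"
    have D: "D \<in> sets M" unfolding D_def using EM KJ by auto
    have Du: "u \<le> Phi (insert b K) (\<lambda>i. Z i \<omega>)" if wD: "\<omega> \<in> D" for \<omega>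
    proof -
      have w: "\<omega> \<in> space M" "\<omega> \<notin> EM K" and "E (insert b K) (\<lambda>i. Z i \<omega>)"
        using wD by (auto simp: D_def EM_def)
      then obtain t where t: "t \<in> insert b K" "u \<le> Phi {p\<in>insert b K. p \<le> t} (\<lambda>i. Z i \<omega>)"
        unfolding E_def by blast
      have "t \<notin> K"
      proof
        assume "t \<in> K"
        hence "u \<le> Phi {p\<in>K. p \<le> t} (\<lambda>i. Z i \<omega>)" using t(2) trunc by simp
        thus False using w \<open>t \<in> K\<close> by (auto simp: EM_def E_def)
      qed
      thus ?thesis using t truncb by auto
    qed
    have "EM (insert b K) = EM K \<union> D" "EM K \<inter> D = {}" using sub2 by (auto simp: D_def)
    hence "u * prob (EM (insert b K)) = u * prob (EM K) + u * prob D"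
      using EM[OF KJ(1)] D by (simp add: finite_measure_Union distrib_left)
    also have "u * prob D = expectation (\<lambda>\<omega>. u * indicator D \<omega>)" using D by simp
    also have "\<dots> \<le> expectation (\<lambda>\<omega>. Phi (insert b K) (\<lambda>i. Z i \<omega>) * indicator D \<omega>)"
      using D Du intP[OF KJ(2) D] by (intro integral_mono integrable_mult_right integrable_real_indicator) (auto simp: indicator_def emeasure_eq_measure)
    also have "u * prob (EM K) \<le> expectation (\<lambda>\<omega>. Phi K (\<lambda>i. Z i \<omega>) * indicator (EM K) \<omega>)"
      by (rule insert.IH[OF KJ(1)])
    also have "\<dots> \<le> expectation (\<lambda>\<omega>. Phi (insert b K) (\<lambda>i. Z i \<omega>) * indicator (EM K) \<omega>)"
      by (rule step[OF KJ(2) bK])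
    also have "expectation (\<lambda>\<omega>. Phi (insert b K) (\<lambda>i. Z i \<omega>) * indicator (EM K) \<omega>) + expectation (\<lambda>\<omega>. Phi (insert b K) (\<lambda>i. Z i \<omega>) * indicator D \<omega>)
       = expectation (\<lambda>\<omega>. Phi (insert b K) (\<lambda>i. Z i \<omega>) * indicator (EM K) \<omega> + Phi (insert b K) (\<lambda>i. Z i \<omega>) * indicator D \<omega>)"
      by (rule Bochner_Integration.integral_add[symmetric, OF intP[OF KJ(2) EM[OF KJ(1)]] intP[OF KJ(2) D]])
    also have "\<dots> = expectation (\<lambda>\<omega>. Phi (insert b K) (\<lambda>i. Z i \<omega>) * indicator (EM (insert b K)) \<omega>)"
      using sub2 by (intro Bochner_Integration.integral_cong) (auto simp: D_def indicator_def)
    finally show ?case by simp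
  qed
  show "{\<omega>\<in>space M. \<exists>t\<in>J. u \<le> (\<integral>\<phi>. (\<Prod>p | p \<in> J \<and> p \<le> t. g p (Z p \<omega>) \<phi>) \<partial>N)} \<in> sets M"
    using EM[OF subset_refl] by (simp add: EM_def E_def Phi_def G_def)
  show "{z\<in>space (PiM J (\<lambda>_. borel)). \<exists>t\<in>J. u \<le> (\<integral>\<phi>. (\<Prod>p | p \<in> J \<and> p \<le> t. g p (z p) \<phi>) \<partial>N)} \<in> sets (PiM J (\<lambda>_. borel))"
    using mE[OF subset_refl] by (simp add: E_def Phi_def G_def)
  show "prob {\<omega>\<in>space M. \<exists>t\<in>J. u \<le> (\<integral>\<phi>. (\<Prod>p | p \<in> J \<and> p \<le> t. g p (Z p \<omega>) \<phi>) \<partial>N)} \<le> exp (\<Sum>p\<in>J. e p) / u"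
  proof -
    have "u * prob (EM J) \<le> expectation (\<lambda>\<omega>. Phi J (\<lambda>i. Z i \<omega>) * indicator (EM J) \<omega>)" by (rule main[OF J subset_refl])
    also have "\<dots> \<le> expectation (\<lambda>\<omega>. Phi J (\<lambda>i. Z i \<omega>) * indicator (space M) \<omega>)"
      using Phib[OF subset_refl] intP[OF subset_refl EM[OF subset_refl]] intP[OF subset_refl sets.top]
      by (intro integral_mono) (auto simp: indicator_def)
    also have "\<dots> = (\<integral>\<phi>. expectation (\<lambda>\<omega>. G J (\<lambda>i. Z i \<omega>) \<phi> * indicator (space M) \<omega>) \<partial>N)"
      by (rule fub) auto
    also have "\<dots> \<le> (\<integral>\<phi>. exp (\<Sum>p\<in>J. e p) \<partial>N)"
    proof (rule integral_mono[OF fubi[OF subset_refl sets.top] N.integrable_const])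
      fix \<phi> assume f: "\<phi> \<in> space N"
      have mgp: "(\<lambda>z. g p z \<phi>) \<in> borel_measurable borel" if "p \<in> J" for p
      proof -
        have "(\<lambda>z. (z, \<phi>)) \<in> measurable borel (borel \<Otimes>\<^sub>M N)" using f by measurable
        from measurable_compose[OF this mg[OF that]] show ?thesis by simp
      qed
      have "expectation (\<lambda>\<omega>. G J (\<lambda>i. Z i \<omega>) \<phi> * indicator (space M) \<omega>) = expectation (\<lambda>\<omega>. \<Prod>p\<in>J. g p (Z p \<omega>) \<phi>)"
        by (intro Bochner_Integration.integral_cong) (auto simp: G_def)
      also have "\<dots> = (\<Prod>p\<in>J. expectation (\<lambda>\<omega>. g p (Z p \<omega>) \<phi>))"
      proof (rule indep_vars_lebesgue_integral[OF J])
        show "indep_vars (\<lambda>_. borel) (\<lambda>p \<omega>. g p (Z p \<omega>) \<phi>) J"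
          by (rule indep_vars_compose2[OF ind, where Y="\<lambda>p z. g p z \<phi>"]) (rule mgp)
        fix p assume p: "p \<in> J"
        show "integrable M (\<lambda>\<omega>. g p (Z p \<omega>) \<phi>)"
          using measurable_compose[OF mZ[OF p] mgp[OF p]] gC[OF p _ f] g0[OF p] by (intro integrable_bounded[of _ C]) auto
      qed
      also have "\<dots> \<le> (\<Prod>p\<in>J. exp (e p))"
        using ge f g0 by (intro prod_mono conjI Bochner_Integration.integral_nonneg) auto
      finally show "expectation (\<lambda>\<omega>. G J (\<lambda>i. Z i \<omega>) \<phi> * indicator (space M) \<omega>) \<le> exp (\<Sum>p\<in>J. e p)"
        by (simp add: exp_sum J)
    qed
    finally have "prob (EM J) \<le> exp (\<Sum>p\<in>J. e p) / u" using u N.prob_space by (simp add: field_simps)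
    thus ?thesis by (simp add: EM_def E_def Phi_def G_def)
  qed
qed

text \<open>A Cayley transform of the right half-plane followed by Schwarz's lemma;
  \<open>7 = (1 + 3/4) / (1 - 3/4)\<close>. The shift by \<open>e\<close> makes the real part
  strictly positive, as the transform requires, and disappears since \<open>e'\<close> is
  arbitrary.\<close>

lemma harnack_inequality:
  assumes g: "g holomorphic_on ball c R" and R: "R > 0"
    and pos: "\<And>z. z \<in> ball c R \<Longrightarrow> Re (g z) \<ge> 0" and w: "dist c w \<le> 3 / 4 * R"
  shows "Re (g c) \<le> 7 * Re (g w)"
proof (rule field_le_epsilon)
  fix e' :: real assume e': "e' > 0"
  define e where "e = e' / 6"
  have e: "e > 0" using e' by (simp add: e_def)
  define b where "b = g c + of_real e"
  have b: "Re b > 0" using pos[of c] R e by (simp add: b_def)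
  define h where "h z = g (c + of_real R * z) + of_real e" for z :: complex
  have hpos: "Re (h z) > 0" if "norm z < 1" for z
  proof -
    have "c + of_real R * z \<in> ball c R" using that R by (simp add: dist_norm norm_mult)
    thus ?thesis using pos e by (simp add: h_def add_nonneg_pos)
  qed
  have hol: "h holomorphic_on ball 0 1"
  proof -
    have "g \<circ> (\<lambda>z. c + of_real R * z) holomorphic_on ball 0 1"
      using R by (intro holomorphic_on_compose_gen[OF _ g] holomorphic_intros) (auto simp: dist_norm norm_mult)
    thus ?thesis unfolding h_def o_def by (intro holomorphic_intros)
  qed
  have lt: "norm (a - b) < norm (a + cnj b)" if "Re a > 0" for a
  proof -
    have "(norm (a - b))\<^sup>2 < (norm (a + cnj b))\<^sup>2"
      unfolding cmod_power2 using that b mult_pos_pos[OF that b] by (simp add: power2_eq_square algebra_simps)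
    thus ?thesis by (rule power_less_imp_less_base) simp
  qed
  define \<phi> where "\<phi> z = (h z - b) / (h z + cnj b)" for z
  have nz: "h z + cnj b \<noteq> 0" if "norm z < 1" for z
    using lt[OF hpos[OF that]] by auto
  define \<zeta> where "\<zeta> = (w - c) / R"
  have z: "norm \<zeta> \<le> 3 / 4" using w R by (simp add: \<zeta>_def norm_divide dist_norm norm_minus_commute field_simps)
  have "norm (\<phi> \<zeta>) \<le> norm \<zeta>"
  proof (rule Schwarz_Lemma(1))
    show "\<phi> holomorphic_on ball 0 1" unfolding \<phi>_def using nz by (intro holomorphic_intros hol) auto
    show "\<phi> 0 = 0" by (simp add: \<phi>_def h_def b_def)
    show "norm (\<phi> z) < 1" if "norm z < 1" for z
      using lt[OF hpos[OF that]] nz[OF that] by (simp add: \<phi>_def norm_divide)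
    show "norm \<zeta> < 1" using z by simp
  qed
  hence "norm (\<phi> \<zeta>) \<le> 3 / 4" using z by simp
  moreover have z1: "norm \<zeta> < 1" using z by simp
  ultimately have "norm (h \<zeta> - b) \<le> 3 / 4 * norm (h \<zeta> + cnj b)"
    using nz[OF z1] by (simp add: \<phi>_def norm_divide field_simps)
  hence "(norm (h \<zeta> - b))\<^sup>2 \<le> (3 / 4 * norm (h \<zeta> + cnj b))\<^sup>2" by (intro power_mono) auto
  \<comment> \<open>\<open>h \<zeta> - b\<close> and \<open>h \<zeta> + cnj b\<close> have the same
    imaginary part, so the inequality between moduli descends to the real parts.\<close>
  hence "(Re (h \<zeta>) - Re b)\<^sup>2 + (Im (h \<zeta>) - Im b)\<^sup>2 \<le> 9 / 16 * ((Re (h \<zeta>) + Re b)\<^sup>2 + (Im (h \<zeta>) - Im b)\<^sup>2)"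
    unfolding power_mult_distrib cmod_power2 by (simp add: power2_eq_square)
  hence "(Re (h \<zeta>) - Re b)\<^sup>2 \<le> 9 / 16 * (Re (h \<zeta>) + Re b)\<^sup>2"
    using zero_le_power2[of "Im (h \<zeta>) - Im b"] unfolding distrib_left by linarith
  moreover have "(3 / 4 * (Re (h \<zeta>) + Re b))\<^sup>2 = 9 / 16 * (Re (h \<zeta>) + Re b)\<^sup>2"
    by (simp only: power_mult_distrib) (simp add: power2_eq_square)
  ultimately have "(Re b - Re (h \<zeta>))\<^sup>2 \<le> (3 / 4 * (Re (h \<zeta>) + Re b))\<^sup>2"
    by (simp only: power2_commute)
  hence "Re b - Re (h \<zeta>) \<le> 3 / 4 * (Re (h \<zeta>) + Re b)"
    by (rule power2_le_imp_le) (use hpos[OF z1] b in auto)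
  moreover have "h \<zeta> = g w + of_real e" using R by (simp add: h_def \<zeta>_def)
  ultimately have "Re (g c) \<le> 7 * Re (g w) + 6 * e" by (simp add: b_def)
  thus "Re (g c) \<le> 7 * Re (g w) + e'" by (simp add: e_def)
qed

subsection \<open>Ballot bounds along the primes\<close>

lemma (in prob_space) indep_vars_nth:
  assumes ind: "indep_vars (\<lambda>_. borel) X J" and xs: "distinct xs" "set xs \<subseteq> J"
  shows "indep_vars (\<lambda>_. borel) (\<lambda>i. X (xs ! i)) {..<length xs}"
proof -
  have "indep_vars (\<lambda>i. PiM {xs ! i} (\<lambda>_. borel)) (\<lambda>i \<omega>. restrict (\<lambda>j. X j \<omega>) {xs ! i}) {..<length xs}"
    using xs by (intro indep_vars_restrict[OF ind]) (auto simp: disjoint_family_on_def nth_eq_iff_index_eq)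
  hence "indep_vars (\<lambda>_. borel) (\<lambda>i \<omega>. (restrict (\<lambda>j. X j \<omega>) {xs ! i}) (xs ! i)) {..<length xs}"
    by (rule indep_vars_compose2) (auto intro!: measurable_component_singleton)
  thus ?thesis by simp
qed

lemma set_take_sorted_wrt:
  assumes s: "sorted_wrt R xs" and R: "\<And>x y. R x y \<Longrightarrow> \<not> R y x" and j: "0 < j" "j \<le> length xs"
  shows "set (take j xs) = {p \<in> set xs. p = xs ! (j - 1) \<or> R p (xs ! (j - 1))}"
proof (intro equalityI subsetI)
  fix p assume "p \<in> set (take j xs)"
  then obtain i where i: "i < j" "p = xs ! i" using j by (auto simp: in_set_conv_nth)
  show "p \<in> {p \<in> set xs. p = xs ! (j - 1) \<or> R p (xs ! (j - 1))}"
    using i j sorted_wrt_nth_less[OF s, of i "j - 1"] by (cases "i = j - 1") auto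
next
  fix p assume p: "p \<in> {p \<in> set xs. p = xs ! (j - 1) \<or> R p (xs ! (j - 1))}"
  then obtain i where i: "i < length xs" "p = xs ! i" by (auto simp: in_set_conv_nth)
  have "i < j"
  proof (rule ccontr)
    assume "\<not> i < j"
    hence "R (xs ! (j - 1)) p" using i j sorted_wrt_nth_less[OF s, of "j - 1" i] by auto
    thus False using p R by auto
  qed
  thus "p \<in> set (take j xs)" using i j by (auto simp: in_set_conv_nth intro!: exI[of _ i])
qed

lemma sum_nth_take:
  assumes "distinct xs" "j \<le> length xs"
  shows "(\<Sum>i<j. f (xs ! i)) = (\<Sum>p\<in>set (take j xs). f p)"
proof -
  have "(\<Sum>p\<in>set (take j xs). f p) = (\<Sum>x\<leftarrow>take j xs. f x)"
    using assms by (subst sum_list_distinct_conv_sum_set) auto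
  also have "\<dots> = (\<Sum>i<j. f (xs ! i))"
    using assms by (simp add: sum_list_sum_nth atLeast0LessThan)
  finally show ?thesis by simp
qed

text \<open>Listing \<open>J\<close> in increasing or decreasing order turns sums from the left or
  from the right into initial segments of a sequence, so one argument with an abstract order serves
  both. The reversed form controls the walk as seen from its end point.\<close>

lemma ballot_bound_ordered:
  fixes c B D :: real
  assumes c: "c > 0" and B: "B \<ge> 0" and D: "D \<ge> 0"
  shows "\<exists>K>0. \<forall>(M::'a measure) X v J b \<delta>. prob_space M \<longrightarrow>
    prob_space.indep_vars M (\<lambda>_. borel) X J \<longrightarrow> finite (J :: nat set) \<longrightarrow>
    (\<forall>i\<in>J. \<forall>\<omega>\<in>space M. \<bar>X i \<omega> :: real\<bar> \<le> B) \<longrightarrow>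
    (\<forall>i\<in>J. 0 \<le> v i) \<longrightarrow>
    (\<forall>\<theta>\<in>{0..1}. \<forall>i\<in>J. exp (c * \<theta>\<^sup>2 * v i) \<le> prob_space.expectation M (\<lambda>\<omega>. exp (\<theta> * X i \<omega>))) \<longrightarrow>
    b \<ge> 1 \<longrightarrow> \<delta> \<ge> 0 \<longrightarrow> \<delta> * sqrt (1 + (\<Sum>i\<in>J. v i)) \<le> D \<longrightarrow>
    measure M {\<omega>\<in>space M. \<forall>t\<in>J. (\<Sum>p | p \<in> J \<and> p \<le> t. X p \<omega>) \<le> b + \<delta> * (\<Sum>p | p \<in> J \<and> p \<le> t. v p) + 8 * (1 + (\<Sum>p | p \<in> J \<and> p \<le> t. v p)) powr (1/8)}
      \<le> K * b / sqrt (1 + (\<Sum>i\<in>J. v i)) \<and>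
    measure M {\<omega>\<in>space M. \<forall>t\<in>J. (\<Sum>p | p \<in> J \<and> t \<le> p. X p \<omega>) \<le> b + \<delta> * (\<Sum>p | p \<in> J \<and> t \<le> p. v p) + 8 * (1 + (\<Sum>p | p \<in> J \<and> t \<le> p. v p)) powr (1/8)}
      \<le> K * b / sqrt (1 + (\<Sum>i\<in>J. v i))"
proof -
  obtain K where K: "K > 0" and Kb: "\<forall>(M::'a measure) X v N b \<delta>. prob_space M \<longrightarrow>
    prob_space.indep_vars M (\<lambda>_. borel) X {..<N::nat} \<longrightarrow>
    (\<forall>i<N. \<forall>\<omega>\<in>space M. \<bar>X i \<omega> :: real\<bar> \<le> B) \<longrightarrow>
    (\<forall>i<N. 0 \<le> v i) \<longrightarrow>
    (\<forall>\<theta>\<in>{0..1}. \<forall>i<N. exp (c * \<theta>\<^sup>2 * v i) \<le> prob_space.expectation M (\<lambda>\<omega>. exp (\<theta> * X i \<omega>))) \<longrightarrow>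
    b \<ge> 1 \<longrightarrow> \<delta> \<ge> 0 \<longrightarrow> \<delta> * sqrt (1 + (\<Sum>i<N. v i)) \<le> D \<longrightarrow>
    measure M {\<omega>\<in>space M. \<forall>j\<le>N. (\<Sum>i<j. X i \<omega>) \<le> b + \<delta> * (\<Sum>i<j. v i) + 8 * (1 + (\<Sum>i<j. v i)) powr (1/8)}
      \<le> K * b / sqrt (1 + (\<Sum>i<N. v i))"
    using ballot_bound[OF c B D, where 'a='a] by (elim exE conjE) (rule that)
  show ?thesis
  proof (intro exI[of _ K] conjI K allI impI)
    fix M :: "'a measure" and X :: "nat \<Rightarrow> 'a \<Rightarrow> real" and v :: "nat \<Rightarrow> real" and J :: "nat set" and b \<delta> :: real
    assume "prob_space M"
    then interpret prob_space M .
    assume ind: "indep_vars (\<lambda>_. borel) X J" and J: "finite J" and bdd: "\<forall>i\<in>J. \<forall>\<omega>\<in>space M. \<bar>X i \<omega>\<bar> \<le> B"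
      and v: "\<forall>i\<in>J. 0 \<le> v i"
      and mgf: "\<forall>\<theta>\<in>{0..1}. \<forall>i\<in>J. exp (c * \<theta>\<^sup>2 * v i) \<le> expectation (\<lambda>\<omega>. exp (\<theta> * X i \<omega>))"
      and b: "b \<ge> 1" and d: "\<delta> \<ge> 0" and dD: "\<delta> * sqrt (1 + (\<Sum>i\<in>J. v i)) \<le> D"
    have mX: "i \<in> J \<Longrightarrow> X i \<in> borel_measurable M" for i using ind by (auto simp: indep_vars_def)
    define bar where "bar V = b + \<delta> * V + 8 * (1 + V) powr (1/8)" for V
    have gen: "prob {\<omega>\<in>space M. \<forall>t\<in>J. (\<Sum>p | p \<in> J \<and> (p = t \<or> R p t). X p \<omega>) \<le> bar (\<Sum>p | p \<in> J \<and> (p = t \<or> R p t). v p)}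
      \<le> K * b / sqrt (1 + (\<Sum>i\<in>J. v i))"
      if xs: "sorted_wrt R xs" "distinct xs" "set xs = J" and R: "\<And>x y. R x y \<Longrightarrow> \<not> R y x" for R :: "nat \<Rightarrow> nat \<Rightarrow> bool" and xs
    proof -
      let ?N = "length xs"
      have memJ: "xs ! i \<in> J" if "i < ?N" for i using that xs(3) nth_mem by blast
      have sJ: "(\<Sum>i<?N. f (xs ! i)) = sum f J" for f :: "nat \<Rightarrow> real" using sum_nth_take[OF xs(2), of ?N f] xs(3) by simp
      have tk: "(\<Sum>i<j. f (xs ! i)) = (\<Sum>p | p \<in> J \<and> (p = xs ! (j-1) \<or> R p (xs ! (j-1))). f p)" if "0 < j" "j \<le> ?N" for f :: "nat \<Rightarrow> real" and j
      proof -
        have "set (take j xs) = {p \<in> J. p = xs ! (j - 1) \<or> R p (xs ! (j - 1))}"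
          using set_take_sorted_wrt[OF xs(1) R that] xs(3) by simp
        thus ?thesis using sum_nth_take[OF xs(2) that(2), of f] by simp
      qed
      have "prob {\<omega>\<in>space M. \<forall>t\<in>J. (\<Sum>p | p \<in> J \<and> (p = t \<or> R p t). X p \<omega>) \<le> bar (\<Sum>p | p \<in> J \<and> (p = t \<or> R p t). v p)}
        \<le> prob {\<omega>\<in>space M. \<forall>j\<le>?N. (\<Sum>i<j. X (xs ! i) \<omega>) \<le> bar (\<Sum>i<j. v (xs ! i))}"
      proof (rule finite_measure_mono)
        show "{\<omega>\<in>space M. \<forall>t\<in>J. (\<Sum>p | p \<in> J \<and> (p = t \<or> R p t). X p \<omega>) \<le> bar (\<Sum>p | p \<in> J \<and> (p = t \<or> R p t). v p)}
          \<subseteq> {\<omega>\<in>space M. \<forall>j\<le>?N. (\<Sum>i<j. X (xs ! i) \<omega>) \<le> bar (\<Sum>i<j. v (xs ! i))}"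
        proof safe
          fix \<omega> j assume w: "\<omega> \<in> space M" and j: "j \<le> ?N"
            and h: "\<forall>t\<in>J. (\<Sum>p | p \<in> J \<and> (p = t \<or> R p t). X p \<omega>) \<le> bar (\<Sum>p | p \<in> J \<and> (p = t \<or> R p t). v p)"
          show "(\<Sum>i<j. X (xs ! i) \<omega>) \<le> bar (\<Sum>i<j. v (xs ! i))"
          proof (cases "j = 0")
            case True thus ?thesis using b by (simp add: bar_def)
          next
            case False
            thus ?thesis using h[rule_format, OF memJ[of "j - 1"]] j tk[of j "\<lambda>p. X p \<omega>"] tk[of j v] by simp
          qed
        qed
        have "{\<omega>\<in>space M. \<forall>j\<le>?N. (\<Sum>i<j. X (xs ! i) \<omega>) \<le> bar (\<Sum>i<j. v (xs ! i))} = space M \<inter> (\<Inter>j\<in>{..?N}. {\<omega>\<in>space M. (\<Sum>i<j. X (xs ! i) \<omega>) \<le> bar (\<Sum>i<j. v (xs ! i))})" by auto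
        moreover have "{\<omega>\<in>space M. (\<Sum>i<j. X (xs ! i) \<omega>) \<le> bar (\<Sum>i<j. v (xs ! i))} \<in> sets M" if "j \<in> {..?N}" for j
        proof -
          have "(\<lambda>\<omega>. \<Sum>i<j. X (xs ! i) \<omega>) \<in> borel_measurable M" using that memJ by (intro borel_measurable_sum mX) auto
          thus ?thesis by measurable
        qed
        ultimately show "{\<omega>\<in>space M. \<forall>j\<le>?N. (\<Sum>i<j. X (xs ! i) \<omega>) \<le> bar (\<Sum>i<j. v (xs ! i))} \<in> sets M"
          by (auto intro!: sets.Int sets.finite_INT)
      qed
      also have "\<dots> \<le> K * b / sqrt (1 + (\<Sum>i<?N. v (xs ! i)))"
        unfolding bar_def
        by (rule Kb[THEN spec, THEN spec, THEN spec, THEN spec, THEN spec, THEN spec,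
             THEN mp, THEN mp, THEN mp, THEN mp, THEN mp, THEN mp, THEN mp, THEN mp])
           (use indep_vars_nth[OF ind xs(2)] xs(3) bdd v mgf b d dD memJ sJ prob_space_axioms in auto)
      finally show ?thesis by (simp add: sJ)
    qed
    let ?xs = "sorted_list_of_set J"
    have s1: "sorted_wrt (<) ?xs" "distinct ?xs" "set ?xs = J" using J by auto
    have s2: "sorted_wrt (\<lambda>x y. y < x) (rev ?xs)" "distinct (rev ?xs)" "set (rev ?xs) = J"
      using J by (auto simp: sorted_wrt_rev)
    have e1: "(p = t \<or> p < t) = (p \<le> t)" "(p = t \<or> t < p) = (t \<le> p)" for p t :: nat by auto
    show "prob {\<omega>\<in>space M. \<forall>t\<in>J. (\<Sum>p | p \<in> J \<and> p \<le> t. X p \<omega>) \<le> b + \<delta> * (\<Sum>p | p \<in> J \<and> p \<le> t. v p) + 8 * (1 + (\<Sum>p | p \<in> J \<and> p \<le> t. v p)) powr (1/8)}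
      \<le> K * b / sqrt (1 + (\<Sum>i\<in>J. v i))"
      using gen[OF s1] by (simp add: e1 bar_def)
    show "prob {\<omega>\<in>space M. \<forall>t\<in>J. (\<Sum>p | p \<in> J \<and> t \<le> p. X p \<omega>) \<le> b + \<delta> * (\<Sum>p | p \<in> J \<and> t \<le> p. v p) + 8 * (1 + (\<Sum>p | p \<in> J \<and> t \<le> p. v p)) powr (1/8)}
      \<le> K * b / sqrt (1 + (\<Sum>i\<in>J. v i))"
      using gen[OF s2] by (simp add: e1 bar_def)
  qed
qed

section \<open>Scales of primes and their reciprocal sums\<close>

definition primes_upto :: "nat \<Rightarrow> nat set" where
  "primes_upto q = {p. prime p \<and> p \<le> q}"

definition recip_sum :: "nat \<Rightarrow> real" where
  "recip_sum q = (\<Sum>p\<in>primes_upto q. 1 / real p)"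

text \<open>Block \<open>k\<close> consists of the primes between \<open>scale_end (k - 1)\<close> and \<open>scale_end k\<close>, on which
  \<open>p powr (-s)\<close> varies on the scale \<open>exp (- k)\<close>; the factor \<open>1/8\<close> makes block \<open>0\<close> empty.\<close>

definition scale_end :: "nat \<Rightarrow> nat" where
  "scale_end k = nat \<lfloor>exp (exp (real k) / 8)\<rfloor>"

definition scale_of :: "nat \<Rightarrow> nat" where
  "scale_of t = (LEAST k. t \<le> scale_end k)"

lemma finite_primes_upto [simp]: "finite (primes_upto q)"
  unfolding primes_upto_def by (rule finite_subset[of _ "{..q}"]) auto

lemma primes_upto_mono: "q \<le> q' \<Longrightarrow> primes_upto q \<subseteq> primes_upto q'"
  by (auto simp: primes_upto_def)

lemma primes_upto_ge_2: "p \<in> primes_upto q \<Longrightarrow> p \<ge> 2"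
  by (auto simp: primes_upto_def prime_ge_2_nat)

lemma recip_sum_mono: "q \<le> q' \<Longrightarrow> recip_sum q \<le> recip_sum q'"
  unfolding recip_sum_def by (intro sum_mono2 primes_upto_mono) auto

lemma recip_sum_nonneg: "recip_sum q \<ge> 0"
  unfolding recip_sum_def by (intro sum_nonneg) auto

lemma scale_end_mono: "j \<le> k \<Longrightarrow> scale_end j \<le> scale_end k"
  unfolding scale_end_def by (intro nat_mono floor_mono) auto

lemma exp_1_less_4: "exp (1::real) < 4"
  using exp_le by linarith

lemma scale_end_0: "scale_end 0 = 1"
proof -
  have "exp (1/8::real) < 2"
  proof -
    have "exp (1/8::real) ^ 8 = exp 1" by (simp flip: exp_of_nat_mult)
    also have "\<dots> < 2 ^ 8" using exp_1_less_4 by simp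
    finally show ?thesis by (rule power_less_imp_less_base) simp
  qed
  hence "\<lfloor>exp (1/8::real)\<rfloor> = 1" by (intro floor_unique) auto
  thus ?thesis by (simp add: scale_end_def)
qed

lemma scale_end_le: "real (scale_end k) \<le> exp (exp (real k) / 8)"
  unfolding scale_end_def by (simp add: of_nat_nat)

lemma scale_end_gt: "exp (exp (real k) / 8) < real (scale_end k) + 1"
proof -
  have "real (nat \<lfloor>exp (exp (real k) / 8)\<rfloor>) = real_of_int \<lfloor>exp (exp (real k) / 8)\<rfloor>"
    by (intro of_nat_nat) (simp add: le_floor_iff)
  thus ?thesis unfolding scale_end_def by linarith
qed

lemma le_scale_end_iff: "t \<le> scale_end k \<longleftrightarrow> real t \<le> exp (exp (real k) / 8)"
  unfolding scale_end_def by (simp add: le_nat_iff le_floor_iff)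

lemma exists_scale: "\<exists>k. t \<le> scale_end k"
proof -
  have "real t \<le> exp (exp (real k) / 8)" if "real k \<ge> 8 * real t" for k
  proof -
    have "real t \<le> real k / 8" using that by simp
    also have "\<dots> \<le> exp (real k) / 8" using exp_ge_add_one_self[of "real k"] by linarith
    also have "\<dots> \<le> exp (exp (real k) / 8)" using exp_ge_add_one_self[of "exp (real k) / 8"] by linarith
    finally show ?thesis .
  qed
  thus ?thesis unfolding le_scale_end_iff using real_arch_simple by blast
qed

lemma scale_of_le: "t \<le> scale_end (scale_of t)"
  unfolding scale_of_def using exists_scale by (rule LeastI_ex)

lemma scale_of_least: "t \<le> scale_end k \<Longrightarrow> scale_of t \<le> k"
  unfolding scale_of_def by (rule Least_le)

lemma scale_of_gt: "k < scale_of t \<Longrightarrow> scale_end k < t"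
  unfolding scale_of_def by (meson not_less_Least not_le)

lemma scale_of_mono: "s \<le> t \<Longrightarrow> scale_of s \<le> scale_of t"
  by (rule scale_of_least) (use scale_of_le[of t] in linarith)

lemma recip_sum_scale_end: "\<exists>C\<ge>0. \<forall>k. \<bar>recip_sum (scale_end k) - real k\<bar> \<le> C"
proof -
  obtain C where C: "\<And>N. N \<ge> 2 \<Longrightarrow> \<bar>recip_sum N - ln (ln (real N))\<bar> \<le> C"
    using mertens_second unfolding recip_sum_def primes_upto_def by blast
  \<comment> \<open>The indices 0 to 3 are handled by monotonicity; from 4 on the floor in
    \<open>scale_end\<close> costs at most a factor 2, which the iterated logarithm turns into a
    bounded error.\<close>
  have "\<bar>recip_sum (scale_end k) - real k\<bar> \<le> \<bar>C\<bar> + 4 + recip_sum (scale_end 4)" for k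
  proof (cases "k \<le> 3")
    case True
    hence "recip_sum (scale_end k) \<le> recip_sum (scale_end 4)" by (intro recip_sum_mono scale_end_mono) auto
    thus ?thesis using recip_sum_nonneg[of "scale_end k"] True by simp
  next
    case False
    define x where "x = exp (real k) / 8"
    have "(2::real) ^ 4 \<le> exp 1 ^ 4" using exp_ge_add_one_self[of "1::real"] by (intro power_mono) auto
    also have "\<dots> = exp (of_nat 4 * 1)" by (rule exp_of_nat_mult[symmetric])
    also have "\<dots> \<le> exp (real k)" using False by simp
    finally have x: "x \<ge> 2" by (simp add: x_def)
    have "exp x \<ge> 3" using exp_ge_add_one_self[of x] x by linarith
    hence s: "real (scale_end k) \<ge> exp x / 2" "real (scale_end k) \<le> exp x" "scale_end k \<ge> 2"
      using scale_end_gt[of k] scale_end_le[of k] by (auto simp: x_def[symmetric])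
    have "ln (exp x / 2) \<le> ln (real (scale_end k))" using s by (subst ln_le_cancel_iff) auto
    hence l1: "x - ln 2 \<le> ln (real (scale_end k))" by (simp add: ln_div)
    have l2: "ln (real (scale_end k)) \<le> x" using s by (metis ln_exp ln_le_cancel_iff exp_gt_zero less_le_trans of_nat_0_less_iff zero_less_numeral)
    have l3: "x / 2 \<le> ln (real (scale_end k))" using l1 x ln_2_less_1 by linarith
    have "ln (x / 2) \<le> ln (ln (real (scale_end k)))" using l3 x by (subst ln_le_cancel_iff) auto
    moreover have "ln (ln (real (scale_end k))) \<le> ln x" using l2 l3 x by (subst ln_le_cancel_iff) auto
    moreover have "ln (x / 2) = real k - ln 16" "ln x = real k - ln 8" by (simp_all add: x_def ln_div)
    moreover have "ln (16::real) \<le> 4" "ln (8::real) \<ge> 0"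
    proof -
      have "ln (16::real) = 4 * ln 2" using ln_realpow[of 2 4] by simp
      thus "ln (16::real) \<le> 4" using ln_2_less_1 by simp
    qed simp
    ultimately show ?thesis using C[OF s(3)] recip_sum_nonneg[of "scale_end 4"] by linarith
  qed
  moreover have "\<bar>C\<bar> + 4 + recip_sum (scale_end 4) \<ge> 0" using recip_sum_nonneg[of "scale_end 4"] by linarith
  ultimately show ?thesis by blast
qed

lemma recip_sum_scale_of: "\<exists>C\<ge>0. (\<forall>k. \<bar>recip_sum (scale_end k) - real k\<bar> \<le> C) \<and> (\<forall>t. \<bar>recip_sum t - real (scale_of t)\<bar> \<le> C)"
proof -
  obtain C where C: "C \<ge> 0" "\<And>k. \<bar>recip_sum (scale_end k) - real k\<bar> \<le> C" using recip_sum_scale_end by blast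
  have "\<bar>recip_sum t - real (scale_of t)\<bar> \<le> C + 1" for t
  proof -
    have "recip_sum t \<le> recip_sum (scale_end (scale_of t))" by (intro recip_sum_mono scale_of_le)
    hence u: "recip_sum t \<le> real (scale_of t) + C" using C(2)[of "scale_of t"] by linarith
    show ?thesis
    proof (cases "scale_of t = 0")
      case True thus ?thesis using u recip_sum_nonneg[of t] C(1) by simp
    next
      case False
      hence "scale_end (scale_of t - 1) < t" by (intro scale_of_gt) auto
      hence "recip_sum (scale_end (scale_of t - 1)) \<le> recip_sum t" by (intro recip_sum_mono) auto
      thus ?thesis using u C(2)[of "scale_of t - 1"] False by (simp add: of_nat_diff Suc_le_eq)
    qed
  qed
  moreover have "\<bar>recip_sum (scale_end k) - real k\<bar> \<le> C + 1" for k using C(2)[of k] by linarith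
  ultimately show ?thesis using C(1) by (intro exI[of _ "C + 1"]) auto
qed

text \<open>Third-order errors at the prime \<open>p\<close> have size \<open>p powr (-3/2)\<close>;
  their total over all primes is finite, so the Taylor expansions cost only constant
  factors.\<close>

lemma sum_recip_cube_sqrt: "\<exists>C\<ge>0. \<forall>L. finite L \<longrightarrow> (\<Sum>p\<in>L. (1 / sqrt (real p)) ^ 3) \<le> C"
proof (intro exI[of _ "\<Sum>n. real n powr (-3/2)"] conjI allI impI)
  show "(\<Sum>n. real n powr (-3/2)) \<ge> 0" by (intro suminf_nonneg summable_inverse_three_halves) auto
  fix L :: "nat set" assume L: "finite L"
  have "(1 / sqrt (real p)) ^ 3 = real p powr (-3/2)" for p
  proof (cases "p = 0")
    case False
    hence "sqrt (real p) ^ 3 = real p powr (3/2)" by (simp add: powr_half_sqrt[symmetric] powr_power)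
    thus ?thesis by (simp add: power_divide powr_minus_divide)
  qed auto
  thus "(\<Sum>p\<in>L. (1 / sqrt (real p)) ^ 3) \<le> (\<Sum>n. real n powr (-3/2))"
    using L by (simp only:) (intro sum_le_suminf summable_inverse_three_halves, auto)
qed

subsection \<open>The one-point estimate\<close>

lemma inverse_sqrt_le:
  assumes "real k + 1 \<le> A * (1 + V)" "0 \<le> V" "0 < A"
  shows "1 / sqrt (1 + V) \<le> sqrt A / sqrt (real k + 1)"
proof -
  have "sqrt (real k + 1) \<le> sqrt A * sqrt (1 + V)"
    using assms(1) by (simp flip: real_sqrt_mult)
  moreover have "sqrt (real k + 1) > 0" "sqrt (1 + V) > 0" using assms by auto
  ultimately show ?thesis by (simp add: field_simps)
qed

text \<open>The small primes, for which the tilted variance bound is not available, get clock speed \<open>0\<close>.\<close>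

definition clock :: "nat \<Rightarrow> real" where
  "clock p = (if 256 * tilt_const \<le> sqrt (real p) then 1 / real p else 0)"

lemma clock_nonneg: "clock p \<ge> 0" and clock_le: "clock p \<le> 1 / real p"
  by (auto simp: clock_def)

text \<open>Only the primes up to a fixed bound have their clock stopped, so the loss is at most
  their reciprocal sum.\<close>

lemma clock_sum: "\<exists>C\<ge>0. \<forall>L. finite L \<longrightarrow> (\<forall>p\<in>L. prime p) \<longrightarrow> (\<Sum>p\<in>L. 1 / real p) \<le> (\<Sum>p\<in>L. clock p) + C"
proof -
  define q where "q = nat \<lceil>(256 * tilt_const)\<^sup>2\<rceil>"
  have "(\<Sum>p\<in>L. 1 / real p) \<le> (\<Sum>p\<in>L. clock p) + recip_sum q" if L: "finite L" "\<forall>p\<in>L. prime p" for L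
  proof -
    have "1 / real p \<le> clock p + (if p \<le> q then 1 / real p else 0)" for p
    proof (cases "p \<le> q")
      case True thus ?thesis using clock_nonneg[of p] by simp
    next
      case False
      hence "(256 * tilt_const)\<^sup>2 \<le> real p" unfolding q_def by linarith
      hence "256 * tilt_const \<le> sqrt (real p)" by (rule real_le_rsqrt)
      thus ?thesis by (simp add: clock_def)
    qed
    hence "(\<Sum>p\<in>L. 1 / real p) \<le> (\<Sum>p\<in>L. clock p + (if p \<le> q then 1 / real p else 0))" by (intro sum_mono)
    also have "\<dots> = (\<Sum>p\<in>L. clock p) + (\<Sum>p\<in>{p\<in>L. p \<le> q}. 1 / real p)"
      using L by (simp add: sum.distrib sum.inter_filter)
    also have "(\<Sum>p\<in>{p\<in>L. p \<le> q}. 1 / real p) \<le> recip_sum q"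
      unfolding recip_sum_def using L by (intro sum_mono2) (auto simp: primes_upto_def)
    finally show ?thesis by simp
  qed
  thus ?thesis using recip_sum_nonneg by blast
qed

text \<open>The ballot theorem in three pieces: stay below the barrier on the first third of the scales,
  stay above the reversed barrier on the last scales, and hit the right unit interval in between.
  The last piece is shortened to \<open>1 / \<delta>\<^sup>2\<close> scales, on which a barrier of slope \<open>\<delta>\<close> is harmless.\<close>

lemma tilted_walk_bound:
  "\<exists>C>0. \<forall>(T::'a measure) Y k b b' y' w0 \<delta>. prob_space T \<longrightarrow>
     prob_space.indep_vars T (\<lambda>_. borel) Y (primes_upto (scale_end k)) \<longrightarrow>
     (\<forall>p\<in>primes_upto (scale_end k). \<forall>\<omega>\<in>space T. \<bar>Y p \<omega> :: real\<bar> \<le> 20) \<longrightarrow>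
     (\<forall>p\<in>primes_upto (scale_end k). \<forall>\<theta>. \<bar>\<theta>\<bar> \<le> 1 \<longrightarrow>
        exp (exp (-18) / 16 * \<theta>\<^sup>2 * clock p) \<le> prob_space.expectation T (\<lambda>\<omega>. exp (\<theta> * Y p \<omega>))) \<longrightarrow>
     (\<forall>p\<in>primes_upto (scale_end k). \<forall>t\<in>{0..1}.
        norm (prob_space.expectation T (\<lambda>\<omega>. iexp (t * Y p \<omega>))) \<le> exp (- (clock p / 16 * t\<^sup>2))) \<longrightarrow>
     1 \<le> y' \<longrightarrow> 1 \<le> b' \<longrightarrow> 1 \<le> b \<longrightarrow> 0 < \<delta> \<longrightarrow> \<delta> \<le> 1 \<longrightarrow>
     measure T {\<omega>\<in>space T. (\<forall>t\<le>scale_end k. (\<Sum>p\<in>primes_upto t. Y p \<omega>) \<le> y') \<and>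
         (\<forall>t\<le>scale_end k. - (\<Sum>p\<in>primes_upto (scale_end k) - primes_upto t. Y p \<omega>)
            \<le> b' + \<delta> * (\<Sum>p\<in>primes_upto (scale_end k) - primes_upto t. clock p)
                + 8 * (1 + (\<Sum>p\<in>primes_upto (scale_end k) - primes_upto t. clock p)) powr (1/8)) \<and>
         w0 - b \<le> (\<Sum>p\<in>primes_upto (scale_end k). Y p \<omega>) \<and> (\<Sum>p\<in>primes_upto (scale_end k). Y p \<omega>) \<le> w0}
     \<le> C * (1 + b) * b' * (min 1 (y' / sqrt (real k + 1)) * (1 / sqrt (real k + 1) + \<delta>) / sqrt (real k + 1))"
proof -
  obtain CT where CT: "CT \<ge> 0" "\<And>k. \<bar>recip_sum (scale_end k) - real k\<bar> \<le> CT"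
    using recip_sum_scale_end by blast
  obtain CV where CV: "CV \<ge> 0" "\<And>L. finite L \<Longrightarrow> (\<forall>p\<in>L. prime p) \<Longrightarrow> (\<Sum>p\<in>L. 1 / real p) \<le> (\<Sum>p\<in>L. clock p) + CV"
    using clock_sum by blast
  define c where "c = exp (-18) / (16::real)"
  \<comment> \<open>The last block has at most \<open>1 / \<delta>^2\<close> scales, so this
    constant bounds \<open>\<delta> * sqrt (1 + VR)\<close> for every
    \<open>\<delta> \<le> 1\<close>.\<close>
  define D where "D = sqrt (2 + 2 * CT)"
  have c: "c > 0" and D: "D \<ge> 0" and B20: "(20::real) \<ge> 0" using CT by (auto simp: c_def D_def)
  obtain K where K: "K > 0" and Kb: "\<forall>(M::'a measure) X v J b \<delta>. prob_space M \<longrightarrow>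
    prob_space.indep_vars M (\<lambda>_. borel) X J \<longrightarrow> finite (J :: nat set) \<longrightarrow>
    (\<forall>i\<in>J. \<forall>\<omega>\<in>space M. \<bar>X i \<omega> :: real\<bar> \<le> 20) \<longrightarrow>
    (\<forall>i\<in>J. 0 \<le> v i) \<longrightarrow>
    (\<forall>\<theta>\<in>{0..1}. \<forall>i\<in>J. exp (c * \<theta>\<^sup>2 * v i) \<le> prob_space.expectation M (\<lambda>\<omega>. exp (\<theta> * X i \<omega>))) \<longrightarrow>
    b \<ge> 1 \<longrightarrow> \<delta> \<ge> 0 \<longrightarrow> \<delta> * sqrt (1 + (\<Sum>i\<in>J. v i)) \<le> D \<longrightarrow>
    measure M {\<omega>\<in>space M. \<forall>t\<in>J. (\<Sum>p | p \<in> J \<and> p \<le> t. X p \<omega>) \<le> b + \<delta> * (\<Sum>p | p \<in> J \<and> p \<le> t. v p) + 8 * (1 + (\<Sum>p | p \<in> J \<and> p \<le> t. v p)) powr (1/8)}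
      \<le> K * b / sqrt (1 + (\<Sum>i\<in>J. v i)) \<and>
    measure M {\<omega>\<in>space M. \<forall>t\<in>J. (\<Sum>p | p \<in> J \<and> t \<le> p. X p \<omega>) \<le> b + \<delta> * (\<Sum>p | p \<in> J \<and> t \<le> p. v p) + 8 * (1 + (\<Sum>p | p \<in> J \<and> t \<le> p. v p)) powr (1/8)}
      \<le> K * b / sqrt (1 + (\<Sum>i\<in>J. v i))"
    using ballot_bound_ordered[OF c B20 D, where 'a='a] by (elim exE conjE) (rule that)
  define AF where "AF = 3 + 3 * CT + 3 * CV"
  define AR where "AR = 1 + 2 * CT + CV"
  \<comment> \<open>The leading 49 contains \<open>48 = 3 * 16\<close>: the middle block has at
    least a third of the scales, and its clock enters divided by 16.\<close>
  define AM where "AM = 49 + 6 * CT + 3 * CV"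
  define CF where "CF = max 1 (K * sqrt AF)"
  define CR where "CR = K * (sqrt AR * sqrt 3)"
  define C where "C = 8 * CF * CR * sqrt AM"
  have pos: "AF > 0" "AR > 0" "AM > 0" using CT CV by (auto simp: AF_def AR_def AM_def)
  have cpos: "CF \<ge> 1" "CR > 0" using K pos by (auto simp: CF_def CR_def)
  have Cpos: "C > 0" using cpos pos by (auto simp: C_def)
  show ?thesis
  proof (intro exI[of _ C] conjI Cpos allI impI)
    fix T :: "'a measure" and Y :: "nat \<Rightarrow> 'a \<Rightarrow> real" and k :: nat and b b' y' w0 \<delta> :: real
    assume "prob_space T"
    then interpret prob_space T .
    define P where "P = primes_upto (scale_end k)"
    assume "indep_vars (\<lambda>_. borel) Y (primes_upto (scale_end k))"
      and "\<forall>p\<in>primes_upto (scale_end k). \<forall>\<omega>\<in>space T. \<bar>Y p \<omega>\<bar> \<le> 20"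
      and "\<forall>p\<in>primes_upto (scale_end k). \<forall>\<theta>. \<bar>\<theta>\<bar> \<le> 1 \<longrightarrow> exp (exp (-18) / 16 * \<theta>\<^sup>2 * clock p) \<le> expectation (\<lambda>\<omega>. exp (\<theta> * Y p \<omega>))"
      and "\<forall>p\<in>primes_upto (scale_end k). \<forall>t\<in>{0..1}. norm (expectation (\<lambda>\<omega>. iexp (t * Y p \<omega>))) \<le> exp (- (clock p / 16 * t\<^sup>2))"
    hence ind: "indep_vars (\<lambda>_. borel) Y P"
      and bdd: "\<And>p \<omega>. p \<in> P \<Longrightarrow> \<omega> \<in> space T \<Longrightarrow> \<bar>Y p \<omega>\<bar> \<le> 20"
      and mgf: "\<And>p \<theta>. p \<in> P \<Longrightarrow> \<bar>\<theta>\<bar> \<le> 1 \<Longrightarrow> exp (c * \<theta>\<^sup>2 * clock p) \<le> expectation (\<lambda>\<omega>. exp (\<theta> * Y p \<omega>))"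
      and chf: "\<And>p t. p \<in> P \<Longrightarrow> t \<in> {0..1} \<Longrightarrow> norm (expectation (\<lambda>\<omega>. iexp (t * Y p \<omega>))) \<le> exp (- (clock p / 16 * t\<^sup>2))"
      by (auto simp: P_def c_def)
    assume y': "1 \<le> y'" and b': "1 \<le> b'" and b: "1 \<le> b" and d: "0 < \<delta>" "\<delta> \<le> 1"
    have mY: "p \<in> P \<Longrightarrow> Y p \<in> borel_measurable T" for p using ind by (auto simp: indep_vars_def)
    define k1 where "k1 = k div 3"
    define R where "R = min k1 (nat \<lfloor>1 / \<delta>\<^sup>2\<rfloor>)"
    have kk: "k1 \<le> k - R" "R \<le> k" "k \<le> 3 * k1 + 2" "k \<le> 3 * (k - R - k1)" by (auto simp: R_def k1_def)
    have sc: "scale_end k1 \<le> scale_end (k - R)" "scale_end (k - R) \<le> scale_end k" "scale_end k1 \<le> scale_end k"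
      using kk by (auto intro!: scale_end_mono)
    define JF where "JF = primes_upto (scale_end k1)"
    define JR where "JR = P - primes_upto (scale_end (k - R))"
    define JM where "JM = primes_upto (scale_end (k - R)) - JF"
    have sub: "JF \<subseteq> P" "primes_upto (scale_end (k - R)) \<subseteq> P" "JF \<subseteq> primes_upto (scale_end (k - R))"
      unfolding JF_def P_def using sc by (auto intro!: primes_upto_mono)
    have J: "JF \<subseteq> P" "JR \<subseteq> P" "JM \<subseteq> P" "JF \<inter> JR = {}" "JF \<inter> JM = {}" "JR \<inter> JM = {}" "JF \<union> JR \<union> JM = P"
      using sub by (auto simp: JR_def JM_def)
    have fin: "finite P" "finite JF" "finite JR" "finite JM" by (auto simp: P_def JF_def JR_def JM_def)
    have pr: "\<forall>p\<in>P. prime p" by (auto simp: P_def primes_upto_def)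
    have sumR: "(\<Sum>p\<in>JR. 1 / real p) = recip_sum (scale_end k) - recip_sum (scale_end (k - R))"
      unfolding JR_def recip_sum_def P_def[symmetric] by (rule sum_diff[OF fin(1) sub(2)])
    have sumM: "(\<Sum>p\<in>JM. 1 / real p) = recip_sum (scale_end (k - R)) - recip_sum (scale_end k1)"
      unfolding JM_def recip_sum_def JF_def[symmetric] by (rule sum_diff[OF _ sub(3)]) simp
    define VF where "VF = (\<Sum>p\<in>JF. clock p)"
    define VR where "VR = (\<Sum>p\<in>JR. clock p)"
    define VM where "VM = (\<Sum>p\<in>JM. clock p / 16)"
    have V0: "VF \<ge> 0" "VR \<ge> 0" "VM \<ge> 0" by (auto simp: VF_def VR_def VM_def clock_nonneg intro!: sum_nonneg)
    have VFl: "real k1 \<le> VF + CT + CV"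
      using CV(2)[of JF] CT(2)[of k1] fin pr J(1) unfolding VF_def recip_sum_def JF_def[symmetric]
      by (smt (verit) subsetD abs_le_iff)
    have VRl: "real R \<le> VR + 2 * CT + CV"
      using CV(2)[of JR] CT(2)[of k] CT(2)[of "k - R"] fin pr J(2) kk sumR unfolding VR_def
      by (smt (verit) subsetD abs_le_iff of_nat_diff)
    have VRu: "VR \<le> real R + 2 * CT"
    proof -
      have "VR \<le> (\<Sum>p\<in>JR. 1 / real p)" unfolding VR_def by (intro sum_mono clock_le)
      thus ?thesis using CT(2)[of k] CT(2)[of "k - R"] kk sumR by (smt (verit) of_nat_diff)
    qed
    have VMl: "real (k - R - k1) \<le> 16 * VM + 2 * CT + CV"
    proof -
      have "16 * VM = (\<Sum>p\<in>JM. clock p)" by (simp add: VM_def sum_distrib_left)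
      moreover have "(\<Sum>p\<in>JM. 1 / real p) \<le> (\<Sum>p\<in>JM. clock p) + CV" using CV(2)[of JM] fin pr J(3) by blast
      moreover have "real (k - R - k1) = real (k - R) - real k1" using kk by (intro of_nat_diff)
      ultimately show ?thesis using CT(2)[of k1] CT(2)[of "k - R"] sumM by linarith
    qed
    let ?sk = "sqrt (real k + 1)"
    have F_le: "1 / sqrt (1 + VF) \<le> sqrt AF / ?sk"
    proof (rule inverse_sqrt_le)
      have "real k + 1 \<le> 3 * real k1 + 3" using kk by linarith
      also have "\<dots> \<le> 3 * (VF + CT + CV) + 3" using mult_left_mono[OF VFl, of 3] by simp
      also have "\<dots> \<le> AF * (1 + VF)" using V0 CT CV by (simp add: AF_def algebra_simps)
      finally show "real k + 1 \<le> AF * (1 + VF)" .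
    qed (use V0 pos in auto)
    have M_le: "1 / sqrt (1 + VM) \<le> sqrt AM / ?sk"
    proof (rule inverse_sqrt_le)
      have "real k \<le> 3 * real (k - R - k1)" using kk(4) by linarith
      also have "\<dots> \<le> 3 * (16 * VM + 2 * CT + CV)" using VMl by (rule mult_left_mono) simp
      finally have "real k + 1 \<le> 3 * (16 * VM + 2 * CT + CV) + 1" by simp
      also have "\<dots> \<le> AM * (1 + VM)" using V0 CT CV by (simp add: AM_def algebra_simps)
      finally show "real k + 1 \<le> AM * (1 + VM)" .
    qed (use V0 pos in auto)
    \<comment> \<open>The two summands correspond to the two arguments of the minimum in
      \<open>R\<close>: a third of all scales, or \<open>1 / \<delta>^2\<close> of them.\<close>
    have R_le: "1 / sqrt (1 + VR) \<le> sqrt AR * (sqrt 3 * (1 / ?sk + \<delta>))"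
    proof -
      have "1 / sqrt (1 + VR) \<le> sqrt AR / sqrt (real R + 1)"
      proof (rule inverse_sqrt_le)
        have "real R + 1 \<le> VR + 2 * CT + CV + 1" using VRl by linarith
        also have "\<dots> \<le> AR * (1 + VR)" using V0 CT CV by (simp add: AR_def algebra_simps)
        finally show "real R + 1 \<le> AR * (1 + VR)" .
      qed (use V0 pos in auto)
      also have "1 / sqrt (real R + 1) \<le> sqrt 3 * (1 / ?sk + \<delta>)"
      proof (cases "k1 \<le> nat \<lfloor>1 / \<delta>\<^sup>2\<rfloor>")
        case True
        have "1 / sqrt (1 + real k1) \<le> sqrt 3 / ?sk"
          by (rule inverse_sqrt_le) (use kk in auto)
        also have "\<dots> \<le> sqrt 3 * (1 / ?sk + \<delta>)" using d by (simp add: algebra_simps)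
        finally show ?thesis using True by (simp add: R_def add.commute)
      next
        case False
        hence "R = nat \<lfloor>1 / \<delta>\<^sup>2\<rfloor>" by (simp add: R_def)
        hence "1 / \<delta>\<^sup>2 \<le> real R + 1" by linarith
        hence "sqrt (1 / \<delta>\<^sup>2) \<le> sqrt (real R + 1)" by (rule real_sqrt_le_mono)
        hence "1 / \<delta> \<le> sqrt (real R + 1)" using d by (simp add: real_sqrt_divide)
        hence "1 / sqrt (real R + 1) \<le> \<delta>" using d by (simp add: field_simps)
        also have "\<dots> \<le> sqrt 3 * \<delta>" using d by simp
        also have "\<dots> \<le> sqrt 3 * (1 / ?sk + \<delta>)" by (intro mult_left_mono) auto
        finally show ?thesis .
      qed
      hence "sqrt AR / sqrt (real R + 1) \<le> sqrt AR * (sqrt 3 * (1 / ?sk + \<delta>))"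
        using mult_left_mono[of "1 / sqrt (real R + 1)" _ "sqrt AR"] pos by simp
      finally show ?thesis .
    qed
    have dR: "\<delta> * sqrt (1 + VR) \<le> D"
    proof -
      have "\<delta>\<^sup>2 * real R \<le> \<delta>\<^sup>2 * (1 / \<delta>\<^sup>2)"
      proof (intro mult_left_mono)
        have "real R \<le> real (nat \<lfloor>1 / \<delta>\<^sup>2\<rfloor>)" unfolding R_def by (rule of_nat_mono) simp
        also have "\<dots> \<le> 1 / \<delta>\<^sup>2" by simp
        finally show "real R \<le> 1 / \<delta>\<^sup>2" .
      qed auto
      hence 1: "\<delta>\<^sup>2 * real R \<le> 1" using d by simp
      have "\<delta>\<^sup>2 * (1 + 2 * CT) \<le> 1 * (1 + 2 * CT)" using d CT by (intro mult_right_mono) (auto simp: power_le_one)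
      hence "\<delta>\<^sup>2 * (1 + (real R + 2 * CT)) \<le> 2 + 2 * CT" using 1 by (simp add: algebra_simps)
      moreover have "\<delta>\<^sup>2 * (1 + VR) \<le> \<delta>\<^sup>2 * (1 + (real R + 2 * CT))" using VRu by (intro mult_left_mono) auto
      ultimately have "sqrt (\<delta>\<^sup>2 * (1 + VR)) \<le> D" unfolding D_def by (intro real_sqrt_le_mono) linarith
      thus ?thesis using d by (simp add: real_sqrt_mult)
    qed
    define PF where "PF x \<longleftrightarrow> (\<forall>t\<in>JF. (\<Sum>p | p \<in> JF \<and> p \<le> t. x p) \<le> y' + 0 * (\<Sum>p | p \<in> JF \<and> p \<le> t. clock p) + 8 * (1 + (\<Sum>p | p \<in> JF \<and> p \<le> t. clock p)) powr (1/8))" for x :: "nat \<Rightarrow> real"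
    define PR where "PR x \<longleftrightarrow> (\<forall>t\<in>JR. (\<Sum>p | p \<in> JR \<and> t \<le> p. - x p) \<le> b' + \<delta> * (\<Sum>p | p \<in> JR \<and> t \<le> p. clock p) + 8 * (1 + (\<Sum>p | p \<in> JR \<and> t \<le> p. clock p)) powr (1/8))" for x :: "nat \<Rightarrow> real"
    have mset: "{x \<in> space N. \<forall>t\<in>J. f t x \<le> (h t :: real)} \<in> sets N" if "finite J" "\<And>t. t \<in> J \<Longrightarrow> f t \<in> borel_measurable N" for N :: "'b measure" and J :: "nat set" and f h
      using that by (intro sets.sets_Collect_finite_All borel_measurable_le) auto
    have PFb: "prob {\<omega>\<in>space T. PF (\<lambda>p. Y p \<omega>)} \<le> K * y' / sqrt (1 + VF)"
      unfolding PF_def VF_def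
      apply (rule Kb[THEN spec, THEN spec, THEN spec, THEN spec, THEN spec, THEN spec,
             THEN mp, THEN mp, THEN mp, THEN mp, THEN mp, THEN mp, THEN mp, THEN mp, THEN mp, THEN conjunct1, of T Y JF clock y' 0])
      using indep_vars_subset[OF ind J(1)] fin bdd J(1) clock_nonneg mgf y' D prob_space_axioms by auto
    have PRb: "prob {\<omega>\<in>space T. PR (\<lambda>p. Y p \<omega>)} \<le> K * b' / sqrt (1 + VR)"
      unfolding PR_def VR_def
    proof (rule Kb[THEN spec, THEN spec, THEN spec, THEN spec, THEN spec, THEN spec,
             THEN mp, THEN mp, THEN mp, THEN mp, THEN mp, THEN mp, THEN mp, THEN mp, THEN mp, THEN conjunct2, of T "\<lambda>p \<omega>. - Y p \<omega>" JR clock b' \<delta>])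
      show "indep_vars (\<lambda>_. borel) (\<lambda>p \<omega>. - Y p \<omega>) JR"
        by (rule indep_vars_compose2[OF indep_vars_subset[OF ind J(2)], where Y="\<lambda>_ x. - x"]) auto
      show "\<forall>\<theta>\<in>{0..1}. \<forall>i\<in>JR. exp (c * \<theta>\<^sup>2 * clock i) \<le> expectation (\<lambda>\<omega>. exp (\<theta> * - Y i \<omega>))"
        using mgf[of _ "- _"] J(2) by auto
    qed (use fin bdd J(2) clock_nonneg b' d dR prob_space_axioms in \<open>auto simp: VR_def\<close>)
    have mPiF: "{x \<in> space (PiM JF (\<lambda>_. borel)). PF x} \<in> sets (PiM JF (\<lambda>_. borel))"
      unfolding PF_def using fin by (intro mset borel_measurable_sum measurable_component_singleton) auto
    have mPiR: "{x \<in> space (PiM JR (\<lambda>_. borel)). PR x} \<in> sets (PiM JR (\<lambda>_. borel))"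
      unfolding PR_def using fin by (intro mset borel_measurable_sum borel_measurable_uminus measurable_component_singleton) auto
    have rF: "PF (restrict x JF) = PF x" for x
    proof -
      have "(\<Sum>p | p \<in> JF \<and> p \<le> t. restrict x JF p) = (\<Sum>p | p \<in> JF \<and> p \<le> t. x p)" for t by (intro sum.cong) auto
      thus ?thesis unfolding PF_def by (simp only:)
    qed
    have rR: "PR (restrict x JR) = PR x" for x
    proof -
      have "(\<Sum>p | p \<in> JR \<and> t \<le> p. - restrict x JR p) = (\<Sum>p | p \<in> JR \<and> t \<le> p. - x p)" for t by (intro sum.cong) auto
      thus ?thesis unfolding PR_def by (simp only:)
    qed
    have three: "prob {\<omega>\<in>space T. PF (\<lambda>i. Y i \<omega>) \<and> PR (\<lambda>i. Y i \<omega>) \<and> \<bar>(\<Sum>i\<in>P. Y i \<omega>) - u\<bar> \<le> 1}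
      \<le> 8 * prob {\<omega>\<in>space T. PF (\<lambda>i. Y i \<omega>)} * prob {\<omega>\<in>space T. PR (\<lambda>i. Y i \<omega>)} / sqrt (1 + VM)" for u
      unfolding VM_def
      by (rule three_block_bound[OF fin(1) ind J(1-6) mPiF rF mPiR rR, unfolded J(7)])
         (use J(3) chf clock_nonneg in auto)
    define q where "q = min 1 (y' / ?sk) * (1 / ?sk + \<delta>) / ?sk"
    have three': "prob {\<omega>\<in>space T. PF (\<lambda>i. Y i \<omega>) \<and> PR (\<lambda>i. Y i \<omega>) \<and> \<bar>(\<Sum>i\<in>P. Y i \<omega>) - u\<bar> \<le> 1} \<le> C * b' * q" for u
    proof -
      \<comment> \<open>For \<open>y' > sqrt (k + 1)\<close> the trivial bound 1 takes over from the
        ballot bound; this minimum is what keeps the late weights linear in \<open>y\<close> when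
        \<open>y\<close> exceeds \<open>sqrt n\<close>.\<close>
      have f: "prob {\<omega>\<in>space T. PF (\<lambda>i. Y i \<omega>)} \<le> CF * min 1 (y' / ?sk)"
      proof (cases "y' / ?sk \<le> 1")
        case True
        have "prob {\<omega>\<in>space T. PF (\<lambda>i. Y i \<omega>)} \<le> (K * y') * (1 / sqrt (1 + VF))" using PFb by simp
        also have "\<dots> \<le> (K * y') * (sqrt AF / ?sk)" using F_le K y' by (intro mult_left_mono) auto
        also have "\<dots> = (K * sqrt AF) * (y' / ?sk)" by simp
        also have "\<dots> \<le> CF * (y' / ?sk)" using y' by (intro mult_right_mono) (auto simp: CF_def)
        also have "y' / ?sk = min 1 (y' / ?sk)" using True by simp
        finally show ?thesis .
      next
        case False
        hence "min 1 (y' / ?sk) = 1" by simp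
        moreover have "prob {\<omega>\<in>space T. PF (\<lambda>i. Y i \<omega>)} \<le> 1" by (rule prob_le_1)
        ultimately show ?thesis using cpos by linarith
      qed
      have "prob {\<omega>\<in>space T. PR (\<lambda>i. Y i \<omega>)} \<le> (K * b') * (1 / sqrt (1 + VR))" using PRb by simp
      also have "\<dots> \<le> (K * b') * (sqrt AR * (sqrt 3 * (1 / ?sk + \<delta>)))" using R_le K b' by (intro mult_left_mono) auto
      finally have r: "prob {\<omega>\<in>space T. PR (\<lambda>i. Y i \<omega>)} \<le> CR * b' * (1 / ?sk + \<delta>)" by (simp add: CR_def mult_ac)
      have "8 * prob {\<omega>\<in>space T. PF (\<lambda>i. Y i \<omega>)} * prob {\<omega>\<in>space T. PR (\<lambda>i. Y i \<omega>)} * (1 / sqrt (1 + VM))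
        \<le> 8 * (CF * min 1 (y' / ?sk)) * (CR * b' * (1 / ?sk + \<delta>)) * (sqrt AM / ?sk)"
        using f r M_le cpos y' b' d V0 pos by (intro mult_mono mult_nonneg_nonneg) auto
      also have "\<dots> = C * b' * q" by (simp add: C_def q_def mult_ac)
      finally show ?thesis using three[of u] by simp
    qed
    \<comment> \<open>The window of length \<open>b\<close> for the end point is covered by windows
      centred at unit steps, at the cost of the factor \<open>1 + b\<close>.\<close>
    define A where "A i = {\<omega>\<in>space T. PF (\<lambda>i. Y i \<omega>) \<and> PR (\<lambda>i. Y i \<omega>) \<and> \<bar>(\<Sum>i\<in>P. Y i \<omega>) - (w0 - b + real i)\<bar> \<le> 1}" for i :: nat
    have mA: "A i \<in> sets T" for i
    proof -
      have "{\<omega>\<in>space T. PF (\<lambda>i. Y i \<omega>)} \<in> sets T"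
        unfolding PF_def using fin J(1) by (intro mset borel_measurable_sum mY) auto
      moreover have "{\<omega>\<in>space T. PR (\<lambda>i. Y i \<omega>)} \<in> sets T"
        unfolding PR_def using fin J(2) by (intro mset borel_measurable_sum borel_measurable_uminus mY) auto
      moreover have "{\<omega>\<in>space T. \<bar>(\<Sum>i\<in>P. Y i \<omega>) - (w0 - b + real i)\<bar> \<le> 1} \<in> sets T"
      proof -
        have "(\<lambda>\<omega>. \<Sum>i\<in>P. Y i \<omega>) \<in> borel_measurable T" by (intro borel_measurable_sum mY)
        thus ?thesis by measurable
      qed
      ultimately have "{\<omega>\<in>space T. PF (\<lambda>i. Y i \<omega>)} \<inter> {\<omega>\<in>space T. PR (\<lambda>i. Y i \<omega>)} \<inter> {\<omega>\<in>space T. \<bar>(\<Sum>i\<in>P. Y i \<omega>) - (w0 - b + real i)\<bar> \<le> 1} \<in> sets T" by auto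
      also have "{\<omega>\<in>space T. PF (\<lambda>i. Y i \<omega>)} \<inter> {\<omega>\<in>space T. PR (\<lambda>i. Y i \<omega>)} \<inter> {\<omega>\<in>space T. \<bar>(\<Sum>i\<in>P. Y i \<omega>) - (w0 - b + real i)\<bar> \<le> 1} = A i"
        by (auto simp: A_def)
      finally show ?thesis .
    qed
    let ?E = "{\<omega>\<in>space T. (\<forall>t\<le>scale_end k. (\<Sum>p\<in>primes_upto t. Y p \<omega>) \<le> y') \<and>
         (\<forall>t\<le>scale_end k. - (\<Sum>p\<in>P - primes_upto t. Y p \<omega>)
            \<le> b' + \<delta> * (\<Sum>p\<in>P - primes_upto t. clock p) + 8 * (1 + (\<Sum>p\<in>P - primes_upto t. clock p)) powr (1/8)) \<and>
         w0 - b \<le> (\<Sum>p\<in>P. Y p \<omega>) \<and> (\<Sum>p\<in>P. Y p \<omega>) \<le> w0}"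
    have "prob ?E \<le> prob (\<Union>i\<in>{..nat \<lfloor>b\<rfloor>}. A i)"
    proof (rule finite_measure_mono)
      show "?E \<subseteq> (\<Union>i\<in>{..nat \<lfloor>b\<rfloor>}. A i)"
      proof
        fix \<omega> assume w: "\<omega> \<in> ?E"
        define S where "S = (\<Sum>p\<in>P. Y p \<omega>)"
        define i where "i = nat \<lfloor>S - (w0 - b)\<rfloor>"
        have S: "w0 - b \<le> S" "S \<le> w0" using w by (auto simp: S_def)
        have i1: "\<bar>S - (w0 - b + real i)\<bar> \<le> 1" using S unfolding i_def by linarith
        have i2: "i \<le> nat \<lfloor>b\<rfloor>" unfolding i_def using S by (intro nat_mono floor_mono) auto
        have pf: "PF (\<lambda>p. Y p \<omega>)"
          unfolding PF_def
        proof
          fix t assume t: "t \<in> JF"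
          hence ts: "t \<le> scale_end k1" by (auto simp: JF_def primes_upto_def)
          have "{p. p \<in> JF \<and> p \<le> t} = primes_upto t" using ts by (auto simp: JF_def primes_upto_def)
          moreover have "(\<Sum>p\<in>primes_upto t. Y p \<omega>) \<le> y'" using w ts sc by auto
          ultimately show "(\<Sum>p | p \<in> JF \<and> p \<le> t. Y p \<omega>) \<le> y' + 0 * (\<Sum>p | p \<in> JF \<and> p \<le> t. clock p) + 8 * (1 + (\<Sum>p | p \<in> JF \<and> p \<le> t. clock p)) powr (1/8)"
            by (simp add: add_increasing2)
        qed
        have pR: "PR (\<lambda>p. Y p \<omega>)"
          unfolding PR_def
        proof
          fix t assume t: "t \<in> JR"
          hence t1: "prime t" "t \<le> scale_end k" "scale_end (k - R) < t" by (auto simp: JR_def P_def primes_upto_def)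
          \<comment> \<open>The tail sum from \<open>t\<close> on includes \<open>t\<close> itself,
            so the complement is cut at \<open>t - 1\<close>.\<close>
          have "{p. p \<in> JR \<and> t \<le> p} = P - primes_upto (t - 1)" using t1 prime_gt_0_nat[OF t1(1)] by (auto simp: JR_def primes_upto_def P_def)
          moreover have "t - 1 \<le> scale_end k" using t1 by simp
          ultimately show "(\<Sum>p | p \<in> JR \<and> t \<le> p. - Y p \<omega>) \<le> b' + \<delta> * (\<Sum>p | p \<in> JR \<and> t \<le> p. clock p) + 8 * (1 + (\<Sum>p | p \<in> JR \<and> t \<le> p. clock p)) powr (1/8)"
            using w by (simp add: sum_negf)
        qed
        show "\<omega> \<in> (\<Union>i\<in>{..nat \<lfloor>b\<rfloor>}. A i)"
          using w pf pR i1 i2 by (auto simp: A_def S_def)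
      qed
    qed (use mA in auto)
    also have "\<dots> \<le> (\<Sum>i\<in>{..nat \<lfloor>b\<rfloor>}. prob (A i))" using mA by (intro finite_measure_subadditive_finite) auto
    also have "\<dots> \<le> (\<Sum>i\<in>{..nat \<lfloor>b\<rfloor>}. C * b' * q)" unfolding A_def by (intro sum_mono three')
    also have "\<dots> = (real (nat \<lfloor>b\<rfloor>) + 1) * (C * b' * q)" by simp
    also have "\<dots> \<le> (1 + b) * (C * b' * q)"
    proof (intro mult_right_mono)
      show "0 \<le> C * b' * q" unfolding q_def using Cpos b' y' d by auto
      show "real (nat \<lfloor>b\<rfloor>) + 1 \<le> 1 + b" using b by simp
    qed
    also have "\<dots> = C * (1 + b) * b' * q" by simp
    finally show "prob {\<omega>\<in>space T. (\<forall>t\<le>scale_end k. (\<Sum>p\<in>primes_upto t. Y p \<omega>) \<le> y') \<and>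
         (\<forall>t\<le>scale_end k. - (\<Sum>p\<in>primes_upto (scale_end k) - primes_upto t. Y p \<omega>)
            \<le> b' + \<delta> * (\<Sum>p\<in>primes_upto (scale_end k) - primes_upto t. clock p)
                + 8 * (1 + (\<Sum>p\<in>primes_upto (scale_end k) - primes_upto t. clock p)) powr (1/8)) \<and>
         w0 - b \<le> (\<Sum>p\<in>primes_upto (scale_end k). Y p \<omega>) \<and> (\<Sum>p\<in>primes_upto (scale_end k). Y p \<omega>) \<le> w0}
      \<le> C * (1 + b) * b' * (min 1 (y' / sqrt (real k + 1)) * (1 / sqrt (real k + 1) + \<delta>) / sqrt (real k + 1))"
      by (simp add: P_def q_def)
  qed
qed


text \<open>The ballot probability for \<open>k\<close> scales as a product of three factors:
  staying below a barrier at height about \<open>y\<close>, ending near it against a reversed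
  barrier of slope \<open>y / n\<close>, and hitting a bounded window. It has the order
  \<open>y * k powr (-3/2)\<close> while \<open>sqrt k\<close> lies between \<open>1 + y\<close> and
  \<open>n / y\<close>.\<close>

definition ballot_weight :: "real \<Rightarrow> real \<Rightarrow> nat \<Rightarrow> real" where
  "ballot_weight n y k = min 1 ((1 + y) / sqrt (real k + 1)) * (1 / sqrt (real k + 1) + y / n) / sqrt (real k + 1)"

text \<open>With \<open>\<delta> = y / n\<close>, the tilt gives each prime the mean
  \<open>(1 + \<delta>) / p\<close> and the normalisation \<open>exp ((1 + \<delta>)^2 / p)\<close>,
  up to third order. Over \<open>k\<close> scales the exponent is \<open>- 2 * (1 + \<delta>) * (k +
  y - g k) + (1 + \<delta>)^2 * k = - k - 2 * y + k * \<delta>^2 - 2 * \<delta> * y + 2 * (1 +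
  \<delta>) * g k\<close>, where \<open>k * \<delta>^2 \<le> y^2 / n + 3\<close> while
  \<open>2 * \<delta> * y = 2 * y^2 / n\<close>. The condition on \<open>g\<close> makes the
  barrier, read from the end, deviate from a line only logarithmically.\<close>

lemma one_point_bound:
  "\<exists>C>0. \<forall>(M::'a measure) X k n y g b. prob_space M \<longrightarrow>
     prob_space.indep_vars M (\<lambda>_. borel) X (primes_upto (scale_end k)) \<longrightarrow>
     (\<forall>p\<in>primes_upto (scale_end k). small_var M (X p) (1 / sqrt (real p))) \<longrightarrow>
     1 \<le> n \<longrightarrow> 0 < y \<longrightarrow> y \<le> n \<longrightarrow> real k \<le> n + 3 \<longrightarrow> 1 \<le> b \<longrightarrow>
     (\<forall>j\<le>k. 0 \<le> g j \<and> g k - g j \<le> ln (1 + real (k - j))) \<longrightarrow>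
     measure M {\<omega>\<in>space M. (\<forall>t\<le>scale_end k. (\<Sum>p\<in>primes_upto t. X p \<omega>) \<le> real (scale_of t) + y - g (scale_of t)) \<and>
         real k + y - g k - b \<le> (\<Sum>p\<in>primes_upto (scale_end k). X p \<omega>)}
     \<le> C * (1 + b)\<^sup>2 * exp (4 * b) * exp (- real k - 2 * y - y\<^sup>2 / n + 2 * (1 + y / n) * g k)
         * ballot_weight n y k"
proof -
  obtain CT where CT: "CT \<ge> 0" "\<And>k. \<bar>recip_sum (scale_end k) - real k\<bar> \<le> CT" "\<And>t. \<bar>recip_sum t - real (scale_of t)\<bar> \<le> CT"
    using recip_sum_scale_of by blast
  obtain CV where CV: "CV \<ge> 0" "\<And>L. finite L \<Longrightarrow> (\<forall>p\<in>L. prime p) \<Longrightarrow> (\<Sum>p\<in>L. 1 / real p) \<le> (\<Sum>p\<in>L. clock p) + CV"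
    using clock_sum by blast
  obtain CZ where CZ: "CZ \<ge> 0" "\<And>L. finite L \<Longrightarrow> (\<Sum>p\<in>L. (1 / sqrt (real p)) ^ 3) \<le> CZ"
    using sum_recip_cube_sqrt by blast
  obtain C where C: "C > 0" and walk: "\<forall>(T::'a measure) Y k b b' y' w0 \<delta>. prob_space T \<longrightarrow>
     prob_space.indep_vars T (\<lambda>_. borel) Y (primes_upto (scale_end k)) \<longrightarrow>
     (\<forall>p\<in>primes_upto (scale_end k). \<forall>\<omega>\<in>space T. \<bar>Y p \<omega> :: real\<bar> \<le> 20) \<longrightarrow>
     (\<forall>p\<in>primes_upto (scale_end k). \<forall>\<theta>. \<bar>\<theta>\<bar> \<le> 1 \<longrightarrow>
        exp (exp (-18) / 16 * \<theta>\<^sup>2 * clock p) \<le> prob_space.expectation T (\<lambda>\<omega>. exp (\<theta> * Y p \<omega>))) \<longrightarrow>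
     (\<forall>p\<in>primes_upto (scale_end k). \<forall>t\<in>{0..1}.
        norm (prob_space.expectation T (\<lambda>\<omega>. iexp (t * Y p \<omega>))) \<le> exp (- (clock p / 16 * t\<^sup>2))) \<longrightarrow>
     1 \<le> y' \<longrightarrow> 1 \<le> b' \<longrightarrow> 1 \<le> b \<longrightarrow> 0 < \<delta> \<longrightarrow> \<delta> \<le> 1 \<longrightarrow>
     measure T {\<omega>\<in>space T. (\<forall>t\<le>scale_end k. (\<Sum>p\<in>primes_upto t. Y p \<omega>) \<le> y') \<and>
         (\<forall>t\<le>scale_end k. - (\<Sum>p\<in>primes_upto (scale_end k) - primes_upto t. Y p \<omega>)
            \<le> b' + \<delta> * (\<Sum>p\<in>primes_upto (scale_end k) - primes_upto t. clock p)
                + 8 * (1 + (\<Sum>p\<in>primes_upto (scale_end k) - primes_upto t. clock p)) powr (1/8)) \<and>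
         w0 - b \<le> (\<Sum>p\<in>primes_upto (scale_end k). Y p \<omega>) \<and> (\<Sum>p\<in>primes_upto (scale_end k). Y p \<omega>) \<le> w0}
     \<le> C * (1 + b) * b' * (min 1 (y' / sqrt (real k + 1)) * (1 / sqrt (real k + 1) + \<delta>) / sqrt (real k + 1))"
    using tilted_walk_bound[where 'a='a] by (elim exE conjE) (rule that)
  define K where "K = tilt_const"
  have K: "K > 0" using tilt_const_ge by (simp add: K_def)
  \<comment> \<open>\<open>C1\<close> and \<open>C2\<close> collect the errors of comparing scale
    index, reciprocal sum, clock and tilted mean, for the walk read forwards and backwards;
    \<open>C3\<close> collects those of the change of measure.\<close>
  define C1 where "C1 = CT + 4 * K * CZ + 1"
  define C2 where "C2 = 8 * CT + 4 * K * CZ + 2 * CV"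
  define C3 where "C3 = exp (3 + 4 * CT + K * CZ)"
  have Cs: "C1 \<ge> 1" "C2 \<ge> 0" "C3 > 0" using CT CV CZ K by (auto simp: C1_def C2_def C3_def)
  define Cf where "Cf = C3 * (C * (1 + C2) * C1)"
  have Cf: "Cf > 0" using Cs C by (simp add: Cf_def)
  show ?thesis
  proof (intro exI[of _ Cf] conjI Cf allI impI)
    fix M :: "'a measure" and X :: "nat \<Rightarrow> 'a \<Rightarrow> real" and k :: nat and n y b :: real and g :: "nat \<Rightarrow> real"
    assume "prob_space M"
    then interpret prob_space M .
    define P where "P = primes_upto (scale_end k)"
    assume "indep_vars (\<lambda>_. borel) X (primes_upto (scale_end k))"
      and "\<forall>p\<in>primes_upto (scale_end k). small_var M (X p) (1 / sqrt (real p))"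
    hence ind: "indep_vars (\<lambda>_. borel) X P" and sv: "\<And>p. p \<in> P \<Longrightarrow> small_var M (X p) (1 / sqrt (real p))"
      by (auto simp: P_def)
    assume n: "1 \<le> n" and y: "0 < y" "y \<le> n" and kn: "real k \<le> n + 3" and b: "1 \<le> b"
      and "\<forall>j\<le>k. 0 \<le> g j \<and> g k - g j \<le> ln (1 + real (k - j))"
    hence g: "\<And>j. j \<le> k \<Longrightarrow> 0 \<le> g j" "\<And>j. j \<le> k \<Longrightarrow> g k - g j \<le> ln (1 + real (k - j))" by auto
    define \<delta> where "\<delta> = y / n"
    have d: "0 < \<delta>" "\<delta> \<le> 1" using y n by (auto simp: \<delta>_def)
    define a where "a = 1 + \<delta>"
    define l where "l = 2 * a"
    have a: "1 \<le> a" "a \<le> 2" using d by (auto simp: a_def)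
    have l: "0 \<le> l" "l \<le> 4" using a by (auto simp: l_def)
    have finP: "finite P" by (simp add: P_def)
    have prP: "\<forall>p\<in>P. prime p" by (auto simp: P_def primes_upto_def)
    have p2: "p \<ge> 2" if "p \<in> P" for p using that primes_upto_ge_2 by (auto simp: P_def)
    have r2: "(1 / sqrt (real p))\<^sup>2 = 1 / real p" for p by (simp add: power_divide)
    have mX: "p \<in> P \<Longrightarrow> X p \<in> borel_measurable M" for p using ind by (auto simp: indep_vars_def)
    have r_le: "1 / sqrt (real p) \<le> 1" if "p \<in> P" for p using p2[OF that] by (simp add: field_simps)
    have bdd: "\<bar>X p \<omega>\<bar> \<le> 10" if "p \<in> P" "\<omega> \<in> space M" for p \<omega>
    proof -
      have "\<bar>X p \<omega>\<bar> \<le> 10 * (1 / sqrt (real p))" using sv[OF that(1)] that(2) by (auto simp: small_var_def)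
      also have "\<dots> \<le> 10 * 1" using r_le[OF that(1)] by (intro mult_left_mono) auto
      finally show ?thesis by simp
    qed
    define T where "T = tilted M P X l"
    have spT: "space T = space M" "sets T = sets M" by (auto simp: T_def)
    have psT: "prob_space T" unfolding T_def by (rule prob_space_tilted[OF finP ind bdd])
    interpret T: prob_space T by (rule psT)
    have indT: "T.indep_vars (\<lambda>_. borel) X P" unfolding T_def by (rule indep_vars_tilted[OF finP ind bdd])
    have TE: "(\<integral>\<omega>. h (X p \<omega>) \<partial>T) = expectation (\<lambda>\<omega>. h (X p \<omega>) * exp (l * X p \<omega>)) / expectation (\<lambda>\<omega>. exp (l * X p \<omega>))"
      if p: "p \<in> P" and h: "h \<in> borel_measurable borel" and hD: "\<And>\<omega>. \<omega> \<in> space M \<Longrightarrow> \<bar>h (X p \<omega>)\<bar> \<le> D" for p h D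
      unfolding T_def by (rule tilted_expectation[OF finP ind bdd p h hD])
    note tilted_facts = tilted_mean_approx[OF sv l psT spT(2)] tilted_centred_bound[OF sv l psT spT(2)]
      tilted_mgf_lower[OF sv l psT spT(2)] tilted_mgf_ge_1[OF sv l psT spT(2)] tilted_char_bound[OF sv l psT spT(2)]
    have Tmean: "\<bar>(\<integral>\<omega>. X p \<omega> \<partial>T) - l * (1 / sqrt (real p))\<^sup>2 / 2\<bar> \<le> 4 * tilt_const * (1 / sqrt (real p)) ^ 3" if p: "p \<in> P" for p
      by (rule tilted_facts(1)[OF p]) (erule TE[OF p], blast)
    have Tcent: "\<bar>X p \<omega> - (\<integral>\<omega>. X p \<omega> \<partial>T)\<bar> \<le> 20 * (1 / sqrt (real p))" if p: "p \<in> P" and w: "\<omega> \<in> space M" for p \<omega>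
      by (rule tilted_facts(2)[OF p _ w]) (erule TE[OF p], blast)
    have Tlow: "exp (exp (-18) / 16 * \<theta>\<^sup>2 * (1 / sqrt (real p))\<^sup>2) \<le> (\<integral>\<omega>. exp (\<theta> * (X p \<omega> - (\<integral>\<omega>. X p \<omega> \<partial>T))) \<partial>T)"
      if p: "p \<in> P" and r: "256 * tilt_const * (1 / sqrt (real p)) \<le> 1" and th: "\<bar>\<theta>\<bar> \<le> 1" for p \<theta>
      by (rule tilted_facts(3)[OF p _ r th]) (erule TE[OF p], blast)
    have Tge1: "(\<integral>\<omega>. exp (\<theta> * (X p \<omega> - (\<integral>\<omega>. X p \<omega> \<partial>T))) \<partial>T) \<ge> 1" if p: "p \<in> P" for p \<theta>
      by (rule tilted_facts(4)[OF p]) (erule TE[OF p], blast)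
    have Tchar: "norm (\<integral>\<omega>. iexp (t * (X p \<omega> - (\<integral>\<omega>. X p \<omega> \<partial>T))) \<partial>T) \<le> exp (- (t\<^sup>2 * (1 / sqrt (real p))\<^sup>2 / 16))"
      if p: "p \<in> P" and r: "256 * tilt_const * (1 / sqrt (real p)) \<le> 1" and t: "\<bar>t\<bar> \<le> 1" for p t
      by (rule tilted_facts(5)[OF p _ r t]) (erule TE[OF p], blast)
    define m where "m p = (\<integral>\<omega>. X p \<omega> \<partial>T)" for p
    define Y where "Y p \<omega> = X p \<omega> - m p" for p \<omega>
    have m_approx: "\<bar>m p - a * (1 / real p)\<bar> \<le> 4 * K * (1 / sqrt (real p)) ^ 3" if p: "p \<in> P" for p
      using Tmean[OF p] unfolding r2
      by (simp add: m_def K_def l_def)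
    have Y20: "\<bar>Y p \<omega>\<bar> \<le> 20" if p: "p \<in> P" and w: "\<omega> \<in> space T" for p \<omega>
    proof -
      have "\<bar>Y p \<omega>\<bar> \<le> 20 * (1 / sqrt (real p))"
        using Tcent[OF p] w by (simp add: Y_def m_def spT)
      also have "\<dots> \<le> 20 * 1" using r_le[OF p] by (intro mult_left_mono) auto
      finally show ?thesis by simp
    qed
    have small: "256 * tilt_const * (1 / sqrt (real p)) \<le> 1" if "p \<in> P" "256 * tilt_const \<le> sqrt (real p)" for p
      using that p2[of p] by (simp add: field_simps)
    have Ymgf: "exp (exp (-18) / 16 * \<theta>\<^sup>2 * clock p) \<le> T.expectation (\<lambda>\<omega>. exp (\<theta> * Y p \<omega>))"
      if p: "p \<in> P" and th: "\<bar>\<theta>\<bar> \<le> 1" for p \<theta>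
    proof (cases "256 * tilt_const \<le> sqrt (real p)")
      case True
      show ?thesis using Tlow[OF p small[OF p True] th] True
        unfolding r2 by (simp add: Y_def m_def clock_def)
    next
      case False
      show ?thesis using Tge1[OF p] False
        by (simp add: Y_def m_def clock_def)
    qed
    have Ychf: "norm (T.expectation (\<lambda>\<omega>. iexp (t * Y p \<omega>))) \<le> exp (- (clock p / 16 * t\<^sup>2))"
      if p: "p \<in> P" and t: "t \<in> {0..1}" for p t
    proof (cases "256 * tilt_const \<le> sqrt (real p)")
      case True
      have "\<bar>t\<bar> \<le> 1" using t by auto
      from Tchar[OF p small[OF p True] this] show ?thesis
        using True unfolding r2 by (simp add: Y_def m_def clock_def mult.commute)
    next
      case False
      have "norm (T.expectation (\<lambda>\<omega>. iexp (t * Y p \<omega>))) \<le> T.expectation (\<lambda>\<omega>. norm (iexp (t * Y p \<omega>)))"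
        by (rule integral_norm_bound)
      thus ?thesis using False T.prob_space by (simp add: clock_def)
    qed
    have indY: "T.indep_vars (\<lambda>_. borel) Y P"
      unfolding Y_def by (rule T.indep_vars_compose2[OF indT, where Y="\<lambda>p x. x - m p"]) auto
    have m_sum: "\<bar>(\<Sum>p\<in>L. m p) - a * (\<Sum>p\<in>L. 1 / real p)\<bar> \<le> 4 * K * CZ" if L: "L \<subseteq> P" for L
    proof -
      have fL: "finite L" using L finP by (rule finite_subset)
      have "\<bar>(\<Sum>p\<in>L. m p) - a * (\<Sum>p\<in>L. 1 / real p)\<bar> = \<bar>\<Sum>p\<in>L. m p - a * (1 / real p)\<bar>"
        by (simp add: sum_subtractf sum_distrib_left)
      also have "\<dots> \<le> (\<Sum>p\<in>L. \<bar>m p - a * (1 / real p)\<bar>)" by (rule sum_abs)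
      also have "\<dots> \<le> (\<Sum>p\<in>L. 4 * K * (1 / sqrt (real p)) ^ 3)" using L by (intro sum_mono m_approx) auto
      also have "\<dots> = 4 * K * (\<Sum>p\<in>L. (1 / sqrt (real p)) ^ 3)" by (simp add: sum_distrib_left)
      also have "\<dots> \<le> 4 * K * CZ" using CZ(2)[OF fL] K by (intro mult_left_mono) auto
      finally show ?thesis .
    qed
    let ?U = "\<lambda>j. real j + y - g j"
    define A where "A = {\<omega>\<in>space M. (\<forall>t\<le>scale_end k. (\<Sum>p\<in>primes_upto t. X p \<omega>) \<le> ?U (scale_of t)) \<and>
         ?U k - b \<le> (\<Sum>p\<in>primes_upto (scale_end k). X p \<omega>)}"
    have mS: "(\<lambda>\<omega>. \<Sum>p\<in>primes_upto t. X p \<omega>) \<in> borel_measurable M" if "t \<le> scale_end k" for t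
      using primes_upto_mono[OF that] by (intro borel_measurable_sum mX) (auto simp: P_def)
    have mA: "A \<in> sets M"
    proof -
      have "{\<omega>\<in>space M. \<forall>t\<in>{..scale_end k}. (\<Sum>p\<in>primes_upto t. X p \<omega>) \<le> ?U (scale_of t)} \<in> sets M"
        by (intro sets.sets_Collect_finite_All' borel_measurable_le mS) auto
      moreover have "{\<omega>\<in>space M. ?U k - b \<le> (\<Sum>p\<in>primes_upto (scale_end k). X p \<omega>)} \<in> sets M"
        using mS[of "scale_end k"] by measurable
      ultimately have "{\<omega>\<in>space M. \<forall>t\<in>{..scale_end k}. (\<Sum>p\<in>primes_upto t. X p \<omega>) \<le> ?U (scale_of t)} \<inter>
        {\<omega>\<in>space M. ?U k - b \<le> (\<Sum>p\<in>primes_upto (scale_end k). X p \<omega>)} \<in> sets M" by auto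
      also have "{\<omega>\<in>space M. \<forall>t\<in>{..scale_end k}. (\<Sum>p\<in>primes_upto t. X p \<omega>) \<le> ?U (scale_of t)} \<inter>
        {\<omega>\<in>space M. ?U k - b \<le> (\<Sum>p\<in>primes_upto (scale_end k). X p \<omega>)} = A" by (auto simp: A_def)
      finally show ?thesis .
    qed
    have tilt: "prob A \<le> exp (- l * (?U k - b)) * (\<Prod>p\<in>P. expectation (\<lambda>\<omega>. exp (l * X p \<omega>))) * measure T A"
      unfolding T_def by (rule prob_le_tilted[OF finP ind bdd l(1) mA]) (auto simp: A_def P_def)
    have prodb: "(\<Prod>p\<in>P. expectation (\<lambda>\<omega>. exp (l * X p \<omega>))) \<le> exp (a\<^sup>2 * (real k + CT) + K * CZ)"
    proof -
      have "(\<Prod>p\<in>P. expectation (\<lambda>\<omega>. exp (l * X p \<omega>))) \<le> (\<Prod>p\<in>P. exp (a\<^sup>2 * (1 / real p) + K * (1 / sqrt (real p)) ^ 3))"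
      proof (intro prod_mono conjI)
        fix p assume p: "p \<in> P"
        have "expectation (\<lambda>\<omega>. exp (l * X p \<omega>)) \<le> 1 + (a\<^sup>2 * (1 / real p) + K * (1 / sqrt (real p)) ^ 3)"
          using small_var_mgf[OF sv[OF p] l] unfolding r2 by (simp add: K_def l_def power_mult_distrib)
        also have "\<dots> \<le> exp (a\<^sup>2 * (1 / real p) + K * (1 / sqrt (real p)) ^ 3)" by (rule exp_ge_add_one_self)
        finally show "expectation (\<lambda>\<omega>. exp (l * X p \<omega>)) \<le> exp (a\<^sup>2 * (1 / real p) + K * (1 / sqrt (real p)) ^ 3)" .
      qed (auto intro: Bochner_Integration.integral_nonneg)
      also have "\<dots> = exp (a\<^sup>2 * recip_sum (scale_end k) + K * (\<Sum>p\<in>P. (1 / sqrt (real p)) ^ 3))"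
        using finP by (simp add: exp_sum[symmetric] sum.distrib sum_distrib_left recip_sum_def P_def)
      also have "\<dots> \<le> exp (a\<^sup>2 * (real k + CT) + K * CZ)"
      proof -
        have "a\<^sup>2 * recip_sum (scale_end k) \<le> a\<^sup>2 * (real k + CT)" using CT(2)[of k] by (intro mult_left_mono) auto
        moreover have "K * (\<Sum>p\<in>P. (1 / sqrt (real p)) ^ 3) \<le> K * CZ" using CZ(2)[OF finP] K by (intro mult_left_mono) auto
        ultimately show ?thesis by simp
      qed
      finally show ?thesis .
    qed
    define y' where "y' = y + C1"
    define b' where "b' = b + C2"
    define w0 where "w0 = ?U k - (\<Sum>p\<in>P. m p)"
    define q where "q y = min 1 (y / sqrt (real k + 1)) * (1 / sqrt (real k + 1) + \<delta>) / sqrt (real k + 1)" for y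
    let ?E = "{\<omega>\<in>space T. (\<forall>t\<le>scale_end k. (\<Sum>p\<in>primes_upto t. Y p \<omega>) \<le> y') \<and>
         (\<forall>t\<le>scale_end k. - (\<Sum>p\<in>primes_upto (scale_end k) - primes_upto t. Y p \<omega>)
            \<le> b' + \<delta> * (\<Sum>p\<in>primes_upto (scale_end k) - primes_upto t. clock p)
                + 8 * (1 + (\<Sum>p\<in>primes_upto (scale_end k) - primes_upto t. clock p)) powr (1/8)) \<and>
         w0 - b \<le> (\<Sum>p\<in>primes_upto (scale_end k). Y p \<omega>) \<and> (\<Sum>p\<in>primes_upto (scale_end k). Y p \<omega>) \<le> w0}"
    have sub: "A \<subseteq> ?E"
    proof
      fix \<omega> assume w: "\<omega> \<in> A"
      define S where "S t = (\<Sum>p\<in>primes_upto t. X p \<omega>)" for t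
      have SU: "S t \<le> ?U (scale_of t)" if "t \<le> scale_end k" for t using w that by (auto simp: A_def S_def)
      have Sk: "?U k - b \<le> S (scale_end k)" using w by (auto simp: A_def S_def)
      have upP: "primes_upto t \<subseteq> P" if "t \<le> scale_end k" for t unfolding P_def by (rule primes_upto_mono[OF that])
      have Ysum: "(\<Sum>p\<in>L. Y p \<omega>) = (\<Sum>p\<in>L. X p \<omega>) - (\<Sum>p\<in>L. m p)" for L by (simp add: Y_def sum_subtractf)
      have 1: "(\<Sum>p\<in>primes_upto t. Y p \<omega>) \<le> y'" if t: "t \<le> scale_end k" for t
      proof -
        have j: "scale_of t \<le> k" by (rule scale_of_least[OF t])
        \<comment> \<open>The tilted mean per unit of reciprocal sum is \<open>a \<ge> 1\<close>, at
          least the slope of the barrier, so after centring the barrier lies below the constant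
          \<open>y'\<close> throughout.\<close>
        have "1 * recip_sum t \<le> a * recip_sum t" using a recip_sum_nonneg by (intro mult_right_mono) auto
        hence "(\<Sum>p\<in>primes_upto t. m p) \<ge> recip_sum t - 4 * K * CZ"
          using m_sum[OF upP[OF t]] unfolding recip_sum_def by linarith
        thus ?thesis using SU[OF t] CT(3)[of t] g(1)[OF j] unfolding Ysum S_def y'_def C1_def by linarith
      qed
      have 2: "- (\<Sum>p\<in>P - primes_upto t. Y p \<omega>) \<le> b' + \<delta> * (\<Sum>p\<in>P - primes_upto t. clock p)
                + 8 * (1 + (\<Sum>p\<in>P - primes_upto t. clock p)) powr (1/8)" if t: "t \<le> scale_end k" for t
      proof -
        define j where "j = scale_of t"
        have j: "j \<le> k" unfolding j_def by (rule scale_of_least[OF t])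
        define V where "V = (\<Sum>p\<in>P - primes_upto t. clock p)"
        have V0: "V \<ge> 0" unfolding V_def by (intro sum_nonneg clock_nonneg)
        have kj: "real (k - j) = real k - real j" using j by simp
        define Td where "Td = (\<Sum>p\<in>P - primes_upto t. 1 / real p)"
        have Td: "Td = recip_sum (scale_end k) - recip_sum t"
          unfolding Td_def recip_sum_def P_def[symmetric] by (rule sum_diff[OF finP upP[OF t]])
        have Td1: "Td \<le> real (k - j) + 2 * CT" "real (k - j) \<le> Td + 2 * CT"
          using CT(2)[of k] CT(3)[of t] kj unfolding Td j_def by linarith+
        have TdV: "Td \<le> V + CV" unfolding Td_def V_def using finP prP by (intro CV(2)) auto
        have Xd: "(\<Sum>p\<in>P - primes_upto t. X p \<omega>) = S (scale_end k) - S t"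
          unfolding S_def P_def[symmetric] by (rule sum_diff[OF finP upP[OF t]])
        have "(\<Sum>p\<in>P - primes_upto t. m p) \<le> a * Td + 4 * K * CZ"
          using m_sum[of "P - primes_upto t"] unfolding Td_def by auto
        moreover have "a * Td \<le> a * (real (k - j) + 2 * CT)" using Td1 a by (intro mult_left_mono) auto
        moreover have "a * (2 * CT) \<le> 2 * (2 * CT)" using a CT by (intro mult_right_mono) auto
        ultimately have m: "(\<Sum>p\<in>P - primes_upto t. m p) \<le> a * real (k - j) + 4 * CT + 4 * K * CZ"
          unfolding distrib_left by linarith
        have "- (S (scale_end k) - S t) \<le> - real (k - j) + ln (1 + real (k - j)) + b"
          using Sk SU[OF t] g(2)[OF j] kj unfolding j_def by linarith
        \<comment> \<open>Read backwards, the excess \<open>a - 1 = \<delta>\<close> of the tilted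
          mean over the slope of the barrier turns into a barrier of slope \<open>\<delta>\<close>,
          and the variation of \<open>g\<close> into the logarithm.\<close>
        hence 3: "- (\<Sum>p\<in>P - primes_upto t. Y p \<omega>) \<le> b + \<delta> * real (k - j) + ln (1 + real (k - j)) + 4 * CT + 4 * K * CZ"
          using m unfolding Ysum Xd a_def distrib_right by linarith
        have kV: "real (k - j) \<le> V + (CV + 2 * CT)" using Td1 TdV by linarith
        have c0: "CV + 2 * CT \<ge> 0" using CV CT by simp
        have 4: "\<delta> * real (k - j) \<le> \<delta> * V + (CV + 2 * CT)"
        proof -
          have "\<delta> * real (k - j) \<le> \<delta> * (V + (CV + 2 * CT))" using kV d by (intro mult_left_mono) auto
          moreover have "\<delta> * (CV + 2 * CT) \<le> 1 * (CV + 2 * CT)" using d c0 by (intro mult_right_mono) auto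
          ultimately show ?thesis unfolding distrib_left[of \<delta> V] mult_1_left by (meson add_left_mono order_trans)
        qed
        \<comment> \<open>The barrier shape of the ballot estimate originates here:
          \<open>ln u = 8 * ln (u powr (1/8)) \<le> 8 * u powr (1/8)\<close>.\<close>
        have 5: "ln (1 + real (k - j)) \<le> 8 * (1 + V) powr (1/8) + (CV + 2 * CT)"
        proof -
          have "1 + real (k - j) \<le> (1 + V) * (1 + (CV + 2 * CT))"
            using kV mult_nonneg_nonneg[OF V0 c0] by (simp add: algebra_simps)
          hence "ln (1 + real (k - j)) \<le> ln ((1 + V) * (1 + (CV + 2 * CT)))" using V0 c0 by (subst ln_le_cancel_iff) auto
          also have "\<dots> = ln (1 + V) + ln (1 + (CV + 2 * CT))" using V0 c0 by (subst ln_mult) auto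
          also have "ln (1 + (CV + 2 * CT)) \<le> CV + 2 * CT" using c0 by (rule ln_add_one_self_le_self)
          also have "ln (1 + V) = 8 * ln ((1 + V) powr (1/8))" using V0 by (simp add: ln_powr)
          also have "ln ((1 + V) powr (1/8)) \<le> (1 + V) powr (1/8)" using V0 ln_le_minus_one[of "(1 + V) powr (1/8)"] by simp
          finally show ?thesis by simp
        qed
        show ?thesis using 3 4 5 unfolding V_def[symmetric] b'_def C2_def by linarith
      qed
      \<comment> \<open>Early blocks can be empty, for instance
        \<open>scale_end 1 = scale_end 0\<close>, so the scale of \<open>scale_end k\<close> may be
        smaller than \<open>k\<close>; monotonicity of the barrier bridges the gap.\<close>
      have 6: "(\<Sum>p\<in>P. X p \<omega>) \<le> ?U k"
      proof -
        define j where "j = scale_of (scale_end k)"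
        have j: "j \<le> k" unfolding j_def by (rule scale_of_least) simp
        have "ln (1 + real (k - j)) \<le> real (k - j)" by (rule ln_add_one_self_le_self) simp
        hence "?U j \<le> ?U k" using g(2)[OF j] j by simp
        thus ?thesis using SU[of "scale_end k"] unfolding S_def P_def j_def by simp
      qed
      show "\<omega> \<in> ?E"
        using w 1 2 6 Sk unfolding w0_def S_def P_def[symmetric] Ysum
        by (auto simp: A_def spT Ysum)
    qed
    have mY: "p \<in> P \<Longrightarrow> Y p \<in> borel_measurable T" for p using indY by (auto simp: T.indep_vars_def)
    have mE: "?E \<in> sets T"
    proof -
      have s1: "(\<lambda>\<omega>. \<Sum>p\<in>L. Y p \<omega>) \<in> borel_measurable T" if "L \<subseteq> P" for L using that by (intro borel_measurable_sum mY) auto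
      have e1: "{\<omega>\<in>space T. \<forall>t\<in>{..scale_end k}. (\<Sum>p\<in>primes_upto t. Y p \<omega>) \<le> y'} \<in> sets T"
        by (intro sets.sets_Collect_finite_All' borel_measurable_le s1) (auto simp: P_def primes_upto_def)
      have e2: "{\<omega>\<in>space T. \<forall>t\<in>{..scale_end k}. - (\<Sum>p\<in>P - primes_upto t. Y p \<omega>) \<le> b' + \<delta> * (\<Sum>p\<in>P - primes_upto t. clock p)
                + 8 * (1 + (\<Sum>p\<in>P - primes_upto t. clock p)) powr (1/8)} \<in> sets T"
        by (intro sets.sets_Collect_finite_All' borel_measurable_le borel_measurable_uminus s1) auto
      have e3: "{\<omega>\<in>space T. w0 - b \<le> (\<Sum>p\<in>P. Y p \<omega>)} \<in> sets T" "{\<omega>\<in>space T. (\<Sum>p\<in>P. Y p \<omega>) \<le> w0} \<in> sets T"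
        using s1[of P] by (auto intro!: borel_measurable_le)
      show ?thesis
        using e1 e2 e3 unfolding P_def Ball_def atMost_iff
        by (intro sets.sets_Collect_conj)
    qed
    have "T.prob A \<le> T.prob ?E" by (rule T.finite_measure_mono[OF sub mE])
    also have "\<dots> \<le> C * (1 + b) * b' * q y'"
      unfolding q_def
      by (rule walk[THEN spec, THEN spec, THEN spec, THEN spec, THEN spec, THEN spec, THEN spec, THEN spec,
           THEN mp, THEN mp, THEN mp, THEN mp, THEN mp, THEN mp, THEN mp, THEN mp, THEN mp, THEN mp])
         (use psT indY Y20 Ymgf Ychf y b d Cs in \<open>auto simp: P_def y'_def b'_def\<close>)
    also have "\<dots> \<le> C * (1 + b) * ((1 + C2) * (1 + b)) * (C1 * q (1 + y))"
    proof (intro mult_mono)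
      show "b' \<le> (1 + C2) * (1 + b)" using Cs b by (simp add: b'_def algebra_simps)
      have yy: "y' \<le> C1 * (1 + y)" using Cs y by (simp add: y'_def algebra_simps mult_le_cancel_right1)
      have "min 1 (y' / sqrt (real k + 1)) \<le> C1 * min 1 ((1 + y) / sqrt (real k + 1))"
      proof (cases "(1 + y) / sqrt (real k + 1) \<le> 1")
        case True
        have "y' / sqrt (real k + 1) \<le> C1 * (1 + y) / sqrt (real k + 1)" using yy by (intro divide_right_mono) auto
        thus ?thesis using True by (simp add: min_le_iff_disj)
      next
        case False thus ?thesis using Cs by (simp add: min_le_iff_disj)
      qed
      hence "min 1 (y' / sqrt (real k + 1)) * ((1 / sqrt (real k + 1) + \<delta>) / sqrt (real k + 1))
         \<le> C1 * min 1 ((1 + y) / sqrt (real k + 1)) * ((1 / sqrt (real k + 1) + \<delta>) / sqrt (real k + 1))"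
        using d by (intro mult_right_mono) auto
      thus "q y' \<le> C1 * q (1 + y)" by (simp add: q_def mult_ac)
      show "0 \<le> q y'" using d y Cs by (auto simp: q_def y'_def)
      show "0 \<le> b'" using b Cs by (simp add: b'_def)
    qed (use C b Cs in auto)
    finally have TA: "T.prob A \<le> C * (1 + C2) * C1 * ((1 + b)\<^sup>2 * q (1 + y))" by (simp add: power2_eq_square mult_ac)
    have expo: "exp (- l * (?U k - b)) * exp (a\<^sup>2 * (real k + CT) + K * CZ)
        \<le> C3 * exp (4 * b) * exp (- real k - 2 * y - y\<^sup>2 / n + 2 * (1 + y / n) * g k)"
    proof -
      have "\<delta> * \<delta> \<le> 1 * 1" using d by (intro mult_mono) auto
      hence d2: "\<delta>\<^sup>2 \<le> 1" by (simp add: power2_eq_square)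
      have "real k * \<delta>\<^sup>2 \<le> (n + 3) * \<delta>\<^sup>2" using kn by (intro mult_right_mono) auto
      also have "\<dots> \<le> y\<^sup>2 / n + 3" using d2 n by (simp add: \<delta>_def power2_eq_square field_simps)
      finally have e1: "real k * \<delta>\<^sup>2 \<le> y\<^sup>2 / n + 3" .
      have e2: "a * b \<le> 2 * b" using a b by (intro mult_right_mono) auto
      have "a * a \<le> 2 * 2" using a by (intro mult_mono) auto
      hence "a\<^sup>2 * CT \<le> 4 * CT" using CT by (intro mult_right_mono) (auto simp: power2_eq_square)
      moreover have "\<delta> * y = y\<^sup>2 / n" by (simp add: \<delta>_def power2_eq_square)
      moreover have "- l * (?U k - b) + (a\<^sup>2 * (real k + CT) + K * CZ)
         = real k * \<delta>\<^sup>2 - real k - 2 * y - 2 * (\<delta> * y) + 2 * (1 + \<delta>) * g k + 2 * (a * b) + a\<^sup>2 * CT + K * CZ"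
        by (simp add: l_def a_def power2_eq_square algebra_simps)
      ultimately have "- l * (?U k - b) + (a\<^sup>2 * (real k + CT) + K * CZ)
         \<le> (3 + 4 * CT + K * CZ) + 4 * b + (- real k - 2 * y - y\<^sup>2 / n + 2 * (1 + \<delta>) * g k)"
        using e1 e2 by linarith
      hence "exp (- l * (?U k - b) + (a\<^sup>2 * (real k + CT) + K * CZ))
         \<le> exp ((3 + 4 * CT + K * CZ) + 4 * b + (- real k - 2 * y - y\<^sup>2 / n + 2 * (1 + \<delta>) * g k))"
        by simp
      thus ?thesis by (simp only: exp_add[of "- l * (?U k - b)"] exp_add[of "(3 + 4 * CT + K * CZ) + 4 * b"] exp_add[of "3 + 4 * CT + K * CZ"] C3_def \<delta>_def)
    qed
    have "prob A \<le> exp (- l * (?U k - b)) * exp (a\<^sup>2 * (real k + CT) + K * CZ) * T.prob A"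
      using tilt prodb by (elim order_trans) (intro mult_right_mono mult_left_mono, auto)
    also have "\<dots> \<le> (C3 * exp (4 * b) * exp (- real k - 2 * y - y\<^sup>2 / n + 2 * (1 + y / n) * g k)) * (C * (1 + C2) * C1 * ((1 + b)\<^sup>2 * q (1 + y)))"
      using Cs by (intro mult_mono[OF expo TA]) auto
    also have "\<dots> = Cf * (1 + b)\<^sup>2 * exp (4 * b) * exp (- real k - 2 * y - y\<^sup>2 / n + 2 * (1 + y / n) * g k) * q (1 + y)"
      by (simp add: Cf_def mult_ac)
    finally show "prob {\<omega>\<in>space M. (\<forall>t\<le>scale_end k. (\<Sum>p\<in>primes_upto t. X p \<omega>) \<le> real (scale_of t) + y - g (scale_of t)) \<and>
         real k + y - g k - b \<le> (\<Sum>p\<in>primes_upto (scale_end k). X p \<omega>)}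
     \<le> Cf * (1 + b)\<^sup>2 * exp (4 * b) * exp (- real k - 2 * y - y\<^sup>2 / n + 2 * (1 + y / n) * g k)
         * ballot_weight n y k"
      by (simp add: A_def q_def \<delta>_def ballot_weight_def)
  qed
qed

subsection \<open>Locating the first crossing\<close>

definition log_product :: "(nat \<Rightarrow> complex) \<Rightarrow> nat set \<Rightarrow> complex \<Rightarrow> real" where
  "log_product Z K s = (\<Sum>p\<in>K. log_factor (of_nat p powr (- s)) (Z p))"

lemma exp_eighth_bound: "exp (1/8 :: real) / sqrt 2 \<le> 9 / 10" "exp (1/8 :: real) \<le> 2"
proof -
  have e: "exp (1/8::real) ^ 8 = exp 1" by (simp flip: exp_of_nat_mult)
  have "exp (1/8::real) ^ 8 \<le> (9/10 * sqrt 2) ^ 8"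
  proof -
    have "sqrt 2 ^ 8 = (16 :: real)" using power_mult[of "sqrt 2" 2 4] by simp
    thus ?thesis unfolding e power_mult_distrib using exp_1_less_4 exp_le by (simp add: eval_nat_numeral)
  qed
  hence "exp (1/8::real) \<le> 9/10 * sqrt 2" by (rule power_le_imp_le_base[of _ 7, simplified]) simp
  thus "exp (1/8 :: real) / sqrt 2 \<le> 9 / 10" by (simp add: field_simps)
  have "exp (1/8::real) ^ 8 \<le> 2 ^ 8" unfolding e using exp_1_less_4 by simp
  thus "exp (1/8 :: real) \<le> 2" by (rule power_le_imp_le_base[of _ 7, simplified]) simp
qed

lemma norm_prime_powr:
  "p > 0 \<Longrightarrow> norm (of_nat p powr (- s) :: complex) = real p powr (- Re s)"
  using norm_powr_real_powr[of "of_nat p" "- s"] by simp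

text \<open>Moving off the critical line by \<open>exp (- k)\<close> changes the modulus by a factor
  of at most \<open>exp (1/8)\<close> for \<open>p\<close> up to \<open>scale_end k\<close>; this is
  a second purpose of the \<open>1/8\<close> in the scale. Since
  \<open>exp (1/8) / sqrt 2 \<le> 9/10\<close>, even the prime 2 keeps away from the
  singularity.\<close>

lemma norm_prime_powr_le:
  assumes p: "p \<in> primes_upto (scale_end k)" and s: "dist (Complex (1/2) h) s \<le> exp (- real k)"
  shows "norm (of_nat p powr (- s) :: complex) \<le> 2 / sqrt (real p)" "norm (of_nat p powr (- s) :: complex) \<le> 9 / 10"
proof -
  have p2: "p \<ge> 2" using primes_upto_ge_2[OF p] .
  have "real p \<le> exp (exp (real k) / 8)" using p by (simp add: primes_upto_def le_scale_end_iff)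
  hence lp: "ln (real p) \<le> exp (real k) / 8" using p2 ln_le_cancel_iff[of "real p" "exp (exp (real k) / 8)"] by simp
  have "\<bar>1/2 - Re s\<bar> \<le> exp (- real k)"
    using abs_Re_le_cmod[of "Complex (1/2) h - s"] s by (simp add: dist_norm)
  hence "1/2 - Re s \<le> exp (- real k)" by linarith
  hence "(1/2 - Re s) * ln (real p) \<le> exp (- real k) * (exp (real k) / 8)"
    using lp p2 by (intro order_trans[OF mult_right_mono mult_left_mono]) auto
  also have "\<dots> = 1 / 8" by (simp add: exp_minus)
  finally have "- Re s * ln (real p) \<le> 1 / 8 - ln (real p) / 2" by (simp add: algebra_simps)
  hence "exp (- Re s * ln (real p)) \<le> exp (1 / 8 - ln (real p) / 2)" by simp
  also have "\<dots> = exp (1/8) / sqrt (real p)"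
  proof -
    have "exp (ln (real p) / 2) = exp (ln (sqrt (real p)))" using p2 by (subst ln_sqrt) auto
    also have "\<dots> = sqrt (real p)" using p2 by (intro exp_ln) auto
    finally have "exp (ln (real p) / 2) = sqrt (real p)" .
    thus ?thesis by (simp add: exp_diff)
  qed
  finally have n: "norm (of_nat p powr (- s) :: complex) \<le> exp (1/8) / sqrt (real p)"
    using p2 by (simp add: norm_prime_powr powr_def)
  also have "\<dots> \<le> 2 / sqrt (real p)" using exp_eighth_bound by (intro divide_right_mono) auto
  finally show "norm (of_nat p powr (- s) :: complex) \<le> 2 / sqrt (real p)" .
  have "exp (1/8) / sqrt (real p) \<le> exp (1/8) / sqrt 2" using p2 by (intro divide_left_mono) auto
  thus "norm (of_nat p powr (- s) :: complex) \<le> 9 / 10" using n exp_eighth_bound by linarith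
qed

lemma unit_mult_ne_1:
  fixes z w :: complex
  assumes "norm z = 1" "norm w < 1" shows "1 - z * w \<noteq> 0"
proof
  assume "1 - z * w = 0"
  hence "norm (z * w) = 1" by simp
  thus False using assms by (simp add: norm_mult)
qed

lemma exp_log_factor:
  assumes "norm z = 1" "norm w < 1"
  shows "exp (log_factor w z) = norm (inverse (1 - z * w))"
  using unit_mult_ne_1[OF assms] by (simp add: log_factor_def exp_minus norm_inverse)

text \<open>The constant 16 makes the grid finer than the radius \<open>exp (-k) / 2\<close> of the discs on which
  Harnack's inequality is applied.\<close>

definition grid :: "nat \<Rightarrow> nat" where "grid k = nat \<lceil>16 * exp (real k)\<rceil>"

definition grid_point :: "nat \<Rightarrow> nat \<Rightarrow> complex" where
  "grid_point k i = Complex (1/2) (real i / real (grid k))"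

lemma grid_bounds: "16 * exp (real k) \<le> real (grid k)" "real (grid k) + 1 \<le> 18 * exp (real k)" "grid k > 0"
proof -
  have e: "exp (real k) \<ge> 1" by simp
  show "16 * exp (real k) \<le> real (grid k)" unfolding grid_def by linarith
  have "16 * exp (real k) \<ge> 0" by simp
  hence "real (grid k) < 16 * exp (real k) + 1" unfolding grid_def by linarith
  thus "real (grid k) + 1 \<le> 18 * exp (real k)" using e by linarith
  show "grid k > 0" using e unfolding grid_def by simp
qed

text \<open>The first crossing is sought in complex neighbourhoods of the segment that shrink with
  the scale, not on the segment itself: minimality then bounds the earlier sums on a whole disc, as
  Harnack's inequality demands. The number \<open>m\<close> is the integer part of the jump; it
  measures both how far the grid point may lie below the barrier and how large the circle average
  must be.\<close>

lemma first_crossing: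
  fixes Z :: "nat \<Rightarrow> complex" and U :: "nat \<Rightarrow> real"
  assumes Z: "\<And>p. norm (Z p) = 1" and U0: "U 0 \<ge> 0" and Umono: "\<And>j k. j \<le> k \<Longrightarrow> k \<le> N \<Longrightarrow> U j \<le> U k"
    and h: "h \<in> {0..1}" and q: "scale_of q \<le> N" and big: "U N < log_product Z (primes_upto q) (Complex (1/2) h)"
  shows "\<exists>k\<in>{1..N}. \<exists>i\<le>grid k. \<exists>m\<le>10 * q.
     (\<forall>t\<le>scale_end (k-1). log_product Z (primes_upto t) (grid_point k i) \<le> U (scale_of t)) \<and>
     U (k-1) - 7 * (real m + 1) \<le> log_product Z (primes_upto (scale_end (k-1))) (grid_point k i) \<and>
     (\<exists>t\<in>primes_upto (scale_end k) - primes_upto (scale_end (k-1)).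
        exp (30 * real m) \<le> 2 * integral {0..1} (\<lambda>x. \<Prod>p | p \<in> primes_upto (scale_end k) - primes_upto (scale_end (k-1)) \<and> p \<le> t.
           norm (inverse (1 - Z p * of_nat p powr (- (grid_point k i + exp (- real k) * cis (2 * pi * x))))) ^ 30))"
proof -
  \<comment> \<open>With radius \<open>exp (- k) / 4\<close>, the disc of radius
    \<open>exp (- k) / 2\<close> about a grid point fits into the neighbourhood of scale
    \<open>k - 1\<close>, because \<open>exp 1 \<ge> 2\<close>.\<close>
  define near where "near k s \<longleftrightarrow> (\<exists>h\<in>{0..1}. dist (Complex (1/2) h) s \<le> exp (- real k) / 4)" for k s
  have near_anti: "near j s" if "near k s" "j \<le> k" for j k s
  proof -
    have "exp (- real k) \<le> exp (- real j)" using that by simp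
    thus ?thesis using that(1) unfolding near_def by (meson divide_right_mono order_trans zero_le_numeral)
  qed
  define S where "S t s = log_product Z (primes_upto t) s" for t s
  define bad where "bad t \<longleftrightarrow> (\<exists>s. near (scale_of t) s \<and> U (scale_of t) < S t s)" for t
  have "bad q"
  proof -
    have "near (scale_of q) (Complex (1/2) h)" unfolding near_def using h by (intro bexI[of _ h]) auto
    moreover have "U (scale_of q) < S q (Complex (1/2) h)" using big Umono[OF q order_refl] by (simp add: S_def)
    ultimately show ?thesis unfolding bad_def by blast
  qed
  define t where "t = (LEAST t. bad t)"
  have t: "bad t" "t \<le> q" unfolding t_def using \<open>bad q\<close> by (auto intro: LeastI Least_le)
  have notbad: "\<not> bad t'" if "t' < t" for t' using that unfolding t_def by (rule not_less_Least)
  define k where "k = scale_of t"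
  have kN: "k \<le> N" unfolding k_def using scale_of_mono[OF t(2)] q by simp
  obtain s where s: "near k s" "U k < S t s" using t(1) unfolding bad_def k_def by blast
  have tpos: "t > 0"
  proof (rule ccontr)
    assume "\<not> t > 0"
    hence t0: "t = 0" by simp
    have "scale_of 0 \<le> 0" by (rule scale_of_least) simp
    hence "k = 0" by (simp add: k_def t0)
    moreover have "primes_upto 0 = {}" by (auto simp: primes_upto_def)
    ultimately show False using s U0 by (simp add: t0 S_def log_product_def)
  qed
  \<comment> \<open>A composite index adds no summand, and the neighbourhood for its predecessor is
    at least as large, so the least bad index is prime.\<close>
  have tpr: "prime t"
  proof (rule ccontr)
    assume np: "\<not> prime t"
    have "primes_upto t = primes_upto (t - 1)"
    proof -
      have "p \<le> t - 1" if "prime p" "p \<le> t" for p using that np by (cases "p = t") auto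
      thus ?thesis by (auto simp: primes_upto_def)
    qed
    hence "S (t - 1) s = S t s" by (simp add: S_def)
    moreover have sc: "scale_of (t - 1) \<le> k" unfolding k_def by (rule scale_of_mono) simp
    ultimately have "bad (t - 1)" unfolding bad_def using s near_anti[OF s(1) sc] Umono[OF sc kN] by (intro exI[of _ s]) auto
    thus False using notbad[of "t - 1"] tpos by simp
  qed
  have k1: "k \<ge> 1"
  proof (rule ccontr)
    assume "\<not> k \<ge> 1"
    hence "scale_of t = 0" by (simp add: k_def)
    hence "t \<le> scale_end 0" using scale_of_le[of t] by metis
    thus False using prime_ge_2_nat[OF tpr] by (simp add: scale_end_0)
  qed
  define e where "e = scale_end (k - 1)"
  have et: "e < t" unfolding e_def using k1 by (intro scale_of_gt) (simp add: k_def)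
  have tek: "t \<le> scale_end k" unfolding k_def by (rule scale_of_le)
  have sce: "scale_of e \<le> k - 1" unfolding e_def by (rule scale_of_least) simp
  \<comment> \<open>Earlier scales have larger neighbourhoods, so minimality covers the
    neighbourhood of scale \<open>k - 1\<close> for all indices up to \<open>e\<close> at
    once.\<close>
  have good: "S t' z \<le> U (scale_of t')" if "t' \<le> e" "near (k - 1) z" for t' z
  proof -
    have "scale_of t' \<le> k - 1" using scale_of_mono[OF that(1)] sce by simp
    hence "near (scale_of t') z" using near_anti[OF that(2)] by simp
    thus ?thesis using notbad[of t'] that et unfolding bad_def by (auto simp: not_less)
  qed
  have goodk: "S e z \<le> U (k - 1)" if "near (k - 1) z" for z
  proof -
    have "U (scale_of e) \<le> U (k - 1)" using kN by (intro Umono[OF sce]) simp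
    thus ?thesis using good[OF order_refl that] by simp
  qed
  define J where "J = primes_upto (scale_end k) - primes_upto e"
  define Jt where "Jt = {p. p \<in> J \<and> p \<le> t}"
  have finJ: "finite J" "finite Jt" by (auto simp: J_def Jt_def)
  have ut: "primes_upto t = primes_upto e \<union> Jt" "primes_upto e \<inter> Jt = {}"
    using et tek by (auto simp: J_def Jt_def primes_upto_def)
  have JtJ: "Jt \<subseteq> primes_upto (scale_end k)" by (auto simp: J_def Jt_def)
  define \<xi> where "\<xi> = log_product Z Jt s"
  have split: "S t s = S e s + \<xi>"
    unfolding S_def \<xi>_def log_product_def ut(1) using finJ ut(2) by (intro sum.union_disjoint) auto
  have near_k1: "near (k - 1) s" by (rule near_anti[OF s(1)]) simp
  have xi_pos: "\<xi> > 0"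
    using split s(2) goodk[OF near_k1] Umono[of "k - 1" k] kN by simp
  have Se: "U (k - 1) - S e s \<le> \<xi>" using split s(2) Umono[of "k - 1" k] kN by simp
  obtain h0 where h0: "h0 \<in> {0..1}" "dist (Complex (1/2) h0) s \<le> exp (- real k) / 4" using s(1) unfolding near_def by blast
  define i where "i = nat \<lfloor>h0 * real (grid k)\<rfloor>"
  define c where "c = grid_point k i"
  have gp: "real (grid k) > 0" using grid_bounds by simp
  have i1: "real i \<le> h0 * real (grid k)" "h0 * real (grid k) < real i + 1"
    using h0 gp by (auto simp: i_def)
  have ig: "i \<le> grid k"
  proof -
    have "h0 * real (grid k) \<le> 1 * real (grid k)" using h0 gp by (intro mult_right_mono) auto
    thus ?thesis using i1 by simp
  qed
  have hi: "real i / real (grid k) \<in> {0..1}" using ig gp by simp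
  have "h0 - real i / real (grid k) = (h0 * real (grid k) - real i) / real (grid k)" using gp by (simp add: field_simps)
  hence "\<bar>h0 - real i / real (grid k)\<bar> = \<bar>h0 * real (grid k) - real i\<bar> / real (grid k)" by simp
  also have "\<dots> \<le> 1 / real (grid k)" using i1 by (intro divide_right_mono) auto
  finally have "\<bar>h0 - real i / real (grid k)\<bar> \<le> 1 / real (grid k)" .
  also have "1 / real (grid k) \<le> 1 / (16 * exp (real k))" using grid_bounds(1)[of k] gp by (intro divide_left_mono) auto
  also have "\<dots> = exp (- real k) / 16" by (simp add: exp_minus field_simps)
  finally have "\<bar>h0 - real i / real (grid k)\<bar> \<le> exp (- real k) / 16" .
  hence "dist (Complex (1/2) h0) c \<le> exp (- real k) / 16"
    by (simp add: c_def grid_point_def dist_complex_def cmod_def)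
  \<comment> \<open>\<open>5/16 = 1/4 + 1/16\<close> is below \<open>3/8 = 3/4 * 1/2\<close>, which
    Harnack's inequality allows for \<open>R = exp (- k) / 2\<close>, and below the
    \<open>1/2\<close> needed for the average over the circle of radius
    \<open>exp (- k)\<close>.\<close>
  hence dcs: "dist c s \<le> 5 / 16 * exp (- real k)"
    using h0(2) dist_triangle[of c s "Complex (1/2) h0"] by (simp add: dist_commute)
  define R where "R = exp (- real k) / 2"
  have R: "R > 0" by (simp add: R_def)
  have ek: "exp (- real (k - 1)) \<ge> 2 * exp (- real k)"
  proof -
    have "exp (- real (k - 1)) = exp 1 * exp (- real k)" using k1 by (simp add: of_nat_diff flip: exp_add)
    moreover have "exp (1::real) \<ge> 2" using exp_ge_add_one_self[of "1::real"] by simp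
    ultimately show ?thesis by (simp add: mult_right_mono)
  qed
  have near_ball: "near (k - 1) z" if "dist c z \<le> R" for z
  proof -
    have "dist (Complex (1/2) (real i / real (grid k))) z \<le> exp (- real (k - 1)) / 4"
      using that ek by (simp add: R_def c_def grid_point_def)
    thus ?thesis unfolding near_def using hi by blast
  qed
  have nb: "norm (of_nat p powr (- z) :: complex) \<le> 9 / 10" if "p \<in> primes_upto (scale_end k)" "dist c z \<le> exp (- real k)" for p z
    using norm_prime_powr_le(2)[OF that(1)] that(2) by (simp add: c_def grid_point_def)
  have eJ: "primes_upto e \<subseteq> primes_upto (scale_end k)" unfolding e_def by (intro primes_upto_mono scale_end_mono) simp
  define g where "g z = of_real (U (k - 1)) + (\<Sum>p\<in>primes_upto e. Ln (1 - Z p * of_nat p powr (- z)))" for z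
  have g_hol: "g holomorphic_on ball c R"
    unfolding g_def
  proof (intro holomorphic_intros)
    fix z p assume z: "z \<in> ball c R" and p: "p \<in> primes_upto e"
    have "dist c z < R" using z by simp
    hence zk: "dist c z \<le> exp (- real k)" using exp_gt_zero[of "- real k"] unfolding R_def by linarith
    have "norm (of_nat p powr (- z) :: complex) \<le> 9/10" using nb[OF _ zk] p eJ by auto
    hence "norm (Z p * of_nat p powr (- z)) < 1" using Z by (simp add: norm_mult)
    hence "Re (1 - Z p * of_nat p powr (- z)) > 0" using complex_Re_le_cmod[of "Z p * of_nat p powr (- z)"] by simp
    thus "1 - Z p * of_nat p powr (- z) \<notin> \<real>\<^sub>\<le>\<^sub>0" by (auto simp: complex_nonpos_Reals_iff)
  qed
  have g_Re: "Re (g z) = U (k - 1) - S e z" if "dist c z \<le> R" for z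
  proof -
    have "Re (Ln (1 - Z p * of_nat p powr (- z))) = - log_factor (of_nat p powr (- z)) (Z p)" if p: "p \<in> primes_upto e" for p
    proof -
      have "dist c z \<le> exp (- real k)" using \<open>dist c z \<le> R\<close> exp_gt_zero[of "- real k"] unfolding R_def by linarith
      hence "norm (of_nat p powr (- z) :: complex) \<le> 9/10" using nb[of p z] p eJ by blast
      thus ?thesis using log_factor_eq_Re_Ln[of "Z p" "of_nat p powr (- z)"] Z by simp
    qed
    thus ?thesis by (simp add: g_def S_def log_product_def sum_negf)
  qed
  txt \<open>\<open>Re g\<close> is the distance of the partial sum to the barrier, which is nonnegative near \<open>c\<close> by minimality of \<open>t\<close>.\<close>
  have "Re (g c) \<le> 7 * Re (g s)"
  proof (rule harnack_inequality[OF g_hol R])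
    show "Re (g z) \<ge> 0" if "z \<in> ball c R" for z
      using that goodk[OF near_ball[of z]] g_Re[of z] by simp
    show "dist c s \<le> 3 / 4 * R" using dcs exp_gt_zero[of "- real k"] unfolding R_def by linarith
  qed
  moreover have "Re (g c) = U (k - 1) - S e c" using R by (intro g_Re) simp
  moreover have "dist c s \<le> R" using dcs exp_gt_zero[of "- real k"] unfolding R_def by linarith
  hence "Re (g s) = U (k - 1) - S e s" by (rule g_Re)
  ultimately have Sc: "U (k - 1) - 7 * \<xi> \<le> S e c" using Se by linarith
  define m where "m = nat \<lfloor>\<xi>\<rfloor>"
  have m: "real m \<le> \<xi>" "\<xi> \<le> real m + 1" using xi_pos unfolding m_def by linarith+
  have dk: "dist c s \<le> exp (- real k)" using dcs exp_gt_zero[of "- real k"] by linarith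
  \<comment> \<open>This crude bound makes the set of possible \<open>m\<close> finite, as the union
    bound requires.\<close>
  have mq: "m \<le> 10 * q"
  proof -
    have "\<xi> \<le> (\<Sum>p\<in>Jt. 10)"
      unfolding \<xi>_def log_product_def
    proof (rule sum_mono)
      fix p assume p: "p \<in> Jt"
      have "norm (of_nat p powr (- s) :: complex) \<le> 9/10" using nb[OF _ dk] p JtJ by auto
      thus "log_factor (of_nat p powr (- s)) (Z p) \<le> 10" using log_factor_linear_approx(2)[of "Z p" "of_nat p powr (- s)"] Z by simp
    qed
    also have "\<dots> = 10 * real (card Jt)" by simp
    also have "card Jt \<le> card {1..q}"
      using t(2) by (intro card_mono) (auto simp: Jt_def J_def primes_upto_def Suc_le_eq prime_gt_0_nat)
    hence "10 * real (card Jt) \<le> 10 * real q" by simp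
    finally show ?thesis using m(1) by (simp flip: of_nat_le_iff[where 'a=real])
  qed
  \<comment> \<open>The 30th power is taken inside the holomorphic function, so the circle average
    bounds \<open>exp (30 * \<xi>)\<close> directly.\<close>
  define G where "G z = (\<Prod>p\<in>Jt. inverse (1 - Z p * of_nat p powr (- z)) ^ 30)" for z
  have G_hol: "G holomorphic_on cball c (exp (- real k))"
    unfolding G_def
  proof (intro holomorphic_intros)
    fix z p assume z: "z \<in> cball c (exp (- real k))" and p: "p \<in> Jt"
    have "norm (of_nat p powr (- z) :: complex) \<le> 9/10" using nb[of p z] z p JtJ by auto
    thus "1 - Z p * of_nat p powr (- z) \<noteq> 0" using Z by (intro unit_mult_ne_1) auto
  qed
  have G1: "norm (G s) \<le> 2 * integral {0..1} (\<lambda>x. norm (G (c + exp (- real k) * cis (2 * pi * x))))"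
    by (rule circle_sup_bound[OF G_hol]) (use dcs exp_gt_zero[of "- real k"] in linarith)+
  have G2: "norm (G s) = exp (30 * \<xi>)"
  proof -
    have "norm (G s) = (\<Prod>p\<in>Jt. exp (log_factor (of_nat p powr (- s)) (Z p)) ^ 30)"
      unfolding G_def prod_norm[symmetric]
    proof (intro prod.cong refl)
      fix p assume p: "p \<in> Jt"
      have "norm (of_nat p powr (- s) :: complex) \<le> 9/10" using nb[OF _ dk] p JtJ by auto
      thus "norm (inverse (1 - Z p * of_nat p powr (- s)) ^ 30) = exp (log_factor (of_nat p powr (- s)) (Z p)) ^ 30"
        using exp_log_factor[of "Z p" "of_nat p powr (- s)"] Z by (simp add: norm_power)
    qed
    also have "\<dots> = exp (30 * \<xi>)"
      unfolding \<xi>_def log_product_def using finJ by (simp add: exp_sum sum_distrib_left flip: exp_of_nat_mult)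
    finally show ?thesis .
  qed
  have G3: "exp (30 * real m) \<le> exp (30 * \<xi>)" using m by simp
  have G4: "norm (G z) = (\<Prod>p\<in>Jt. norm (inverse (1 - Z p * of_nat p powr (- z))) ^ 30)" for z
    unfolding G_def by (simp add: norm_power flip: prod_norm)
  have sup: "exp (30 * real m) \<le> 2 * integral {0..1} (\<lambda>x. \<Prod>p\<in>Jt. norm (inverse (1 - Z p * of_nat p powr (- (c + exp (- real k) * cis (2 * pi * x))))) ^ 30)"
    using G1[unfolded G2, unfolded G4] G3 by linarith
  have xi_m: "u - 7 * (real m + 1) \<le> v" if "u - 7 * \<xi> \<le> v" for u v
  proof -
    have "u - 7 * (real m + 1) \<le> u - 7 * \<xi>" using m(2) by (intro diff_left_mono mult_left_mono) auto
    thus ?thesis using that by (rule order_trans)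
  qed
  show ?thesis
  proof (rule bexI[of _ k], rule exI[of _ i], rule conjI[OF ig], rule exI[of _ m], intro conjI mq allI impI)
    show "k \<in> {1..N}" using k1 kN by simp
    show "log_product Z (primes_upto t') (grid_point k i) \<le> U (scale_of t')" if "t' \<le> scale_end (k - 1)" for t'
      using good[of t' c] near_ball[of c] R that unfolding e_def[symmetric] S_def c_def by simp
    show "U (k - 1) - 7 * (real m + 1) \<le> log_product Z (primes_upto (scale_end (k - 1))) (grid_point k i)"
      using xi_m[OF Sc] by (simp add: e_def S_def c_def)
    have "t \<in> J" using tpr tek et by (auto simp: J_def primes_upto_def)
    thus "\<exists>t\<in>primes_upto (scale_end k) - primes_upto (scale_end (k-1)).
        exp (30 * real m) \<le> 2 * integral {0..1} (\<lambda>x. \<Prod>p | p \<in> primes_upto (scale_end k) - primes_upto (scale_end (k-1)) \<and> p \<le> t.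
           norm (inverse (1 - Z p * of_nat p powr (- (grid_point k i + exp (- real k) * cis (2 * pi * x))))) ^ 30)"
      using sup unfolding Jt_def J_def e_def c_def by blast
  qed
qed

subsection \<open>Probability of a crossing in a given block\<close>

lemma borel_measurable_powr_const [measurable]:
  fixes c :: complex
  assumes [measurable]: "g \<in> borel_measurable M"
  shows "(\<lambda>x. c powr g x) \<in> borel_measurable M"
  by (cases "c = 0") (simp_all add: powr_def)

locale unit_variable = prob_space M for M :: "'a measure" +
  fixes Z :: "'a \<Rightarrow> complex"
  assumes Z_meas [measurable]: "Z \<in> borel_measurable M"
    and Z_distr: "distr M borel Z = uniform_circle"
    and Z_norm: "\<And>\<omega>. \<omega> \<in> space M \<Longrightarrow> norm (Z \<omega>) = 1"
begin

lemma expectation_Z: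
  fixes g :: "complex \<Rightarrow> real"
  assumes "g \<in> borel_measurable borel"
  shows "expectation (\<lambda>\<omega>. g (Z \<omega>)) = (\<integral>z. g z \<partial>uniform_circle)"
  using integral_distr[OF Z_meas assms] by (simp add: Z_distr)

lemma small_var_log_factor:
  assumes w: "w \<noteq> 0" "norm w \<le> 9/10"
  shows "small_var M (\<lambda>\<omega>. log_factor w (Z \<omega>)) (norm w)"
  unfolding small_var_def
proof (intro conjI)
  show "(\<lambda>\<omega>. log_factor w (Z \<omega>)) \<in> borel_measurable M" by measurable
  show "\<forall>\<omega>\<in>space M. \<bar>log_factor w (Z \<omega>)\<bar> \<le> 10 * norm w"
    using log_factor_linear_approx(2) w Z_norm by blast
  show "expectation (\<lambda>\<omega>. log_factor w (Z \<omega>)) = 0"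
    using expectation_Z[OF log_factor_measurable, of w] log_factor_mean[OF w(2)] by simp
  show "\<bar>expectation (\<lambda>\<omega>. (log_factor w (Z \<omega>))\<^sup>2) - (norm w)\<^sup>2 / 2\<bar> \<le> 110 * norm w ^ 3"
    by (subst expectation_Z[of "\<lambda>z. (log_factor w z)\<^sup>2"]) (auto intro: log_factor_second_moment w)
qed (use w in auto)

text \<open>The linear term of the expansion has mean 0, so the moment is 1 plus a quadratic error.
  Here \<open>270 = 30 * 9\<close> and \<open>90000 = (30 * 10)^2\<close> come from the bounds on
  \<open>log_factor\<close>.\<close>

lemma inverse_power_moment:
  assumes w: "norm w \<le> 9/10"
  shows "1 \<le> expectation (\<lambda>\<omega>. norm (inverse (1 - Z \<omega> * w)) ^ 30)"
    and "expectation (\<lambda>\<omega>. norm (inverse (1 - Z \<omega> * w)) ^ 30) \<le> exp (90000 * exp 270 * (norm w)\<^sup>2)"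
    and "\<omega> \<in> space M \<Longrightarrow> norm (inverse (1 - Z \<omega> * w)) ^ 30 \<le> exp 270"
proof -
  show "1 \<le> expectation (\<lambda>\<omega>. norm (inverse (1 - Z \<omega> * w)) ^ 30)"
    using inverse_power_circle_ge_1[OF w, of 30] by (subst expectation_Z[of "\<lambda>z. norm (inverse (1 - z * w)) ^ 30"]) auto
  have eq: "norm (inverse (1 - Z \<omega> * w)) ^ 30 = exp (30 * log_factor w (Z \<omega>))" if "\<omega> \<in> space M" for \<omega>
    using exp_log_factor[of "Z \<omega>" w] Z_norm[OF that] w exp_of_nat_mult[of 30 "log_factor w (Z \<omega>)"] by simp
  have b: "\<bar>log_factor w (Z \<omega>)\<bar> \<le> 10 * norm w" "\<bar>log_factor w (Z \<omega>)\<bar> \<le> 9" if "\<omega> \<in> space M" for \<omega>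
    using log_factor_linear_approx(2)[OF Z_norm[OF that] w] w by linarith+
  show le: "norm (inverse (1 - Z \<omega> * w)) ^ 30 \<le> exp 270" if "\<omega> \<in> space M" for \<omega>
    using b(2)[OF that] by (simp add: eq[OF that])
  have "expectation (\<lambda>\<omega>. norm (inverse (1 - Z \<omega> * w)) ^ 30) \<le> expectation (\<lambda>\<omega>. 1 + 30 * log_factor w (Z \<omega>) + 90000 * (norm w)\<^sup>2 * exp 270)"
  proof (rule integral_mono)
    show "integrable M (\<lambda>\<omega>. norm (inverse (1 - Z \<omega> * w)) ^ 30)"
      using le by (intro integrable_bounded[of _ "exp 270"]) auto
    have "integrable M (\<lambda>\<omega>. log_factor w (Z \<omega>))" using b by (intro integrable_bounded[of _ 9]) auto
    thus "integrable M (\<lambda>\<omega>. 1 + 30 * log_factor w (Z \<omega>) + 90000 * (norm w)\<^sup>2 * exp 270)" by simp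
    fix \<omega> assume w': "\<omega> \<in> space M"
    define u where "u = 30 * log_factor w (Z \<omega>)"
    have "\<bar>u\<bar> \<le> 300 * norm w" "\<bar>u\<bar> \<le> 270" using b[OF w'] by (auto simp: u_def)
    have "u\<^sup>2 = \<bar>u\<bar> * \<bar>u\<bar>" by (simp add: power2_eq_square)
    also have "\<dots> \<le> (300 * norm w) * (300 * norm w)" using \<open>\<bar>u\<bar> \<le> 300 * norm w\<close> by (intro mult_mono) auto
    finally have "u\<^sup>2 * exp \<bar>u\<bar> \<le> 90000 * (norm w)\<^sup>2 * exp 270"
      using \<open>\<bar>u\<bar> \<le> 270\<close> by (intro mult_mono) (auto simp: power2_eq_square)
    moreover have "exp u \<le> 1 + u + u\<^sup>2 * exp \<bar>u\<bar>" using exp_taylor1[of u] by linarith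
    ultimately show "norm (inverse (1 - Z \<omega> * w)) ^ 30 \<le> 1 + 30 * log_factor w (Z \<omega>) + 90000 * (norm w)\<^sup>2 * exp 270"
      by (simp add: eq[OF w'] u_def)
  qed
  also have "\<dots> = 1 + 90000 * (norm w)\<^sup>2 * exp 270"
  proof -
    have "integrable M (\<lambda>\<omega>. log_factor w (Z \<omega>))" using b by (intro integrable_bounded[of _ 9]) auto
    moreover have "expectation (\<lambda>\<omega>. log_factor w (Z \<omega>)) = 0"
      using expectation_Z[OF log_factor_measurable, of w] log_factor_mean[OF w] by simp
    ultimately show ?thesis using prob_space by simp
  qed
  also have "\<dots> \<le> exp (90000 * exp 270 * (norm w)\<^sup>2)"
    using exp_ge_add_one_self[of "90000 * exp 270 * (norm w)\<^sup>2"] by (simp add: mult_ac)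
  finally show "expectation (\<lambda>\<omega>. norm (inverse (1 - Z \<omega> * w)) ^ 30) \<le> exp (90000 * exp 270 * (norm w)\<^sup>2)" .
qed

end

lemma (in prob_space) prob_indep_disjoint:
  fixes X :: "'i \<Rightarrow> 'a \<Rightarrow> 'b::topological_space"
  assumes ind: "indep_vars (\<lambda>_. borel) X I" and JK: "J \<inter> K = {}" "J \<subseteq> I" "K \<subseteq> I"
    and F: "{x \<in> space (PiM J (\<lambda>_. borel)). PF x} \<in> sets (PiM J (\<lambda>_. borel))" "\<And>x. PF (restrict x J) = PF x"
    and R: "{x \<in> space (PiM K (\<lambda>_. borel)). PR x} \<in> sets (PiM K (\<lambda>_. borel))" "\<And>x. PR (restrict x K) = PR x"
  shows "{\<omega>\<in>space M. PF (\<lambda>i. X i \<omega>) \<and> PR (\<lambda>i. X i \<omega>)} \<in> sets M"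
    and "prob {\<omega>\<in>space M. PF (\<lambda>i. X i \<omega>) \<and> PR (\<lambda>i. X i \<omega>)} = prob {\<omega>\<in>space M. PF (\<lambda>i. X i \<omega>)} * prob {\<omega>\<in>space M. PR (\<lambda>i. X i \<omega>)}"
proof -
  let ?f = "\<lambda>x. indicator {x. PF x} x :: real" and ?r = "\<lambda>x. indicator {x. PR x} x :: real"
  have rv: "i \<in> I \<Longrightarrow> X i \<in> borel_measurable M" for i using ind by (auto simp: indep_vars_def)
  have ms: "{\<omega>\<in>space M. Q (\<lambda>i. X i \<omega>)} \<in> sets M" and mi: "(\<lambda>x. indicator {x. Q x} x :: real) \<in> borel_measurable (PiM L (\<lambda>_. borel))"
    if m: "{x \<in> space (PiM L (\<lambda>_. borel)). Q x} \<in> sets (PiM L (\<lambda>_. borel))" and r: "\<And>x. Q (restrict x L) = Q x" and L: "L \<subseteq> I" for Q L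
  proof -
    have rM: "(\<lambda>\<omega>. restrict (\<lambda>i. X i \<omega>) L) \<in> measurable M (PiM L (\<lambda>_. borel))"
      using L by (intro measurable_restrict rv) auto
    have "{\<omega>\<in>space M. Q (\<lambda>i. X i \<omega>)} = (\<lambda>\<omega>. restrict (\<lambda>i. X i \<omega>) L) -` {x \<in> space (PiM L (\<lambda>_. borel)). Q x} \<inter> space M"
      using measurable_space[OF rM] by (auto simp: r)
    thus "{\<omega>\<in>space M. Q (\<lambda>i. X i \<omega>)} \<in> sets M" using measurable_sets[OF rM m] by simp
    have "(\<lambda>x. indicator {x \<in> space (PiM L (\<lambda>_. borel)). Q x} x :: real) \<in> borel_measurable (PiM L (\<lambda>_. borel))"
      using m by measurable
    also have "?this \<longleftrightarrow> (\<lambda>x. indicator {x. Q x} x :: real) \<in> borel_measurable (PiM L (\<lambda>_. borel))"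
      by (intro measurable_cong) (auto simp: indicator_def)
    finally show "(\<lambda>x. indicator {x. Q x} x :: real) \<in> borel_measurable (PiM L (\<lambda>_. borel))" .
  qed
  have sF: "{\<omega>\<in>space M. PF (\<lambda>i. X i \<omega>)} \<in> sets M" by (rule ms[OF F JK(2)])
  have sR: "{\<omega>\<in>space M. PR (\<lambda>i. X i \<omega>)} \<in> sets M" by (rule ms[OF R JK(3)])
  have "{\<omega>\<in>space M. PF (\<lambda>i. X i \<omega>)} \<inter> {\<omega>\<in>space M. PR (\<lambda>i. X i \<omega>)} \<in> sets M" using sF sR by auto
  also have i: "{\<omega>\<in>space M. PF (\<lambda>i. X i \<omega>)} \<inter> {\<omega>\<in>space M. PR (\<lambda>i. X i \<omega>)} = {\<omega>\<in>space M. PF (\<lambda>i. X i \<omega>) \<and> PR (\<lambda>i. X i \<omega>)}" by auto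
  finally show sFR: "{\<omega>\<in>space M. PF (\<lambda>i. X i \<omega>) \<and> PR (\<lambda>i. X i \<omega>)} \<in> sets M" .
  have ex: "expectation (\<lambda>\<omega>. indicator {x. Q x} (\<lambda>i. X i \<omega>)) = prob {\<omega>\<in>space M. Q (\<lambda>i. X i \<omega>)}"
    "integrable M (\<lambda>\<omega>. indicator {x. Q x} (\<lambda>i. X i \<omega>) :: real)" if "{\<omega>\<in>space M. Q (\<lambda>i. X i \<omega>)} \<in> sets M" for Q
  proof -
    have "expectation (\<lambda>\<omega>. indicator {x. Q x} (\<lambda>i. X i \<omega>)) = expectation (indicator {\<omega>\<in>space M. Q (\<lambda>i. X i \<omega>)})"
      by (intro Bochner_Integration.integral_cong) (auto simp: indicator_def)
    also have "\<dots> = prob {\<omega>\<in>space M. Q (\<lambda>i. X i \<omega>)}" using that by (subst Bochner_Integration.integral_indicator) (auto simp: emeasure_eq_measure Int_absorb2)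
    finally show "expectation (\<lambda>\<omega>. indicator {x. Q x} (\<lambda>i. X i \<omega>)) = prob {\<omega>\<in>space M. Q (\<lambda>i. X i \<omega>)}" .
    have "integrable M (indicator {\<omega>\<in>space M. Q (\<lambda>i. X i \<omega>)} :: _ \<Rightarrow> real)"
      using that by (intro integrable_real_indicator) (auto simp: emeasure_eq_measure)
    also have "?this \<longleftrightarrow> integrable M (\<lambda>\<omega>. indicator {x. Q x} (\<lambda>i. X i \<omega>) :: real)"
      by (intro Bochner_Integration.integrable_cong) (auto simp: indicator_def)
    finally show "integrable M (\<lambda>\<omega>. indicator {x. Q x} (\<lambda>i. X i \<omega>) :: real)" .
  qed
  have "expectation (\<lambda>\<omega>. ?f (\<lambda>i. X i \<omega>) * ?r (\<lambda>i. X i \<omega>)) = expectation (\<lambda>\<omega>. ?f (\<lambda>i. X i \<omega>)) * expectation (\<lambda>\<omega>. ?r (\<lambda>i. X i \<omega>))"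
    by (intro indep_disjoint_expectation_mult[OF ind JK mi[OF F JK(2)] _ mi[OF R JK(3)] _ ex(2)[OF sF] ex(2)[OF sR]])
       (auto simp: indicator_def F(2)[unfolded restrict_def] R(2)[unfolded restrict_def] F(2) R(2))
  moreover have "expectation (\<lambda>\<omega>. ?f (\<lambda>i. X i \<omega>) * ?r (\<lambda>i. X i \<omega>)) = expectation (\<lambda>\<omega>. indicator {x. PF x \<and> PR x} (\<lambda>i. X i \<omega>))"
    by (intro Bochner_Integration.integral_cong) (auto simp: indicator_def)
  ultimately show "prob {\<omega>\<in>space M. PF (\<lambda>i. X i \<omega>) \<and> PR (\<lambda>i. X i \<omega>)} = prob {\<omega>\<in>space M. PF (\<lambda>i. X i \<omega>)} * prob {\<omega>\<in>space M. PR (\<lambda>i. X i \<omega>)}"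
    using ex(1)[OF sFR] ex(1)[OF sF] ex(1)[OF sR] by simp
qed

section \<open>The two events that make up a crossing\<close>

definition block_primes :: "nat \<Rightarrow> nat set" where
  "block_primes k = primes_upto (scale_end k) - primes_upto (scale_end (k - 1))"

definition block_circle :: "nat \<Rightarrow> nat \<Rightarrow> nat \<Rightarrow> real \<Rightarrow> complex" where
  "block_circle k i p x = of_nat p powr (- (grid_point k i + exp (- real k) * cis (2 * pi * x)))"

text \<open>Phrased through the average over a circle instead of the jump at a point, the event
  admits a moment bound and depends on the primes of the block alone.\<close>

definition block_large :: "nat \<Rightarrow> nat \<Rightarrow> nat \<Rightarrow> (nat \<Rightarrow> complex) \<Rightarrow> bool" where
  "block_large k i m Z \<longleftrightarrow> (\<exists>t\<in>block_primes k. exp (30 * real m) / 2 \<le>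
     (\<integral>x. (\<Prod>p | p \<in> block_primes k \<and> p \<le> t. norm (inverse (1 - Z p * block_circle k i p x)) ^ 30) \<partial>uniform_measure lborel {0..1}))"

definition barrier_hit :: "nat \<Rightarrow> complex \<Rightarrow> (nat \<Rightarrow> real) \<Rightarrow> real \<Rightarrow> (nat \<Rightarrow> complex) \<Rightarrow> bool" where
  "barrier_hit k c U b Z \<longleftrightarrow> (\<forall>t\<le>scale_end k. log_product Z (primes_upto t) c \<le> U (scale_of t)) \<and>
     U k - b \<le> log_product Z (primes_upto (scale_end k)) c"

lemma block_circle_bounds:
  assumes "p \<in> primes_upto (scale_end k)"
  shows "norm (block_circle k i p x) \<le> 2 / sqrt (real p)" "norm (block_circle k i p x) \<le> 9 / 10"
proof -
  have "dist (Complex (1/2) (real i / real (grid k))) (grid_point k i + exp (- real k) * cis (2 * pi * x)) \<le> exp (- real k)"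
    by (simp add: grid_point_def dist_norm norm_mult)
  from norm_prime_powr_le[OF assms this]
  show "norm (block_circle k i p x) \<le> 2 / sqrt (real p)" "norm (block_circle k i p x) \<le> 9 / 10"
    by (simp_all add: block_circle_def)
qed

lemma block_circle_measurable [measurable]: "(\<lambda>x. block_circle k i p x) \<in> borel_measurable borel"
  unfolding block_circle_def by measurable

lemma block_circle_continuous: "p > 0 \<Longrightarrow> continuous_on S (\<lambda>x. block_circle k i p x)"
  unfolding block_circle_def powr_def by (auto intro!: continuous_intros)

lemma integral_block_circle:
  assumes Z: "\<And>p. norm (Z p) = 1" and K: "K \<subseteq> primes_upto (scale_end k)"
  shows "integral {0..1} (\<lambda>x. \<Prod>p\<in>K. norm (inverse (1 - Z p * block_circle k i p x)) ^ 30)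
     = (\<integral>x. (\<Prod>p\<in>K. norm (inverse (1 - Z p * block_circle k i p x)) ^ 30) \<partial>uniform_measure lborel {0..1})"
proof (rule integral_uniform_unit_interval[symmetric])
  show "(\<lambda>x. \<Prod>p\<in>K. norm (inverse (1 - Z p * block_circle k i p x)) ^ 30) \<in> borel_measurable borel" by measurable
  show "continuous_on {0..1} (\<lambda>x. \<Prod>p\<in>K. norm (inverse (1 - Z p * block_circle k i p x)) ^ 30)"
  proof (intro continuous_intros block_circle_continuous ballI)
    fix p x assume p: "p \<in> K"
    thus "p > 0" using K primes_upto_ge_2[of p] by force
    have "norm (block_circle k i p x) \<le> 9 / 10" using p K by (intro block_circle_bounds) auto
    thus "1 - Z p * block_circle k i p x \<noteq> 0" using Z by (intro unit_mult_ne_1) auto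
  qed
qed

lemma restrict_cong_log_product: "K \<subseteq> L \<Longrightarrow> log_product (restrict z L) K s = log_product z K s"
  unfolding log_product_def by (intro sum.cong) auto

text \<open>The reciprocal sum over one block is at most \<open>1 + 2 * CT\<close>, so the expected
  30th power of the product is bounded uniformly in the block, and the maximal inequality yields
  \<open>exp (- 30 * m)\<close>.\<close>

lemma block_large_bound:
  "\<exists>C>0. \<forall>(M::'a measure) Z k i m. prob_space M \<longrightarrow> prob_space.indep_vars M (\<lambda>_. borel) Z {p. prime p} \<longrightarrow>
     (\<forall>p. prime p \<longrightarrow> unit_variable M (Z p)) \<longrightarrow> k \<ge> 1 \<longrightarrow>
     {z\<in>space (PiM (block_primes k) (\<lambda>_. borel)). block_large k i m z} \<in> sets (PiM (block_primes k) (\<lambda>_. borel)) \<and>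
     measure M {\<omega>\<in>space M. block_large k i m (\<lambda>p. Z p \<omega>)} \<le> C * exp (- 30 * real m)"
proof -
  obtain CT where CT: "CT \<ge> 0" "\<And>k. \<bar>recip_sum (scale_end k) - real k\<bar> \<le> CT"
    using recip_sum_scale_end by blast
  define e where "e p = 90000 * exp 270 * (4 / real p)" for p
  define C where "C = 2 * exp (90000 * exp 270 * 4 * (1 + 2 * CT))"
  show ?thesis
  proof (intro exI[of _ C] conjI allI impI)
    fix M :: "'a measure" and Z :: "nat \<Rightarrow> 'a \<Rightarrow> complex" and k i m :: nat
    assume "prob_space M"
    then interpret prob_space M .
    assume ind: "indep_vars (\<lambda>_. borel) Z {p. prime p}" and uv: "\<forall>p. prime p \<longrightarrow> unit_variable M (Z p)" and k: "k \<ge> 1"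
    define J where "J = block_primes k"
    have J: "finite J" "J \<subseteq> {p. prime p}" "J \<subseteq> primes_upto (scale_end k)" by (auto simp: J_def block_primes_def primes_upto_def)
    define g where "g p z x = norm (inverse (1 - z * block_circle k i p x)) ^ 30" for p z x
    define u where "u = exp (30 * real m) / 2"
    define N where "N = uniform_measure lborel {0..1::real}"
    have sN[measurable_cong]: "sets N = sets borel" by (simp add: N_def)
    have indJ: "indep_vars (\<lambda>_. borel) Z J" by (rule indep_vars_subset[OF ind J(2)])
    have eb: "exp (90000 * exp 270 * (norm (block_circle k i p x))\<^sup>2) \<le> exp (e p)" if "p \<in> J" for p x
    proof -
      have "(norm (block_circle k i p x))\<^sup>2 \<le> (2 / sqrt (real p))\<^sup>2" using block_circle_bounds(1) J(3) that by (intro power_mono) auto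
      also have "\<dots> = 4 / real p" by (simp add: power_divide)
      finally have "90000 * exp 270 * (norm (block_circle k i p x))\<^sup>2 \<le> e p" unfolding e_def by (intro mult_left_mono) auto
      thus ?thesis by simp
    qed
    have mg: "(\<lambda>(z, x). g p z x) \<in> borel_measurable (borel \<Otimes>\<^sub>M N)" if "p \<in> J" for p
      unfolding g_def by measurable
    have mom: "1 \<le> expectation (\<lambda>\<omega>. g p (Z p \<omega>) x)" "expectation (\<lambda>\<omega>. g p (Z p \<omega>) x) \<le> exp (e p)"
      "\<omega> \<in> space M \<Longrightarrow> g p (Z p \<omega>) x \<le> exp 270" if p: "p \<in> J" for p x \<omega>
    proof -
      interpret Z: unit_variable M "Z p" using uv J(2) p by auto
      have b: "norm (block_circle k i p x) \<le> 9/10" using block_circle_bounds(2) J(3) p by auto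
      show "1 \<le> expectation (\<lambda>\<omega>. g p (Z p \<omega>) x)" "\<omega> \<in> space M \<Longrightarrow> g p (Z p \<omega>) x \<le> exp 270"
        unfolding g_def using Z.inverse_power_moment[OF b] by auto
      show "expectation (\<lambda>\<omega>. g p (Z p \<omega>) x) \<le> exp (e p)"
        unfolding g_def using Z.inverse_power_moment(2)[OF b] eb[OF p, of x] by linarith
    qed
    have g0: "g p z x \<ge> 0" for p z x by (simp add: g_def)
    have u: "u > 0" by (simp add: u_def)
    have pN: "prob_space N" unfolding N_def by (rule prob_space_uniform_unit_interval)
    have bl: "block_large k i m z \<longleftrightarrow> (\<exists>t\<in>J. u \<le> (\<integral>x. (\<Prod>p | p \<in> J \<and> p \<le> t. g p (z p) x) \<partial>N))" for z
      by (simp only: block_large_def g_def J_def N_def u_def)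
    note max = product_maximal_inequality[where g=g and C="exp 270" and e=e, OF J(1) indJ pN _ _ _ _ _ u]
    show "{z\<in>space (PiM (block_primes k) (\<lambda>_. borel)). block_large k i m z} \<in> sets (PiM (block_primes k) (\<lambda>_. borel))"
      unfolding J_def[symmetric] bl by (rule max(2)) (blast intro: mg g0 mom)+
    have "prob {\<omega>\<in>space M. block_large k i m (\<lambda>p. Z p \<omega>)} \<le> exp (\<Sum>p\<in>J. e p) / u"
      unfolding bl by (rule max(3)) (blast intro: mg g0 mom)+
    also have "(\<Sum>p\<in>J. e p) = 90000 * exp 270 * 4 * (\<Sum>p\<in>J. 1 / real p)" by (simp add: e_def sum_distrib_left)
    also have "(\<Sum>p\<in>J. 1 / real p) = recip_sum (scale_end k) - recip_sum (scale_end (k - 1))"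
      unfolding J_def block_primes_def recip_sum_def by (intro sum_diff primes_upto_mono scale_end_mono) auto
    also have "90000 * exp 270 * 4 * (recip_sum (scale_end k) - recip_sum (scale_end (k - 1))) \<le> 90000 * exp 270 * 4 * (1 + 2 * CT)"
    proof -
      have "real (k - 1) = real k - 1" using k by (simp add: of_nat_diff)
      hence "recip_sum (scale_end k) - recip_sum (scale_end (k - 1)) \<le> 1 + 2 * CT"
        using CT(2)[of k] CT(2)[of "k - 1"] by linarith
      thus ?thesis by (intro mult_left_mono) auto
    qed
    hence "exp (90000 * exp 270 * 4 * (recip_sum (scale_end k) - recip_sum (scale_end (k - 1)))) / u \<le> exp (90000 * exp 270 * 4 * (1 + 2 * CT)) / u"
      using u by (intro divide_right_mono) auto
    also have "\<dots> = C * exp (- 30 * real m)" by (simp add: C_def u_def exp_minus field_simps)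
    finally show "prob {\<omega>\<in>space M. block_large k i m (\<lambda>p. Z p \<omega>)} \<le> C * exp (- 30 * real m)" .
  qed (simp add: C_def)
qed

lemma log_product_measurable:
  assumes "K \<subseteq> L"
  shows "(\<lambda>z. log_product z K s) \<in> borel_measurable (PiM L (\<lambda>_. borel))"
  unfolding log_product_def
  using assms by (intro borel_measurable_sum measurable_compose[OF measurable_component_singleton, where g="log_factor _"] log_factor_measurable) auto

lemma barrier_hit_measurable:
  "{z\<in>space (PiM (primes_upto (scale_end k)) (\<lambda>_. borel)). barrier_hit k c U b z} \<in> sets (PiM (primes_upto (scale_end k)) (\<lambda>_. borel))"
proof -
  let ?N = "PiM (primes_upto (scale_end k)) (\<lambda>_. borel :: complex measure)"
  have "{z\<in>space ?N. \<forall>t\<in>{..scale_end k}. log_product z (primes_upto t) c \<le> U (scale_of t)} \<in> sets ?N"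
    by (intro sets.sets_Collect_finite_All borel_measurable_le log_product_measurable primes_upto_mono) auto
  moreover have "{z\<in>space ?N. U k - b \<le> log_product z (primes_upto (scale_end k)) c} \<in> sets ?N"
    by (intro borel_measurable_le log_product_measurable) auto
  ultimately show ?thesis unfolding barrier_hit_def Ball_def atMost_iff by (intro sets.sets_Collect_conj)
qed

text \<open>\<open>barrier_hit\<close> involves the primes up to \<open>scale_end k\<close> and
  \<open>block_large\<close> those of the next block, so the two probabilities multiply. The grid
  point already belongs to scale \<open>k + 1\<close>, the scale of the jump.\<close>

lemma crossing_bound:
  "\<exists>C>0. \<forall>(M::'a measure) Z k i m n y g. prob_space M \<longrightarrow> prob_space.indep_vars M (\<lambda>_. borel) Z {p. prime p} \<longrightarrow>
     (\<forall>p. prime p \<longrightarrow> unit_variable M (Z p)) \<longrightarrow>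
     1 \<le> n \<longrightarrow> 0 < y \<longrightarrow> y \<le> n \<longrightarrow> real k \<le> n + 3 \<longrightarrow>
     (\<forall>j\<le>k. 0 \<le> g j \<and> g k - g j \<le> ln (1 + real (k - j))) \<longrightarrow>
     (let E = {\<omega>\<in>space M. barrier_hit k (grid_point (Suc k) i) (\<lambda>j. real j + y - g j) (7 * (real m + 1)) (\<lambda>p. Z p \<omega>)
                 \<and> block_large (Suc k) i m (\<lambda>p. Z p \<omega>)}
      in E \<in> sets M \<and> measure M E
     \<le> C * exp (- real m) * exp (- real k - 2 * y - y\<^sup>2 / n + 2 * (1 + y / n) * g k)
         * ballot_weight n y k)"
proof -
  obtain C where C: "C > 0" and opb: "\<forall>(M::'a measure) X k n y g b. prob_space M \<longrightarrow>
     prob_space.indep_vars M (\<lambda>_. borel) X (primes_upto (scale_end k)) \<longrightarrow>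
     (\<forall>p\<in>primes_upto (scale_end k). small_var M (X p) (1 / sqrt (real p))) \<longrightarrow>
     1 \<le> n \<longrightarrow> 0 < y \<longrightarrow> y \<le> n \<longrightarrow> real k \<le> n + 3 \<longrightarrow> 1 \<le> b \<longrightarrow>
     (\<forall>j\<le>k. 0 \<le> g j \<and> g k - g j \<le> ln (1 + real (k - j))) \<longrightarrow>
     measure M {\<omega>\<in>space M. (\<forall>t\<le>scale_end k. (\<Sum>p\<in>primes_upto t. X p \<omega>) \<le> real (scale_of t) + y - g (scale_of t)) \<and>
         real k + y - g k - b \<le> (\<Sum>p\<in>primes_upto (scale_end k). X p \<omega>)}
     \<le> C * (1 + b)\<^sup>2 * exp (4 * b) * exp (- real k - 2 * y - y\<^sup>2 / n + 2 * (1 + y / n) * g k)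
         * ballot_weight n y k"
    using one_point_bound[where 'a='a] by (elim exE conjE) (rule that)
  obtain CB where CB: "CB > 0" and blb: "\<forall>(M::'a measure) Z k i m. prob_space M \<longrightarrow> prob_space.indep_vars M (\<lambda>_. borel) Z {p. prime p} \<longrightarrow>
     (\<forall>p. prime p \<longrightarrow> unit_variable M (Z p)) \<longrightarrow> k \<ge> 1 \<longrightarrow>
     {z\<in>space (PiM (block_primes k) (\<lambda>_. borel)). block_large k i m z} \<in> sets (PiM (block_primes k) (\<lambda>_. borel)) \<and>
     measure M {\<omega>\<in>space M. block_large k i m (\<lambda>p. Z p \<omega>)} \<le> CB * exp (- 30 * real m)"
    using block_large_bound[where 'a='a] by (elim exE conjE) (rule that)
  define K where "K = C * 256 * exp 28 * CB"
  have K: "K > 0" using C CB by (simp add: K_def)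
  show ?thesis
  proof (intro exI[of _ K] conjI K allI impI)
    fix M :: "'a measure" and Z :: "nat \<Rightarrow> 'a \<Rightarrow> complex" and k i m :: nat and n y :: real and g :: "nat \<Rightarrow> real"
    assume pM: "prob_space M"
    then interpret prob_space M .
    assume ind: "indep_vars (\<lambda>_. borel) Z {p. prime p}" and uv: "\<forall>p. prime p \<longrightarrow> unit_variable M (Z p)"
      and n: "1 \<le> n" and y: "0 < y" "y \<le> n" and kn: "real k \<le> n + 3"
      and g: "\<forall>j\<le>k. 0 \<le> g j \<and> g k - g j \<le> ln (1 + real (k - j))"
    define c where "c = grid_point (Suc k) i"
    define h where "h = real i / real (grid (Suc k))"
    have ch: "c = Complex (1/2) h" by (simp add: c_def h_def grid_point_def)
    define b where "b = 7 * (real m + 1)"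
    define P where "P = primes_upto (scale_end k)"
    define J where "J = block_primes (Suc k)"
    define U where "U j = real j + y - g j" for j
    define X where "X p \<omega> = log_factor (of_nat p powr (- c)) (Z p \<omega>)" for p \<omega>
    have indX: "indep_vars (\<lambda>_. borel) X P"
    proof -
      have "indep_vars (\<lambda>_. borel) Z P" by (rule indep_vars_subset[OF ind]) (auto simp: P_def primes_upto_def)
      thus ?thesis unfolding X_def by (rule indep_vars_compose2[where Y="\<lambda>p. log_factor (of_nat p powr (- c))"]) measurable
    qed
    have sv: "small_var M (X p) (1 / sqrt (real p))" if p: "p \<in> P" for p
    proof -
      have pp: "prime p" using p by (auto simp: P_def primes_upto_def)
      interpret Z: unit_variable M "Z p" using uv pp by auto
      have p0: "p > 0" using pp prime_gt_0_nat by auto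
      have rc: "Re c = 1/2" by (simp add: ch)
      hence nw: "norm (of_nat p powr (- c) :: complex) = 1 / sqrt (real p)"
        using p0 norm_prime_powr[of p c, unfolded rc] powr_minus[of "real p" "1/2"] by (simp add: powr_half_sqrt inverse_eq_divide)
      have "norm (of_nat p powr (- c) :: complex) \<le> 9/10"
        using norm_prime_powr_le(2)[of p k h c] p by (simp add: P_def ch)
      moreover have "(of_nat p powr (- c) :: complex) \<noteq> 0" using p0 by simp
      ultimately show ?thesis unfolding X_def using Z.small_var_log_factor[of "of_nat p powr (- c)"] by (simp add: nw)
    qed
    define PF where "PF = barrier_hit k c U b"
    define PR where "PR = block_large (Suc k) i m"
    define q where "q = ballot_weight n y k"
    have q0: "q \<ge> 0" using y n by (auto simp: q_def ballot_weight_def)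
    define ee where "ee = exp (- real k - 2 * y - y\<^sup>2 / n + 2 * (1 + y / n) * g k)"
    have b1: "1 \<le> b" by (simp add: b_def)
    have pF: "prob {\<omega>\<in>space M. PF (\<lambda>p. Z p \<omega>)} \<le> C * (1 + b)\<^sup>2 * exp (4 * b) * ee * q"
    proof -
      have "prob {\<omega>\<in>space M. PF (\<lambda>p. Z p \<omega>)} = prob {\<omega>\<in>space M. (\<forall>t\<le>scale_end k. (\<Sum>p\<in>primes_upto t. X p \<omega>) \<le> real (scale_of t) + y - g (scale_of t)) \<and>
         real k + y - g k - b \<le> (\<Sum>p\<in>primes_upto (scale_end k). X p \<omega>)}"
        by (simp add: PF_def barrier_hit_def log_product_def X_def U_def)
      also have "\<dots> \<le> C * (1 + b)\<^sup>2 * exp (4 * b) * ee * q"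
        unfolding ee_def q_def
        by (rule opb[THEN spec, THEN spec, THEN spec, THEN spec, THEN spec, THEN spec, THEN spec,
              THEN mp, THEN mp, THEN mp, THEN mp, THEN mp, THEN mp, THEN mp, THEN mp, THEN mp])
           (use pM indX sv n y kn b1 g in \<open>auto simp: P_def\<close>)
      finally show ?thesis .
    qed
    have bl: "{z\<in>space (PiM J (\<lambda>_. borel)). PR z} \<in> sets (PiM J (\<lambda>_. borel)) \<and> prob {\<omega>\<in>space M. PR (\<lambda>p. Z p \<omega>)} \<le> CB * exp (- 30 * real m)"
      unfolding PR_def J_def
      by (rule blb[THEN spec, THEN spec, THEN spec, THEN spec, THEN spec, THEN mp, THEN mp, THEN mp, THEN mp])
         (use pM ind uv in auto)
    have PJ: "P \<inter> J = {}" "P \<subseteq> {p. prime p}" "J \<subseteq> {p. prime p}" by (auto simp: P_def J_def block_primes_def primes_upto_def)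
    have mF: "{z\<in>space (PiM P (\<lambda>_. borel)). PF z} \<in> sets (PiM P (\<lambda>_. borel))"
      unfolding P_def PF_def by (rule barrier_hit_measurable)
    have rF: "PF (restrict z P) = PF z" for z
    proof -
      have "log_product (restrict z P) (primes_upto t) c = log_product z (primes_upto t) c" if "t \<le> scale_end k" for t
        unfolding P_def by (rule restrict_cong_log_product[OF primes_upto_mono[OF that]])
      thus ?thesis unfolding PF_def barrier_hit_def by (intro conj_cong) auto
    qed
    have rR: "PR (restrict z J) = PR z" for z
    proof -
      have "(\<Prod>p | p \<in> J \<and> p \<le> t. norm (inverse (1 - restrict z J p * block_circle (Suc k) i p x)) ^ 30) = (\<Prod>p | p \<in> J \<and> p \<le> t. norm (inverse (1 - z p * block_circle (Suc k) i p x)) ^ 30)" for t x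
        by (intro prod.cong) auto
      thus ?thesis unfolding PR_def block_large_def J_def[symmetric] by (simp only:)
    qed
    note indep = prob_indep_disjoint[OF ind PJ mF rF conjunct1[OF bl] rR]
    have "prob {\<omega>\<in>space M. PF (\<lambda>p. Z p \<omega>) \<and> PR (\<lambda>p. Z p \<omega>)} \<le> (C * (1 + b)\<^sup>2 * exp (4 * b) * ee * q) * (CB * exp (- 30 * real m))"
      unfolding indep(2) using pF bl C q0 by (intro mult_mono) (auto simp: ee_def)
    also have "\<dots> \<le> K * exp (- real m) * ee * q"
    proof -
      \<comment> \<open>\<open>(1 + b)^2\<close> costs a multiple of \<open>exp m\<close> and the
        window \<open>exp (4 * b)\<close> costs \<open>exp (28 * m + 28)\<close>; the factor
        \<open>exp (- 30 * m)\<close> leaves \<open>exp (- m)\<close> for the sum over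
        \<open>m\<close>.\<close>
      have "real m / 2 + 1 \<le> exp (real m / 2)" by (subst add.commute) (rule exp_ge_add_one_self)
      hence "real m + 1 \<le> 2 * exp (real m / 2)" by linarith
      hence "1 + b \<le> 16 * exp (real m / 2)" by (simp add: b_def)
      hence "(1 + b)\<^sup>2 \<le> (16 * exp (real m / 2))\<^sup>2" using b1 by (intro power_mono) auto
      also have "\<dots> = 256 * exp (real m)" by (simp add: power2_eq_square flip: exp_add)
      finally have "(1 + b)\<^sup>2 * (exp (4 * b) * exp (- 30 * real m)) \<le> (256 * exp (real m)) * (exp (4 * b) * exp (- 30 * real m))"
        by (intro mult_right_mono) auto
      also have "\<dots> = 256 * exp 28 * exp (- real m)" by (simp add: b_def algebra_simps flip: exp_add)
      finally have "(C * CB * ee * q) * ((1 + b)\<^sup>2 * (exp (4 * b) * exp (- 30 * real m))) \<le> (C * CB * ee * q) * (256 * exp 28 * exp (- real m))"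
        using C CB q0 by (intro mult_left_mono) (auto simp: ee_def)
      thus ?thesis by (simp add: K_def mult_ac)
    qed
    finally show "let E = {\<omega>\<in>space M. barrier_hit k (grid_point (Suc k) i) (\<lambda>j. real j + y - g j) (7 * (real m + 1)) (\<lambda>p. Z p \<omega>)
                 \<and> block_large (Suc k) i m (\<lambda>p. Z p \<omega>)}
      in E \<in> sets M \<and> measure M E
     \<le> K * exp (- real m) * exp (- real k - 2 * y - y\<^sup>2 / n + 2 * (1 + y / n) * g k)
         * ballot_weight n y k"
      using indep(1) unfolding Let_def PF_def PR_def c_def b_def ee_def q_def U_def by simp
  qed
qed

subsection \<open>Summation over the scales\<close>

text \<open>The last scale is \<open>ln (ln x)\<close> up to a constant; the excess of at most 4 is
  what the constant 4 in the barrier makes up for.\<close>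

lemma final_scale:
  assumes x: "x \<ge> exp (exp 16)"
  defines "N \<equiv> scale_of (nat \<lfloor>x\<rfloor>)"
  shows "ln (ln x) \<le> real N" "real N \<le> ln (ln x) + 4" "N \<ge> 1"
proof -
  define q where "q = nat \<lfloor>x\<rfloor>"
  have e16: "exp (16::real) \<ge> 17" using exp_ge_add_one_self[of "16::real"] by simp
  have "exp (17::real) \<ge> 18" using exp_ge_add_one_self[of "17::real"] by simp
  moreover have "exp (exp (16::real)) \<ge> exp 17" using e16 by simp
  ultimately have x18: "x \<ge> 18" using x by linarith
  have lx: "ln x \<ge> exp 16" using x x18 by (simp add: ln_ge_iff)
  have lx0: "ln x > 0" using lx e16 by linarith
  have q: "real q \<le> x" "x < real q + 1" unfolding q_def using x18 by linarith+
  have q2: "q > 1" using q x18 by linarith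
  show N1: "N \<ge> 1"
  proof (rule ccontr)
    assume "\<not> N \<ge> 1"
    hence "q \<le> scale_end 0" using scale_of_le[of q] by (simp add: N_def q_def not_le)
    thus False using q2 by (simp add: scale_end_0)
  qed
  have "real q \<le> exp (exp (real N) / 8)" using scale_of_le[of q] by (simp add: N_def q_def flip: le_scale_end_iff)
  hence "x \<le> exp (exp (real N) / 8) + 1" using q by linarith
  also have "\<dots> \<le> 2 * exp (exp (real N) / 8)" by simp
  also have "\<dots> \<le> exp 1 * exp (exp (real N) / 8)" using exp_ge_add_one_self[of "1::real"] by (intro mult_right_mono) auto
  also have "\<dots> = exp (1 + exp (real N) / 8)" by (simp add: exp_add)
  also have "\<dots> \<le> exp (exp (real N))"
  proof -
    have "real N \<ge> 1" using N1 by simp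
    hence "1 + exp (real N) / 8 \<le> exp (real N)" using exp_ge_add_one_self[of "real N"] by linarith
    thus ?thesis by simp
  qed
  finally have "ln x \<le> exp (real N)" using x18 ln_le_cancel_iff[of x "exp (exp (real N))"] by simp
  thus "ln (ln x) \<le> real N" using lx0 ln_le_cancel_iff[of "ln x" "exp (real N)"] by simp
  have "scale_end (N - 1) < q" unfolding q_def using N1 by (intro scale_of_gt) (simp add: N_def)
  hence "exp (exp (real (N - 1)) / 8) < x" using scale_end_gt[of "N - 1"] q by linarith
  hence "exp (real (N - 1)) / 8 < ln x" using x18 ln_less_cancel_iff[of "exp (exp (real (N - 1)) / 8)" x] by simp
  hence "exp (real (N - 1)) < 8 * ln x" by simp
  also have "8 \<le> exp (3::real)"
    using exp_ge_add_one_self[of "1::real"] power_mono[of 2 "exp (1::real)" 3] by (simp flip: exp_of_nat_mult)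
  hence "8 * ln x \<le> exp 3 * ln x" using lx0 by (intro mult_right_mono) auto
  also have "\<dots> = exp (3 + ln (ln x))" using lx0 by (simp add: exp_add)
  finally show "real N \<le> ln (ln x) + 4" using N1 by (simp add: of_nat_diff)
qed

lemma sum_inverse_square_le: "(\<Sum>k<N. 1 / (1 + real N - real k)\<^sup>2) \<le> 1"
proof -
  have "(\<Sum>k<N. 1 / (1 + real N - real k)\<^sup>2) = (\<Sum>k<N. 1 / (2 + real (N - Suc k))\<^sup>2)"
    by (intro sum.cong) (auto simp: of_nat_diff)
  also have "\<dots> = (\<Sum>j<N. 1 / (2 + real j)\<^sup>2)" by (rule sum.nat_diff_reindex)
  also have "\<dots> \<le> 1 - 1 / (real N + 1)"
  proof (induction N)
    case (Suc N)
    have "1 / (2 + real N)\<^sup>2 \<le> 1 / (real N + 1) - 1 / (real N + 2)"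
      by (simp add: divide_simps power2_eq_square) (simp add: algebra_simps)
    thus ?case using Suc by (simp add: add_ac)
  qed simp
  also have "\<dots> \<le> 1" by simp
  finally show ?thesis .
qed

lemma sum_inverse_le: "N \<ge> 1 \<Longrightarrow> (\<Sum>k<N. 1 / (real k + 1)) \<le> 1 + ln (real N)"
proof (induction N rule: dec_induct)
  case (step N)
  have "ln (real N / (real N + 1)) \<le> real N / (real N + 1) - 1"
    using step by (intro ln_le_minus_one) auto
  hence "1 / (real N + 1) \<le> ln (real N + 1) - ln (real N)"
    using step by (simp add: ln_div field_simps)
  thus ?case using step by (simp add: add_ac)
qed simp

text \<open>For \<open>n \<ge> 1\<close> the value at \<open>k = N\<close> is
  \<open>4 + 3/4 * ln n\<close>, so \<open>N - barrier n N N \<le> n - 3/4 * ln n\<close> even when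
  \<open>N\<close> exceeds \<open>n\<close> by 4. Away from the end it falls by the logarithm of the
  distance, so that \<open>exp (2 * g)\<close> decays like the inverse square of the distance, and
  the maximum switches it off at distances beyond a multiple of \<open>n powr (3/4)\<close>.\<close>

definition barrier :: "real \<Rightarrow> nat \<Rightarrow> nat \<Rightarrow> real" where
  "barrier n N k = max 0 (4 + 3/4 * ln n - ln (1 + real N - real k))"

lemma ballot_weight_nonneg: "y > 0 \<Longrightarrow> n > 0 \<Longrightarrow> ballot_weight n y k \<ge> 0"
  unfolding ballot_weight_def by auto

text \<open>Dropping the minimum leaves a summable part and a harmonic part; the latter is why the
  slope \<open>y / n\<close> has to beat a logarithm.\<close>

lemma ballot_weight_le:
  assumes "y \<ge> 1" "n > 0"
  shows "ballot_weight n y k \<le> 2 * y * (1 / sqrt (real k + 1)) ^ 3 + 2 * y\<^sup>2 / n * (1 / (real k + 1))"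
proof -
  define r where "r = 1 / sqrt (real k + 1)"
  have r: "r > 0" "r * r = 1 / (real k + 1)" by (auto simp: r_def)
  have "ballot_weight n y k = min 1 ((1 + y) * r) * ((r + y / n) * r)"
    by (simp add: ballot_weight_def r_def)
  also have "\<dots> \<le> (2 * y * r) * ((r + y / n) * r)"
    using assms r by (intro mult_right_mono order_trans[OF min.cobounded2]) auto
  also have "\<dots> = 2 * y * r ^ 3 + 2 * y\<^sup>2 / n * (r * r)"
    by (simp add: algebra_simps power2_eq_square power3_eq_cube)
  finally show ?thesis unfolding r(2) by (simp add: r_def)
qed

text \<open>For \<open>y \<le> sqrt n\<close> the slope \<open>y / n\<close> is at most
  \<open>1 / sqrt n\<close> and the first factor gives \<open>y / sqrt n\<close>; for larger
  \<open>y\<close> the slope dominates and the first factor is bounded by 1. Either way the order is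
  \<open>y * n powr (-3/2)\<close>.\<close>

lemma ballot_weight_late:
  assumes y: "y \<ge> 1" and n: "n > 0" and k: "n / 2 \<le> real k + 1"
  shows "ballot_weight n y k \<le> 12 * y / (n * sqrt n)"
proof -
  define r where "r = 1 / sqrt (real k + 1)"
  define s where "s = 1 / sqrt n"
  have r: "r > 0" by (simp add: r_def)
  have s: "s > 0" "s * s = 1 / n" using n by (auto simp: s_def)
  have "r * r \<le> 2 * (s * s)" using n k by (simp add: r_def s(2) field_simps)
  also have "\<dots> \<le> 9/4 * (s * s)" using s(1) by simp
  also have "\<dots> = (3/2 * s) * (3/2 * s)" by simp
  finally have rs: "r \<le> 3/2 * s" using s(1) power2_le_imp_le[of r "3/2 * s"] by (simp add: power2_eq_square)
  have w: "ballot_weight n y k = min 1 ((1 + y) * r) * ((r + y * s * s) * r)"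
    by (simp add: ballot_weight_def r_def s(2) mult.assoc)
  have "ballot_weight n y k \<le> 12 * y * s * s * s"
  proof (cases "y * s \<le> 1")
    case True
    have ys: "y * s * s \<le> s" using mult_right_mono[OF True, of s] s by simp
    have "ballot_weight n y k \<le> (2 * y * (3/2 * s)) * ((3/2 * s + s) * (3/2 * s))"
      unfolding w
    proof (intro mult_mono add_mono)
      have "(1 + y) * r \<le> 2 * y * (3/2 * s)" using y r rs by (intro mult_mono) auto
      thus "min 1 ((1 + y) * r) \<le> 2 * y * (3/2 * s)" by simp
    qed (use y r s rs ys in \<open>auto intro!: add_nonneg_nonneg mult_nonneg_nonneg\<close>)
    also have "\<dots> \<le> 12 * y * s * s * s" using y s by (simp add: mult_ac)
    finally show ?thesis .
  next
    case False
    have ys: "s \<le> y * s * s" using mult_right_mono[of 1 "y * s" s] False s by simp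
    hence rs': "r \<le> 3/2 * (y * s * s)" using rs by linarith
    have "ballot_weight n y k \<le> 1 * ((3/2 * (y * s * s) + y * s * s) * (3/2 * s))"
      unfolding w using y r s rs by (intro mult_mono add_mono rs' order_refl) (auto intro!: add_nonneg_nonneg mult_nonneg_nonneg)
    also have "\<dots> \<le> 12 * y * s * s * s" using y s by (simp add: mult_ac)
    finally show ?thesis .
  qed
  also have "\<dots> = 12 * y * (s * s) * s" by (simp add: mult_ac)
  also have "\<dots> = 12 * y / (n * sqrt n)" unfolding s(2) by (simp add: s_def)
  finally show ?thesis .
qed

text \<open>\<open>exp (2 * g)\<close> is at most 1 plus a multiple of
  \<open>n powr (3/2) / d^2\<close>, with \<open>d\<close> the distance to the end. In the later
  scales \<open>n powr (3/2)\<close> cancels against the ballot weight and \<open>1 / d^2\<close> is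
  summable; in the earlier ones \<open>n powr (3/2) / d^2\<close> is bounded, and the ballot weights
  themselves sum to \<open>O(y)\<close>.\<close>

lemma barrier_sum_bound:
  "\<exists>C>0. \<forall>n y N. 16 \<le> ln n \<longrightarrow> 0 < n \<longrightarrow> n \<le> real N \<longrightarrow> real N \<le> n + 4 \<longrightarrow> 1 \<le> y \<longrightarrow> y \<le> n / ln n \<longrightarrow>
     (\<Sum>k<N. exp (2 * (1 + y / n) * barrier n N k) * ballot_weight n y k) \<le> C * y"
proof -
  obtain \<Sigma> where \<Sigma>0: "\<Sigma> \<ge> 0" and \<Sigma>: "\<And>L. finite L \<Longrightarrow> (\<Sum>p\<in>L. (1 / sqrt (real p)) ^ 3) \<le> \<Sigma>"
    using sum_recip_cube_sqrt by blast
  define C where "C = exp 2 * ((1 + 4 * exp 8) * (2 * \<Sigma> + 6) + 12 * exp 8)"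
  have "C > 0" using \<Sigma>0 unfolding C_def by (intro mult_pos_pos add_nonneg_pos mult_nonneg_nonneg) (auto simp: add_nonneg_nonneg)
  moreover have "(\<Sum>k<N. exp (2 * (1 + y / n) * barrier n N k) * ballot_weight n y k) \<le> C * y"
    if L: "16 \<le> ln n" and n: "0 < n" and N: "n \<le> real N" "real N \<le> n + 4" and y: "1 \<le> y" "y \<le> n / ln n" for n y N
  proof -
    define L where "L = ln n"
    have L16: "L \<ge> 16" using L by (simp add: L_def)
    have n16: "n \<ge> 17" using L n ln_le_minus_one[of n] by linarith
    have yn: "y / n \<le> 1 / L" using y(2) n L16 unfolding L_def[symmetric] by (simp add: field_simps)
    have yn0: "y / n \<ge> 0" using y n by simp
    have point: "exp (2 * (1 + y / n) * barrier n N k) * ballot_weight n y k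
        \<le> exp 2 * ((1 + 4 * exp 8) * ballot_weight n y k + 12 * exp 8 * y * (1 / (1 + real N - real k)\<^sup>2))"
      if k: "k < N" for k
    proof -
      define g where "g = barrier n N k"
      define d where "d = 1 + real N - real k"
      have d: "d \<ge> 2" using k by (simp add: d_def)
      have g0: "g \<ge> 0" by (simp add: g_def barrier_def)
      have "ln d \<ge> 0" using d by simp
      \<comment> \<open>The bound 16 on \<open>ln n\<close> is exactly what brings
        \<open>4 + 3/4 * ln n\<close> below \<open>ln n\<close>.\<close>
      hence gL: "g \<le> L" using L16 unfolding g_def barrier_def d_def[symmetric] L_def[symmetric] by simp
      \<comment> \<open>First use of \<open>y \<le> n / ln n\<close>: the part of the tilt that
        depends on \<open>y\<close> costs no more than the factor \<open>exp 2\<close>.\<close>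
      have "y / n * g \<le> 1 / L * L" using yn yn0 gL g0 L16 by (intro mult_mono) auto
      hence "y / n * g \<le> 1" using L16 by simp
      moreover have "2 * (1 + y / n) * g = 2 * g + 2 * (y / n * g)" by (simp add: algebra_simps)
      ultimately have "2 * (1 + y / n) * g \<le> 2 + 2 * g" by linarith
      hence e1: "exp (2 * (1 + y / n) * g) \<le> exp 2 * exp (2 * g)" by (simp flip: exp_add)
      have n32: "exp (3/2 * L) = n * sqrt n"
      proof -
        have "exp (3/2 * L) = exp (L + ln (sqrt n))" using n by (simp add: L_def ln_sqrt)
        thus ?thesis using n by (simp add: exp_add L_def)
      qed
      have e2: "exp (2 * g) \<le> 1 + exp 8 * (n * sqrt n) / d\<^sup>2"
      proof (cases "g = 0")
        case False
        hence "2 * g = 8 + 3/2 * L - (ln d + ln d)"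
          unfolding g_def barrier_def d_def[symmetric] L_def[symmetric] by (auto simp: max_def split: if_splits)
        hence "exp (2 * g) = exp 8 * exp (3/2 * L) / (exp (ln d) * exp (ln d))"
          by (simp only: exp_add exp_diff)
        also have "\<dots> = exp 8 * (n * sqrt n) / d\<^sup>2" using d unfolding n32 by (simp add: power2_eq_square)
        finally show ?thesis by simp
      qed (use n in simp)
      define w where "w = ballot_weight n y k"
      have w0: "w \<ge> 0" unfolding w_def using y n by (intro ballot_weight_nonneg) auto
      have e3: "(n * sqrt n) / d\<^sup>2 * w \<le> 4 * w + 12 * y * (1 / d\<^sup>2)"
      proof (cases "n / 2 \<le> real k + 1")
        case True
        have "(n * sqrt n) / d\<^sup>2 * w \<le> (n * sqrt n) / d\<^sup>2 * (12 * y / (n * sqrt n))"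
          unfolding w_def using y n True by (intro mult_left_mono ballot_weight_late) auto
        also have "\<dots> = 12 * y * (1 / d\<^sup>2)" using n by simp
        finally show ?thesis using w0 by simp
      next
        case False
        have "n / 2 \<le> d" using False N by (simp add: d_def)
        hence "(n / 2) * (n / 2) \<le> d\<^sup>2" unfolding power2_eq_square using n by (intro mult_mono) auto
        moreover have "sqrt n \<le> n" using n16 by (simp add: real_le_lsqrt real_sqrt_le_iff sqrt_le_D power2_eq_square real_sqrt_le_mono)
        hence "n * sqrt n \<le> n * n" using n by (intro mult_left_mono) auto
        ultimately have "n * sqrt n \<le> 4 * d\<^sup>2" by simp
        hence "(n * sqrt n) / d\<^sup>2 \<le> 4" using d by (simp add: field_simps)
        hence "(n * sqrt n) / d\<^sup>2 * w \<le> 4 * w" using w0 by (rule mult_right_mono)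
        thus ?thesis using y by (simp add: add_increasing2)
      qed
      have "exp (2 * (1 + y / n) * g) * w \<le> (exp 2 * (1 + exp 8 * (n * sqrt n) / d\<^sup>2)) * w"
        using e1 e2 w0 by (intro mult_right_mono order_trans[OF e1] mult_left_mono) auto
      also have "\<dots> = exp 2 * (w + exp 8 * ((n * sqrt n) / d\<^sup>2 * w))" by (simp add: algebra_simps)
      also have "\<dots> \<le> exp 2 * (w + exp 8 * (4 * w + 12 * y * (1 / d\<^sup>2)))"
        using e3 by (intro mult_left_mono add_left_mono) auto
      also have "\<dots> = exp 2 * ((1 + 4 * exp 8) * w + 12 * exp 8 * y * (1 / d\<^sup>2))" by (simp add: algebra_simps)
      finally show ?thesis unfolding w_def g_def d_def .
    qed
    have N1: "N \<ge> 1" using N n16 by simp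
    have "ln (real N) \<le> ln (n * n)"
    proof (rule ln_mono)
      have "2 * n \<le> n * n" using n16 by (intro mult_right_mono) auto
      thus "real N \<le> n * n" using N n16 by linarith
    qed (use N1 n in auto)
    hence lN: "1 + ln (real N) \<le> 3 * L" using L16 n by (simp add: ln_mult L_def)
    have "(\<Sum>k<N. ballot_weight n y k) \<le> (\<Sum>k<N. 2 * y * (1 / sqrt (real k + 1)) ^ 3 + 2 * y\<^sup>2 / n * (1 / (real k + 1)))"
      using y n by (intro sum_mono ballot_weight_le)
    also have "\<dots> = 2 * y * (\<Sum>k<N. (1 / sqrt (real k + 1)) ^ 3) + 2 * y\<^sup>2 / n * (\<Sum>k<N. 1 / (real k + 1))"
      by (simp only: sum.distrib sum_distrib_left)
    also have "\<dots> \<le> 2 * y * \<Sigma> + 2 * y\<^sup>2 / n * (3 * L)"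
    proof (intro add_mono mult_left_mono)
      have "(\<Sum>k<N. (1 / sqrt (real k + 1)) ^ 3) = (\<Sum>p\<in>Suc ` {..<N}. (1 / sqrt (real p)) ^ 3)"
        by (subst sum.reindex) (auto simp: add.commute)
      thus "(\<Sum>k<N. (1 / sqrt (real k + 1)) ^ 3) \<le> \<Sigma>" using \<Sigma>[of "Suc ` {..<N}"] by simp
      show "(\<Sum>k<N. 1 / (real k + 1)) \<le> 3 * L" using sum_inverse_le[OF N1] lN by linarith
    qed (use y n in auto)
    \<comment> \<open>Second use of \<open>y \<le> n / ln n\<close>: it cancels the logarithm from
      the harmonic sum.\<close>
    also have "2 * y\<^sup>2 / n * (3 * L) = 6 * y * (y / n * L)" by (simp add: power2_eq_square)
    also have "\<dots> \<le> 6 * y * (1 / L * L)" using yn y L16 by (intro mult_left_mono mult_right_mono) auto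
    also have "\<dots> = 6 * y" using L16 by simp
    finally have wsum: "(\<Sum>k<N. ballot_weight n y k) \<le> (2 * \<Sigma> + 6) * y" by (simp add: algebra_simps)
    have "(\<Sum>k<N. exp (2 * (1 + y / n) * barrier n N k) * ballot_weight n y k)
      \<le> (\<Sum>k<N. exp 2 * ((1 + 4 * exp 8) * ballot_weight n y k + 12 * exp 8 * y * (1 / (1 + real N - real k)\<^sup>2)))"
      by (intro sum_mono point) simp
    also have "\<dots> = exp 2 * ((1 + 4 * exp 8) * (\<Sum>k<N. ballot_weight n y k) + 12 * exp 8 * y * (\<Sum>k<N. 1 / (1 + real N - real k)\<^sup>2))"
      by (simp only: sum.distrib sum_distrib_left[symmetric])
    also have "\<dots> \<le> exp 2 * ((1 + 4 * exp 8) * ((2 * \<Sigma> + 6) * y) + 12 * exp 8 * y * 1)"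
      using wsum sum_inverse_square_le[of N] y by (intro mult_left_mono add_mono) (auto intro: add_nonneg_nonneg)
    also have "\<dots> = C * y" by (simp add: C_def algebra_simps)
    finally show ?thesis .
  qed
  ultimately show ?thesis by blast
qed

text \<open>The difference of the two sides in
  \<open>1 + N - j \<le> (1 + k - j) * (1 + N - k)\<close> is
  \<open>(k - j) * (N - k) \<ge> 0\<close>. Taking maxima with 0 preserves the bound because its
  right side is nonnegative.\<close>

lemma barrier_increment:
  assumes "j \<le> k" "k \<le> N"
  shows "barrier n N k - barrier n N j \<le> ln (1 + real (k - j))"
proof -
  have pos: "1 + real N - real k \<ge> 1" "1 + real N - real j \<ge> 1" using assms by auto
  have "0 \<le> (real k - real j) * (real N - real k)" using assms by (intro mult_nonneg_nonneg) auto
  hence "1 + real N - real j \<le> (1 + real (k - j)) * (1 + real N - real k)"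
    using assms by (simp add: of_nat_diff algebra_simps)
  hence "ln (1 + real N - real j) \<le> ln ((1 + real (k - j)) * (1 + real N - real k))"
    using pos by (intro ln_mono) auto
  also have "\<dots> = ln (1 + real (k - j)) + ln (1 + real N - real k)" using pos by (intro ln_mult_pos) auto
  finally have "ln (1 + real N - real j) - ln (1 + real N - real k) \<le> ln (1 + real (k - j))" by simp
  moreover have "0 \<le> ln (1 + real (k - j))" by simp
  ultimately show ?thesis unfolding barrier_def by linarith
qed

lemma barrier_nonneg: "barrier n N k \<ge> 0"
  by (simp add: barrier_def)

definition crossing :: "real \<Rightarrow> real \<Rightarrow> nat \<Rightarrow> nat \<times> nat \<times> nat \<Rightarrow> (nat \<Rightarrow> complex) \<Rightarrow> bool" where
  "crossing n y N = (\<lambda>(k, i, m) Z.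
     barrier_hit k (grid_point (Suc k) i) (\<lambda>j. real j + y - barrier n N j) (7 * (real m + 1)) Z \<and>
     block_large (Suc k) i m Z)"

lemma norm_euler_product:
  assumes Z: "\<And>p. norm (Z p) = 1" and a: "\<And>p. p \<in> primes_upto (nat \<lfloor>x\<rfloor>) \<Longrightarrow> Z p = a p" and x: "x \<ge> 0"
  shows "norm (euler_product a x (1 / 2 + \<i> * of_real h)) = exp (log_product Z (primes_upto (nat \<lfloor>x\<rfloor>)) (Complex (1/2) h))"
proof -
  have s: "1 / 2 + \<i> * of_real h = Complex (1/2) h" by (simp add: complex_eq_iff)
  have P: "{p. prime p \<and> real p \<le> x} = primes_upto (nat \<lfloor>x\<rfloor>)"
    using x by (auto simp: primes_upto_def le_nat_iff le_floor_iff)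
  have "norm (inverse (1 - a p * of_nat p powr (- Complex (1/2) h))) = exp (log_factor (of_nat p powr (- Complex (1/2) h)) (Z p))"
    if p: "p \<in> primes_upto (nat \<lfloor>x\<rfloor>)" for p
  proof -
    have p2: "p \<ge> 2" using primes_upto_ge_2[OF p] .
    have "real p powr (- (1/2)) < 1" using p2 by (intro powr_less_one) auto
    hence "norm (of_nat p powr (- Complex (1/2) h) :: complex) < 1" using p2 by (subst norm_prime_powr) auto
    thus ?thesis using exp_log_factor[OF Z[of p]] a[OF p] by simp
  qed
  thus ?thesis unfolding euler_product_def s P log_product_def
    by (simp add: exp_sum flip: prod_norm)
qed

text \<open>The threshold equals \<open>exp (n - 3/4 * ln n + y)\<close>, whose exponent is at least
  the barrier at scale \<open>N\<close>; a supremum strictly above it supplies an actual point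
  \<open>h\<close> where the walk ends above the barrier.\<close>

lemma large_value_crossing:
  assumes Z: "\<And>p. norm (Z p) = 1" and a: "\<And>p. p \<in> primes_upto (nat \<lfloor>x\<rfloor>) \<Longrightarrow> Z p = a p"
    and x: "x \<ge> exp (exp 16)" and n: "n = ln (ln x)" "n \<ge> 1" and y: "y \<ge> 0" and N: "N = scale_of (nat \<lfloor>x\<rfloor>)"
    and N_far: "4 + 3/4 * ln n \<le> ln (1 + real N)"
    and large: "(SUP h \<in> {0..1 :: real}. norm (euler_product a x (1 / 2 + \<i> * of_real h))) > ln x / n powr (3 / 4) * exp y"
  shows "\<exists>k<N. \<exists>i\<le>grid (Suc k). \<exists>m\<le>10 * nat \<lfloor>x\<rfloor>. crossing n y N (k, i, m) Z"
proof -
  define U where "U j = real j + y - barrier n N j" for j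
  have x0: "x > 0" using x exp_gt_zero[of "exp 16"] by linarith
  have lx0: "ln x > 0"
  proof -
    have "ln x \<ge> exp 16" using x x0 by (simp add: ln_ge_iff)
    thus ?thesis using exp_gt_zero[of "16::real"] by linarith
  qed
  obtain h where h: "h \<in> {0..1::real}" and lh: "ln x / n powr (3 / 4) * exp y < norm (euler_product a x (1 / 2 + \<i> * of_real h))"
    using less_cSupD[OF _ large] by auto
  have "ln x / n powr (3 / 4) * exp y = exp (n - 3/4 * ln n + y)"
  proof -
    have "exp n = ln x" "n \<noteq> 0" using n lx0 by auto
    thus ?thesis by (simp add: powr_def exp_add exp_diff)
  qed
  hence "n - 3/4 * ln n + y < log_product Z (primes_upto (nat \<lfloor>x\<rfloor>)) (Complex (1/2) h)"
    using lh norm_euler_product[of Z x a h] Z a x0 by simp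
  moreover have "U N \<le> n - 3/4 * ln n + y"
    using final_scale(2)[OF x] n unfolding U_def barrier_def N by simp
  ultimately have big: "U N < log_product Z (primes_upto (nat \<lfloor>x\<rfloor>)) (Complex (1/2) h)" by linarith
  \<comment> \<open>By \<open>N_far\<close> the barrier correction vanishes at scale 0.\<close>
  have U0: "U 0 \<ge> 0" using N_far y by (simp add: U_def barrier_def)
  have Umono: "U j \<le> U k" if jk: "j \<le> k" "k \<le> N" for j k
  proof -
    have "ln (1 + real (k - j)) \<le> real (k - j)" by (rule ln_add_one_self_le_self) simp
    thus ?thesis using barrier_increment[OF jk, of n] jk by (simp add: U_def of_nat_diff)
  qed
  obtain k i m where k: "k \<in> {1..N}" and i: "i \<le> grid k" and m: "m \<le> 10 * nat \<lfloor>x\<rfloor>"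
    and below: "\<forall>t\<le>scale_end (k-1). log_product Z (primes_upto t) (grid_point k i) \<le> U (scale_of t)"
    and hit: "U (k-1) - 7 * (real m + 1) \<le> log_product Z (primes_upto (scale_end (k-1))) (grid_point k i)"
    and block: "\<exists>t\<in>primes_upto (scale_end k) - primes_upto (scale_end (k-1)).
        exp (30 * real m) \<le> 2 * integral {0..1} (\<lambda>x. \<Prod>p | p \<in> primes_upto (scale_end k) - primes_upto (scale_end (k-1)) \<and> p \<le> t.
           norm (inverse (1 - Z p * of_nat p powr (- (grid_point k i + exp (- real k) * cis (2 * pi * x))))) ^ 30)"
    using first_crossing[OF Z U0 Umono h _ big] N by blast
  obtain k' where k': "k = Suc k'" using k by (cases k) auto
  have "block_large k i m Z"
  proof -
    from block obtain t where t: "t \<in> block_primes k"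
      and "exp (30 * real m) \<le> 2 * integral {0..1} (\<lambda>x. \<Prod>p | p \<in> block_primes k \<and> p \<le> t. norm (inverse (1 - Z p * block_circle k i p x)) ^ 30)"
      unfolding block_primes_def block_circle_def by blast
    moreover have "{p. p \<in> block_primes k \<and> p \<le> t} \<subseteq> primes_upto (scale_end k)" by (auto simp: block_primes_def)
    ultimately show ?thesis unfolding block_large_def by (intro bexI[OF _ t]) (simp add: integral_block_circle[OF Z])
  qed
  moreover have "barrier_hit k' (grid_point k i) U (7 * (real m + 1)) Z"
    using below hit unfolding barrier_hit_def by (simp add: k')
  ultimately have "crossing n y N (k', i, m) Z" unfolding crossing_def U_def by (simp add: k')
  moreover have "k' < N" using k by (simp add: k')
  ultimately show ?thesis using i m unfolding k' by blast
qed

text \<open>The \<open>f p\<close> lie on the circle only almost surely; the deterministic steps need it everywhere.\<close>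

definition unit_part :: "complex \<Rightarrow> complex" where
  "unit_part z = (if norm z = 1 then z else 1)"

lemma unit_part_measurable [measurable]: "unit_part \<in> borel_measurable borel"
  unfolding unit_part_def by measurable

lemma norm_unit_part [simp]: "norm (unit_part z) = 1"
  by (simp add: unit_part_def)

context steinhaus_multiplicative
begin

lemma f_measurable: "prime p \<Longrightarrow> f p \<in> borel_measurable M"
  using f_indep by (auto simp: indep_vars_def)

lemma unit_variable_unit_part:
  assumes p: "prime p"
  shows "unit_variable M (\<lambda>\<omega>. unit_part (f p \<omega>))"
proof
  note [measurable] = f_measurable[OF p]
  show "(\<lambda>\<omega>. unit_part (f p \<omega>)) \<in> borel_measurable M" by measurable
  have "distr M borel (\<lambda>\<omega>. unit_part (f p \<omega>)) = distr (distr M borel (f p)) borel unit_part"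
    by (subst distr_distr) (auto simp: comp_def)
  also have "\<dots> = distr (uniform_measure lborel {0..2 * pi}) borel (unit_part \<circ> cis)"
    unfolding f_uniform[OF p] uniform_circle_def by (rule distr_distr) measurable
  also have "unit_part \<circ> cis = cis" by (auto simp: unit_part_def)
  finally show "distr M borel (\<lambda>\<omega>. unit_part (f p \<omega>)) = uniform_circle" by (simp add: uniform_circle_def)
qed simp

lemma indep_unit_part: "indep_vars (\<lambda>_. borel) (\<lambda>p \<omega>. unit_part (f p \<omega>)) {p. prime p}"
  by (rule indep_vars_compose2[OF f_indep, where Y="\<lambda>_. unit_part"]) simp

lemma AE_unit_part: "AE \<omega> in M. \<forall>p\<in>primes_upto q. unit_part (f p \<omega>) = f p \<omega>"
proof (rule AE_finite_allI)
  fix p assume "p \<in> primes_upto q"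
  hence p: "prime p" by (simp add: primes_upto_def)
  note [measurable] = f_measurable[OF p]
  have "AE z in distr M borel (f p). norm z = 1" unfolding f_uniform[OF p] by (rule AE_uniform_circle)
  hence "AE \<omega> in M. norm (f p \<omega>) = 1" by (subst (asm) AE_distr_iff) auto
  thus "AE \<omega> in M. unit_part (f p \<omega>) = f p \<omega>" by eventually_elim (simp add: unit_part_def)
qed simp

text \<open>Union bound over scale, grid point and jump size: at most
  \<open>18 * exp (k + 1)\<close> grid points and a geometric sum of at most 2 over \<open>m\<close>
  give the factor 36. The inclusion of events holds outside the null set where some
  \<open>f p\<close> leaves the circle.\<close>

lemma prob_large_value_le:
  fixes x y :: real
  defines "n \<equiv> ln (ln x)" and "N \<equiv> scale_of (nat \<lfloor>x\<rfloor>)"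
  assumes x: "x \<ge> exp (exp 16)" and n1: "n \<ge> 1" and y: "y \<ge> 0" and N_far: "4 + 3/4 * ln n \<le> ln (1 + real N)"
    and cross: "\<And>k i m. k < N \<Longrightarrow> {\<omega>\<in>space M. crossing n y N (k, i, m) (\<lambda>p. unit_part (f p \<omega>))} \<in> sets M"
      "\<And>k i m. k < N \<Longrightarrow> prob {\<omega>\<in>space M. crossing n y N (k, i, m) (\<lambda>p. unit_part (f p \<omega>))} \<le> exp (- real m) * b k"
  shows "prob {\<omega> \<in> space M. (SUP h \<in> {0..1 :: real}. norm (euler_product (\<lambda>n. f n \<omega>) x (1 / 2 + \<i> * of_real h))) > ln x / n powr (3 / 4) * exp y}
     \<le> (\<Sum>k<N. 36 * exp (real k + 1) * b k)"
proof -
  let ?A = "{\<omega> \<in> space M. (SUP h \<in> {0..1 :: real}. norm (euler_product (\<lambda>n. f n \<omega>) x (1 / 2 + \<i> * of_real h))) > ln x / n powr (3 / 4) * exp y}"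
  define q where "q = nat \<lfloor>x\<rfloor>"
  define E where "E t = {\<omega>\<in>space M. crossing n y N t (\<lambda>p. unit_part (f p \<omega>))}" for t
  define I where "I = (SIGMA k:{..<N}. {..grid (Suc k)} \<times> {..10 * q})"
  have I: "finite I" by (auto simp: I_def)
  have EI: "E t \<in> sets M" if "t \<in> I" for t using that cross(1) by (auto simp: I_def E_def)
  have b0: "b k \<ge> 0" if "k < N" for k
    using order_trans[OF measure_nonneg cross(2)[OF that, of 0 0]] by simp
  \<comment> \<open>The subtracted \<open>exp (- r)\<close> makes the bound inductive, because
    \<open>exp 1 \<ge> 2\<close>.\<close>
  have gs: "(\<Sum>m\<le>r. exp (- real m)) \<le> 2 - exp (- real r)" for r
  proof (induction r)
    case (Suc r)
    have "exp (- real r) = exp 1 * exp (- real (Suc r))" by (simp flip: exp_add)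
    moreover have "exp 1 * exp (- real (Suc r)) \<ge> 2 * exp (- real (Suc r))"
      using exp_ge_add_one_self[of "1::real"] by (intro mult_right_mono) auto
    ultimately show ?case using Suc unfolding sum.atMost_Suc by linarith
  qed simp
  have sumE: "(\<Sum>t\<in>I. prob (E t)) \<le> (\<Sum>k<N. 36 * exp (real k + 1) * b k)"
  proof -
    have "(\<Sum>t\<in>I. prob (E t)) \<le> (\<Sum>(k, i, m)\<in>I. exp (- real m) * b k)"
      using cross(2) by (intro sum_mono) (auto simp: I_def E_def)
    also have "\<dots> = (\<Sum>k<N. \<Sum>(i, m)\<in>{..grid (Suc k)} \<times> {..10 * q}. exp (- real m) * b k)"
      unfolding I_def by (subst sum.Sigma) auto
    also have "\<dots> = (\<Sum>k<N. \<Sum>i\<le>grid (Suc k). \<Sum>m\<le>10 * q. exp (- real m) * b k)"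
      by (simp only: sum.cartesian_product)
    also have "\<dots> = (\<Sum>k<N. (real (grid (Suc k)) + 1) * ((\<Sum>m\<le>10 * q. exp (- real m)) * b k))"
      by (simp add: sum_distrib_right add_ac)
    also have "\<dots> \<le> (\<Sum>k<N. (18 * exp (real (Suc k))) * (2 * b k))"
    proof (intro sum_mono mult_mono mult_right_mono grid_bounds)
      show "(\<Sum>m\<le>10 * q. exp (- real m)) \<le> 2" using gs[of "10 * q"] exp_gt_zero[of "- real (10 * q)"] by linarith
    qed (use b0 in \<open>auto intro!: mult_nonneg_nonneg sum_nonneg\<close>)
    finally show ?thesis by (simp add: mult_ac add_ac)
  qed
  show ?thesis
  proof (cases "?A \<in> sets M")
    case True
    have "prob ?A \<le> prob (\<Union>t\<in>I. E t)"
    proof (rule finite_measure_mono_AE)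
      show "AE \<omega> in M. \<omega> \<in> ?A \<longrightarrow> \<omega> \<in> (\<Union>t\<in>I. E t)"
        using AE_unit_part[of q]
      proof eventually_elim
        case (elim \<omega>)
        show ?case
        proof
          assume A: "\<omega> \<in> ?A"
          have "\<exists>k<N. \<exists>i\<le>grid (Suc k). \<exists>m\<le>10 * nat \<lfloor>x\<rfloor>. crossing n y N (k, i, m) (\<lambda>p. unit_part (f p \<omega>))"
            by (rule large_value_crossing[where a="\<lambda>p. f p \<omega>"])
               (use A elim x n1 y N_far in \<open>auto simp: n_def N_def q_def\<close>)
          thus "\<omega> \<in> (\<Union>t\<in>I. E t)" using A unfolding I_def E_def q_def by force
        qed
      qed
      show "(\<Union>t\<in>I. E t) \<in> sets M" using I EI by auto
    qed
    also have "\<dots> \<le> (\<Sum>t\<in>I. prob (E t))"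
      using EI by (intro finite_measure_subadditive_finite I) auto
    finally show ?thesis using sumE by linarith
  next
    \<comment> \<open>A set that is not measurable is given measure 0, and the right side is
      nonnegative.\<close>
    case False
    have "(\<Sum>k<N. 36 * exp (real k + 1) * b k) \<ge> 0" using b0 by (intro sum_nonneg mult_nonneg_nonneg) auto
    thus ?thesis by (simp only: measure_notin_sets[OF False])
  qed
qed

end

theorem corollary1p4:
  "\<exists>K > 0. \<exists>x0 > 0. \<forall>(M :: 'a measure) (f :: nat \<Rightarrow> 'a \<Rightarrow> complex) (x :: real) (y :: real).
     steinhaus_multiplicative M f \<longrightarrow> x \<ge> x0 \<longrightarrow>
     1 < y \<longrightarrow> y \<le> ln (ln x) / ln (ln (ln x)) \<longrightarrow>
     measure M {\<omega> \<in> space M.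
        (SUP h \<in> {0..1 :: real}. norm (euler_product (\<lambda>n. f n \<omega>) x (1 / 2 + \<i> * of_real h)))
          > ln x / ln (ln x) powr (3 / 4) * exp y}
       \<le> K * y * exp (- 2 * y - y\<^sup>2 / ln (ln x))"
proof -
  obtain C where C: "C > 0" and cb: "\<forall>(M::'a measure) Z k i m n y g. prob_space M \<longrightarrow> prob_space.indep_vars M (\<lambda>_. borel) Z {p. prime p} \<longrightarrow>
     (\<forall>p. prime p \<longrightarrow> unit_variable M (Z p)) \<longrightarrow>
     1 \<le> n \<longrightarrow> 0 < y \<longrightarrow> y \<le> n \<longrightarrow> real k \<le> n + 3 \<longrightarrow>
     (\<forall>j\<le>k. 0 \<le> g j \<and> g k - g j \<le> ln (1 + real (k - j))) \<longrightarrow>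
     (let E = {\<omega>\<in>space M. barrier_hit k (grid_point (Suc k) i) (\<lambda>j. real j + y - g j) (7 * (real m + 1)) (\<lambda>p. Z p \<omega>)
                 \<and> block_large (Suc k) i m (\<lambda>p. Z p \<omega>)}
      in E \<in> sets M \<and> measure M E
     \<le> C * exp (- real m) * exp (- real k - 2 * y - y\<^sup>2 / n + 2 * (1 + y / n) * g k)
         * ballot_weight n y k)"
    using crossing_bound[where 'a='a] by (elim exE conjE) (rule that)
  obtain D where D: "D > 0" and bs: "\<forall>n y N. 16 \<le> ln n \<longrightarrow> 0 < n \<longrightarrow> n \<le> real N \<longrightarrow> real N \<le> n + 4 \<longrightarrow> 1 \<le> y \<longrightarrow> y \<le> n / ln n \<longrightarrow>
     (\<Sum>k<N. exp (2 * (1 + y / n) * barrier n N k) * ballot_weight n y k) \<le> D * y"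
    using barrier_sum_bound by (elim exE conjE) (rule that)
  define K where "K = 36 * exp 1 * C * D"
  \<comment> \<open>Three exponentials, so that \<open>n = ln (ln x)\<close> satisfies
    \<open>ln n \<ge> 16\<close>.\<close>
  define x0 :: real where "x0 = exp (exp (exp 16))"
  have K: "K > 0" using C D by (simp add: K_def)
  show ?thesis
  proof (rule exI[of _ K], rule conjI[OF K], rule exI[of _ x0], rule conjI, simp add: x0_def, intro allI impI)
    fix M :: "'a measure" and f :: "nat \<Rightarrow> 'a \<Rightarrow> complex" and x y :: real
    assume "steinhaus_multiplicative M f" and x: "x \<ge> x0" and y1: "1 < y" and y2: "y \<le> ln (ln x) / ln (ln (ln x))"
    then interpret steinhaus_multiplicative M f by simp
    define n where "n = ln (ln x)"
    define N where "N = scale_of (nat \<lfloor>x\<rfloor>)"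
    have xpos: "x > 0" using x exp_gt_zero[of "exp (exp 16)"] unfolding x0_def by linarith
    have l1: "ln x \<ge> exp (exp 16)" using x xpos by (simp add: x0_def ln_ge_iff)
    hence lpos: "ln x > 0" using exp_gt_zero[of "exp 16"] by linarith
    have l2: "n \<ge> exp 16" using l1 lpos by (simp add: n_def ln_ge_iff)
    hence npos: "n > 0" using exp_gt_zero[of "16::real"] by linarith
    have l3: "ln n \<ge> 16" using l2 npos by (simp add: ln_ge_iff)
    have e17: "exp (16::real) \<ge> 17" using exp_ge_add_one_self[of "16::real"] by simp
    have n1: "n \<ge> 1" using l2 e17 by linarith
    have "exp (exp (16::real)) \<le> exp (exp (exp 16))" using exp_ge_add_one_self[of "exp (16::real)"] exp_ge_add_one_self[of "16::real"] by simp
    hence x': "x \<ge> exp (exp 16)" using x unfolding x0_def by linarith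
    note N = final_scale[OF x', folded N_def n_def]
    have y2: "y \<le> n / ln n" using y2 by (simp add: n_def)
    also have "\<dots> \<le> n / 1" using l2 l3 e17 by (intro divide_left_mono) auto
    finally have yn: "y \<le> n" by simp
    have "ln n \<le> ln (1 + real N)" using N npos by (intro ln_mono) auto
    hence far: "4 + 3/4 * ln n \<le> ln (1 + real N)" using l3 by linarith
    define b where "b k = C * exp (- real k - 2 * y - y\<^sup>2 / n + 2 * (1 + y / n) * barrier n N k) * ballot_weight n y k" for k
    have cross: "{\<omega>\<in>space M. crossing n y N (k, i, m) (\<lambda>p. unit_part (f p \<omega>))} \<in> sets M \<and>
      prob {\<omega>\<in>space M. crossing n y N (k, i, m) (\<lambda>p. unit_part (f p \<omega>))} \<le> exp (- real m) * b k" if k: "k < N" for k i m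
    proof -
      have g: "\<forall>j\<le>k. 0 \<le> barrier n N j \<and> barrier n N k - barrier n N j \<le> ln (1 + real (k - j))"
        using k barrier_nonneg barrier_increment by simp
      have kn: "real k \<le> n + 3" using k N by linarith
      have "let E = {\<omega>\<in>space M. crossing n y N (k, i, m) (\<lambda>p. unit_part (f p \<omega>))}
        in E \<in> sets M \<and> measure M E \<le> C * exp (- real m) * exp (- real k - 2 * y - y\<^sup>2 / n + 2 * (1 + y / n) * barrier n N k) * ballot_weight n y k"
        unfolding crossing_def prod.case
        by (rule cb[THEN spec, THEN spec, THEN spec, THEN spec, THEN spec, THEN spec, THEN spec, THEN spec,
              THEN mp, THEN mp, THEN mp, THEN mp, THEN mp, THEN mp, THEN mp, THEN mp])
           (use n1 y1 yn kn g indep_unit_part unit_variable_unit_part prob_space_axioms in simp_all)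
      thus ?thesis by (simp add: Let_def b_def mult_ac)
    qed
    have "measure M {\<omega> \<in> space M. (SUP h \<in> {0..1 :: real}. norm (euler_product (\<lambda>n. f n \<omega>) x (1 / 2 + \<i> * of_real h)))
          > ln x / ln (ln x) powr (3 / 4) * exp y} \<le> (\<Sum>k<N. 36 * exp (real k + 1) * b k)"
      unfolding N_def
      by (rule prob_large_value_le) (use x' n1 y1 far cross in \<open>auto simp: n_def N_def\<close>)
    also have "\<dots> = (\<Sum>k<N. 36 * exp 1 * C * exp (- 2 * y - y\<^sup>2 / n) * (exp (2 * (1 + y / n) * barrier n N k) * ballot_weight n y k))"
    proof (intro sum.cong refl)
      fix k
      \<comment> \<open>The number of grid points, of order \<open>exp (k + 1)\<close>, cancels
        \<open>exp (- k)\<close>; what remains to be summed over \<open>k\<close> is the barrier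
        factor times the ballot weight.\<close>
      have "exp (real k + 1) * exp (- real k - 2 * y - y\<^sup>2 / n + 2 * (1 + y / n) * barrier n N k)
        = exp 1 * exp (- 2 * y - y\<^sup>2 / n) * exp (2 * (1 + y / n) * barrier n N k)"
        by (simp flip: exp_add)
      hence "36 * C * ballot_weight n y k * (exp (real k + 1) * exp (- real k - 2 * y - y\<^sup>2 / n + 2 * (1 + y / n) * barrier n N k))
        = 36 * C * ballot_weight n y k * (exp 1 * exp (- 2 * y - y\<^sup>2 / n) * exp (2 * (1 + y / n) * barrier n N k))" by simp
      thus "36 * exp (real k + 1) * b k = 36 * exp 1 * C * exp (- 2 * y - y\<^sup>2 / n) * (exp (2 * (1 + y / n) * barrier n N k) * ballot_weight n y k)"
        by (simp only: b_def mult_ac)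
    qed
    also have "\<dots> = 36 * exp 1 * C * exp (- 2 * y - y\<^sup>2 / n) * (\<Sum>k<N. exp (2 * (1 + y / n) * barrier n N k) * ballot_weight n y k)"
      by (simp only: sum_distrib_left)
    also have "\<dots> \<le> 36 * exp 1 * C * exp (- 2 * y - y\<^sup>2 / n) * (D * y)"
    proof (rule mult_left_mono)
      show "(\<Sum>k<N. exp (2 * (1 + y / n) * barrier n N k) * ballot_weight n y k) \<le> D * y"
        using bs l3 npos N y1 y2 by simp
    qed (use C in simp)
    also have "\<dots> = K * y * exp (- 2 * y - y\<^sup>2 / ln (ln x))" by (simp add: K_def n_def)
    finally show "measure M {\<omega> \<in> space M. (SUP h \<in> {0..1 :: real}. norm (euler_product (\<lambda>n. f n \<omega>) x (1 / 2 + \<i> * of_real h)))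
          > ln x / ln (ln x) powr (3 / 4) * exp y} \<le> K * y * exp (- 2 * y - y\<^sup>2 / ln (ln x))" .
  qed
qed

end
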